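(* (Generalized second law for a quasi-stationary black hole which arises from gravitational collapse.) Consider a real massless scalar field on a background geometry which describes the formation of a quasi-stationary black hole, and let $T(\rho)=\mathrm{Tr}_{H^+}[S\rho S^\dagger]$ be its evolution map from density matrices on $\mathcal F_{\mathcal I^-(v>v_0)}$ to density matrices on $\mathcal F(\mathcal H_{\mathcal I^+})$; let $\rho_{th}=\rho_{th}(\beta_{BH},\Omega_{BH})$ and $\tilde\rho_{th}=\tilde\rho_{th}(\beta_{BH},\Omega_{BH})$ be the thermal density matrices (all as specified in the context). Let $\rho_0$ be an initial density matrix on $\mathcal F_{\mathcal I^-(v>v_0)}$ such that $$[\rho_0,\rho_{th}]=[T(\rho_0),\tilde\rho_{th}]=0$$ and such that $\mathcal U[\rho_0]=-\mathrm{Tr}[\rho_{th}f(\rho_0\rho_{th}^{-1})]$, with $f(x)=x\ln x$, converges absolutely, i.e. $\mathrm{Tr}[\rho_{th}|f(\rho_0\rho_{th}^{-1})|]<\infty$. Then $$U[T(\rho_0);\beta_{BH},\Omega_{BH})\ \ge\ U[\rho_0;\beta_{BH},\Omega_{BH}),$$ where $$U[\rho;\beta_{BH},\Omega_{BH})=-\mathrm{Tr}[\rho\ln\rho]-\beta_{BH}\big(\mathrm{Tr}[\boldsymbol E\rho]-\Omega_{BH}\mathrm{Tr}[\boldsymbol L_z\rho]\big)$$ for density matrices on $\mathcal F_{\mathcal I^-(v>v_0)}$, and the same expression with $\tilde{\boldsymbol E},\tilde{\boldsymbol L}_z$ in place of $\boldsymbol E,\boldsymbol L_z$ for density matrices on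 $\mathcal F(\mathcal H_{\mathcal I^+})$. This inequality is equivalent to the generalized second law $\Delta S_{BH}+\Delta S_{matter}\ge0$, given the first law $\Delta S_{BH}=\beta_{BH}(\Delta M_{BH}-\Omega_{BH}\Delta J_{BH})$ and the conservation laws $\Delta M_{BH}+\Delta E_{matter}=0$ and $\Delta J_{BH}+\Delta L_{matter}=0$. The assumptions on $\rho_0$ are satisfied when $\rho_0$ is diagonal in the basis $\{|\{n_{{}_i\gamma}\}\rangle\}$ and contains at most a finite number of excitations.
   Context: Geometry. $\mathcal I^-$ and $\mathcal I^+$ are past and future null infinity, $H^+$ is the future event horizon, formed at $v=v_0$ ($v$ the advanced null coordinate). $\Omega_{BH}$ and $\kappa$ are the angular velocity and surface gravity of the black hole, and $\beta_{BH}=2\pi/\kappa$. $S_{BH},M_{BH},J_{BH}$ are the entropy, mass and angular momentum of the black hole; $S_{matter},E_{matter},L_{matter}$ are the entropy, energy and azimuthal angular momentum of the matter field; $\Delta$ denotes the change under the evolution. Modes. Modes are labelled by $i=1,2,\dots$; $\omega_i$ and $m_i$ are the frequency and azimuthal angular momentum quantum number of mode $i$, and $x_i=\exp(-\pi(\omega_i-\Omega_{BH}m_i)/\kappa)$. $t_i,T_i$ are the transmission and $r_i,R_i$ the reflection coefficients of mode $i$ (on the Schwarzschild metric), satisfying $|t_i|^2+|r_i|^2=|T_i|^2+|R_i|^2=1$, $t_i=T_i$, $r_i=-R_i^*T_i/T_i^*$. Spaces. $\mathcal H_{\mathcal I^\pm}$ and $\mathcal H_{H^+}$ are the Hilbert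 spaces of positive-frequency mode functions at $\mathcal I^\pm$ and on $H^+$. $\mathcal F(\mathcal H)$ is the symmetric Fock space over $\mathcal H$, with vacuum $|0\rangle$ and creation operators $a^\dagger(\cdot)$; $(\cdots)_{sym}$ denotes symmetrization. ${}_i\rho\in\mathcal H_{\mathcal I^+}$ and ${}_i\sigma,{}_i\tau\in\mathcal H_{H^+}$ are orthonormal wave-packet modes; the ${}_i\rho$ generate $\mathcal H_{\mathcal I^+}$ and the ${}_i\sigma,{}_i\tau$ together generate $\mathcal H_{H^+}$. In $\mathcal H_{\mathcal I^+}\oplus\mathcal H_{H^+}$, ${}_i\gamma=T_i\,{}_i\sigma+R_i\,{}_i\rho$ and ${}_i\lambda=t_i\,{}_i\rho+r_i\,{}_i\sigma$. $A$ is the Bogoliubov transformation from $\mathcal H_{\mathcal I^+}\oplus\mathcal H_{H^+}$ to $\mathcal H_{\mathcal I^-}$, and $A\,{}_i\gamma$ is a wave packet peaked on $\mathcal I^-$ at $v>v_0$. $\mathcal F_{\mathcal I^-(v>v_0)}\subset\mathcal F(\mathcal H_{\mathcal I^-})$ is the subspace of states with no excitation of modes located at $v<v_0$. A density matrix is a bounded, self-adjoint, positive semi-definite operator of trace 1. Number states. For sets of non-negative integers, $|\{n_{{}_i\gamma}\}\rangle=\prod_i\frac{1}{\sqrt{n_{{}_i\gamma}!}}(a^\dagger(A\,{}_i\gamma))^{n_{{}_i\gamma}}|0\rangle$, and the set of all these generates $\mathcal F_{\mathcal I^-(v>v_0)}$; $|\{n_{{}_i\rho}\}\rangle=\prod_i\frac{1}{\sqrt{n_{{}_i\rho}!}}(a^\dagger({}_i\rho))^{n_{{}_i\rho}}|0\rangle$,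 and the set of all these generates $\mathcal F(\mathcal H_{\mathcal I^+})$. S-matrix. $S$ describes the evolution from $\mathcal F_{\mathcal I^-(v>v_0)}$ to $\mathcal F(\mathcal H_{\mathcal I^+})\otimes\mathcal F(\mathcal H_{H^+})$ and is given by $S|0\rangle=N\sum_{n=0}^\infty\frac{\sqrt{(2n)!}}{2^n n!}(\otimes^n\epsilon)_{sym}$ and $S\,a^\dagger(A\,{}_i\gamma)\,S^{-1}=R_i\,a^\dagger({}_i\rho)+T_i\,a^\dagger({}_i\sigma)$, where $\epsilon=2\sum_i x_i({}_i\lambda\otimes{}_i\tau)_{sym}$ and $N$ is the normalization constant making $S|0\rangle$ a unit vector. $\mathrm{Tr}_{H^+}$ is the partial trace over $\mathcal F(\mathcal H_{H^+})$. Thermal states and observables. $\rho_{th}=Z^{-1}\sum_{\{n_{{}_i\gamma}\}}e^{-\beta_{BH}\sum_i n_{{}_i\gamma}(\omega_i-\Omega_{BH}m_i)}|\{n_{{}_i\gamma}\}\rangle\langle\{n_{{}_i\gamma}\}|$, $\tilde\rho_{th}=Z^{-1}\sum_{\{n_{{}_i\rho}\}}e^{-\beta_{BH}\sum_i n_{{}_i\rho}(\omega_i-\Omega_{BH}m_i)}|\{n_{{}_i\rho}\}\rangle\langle\{n_{{}_i\rho}\}|$, $Z=\sum_{\{j_i\}}e^{-\beta_{BH}\sum_i j_i(\omega_i-\Omega_{BH}m_i)}$. $\boldsymbol E=\sum_{\{n_{{}_i\gamma}\}}(\sum_i n_{{}_i\gamma}\omega_i)|\{n_{{}_i\gamma}\}\rangle\langle\{n_{{}_i\gamma}\}|$,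 $\boldsymbol L_z=\sum_{\{n_{{}_i\gamma}\}}(\sum_i n_{{}_i\gamma}m_i)|\{n_{{}_i\gamma}\}\rangle\langle\{n_{{}_i\gamma}\}|$; $\tilde{\boldsymbol E},\tilde{\boldsymbol L}_z$ are the analogous operators with ${}_i\rho$ in place of ${}_i\gamma$. One has $\mathcal U[\rho_0]=U[\rho_0;\beta_{BH},\Omega_{BH})-\ln Z$.
   Formalization: In the last sentence, "at most a finite number of excitations" is taken to mean boundedly many quanta, all in finitely many modes; with infinitely many modes allowed, the absolute convergence of U[ρ_0] can fail even for one-quantum diagonal states. *)

theory Defs
  imports "HOL-Analysis.Analysis" "HOL-Library.Poly_Mapping" "HOL-Combinatorics.Permutations"
begin

section \<open>Complex Hilbert spaces\<close>

text \<open>Every complex Hilbert space is unitarily equivalent to the space of square-summable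
  functions on an index type (of arbitrary cardinality), so the one-particle spaces are taken to
  be of this form. The real inner product of the class instance is the real part of \<open>cinner\<close>.\<close>

typedef 'a ell2 = "{f :: 'a \<Rightarrow> complex. (\<lambda>x. (cmod (f x))\<^sup>2) summable_on UNIV}"
  morphisms coord Abs_ell2
  by (rule exI[of _ "\<lambda>_. 0"]) simp

setup_lifting type_definition_ell2

definition mk_ell2 :: "('a \<Rightarrow> complex) \<Rightarrow> 'a ell2" where
  "mk_ell2 f = (if (\<lambda>x. (cmod (f x))\<^sup>2) summable_on UNIV then Abs_ell2 f else Abs_ell2 (\<lambda>_. 0))"

lemma ell2_add_summable:
  fixes f g :: "'a \<Rightarrow> complex"
  assumes f: "(\<lambda>x. (cmod (f x))\<^sup>2) summable_on UNIV" and g: "(\<lambda>x. (cmod (g x))\<^sup>2) summable_on UNIV"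
  shows "(\<lambda>x. (cmod (f x + g x))\<^sup>2) summable_on UNIV"
proof (rule summable_on_comparison_test)
  show "(\<lambda>x. 2 * (cmod (f x))\<^sup>2 + 2 * (cmod (g x))\<^sup>2) summable_on UNIV"
    by (intro summable_on_add summable_on_cmult_right f g)
  fix x
  have "(cmod (f x + g x))\<^sup>2 \<le> (cmod (f x) + cmod (g x))\<^sup>2"
    by (intro power_mono norm_triangle_ineq) simp
  also have "\<dots> \<le> 2 * (cmod (f x))\<^sup>2 + 2 * (cmod (g x))\<^sup>2"
    using zero_le_power2[of "cmod (f x) - cmod (g x)"]
    by (simp add: power2_eq_square algebra_simps)
  finally show "(cmod (f x + g x))\<^sup>2 \<le> 2 * (cmod (f x))\<^sup>2 + 2 * (cmod (g x))\<^sup>2" .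
qed simp

lemma ell2_scale_summable:
  fixes f :: "'a \<Rightarrow> complex"
  assumes f: "(\<lambda>x. (cmod (f x))\<^sup>2) summable_on UNIV"
  shows "(\<lambda>x. (cmod (c * f x))\<^sup>2) summable_on UNIV"
  using summable_on_cmult_right[OF f, of "(cmod c)\<^sup>2"]
  by (simp add: norm_mult power_mult_distrib)

lemma ell2_prod_summable:
  fixes f g :: "'a \<Rightarrow> complex"
  assumes f: "(\<lambda>x. (cmod (f x))\<^sup>2) summable_on UNIV" and g: "(\<lambda>x. (cmod (g x))\<^sup>2) summable_on UNIV"
  shows "(\<lambda>x. cnj (f x) * g x) summable_on UNIV"
proof (rule abs_summable_summable, rule summable_on_comparison_test)
  show "(\<lambda>x. (cmod (f x))\<^sup>2 + (cmod (g x))\<^sup>2) summable_on UNIV"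
    by (intro summable_on_add f g)
  fix x
  have "2 * (cmod (f x) * cmod (g x)) \<le> (cmod (f x))\<^sup>2 + (cmod (g x))\<^sup>2"
    using zero_le_power2[of "cmod (f x) - cmod (g x)"]
    by (simp add: power2_eq_square algebra_simps)
  moreover have "0 \<le> cmod (f x) * cmod (g x)" by simp
  ultimately show "norm (cnj (f x) * g x) \<le> (cmod (f x))\<^sup>2 + (cmod (g x))\<^sup>2"
    unfolding norm_mult complex_mod_cnj by linarith
qed simp

definition cinner :: "'a ell2 \<Rightarrow> 'a ell2 \<Rightarrow> complex" where
  "cinner f g = (\<Sum>\<^sub>\<infinity>x. cnj (coord f x) * coord g x)"

lift_definition scaleC :: "complex \<Rightarrow> 'a ell2 \<Rightarrow> 'a ell2"  (infixr \<open>*\<^sub>C\<close> 75)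
  is "\<lambda>c f x. c * f x"
  by (simp add: ell2_scale_summable)

instantiation ell2 :: (type) real_inner
begin

lift_definition zero_ell2 :: "'a ell2" is "\<lambda>_. 0" by simp
lift_definition plus_ell2 :: "'a ell2 \<Rightarrow> 'a ell2 \<Rightarrow> 'a ell2" is "\<lambda>f g x. f x + g x"
  by (simp add: ell2_add_summable)
lift_definition uminus_ell2 :: "'a ell2 \<Rightarrow> 'a ell2" is "\<lambda>f x. - f x" by simp
definition minus_ell2 :: "'a ell2 \<Rightarrow> 'a ell2 \<Rightarrow> 'a ell2" where "minus_ell2 f g = f + - g"
lift_definition scaleR_ell2 :: "real \<Rightarrow> 'a ell2 \<Rightarrow> 'a ell2" is "\<lambda>r f x. complex_of_real r * f x"
  using ell2_scale_summable by blast
definition inner_ell2 :: "'a ell2 \<Rightarrow> 'a ell2 \<Rightarrow> real" where "inner_ell2 f g = Re (cinner f g)"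
definition norm_ell2 :: "'a ell2 \<Rightarrow> real" where "norm_ell2 f = sqrt (inner f f)"
definition dist_ell2 :: "'a ell2 \<Rightarrow> 'a ell2 \<Rightarrow> real" where "dist_ell2 f g = norm (f - g)"
definition sgn_ell2 :: "'a ell2 \<Rightarrow> 'a ell2" where "sgn_ell2 f = inverse (norm f) *\<^sub>R f"
definition uniformity_ell2 :: "('a ell2 \<times> 'a ell2) filter" where
  "uniformity_ell2 = (INF e\<in>{0<..}. principal {(x, y). dist x y < e})"
definition open_ell2 :: "'a ell2 set \<Rightarrow> bool" where
  "open_ell2 U = (\<forall>x\<in>U. eventually (\<lambda>(x', y). x' = x \<longrightarrow> y \<in> U) uniformity)"

lemma coord_summable: "(\<lambda>x. (cmod (coord f x))\<^sup>2) summable_on UNIV"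
  using coord[of f] by simp

lemma cinner_summable: "(\<lambda>x. cnj (coord f x) * coord g x) summable_on UNIV"
  by (rule ell2_prod_summable) (rule coord_summable)+

lemma cinner_self: "cinner f f = complex_of_real (\<Sum>\<^sub>\<infinity>x. (cmod (coord f x))\<^sup>2)"
proof -
  have "((\<lambda>x. complex_of_real ((cmod (coord f x))\<^sup>2)) has_sum
      complex_of_real (\<Sum>\<^sub>\<infinity>x. (cmod (coord f x))\<^sup>2)) UNIV"
    by (rule has_sum_of_real[OF has_sum_infsum[OF coord_summable]])
  moreover have "complex_of_real ((cmod z)\<^sup>2) = cnj z * z" for z
    by (metis complex_norm_square mult.commute)
  ultimately show ?thesis unfolding cinner_def by (simp add: infsumI)
qed

instance
proof
  fix f g h :: "'a ell2" and r s :: real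
  show "f + g + h = f + (g + h)" by transfer (simp add: algebra_simps)
  show "f + g = g + f" by transfer (simp add: algebra_simps)
  show "0 + f = f" by transfer simp
  show "- f + f = 0" by transfer simp
  show "f - g = f + - g" by (simp add: minus_ell2_def)
  show "r *\<^sub>R (f + g) = r *\<^sub>R f + r *\<^sub>R g" by transfer (simp add: algebra_simps)
  show "(r + s) *\<^sub>R f = r *\<^sub>R f + s *\<^sub>R f" by transfer (simp add: algebra_simps)
  show "r *\<^sub>R s *\<^sub>R f = (r * s) *\<^sub>R f" by transfer (simp add: algebra_simps)
  show "1 *\<^sub>R f = f" by transfer simp
  show "dist f g = norm (f - g)" by (simp add: dist_ell2_def)
  show "sgn f = inverse (norm f) *\<^sub>R f" by (simp add: sgn_ell2_def)
  show "uniformity = (INF e\<in>{0<..}. principal {(x, y). dist x (y :: 'a ell2) < e})"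
    by (simp add: uniformity_ell2_def)
  show "open U = (\<forall>x\<in>U. \<forall>\<^sub>F (x', y) in uniformity. x' = x \<longrightarrow> y \<in> U)" for U :: "'a ell2 set"
    by (simp add: open_ell2_def)
  show "norm f = sqrt (inner f f)" by (simp add: norm_ell2_def)
  have "cinner f g = cnj (cinner g f)"
    unfolding cinner_def infsum_cnj[symmetric] by (simp add: mult.commute)
  then show "inner f g = inner g f" by (simp add: inner_ell2_def)
  have "cinner (f + g) h = cinner f h + cinner g h"
    unfolding cinner_def
    by (subst infsum_add[symmetric, OF cinner_summable cinner_summable])
      (simp add: plus_ell2.rep_eq algebra_simps)
  then show "inner (f + g) h = inner f h + inner g h" by (simp add: inner_ell2_def)
  have "cinner (r *\<^sub>R f) g = complex_of_real r * cinner f g"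
    unfolding cinner_def
    by (subst infsum_cmult_right[symmetric, OF cinner_summable])
      (simp add: scaleR_ell2.rep_eq algebra_simps)
  then show "inner (r *\<^sub>R f) g = r * inner f g" by (simp add: inner_ell2_def)
  show "0 \<le> inner f f" by (simp add: inner_ell2_def cinner_self infsum_nonneg)
  show "(inner f f = 0) = (f = 0)"
  proof
    assume "inner f f = 0"
    then have *: "(\<Sum>\<^sub>\<infinity>x. (cmod (coord f x))\<^sup>2) = 0" by (simp add: inner_ell2_def cinner_self)
    have "(cmod (coord f x))\<^sup>2 = 0" for x
      using nonneg_infsum_le_0D[OF _ coord_summable, of f x] * by simp
    then show "f = 0" by (simp add: coord_inject[symmetric] zero_ell2.rep_eq fun_eq_iff)
  next
    assume "f = 0"
    then show "inner f f = 0" by (simp add: inner_ell2_def cinner_self zero_ell2.rep_eq)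
  qed
qed

end

definition ket :: "'a \<Rightarrow> 'a ell2" where
  "ket a = mk_ell2 (\<lambda>x. if x = a then 1 else 0)"

definition clinear :: "('a ell2 \<Rightarrow> 'b ell2) \<Rightarrow> bool" where
  "clinear A \<longleftrightarrow> linear A \<and> (\<forall>c v. A (c *\<^sub>C v) = c *\<^sub>C A v)"

definition bounded_clinear :: "('a ell2 \<Rightarrow> 'b ell2) \<Rightarrow> bool" where
  "bounded_clinear A \<longleftrightarrow> bounded_linear A \<and> clinear A"

text \<open>The closed complex subspace generated by a set.\<close>

definition closed_cspan :: "'a ell2 set \<Rightarrow> 'a ell2 set" where
  "closed_cspan B = closure (span {c *\<^sub>C b | c b. b \<in> B})"

definition orthonormal_family :: "('i \<Rightarrow> 'a ell2) \<Rightarrow> bool" where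
  "orthonormal_family e \<longleftrightarrow> (\<forall>i j. cinner (e i) (e j) = (if i = j then 1 else 0))"

definition onb :: "'a ell2 set \<Rightarrow> 'a ell2 set \<Rightarrow> bool" where
  "onb K B \<longleftrightarrow> (\<forall>b\<in>B. \<forall>c\<in>B. cinner b c = (if b = c then 1 else 0)) \<and> closed_cspan B = K"

definition dsum_left :: "'a ell2 \<Rightarrow> ('a + 'b) ell2" where
  "dsum_left f = mk_ell2 (case_sum (coord f) (\<lambda>_. 0))"

definition dsum_right :: "'b ell2 \<Rightarrow> ('a + 'b) ell2" where
  "dsum_right g = mk_ell2 (case_sum (\<lambda>_. 0) (coord g))"

section \<open>Operators on a closed subspace, possibly unbounded\<close>

text \<open>A possibly unbounded operator is given by its graph. The product of operators \<open>X Y\<close> is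
  the relational composition \<open>Y O X\<close>, and the inverse is the converse relation.\<close>

type_synonym 'a graph_op = "('a ell2 \<times> 'a ell2) set"

definition graph_on :: "'a ell2 set \<Rightarrow> ('a ell2 \<Rightarrow> 'a ell2) \<Rightarrow> 'a graph_op" where
  "graph_on K A = {(v, A v) | v. v \<in> K}"

definition gop_add :: "'a graph_op \<Rightarrow> 'a graph_op \<Rightarrow> 'a graph_op" where
  "gop_add X Y = {(v, w + w') | v w w'. (v, w) \<in> X \<and> (v, w') \<in> Y}"

definition gop_scale :: "real \<Rightarrow> 'a graph_op \<Rightarrow> 'a graph_op" where
  "gop_scale r X = {(v, r *\<^sub>R w) | v w. (v, w) \<in> X}"

text \<open>The function \<open>f\<close> of a symmetric operator that has a complete set of eigenvectors, as all
  operators below to which this is applied do: the closed operator that acts as \<open>f a\<close> on the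
  eigenvectors of eigenvalue \<open>a\<close>.\<close>

definition fun_of_op :: "(real \<Rightarrow> real) \<Rightarrow> 'a graph_op \<Rightarrow> 'a graph_op" where
  "fun_of_op f X = closure (span {(v, f a *\<^sub>R v) | v a. (v, a *\<^sub>R v) \<in> X})"

text \<open>\<open>has_trace K X t\<close>: the densely defined operator \<open>X\<close> on \<open>K\<close> extends to a bounded operator
  whose diagonal sums converge absolutely (\<open>has_sum\<close> is unconditional) to \<open>t\<close> in every
  orthonormal basis of \<open>K\<close>, that is, to a trace-class operator of trace \<open>t\<close>.\<close>

definition has_trace :: "'a ell2 set \<Rightarrow> 'a graph_op \<Rightarrow> complex \<Rightarrow> bool" where
  "has_trace K X t \<longleftrightarrow> K \<subseteq> closure (Domain X) \<and>
     (\<exists>W. bounded_clinear W \<and> (\<forall>(v, w)\<in>X. W v = w) \<and>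
          (\<forall>B. onb K B \<longrightarrow> ((\<lambda>b. cinner b (W b)) has_sum t) B))"

definition trace_converges :: "'a ell2 set \<Rightarrow> 'a graph_op \<Rightarrow> bool" where
  "trace_converges K X \<longleftrightarrow> (\<exists>t. has_trace K X t)"

definition Tr :: "'a ell2 set \<Rightarrow> 'a graph_op \<Rightarrow> complex" where
  "Tr K X = (THE t. has_trace K X t)"

text \<open>An operator on \<open>K\<close> is extended by zero to the orthogonal complement of \<open>K\<close>; for a
  self-adjoint operator this is what \<open>range \<rho> \<subseteq> K\<close> expresses.\<close>

definition density_matrix :: "'a ell2 set \<Rightarrow> ('a ell2 \<Rightarrow> 'a ell2) \<Rightarrow> bool" where
  "density_matrix K \<rho> \<longleftrightarrow> bounded_clinear \<rho> \<and> range \<rho> \<subseteq> K \<and>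
     (\<forall>u v. cinner u (\<rho> v) = cinner (\<rho> u) v) \<and>
     (\<forall>v. 0 \<le> Re (cinner v (\<rho> v))) \<and>
     has_trace K (graph_on K \<rho>) 1"

definition commute :: "('a ell2 \<Rightarrow> 'a ell2) \<Rightarrow> ('a ell2 \<Rightarrow> 'a ell2) \<Rightarrow> bool" where
  "commute X Y \<longleftrightarrow> X \<circ> Y = Y \<circ> X"

text \<open>\<open>diag_op b w\<close> and \<open>diag_gop b w\<close> are \<open>\<Sum>n. w n |b n\<rangle>\<langle>b n|\<close> for an orthonormal family
  \<open>b\<close>: the former as a bounded operator (for bounded \<open>w\<close>), the latter on its natural domain.\<close>

definition diag_op :: "('i \<Rightarrow> 'a ell2) \<Rightarrow> ('i \<Rightarrow> real) \<Rightarrow> 'a ell2 \<Rightarrow> 'a ell2" where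
  "diag_op b w v = (\<Sum>\<^sub>\<infinity>n. (complex_of_real (w n) * cinner (b n) v) *\<^sub>C b n)"

definition diag_gop :: "('i \<Rightarrow> 'a ell2) \<Rightarrow> ('i \<Rightarrow> real) \<Rightarrow> 'a graph_op" where
  "diag_gop b w = {(v, u). v \<in> closed_cspan (range b) \<and>
     ((\<lambda>n. (complex_of_real (w n) * cinner (b n) v) *\<^sub>C b n) has_sum u) UNIV}"

definition tensor2 :: "'a ell2 \<Rightarrow> 'b ell2 \<Rightarrow> ('a \<times> 'b) ell2" where
  "tensor2 f g = mk_ell2 (\<lambda>(x, y). coord f x * coord g y)"

text \<open>Partial trace over the second factor:
  \<open>\<langle>x| partial_trace W |f\<rangle> = \<Sum>y. \<langle>x \<otimes> y| W |f \<otimes> y\<rangle>\<close>.\<close>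

definition partial_trace ::
    "(('a \<times> 'b) ell2 \<Rightarrow> ('a \<times> 'b) ell2) \<Rightarrow> 'a ell2 \<Rightarrow> 'a ell2" where
  "partial_trace W f = mk_ell2 (\<lambda>x. \<Sum>\<^sub>\<infinity>y. coord (W (tensor2 f (ket y))) (x, y))"

section \<open>Symmetric Fock space\<close>

text \<open>The \<open>n\<close>-fold tensor power of \<open>'a ell2\<close> is the set of square-summable functions on lists of
  length \<open>n\<close>, so \<open>'a list ell2\<close> is the full Fock space over \<open>'a ell2\<close>, with the degree-respecting
  tensor product \<open>tensor\<close>.\<close>

definition tensor :: "'a list ell2 \<Rightarrow> 'a list ell2 \<Rightarrow> 'a list ell2" where
  "tensor \<psi> \<phi> = mk_ell2 (\<lambda>l. \<Sum>k\<le>length l. coord \<psi> (take k l) * coord \<phi> (drop k l))"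

definition symmetrize :: "'a list ell2 \<Rightarrow> 'a list ell2" where
  "symmetrize \<psi> = mk_ell2 (\<lambda>l.
     (\<Sum>\<pi> | \<pi> permutes {..<length l}. coord \<psi> (permute_list \<pi> l)) / fact (length l))"

definition fock :: "'a list ell2 set" where
  "fock = {\<psi>. symmetrize \<psi> = \<psi>}"

definition vac :: "'a list ell2" where
  "vac = ket []"

definition one_particle :: "'a ell2 \<Rightarrow> 'a list ell2" where
  "one_particle f = mk_ell2 (\<lambda>l. case l of [a] \<Rightarrow> coord f a | _ \<Rightarrow> 0)"

text \<open>The component of degree \<open>n\<close> of \<open>a\<^sup>\<dagger>(f) \<psi>\<close> is \<open>\<surd>n (f \<otimes> \<psi>)\<^sub>s\<^sub>y\<^sub>m\<close>. Outside the domain of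
  \<open>a\<^sup>\<dagger>(f)\<close> the value is the junk value 0 of \<open>mk_ell2\<close>; all vectors to which it is applied
  below are in its domain.\<close>

definition create :: "'a ell2 \<Rightarrow> 'a list ell2 \<Rightarrow> 'a list ell2" where
  "create f \<psi> = mk_ell2 (\<lambda>l. complex_of_real (sqrt (real (length l))) *
     coord (symmetrize (tensor (one_particle f) \<psi>)) l)"

text \<open>Occupation numbers are finitely supported. The creation operators commute on number
  states, so the order of the product is immaterial.\<close>

type_synonym occ = "nat \<Rightarrow>\<^sub>0 nat"

definition number_state :: "(nat \<Rightarrow> 'a ell2) \<Rightarrow> occ \<Rightarrow> 'a list ell2" where
  "number_state e n = foldr
     (\<lambda>i \<psi>. (1 / sqrt (fact (Poly_Mapping.lookup n i))) *\<^sub>R (create (e i) ^^ Poly_Mapping.lookup n i) \<psi>)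
     (sorted_list_of_set (Poly_Mapping.keys n)) vac"

text \<open>The canonical unitary from the Fock space of a direct sum to the tensor product of the Fock
  spaces. The factor counts the interleavings of the two lists; with it,
  \<open>a\<^sup>\<dagger>(f \<oplus> 0)\<close> becomes \<open>a\<^sup>\<dagger>(f) \<otimes> 1\<close> and \<open>a\<^sup>\<dagger>(0 \<oplus> g)\<close> becomes \<open>1 \<otimes> a\<^sup>\<dagger>(g)\<close>.\<close>

definition fock_split :: "('a + 'b) list ell2 \<Rightarrow> ('a list \<times> 'b list) ell2" where
  "fock_split \<psi> = mk_ell2 (\<lambda>(l, l').
     complex_of_real (sqrt (real ((length l + length l') choose length l))) *
     coord \<psi> (map Inl l @ map Inr l'))"

section \<open>Scattering on the black-hole background\<close>

text \<open>The geometry and the wave equation enter through the modes, their frequencies and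
  azimuthal numbers, the scattering coefficients and the Bogoliubov transformation. The index
  types \<open>'x\<close>, \<open>'y\<close>, \<open>'z\<close> belong to future null infinity, the future horizon and past null
  infinity.\<close>

record ('x, 'y, 'z) scattering =
  kappa :: real
  Omega_BH :: real
  freq :: "nat \<Rightarrow> real"
  azim :: "nat \<Rightarrow> int"
  t_coeff :: "nat \<Rightarrow> complex"
  r_coeff :: "nat \<Rightarrow> complex"
  T_coeff :: "nat \<Rightarrow> complex"
  R_coeff :: "nat \<Rightarrow> complex"
  rho_mode :: "nat \<Rightarrow> 'x ell2"
  sigma_mode :: "nat \<Rightarrow> 'y ell2"
  tau_mode :: "nat \<Rightarrow> 'y ell2"
  bogoliubov :: "('x + 'y) ell2 \<Rightarrow> 'z ell2"

definition beta_BH :: "('x, 'y, 'z) scattering \<Rightarrow> real" where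
  "beta_BH D = 2 * pi / kappa D"

definition boltz :: "('x, 'y, 'z) scattering \<Rightarrow> nat \<Rightarrow> real" where
  "boltz D i = exp (- pi * (freq D i - Omega_BH D * azim D i) / kappa D)"

definition gamma_mode :: "('x, 'y, 'z) scattering \<Rightarrow> nat \<Rightarrow> ('x + 'y) ell2" where
  "gamma_mode D i = T_coeff D i *\<^sub>C dsum_right (sigma_mode D i)
     + R_coeff D i *\<^sub>C dsum_left (rho_mode D i)"

definition lambda_mode :: "('x, 'y, 'z) scattering \<Rightarrow> nat \<Rightarrow> ('x + 'y) ell2" where
  "lambda_mode D i = t_coeff D i *\<^sub>C dsum_left (rho_mode D i)
     + r_coeff D i *\<^sub>C dsum_right (sigma_mode D i)"

definition in_mode :: "('x, 'y, 'z) scattering \<Rightarrow> nat \<Rightarrow> 'z ell2" where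
  "in_mode D i = bogoliubov D (gamma_mode D i)"

definition in_state :: "('x, 'y, 'z) scattering \<Rightarrow> occ \<Rightarrow> 'z list ell2" where
  "in_state D = number_state (in_mode D)"

definition out_state :: "('x, 'y, 'z) scattering \<Rightarrow> occ \<Rightarrow> 'x list ell2" where
  "out_state D = number_state (rho_mode D)"

text \<open>The states at past null infinity without excitations at \<open>v < v\<^sub>0\<close>.\<close>

definition F_in :: "('x, 'y, 'z) scattering \<Rightarrow> 'z list ell2 set" where
  "F_in D = closed_cspan (range (in_state D))"

definition F_out :: "('x, 'y, 'z) scattering \<Rightarrow> 'x list ell2 set" where
  "F_out D = fock"

definition occ_sum :: "(nat \<Rightarrow> real) \<Rightarrow> occ \<Rightarrow> real" where
  "occ_sum w n = (\<Sum>i\<in>Poly_Mapping.keys n. real (Poly_Mapping.lookup n i) * w i)"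

definition gibbs_weight :: "('x, 'y, 'z) scattering \<Rightarrow> occ \<Rightarrow> real" where
  "gibbs_weight D n = exp (- beta_BH D * occ_sum (\<lambda>i. freq D i - Omega_BH D * azim D i) n)"

definition Z_part :: "('x, 'y, 'z) scattering \<Rightarrow> real" where
  "Z_part D = (\<Sum>\<^sub>\<infinity>n. gibbs_weight D n)"

text \<open>The isometry of the Bogoliubov transformation on the \<open>\<gamma>\<close>-modes is what makes the in-states
  orthonormal; convergence of the partition function makes the thermal states density matrices
  and the out-vacuum below normalizable.\<close>

definition collapse_scattering :: "('x, 'y, 'z) scattering \<Rightarrow> bool" where
  "collapse_scattering D \<longleftrightarrow>
     kappa D > 0 \<and>
     (\<forall>i. (cmod (t_coeff D i))\<^sup>2 + (cmod (r_coeff D i))\<^sup>2 = 1 \<and>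
          (cmod (T_coeff D i))\<^sup>2 + (cmod (R_coeff D i))\<^sup>2 = 1 \<and>
          t_coeff D i = T_coeff D i \<and>
          r_coeff D i = - cnj (R_coeff D i) * T_coeff D i / cnj (T_coeff D i)) \<and>
     orthonormal_family (rho_mode D) \<and> closed_cspan (range (rho_mode D)) = UNIV \<and>
     orthonormal_family (case_sum (sigma_mode D) (tau_mode D)) \<and>
     closed_cspan (range (sigma_mode D) \<union> range (tau_mode D)) = UNIV \<and>
     clinear (bogoliubov D) \<and> orthonormal_family (in_mode D) \<and>
     gibbs_weight D summable_on UNIV"

definition eps_pair :: "('x, 'y, 'z) scattering \<Rightarrow> ('x + 'y) list ell2" where
  "eps_pair D = 2 *\<^sub>R (\<Sum>\<^sub>\<infinity>i. boltz D i *\<^sub>R symmetrize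
     (tensor (one_particle (lambda_mode D i)) (one_particle (dsum_right (tau_mode D i)))))"

definition out_vacuum_series :: "('x, 'y, 'z) scattering \<Rightarrow> ('x + 'y) list ell2" where
  "out_vacuum_series D = (\<Sum>\<^sub>\<infinity>n. (sqrt (fact (2 * n)) / (2 ^ n * fact n)) *\<^sub>R
     symmetrize ((tensor (eps_pair D) ^^ n) vac))"

text \<open>\<open>S\<close> is extended by zero to the orthogonal complement of \<open>F_in\<close>. Its values are written in
  the Fock space of the direct sum, which \<open>fock_split\<close> identifies with the tensor product of the
  two Fock spaces. The last clause is \<open>S a\<^sup>\<dagger>(A \<gamma>\<^sub>i) S\<^sup>-\<^sup>1 = R\<^sub>i a\<^sup>\<dagger>(\<rho>\<^sub>i) + T\<^sub>i a\<^sup>\<dagger>(\<sigma>\<^sub>i)\<close>, applied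
  to the images of the number states.\<close>

definition S_matrix ::
    "('x, 'y, 'z) scattering \<Rightarrow> complex \<Rightarrow> ('z list ell2 \<Rightarrow> ('x + 'y) list ell2) \<Rightarrow> bool" where
  "S_matrix D N S \<longleftrightarrow>
     bounded_clinear S \<and> range S \<subseteq> fock \<and>
     (\<forall>v. (\<forall>u\<in>F_in D. cinner u v = 0) \<longrightarrow> S v = 0) \<and>
     S vac = N *\<^sub>C out_vacuum_series D \<and> norm (S vac) = 1 \<and>
     (\<forall>i n. S (create (in_mode D i) (in_state D n)) =
        R_coeff D i *\<^sub>C create (dsum_left (rho_mode D i)) (S (in_state D n))
        + T_coeff D i *\<^sub>C create (dsum_right (sigma_mode D i)) (S (in_state D n)))"

text \<open>The library's \<open>adjoint\<close> refers to the real inner product; for complex-linear operators it is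
  the Hilbert-space adjoint.\<close>

definition evolve ::
    "('z list ell2 \<Rightarrow> ('x + 'y) list ell2) \<Rightarrow> ('z list ell2 \<Rightarrow> 'z list ell2)
      \<Rightarrow> 'x list ell2 \<Rightarrow> 'x list ell2" where
  "evolve S \<rho> = partial_trace ((fock_split \<circ> S) \<circ> \<rho> \<circ> adjoint (fock_split \<circ> S))"

section \<open>Thermal states, observables and the functionals of the second law\<close>

text \<open>Below, \<open>b\<close> is \<open>in_state D\<close> or \<open>out_state D\<close>, and \<open>K\<close> is accordingly \<open>F_in D\<close> or
  \<open>F_out D\<close>.\<close>

definition thermal ::
    "('x, 'y, 'z) scattering \<Rightarrow> (occ \<Rightarrow> 'a ell2) \<Rightarrow> 'a ell2 \<Rightarrow> 'a ell2" where
  "thermal D b = diag_op b (\<lambda>n. gibbs_weight D n / Z_part D)"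

definition energy_op :: "('x, 'y, 'z) scattering \<Rightarrow> (occ \<Rightarrow> 'a ell2) \<Rightarrow> 'a graph_op" where
  "energy_op D b = diag_gop b (occ_sum (freq D))"

definition angmom_op :: "('x, 'y, 'z) scattering \<Rightarrow> (occ \<Rightarrow> 'a ell2) \<Rightarrow> 'a graph_op" where
  "angmom_op D b = diag_gop b (occ_sum (\<lambda>i. real_of_int (azim D i)))"

definition xlnx :: "real \<Rightarrow> real" where
  "xlnx x = x * ln x"

text \<open>The operators \<open>\<rho> ln \<rho>\<close>, \<open>E \<rho>\<close> and \<open>L\<^sub>z \<rho>\<close>.\<close>

definition rho_ln_rho :: "'a ell2 set \<Rightarrow> ('a ell2 \<Rightarrow> 'a ell2) \<Rightarrow> 'a graph_op" where
  "rho_ln_rho K \<rho> = fun_of_op xlnx (graph_on K \<rho>)"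

definition E_rho :: "('x, 'y, 'z) scattering \<Rightarrow> 'a ell2 set \<Rightarrow> (occ \<Rightarrow> 'a ell2)
    \<Rightarrow> ('a ell2 \<Rightarrow> 'a ell2) \<Rightarrow> 'a graph_op" where
  "E_rho D K b \<rho> = graph_on K \<rho> O energy_op D b"

definition L_rho :: "('x, 'y, 'z) scattering \<Rightarrow> 'a ell2 set \<Rightarrow> (occ \<Rightarrow> 'a ell2)
    \<Rightarrow> ('a ell2 \<Rightarrow> 'a ell2) \<Rightarrow> 'a graph_op" where
  "L_rho D K b \<rho> = graph_on K \<rho> O angmom_op D b"

definition S_matter :: "'a ell2 set \<Rightarrow> ('a ell2 \<Rightarrow> 'a ell2) \<Rightarrow> real" where
  "S_matter K \<rho> = - Re (Tr K (rho_ln_rho K \<rho>))"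

definition E_matter :: "('x, 'y, 'z) scattering \<Rightarrow> 'a ell2 set \<Rightarrow> (occ \<Rightarrow> 'a ell2)
    \<Rightarrow> ('a ell2 \<Rightarrow> 'a ell2) \<Rightarrow> real" where
  "E_matter D K b \<rho> = Re (Tr K (E_rho D K b \<rho>))"

definition L_matter :: "('x, 'y, 'z) scattering \<Rightarrow> 'a ell2 set \<Rightarrow> (occ \<Rightarrow> 'a ell2)
    \<Rightarrow> ('a ell2 \<Rightarrow> 'a ell2) \<Rightarrow> real" where
  "L_matter D K b \<rho> = Re (Tr K (L_rho D K b \<rho>))"

definition traces_converge :: "('x, 'y, 'z) scattering \<Rightarrow> 'a ell2 set \<Rightarrow> (occ \<Rightarrow> 'a ell2)
    \<Rightarrow> ('a ell2 \<Rightarrow> 'a ell2) \<Rightarrow> bool" where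
  "traces_converge D K b \<rho> \<longleftrightarrow> trace_converges K (rho_ln_rho K \<rho>) \<and>
     trace_converges K (E_rho D K b \<rho>) \<and> trace_converges K (L_rho D K b \<rho>)"

definition U_fun :: "('x, 'y, 'z) scattering \<Rightarrow> 'a ell2 set \<Rightarrow> (occ \<Rightarrow> 'a ell2)
    \<Rightarrow> ('a ell2 \<Rightarrow> 'a ell2) \<Rightarrow> real" where
  "U_fun D K b \<rho> = S_matter K \<rho>
     - beta_BH D * (E_matter D K b \<rho> - Omega_BH D * L_matter D K b \<rho>)"

text \<open>Entropy and energy may diverge separately although their combination is finite. The
  following version of \<open>U_fun\<close> takes a single trace, of \<open>\<rho> ln \<rho> + \<beta> (E \<rho> - \<Omega> L\<^sub>z \<rho>)\<close>.\<close>

definition U_op :: "('x, 'y, 'z) scattering \<Rightarrow> 'a ell2 set \<Rightarrow> (occ \<Rightarrow> 'a ell2)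
    \<Rightarrow> ('a ell2 \<Rightarrow> 'a ell2) \<Rightarrow> 'a graph_op" where
  "U_op D K b \<rho> = gop_add (rho_ln_rho K \<rho>)
     (gop_scale (beta_BH D)
       (gop_add (E_rho D K b \<rho>) (gop_scale (- Omega_BH D) (L_rho D K b \<rho>))))"

definition U_joint :: "('x, 'y, 'z) scattering \<Rightarrow> 'a ell2 set \<Rightarrow> (occ \<Rightarrow> 'a ell2)
    \<Rightarrow> ('a ell2 \<Rightarrow> 'a ell2) \<Rightarrow> real" where
  "U_joint D K b \<rho> = - Re (Tr K (U_op D K b \<rho>))"

text \<open>\<open>Tr[\<rho>\<^sub>t\<^sub>h |f(\<rho> \<rho>\<^sub>t\<^sub>h\<^sup>-\<^sup>1)|] < \<infinity>\<close> with \<open>f(x) = x ln x\<close>.\<close>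

definition rel_abs_convergent ::
    "'a ell2 set \<Rightarrow> ('a ell2 \<Rightarrow> 'a ell2) \<Rightarrow> ('a ell2 \<Rightarrow> 'a ell2) \<Rightarrow> bool" where
  "rel_abs_convergent K \<rho>\<^sub>t\<^sub>h \<rho> \<longleftrightarrow> trace_converges K
     (fun_of_op (\<lambda>x. \<bar>xlnx x\<bar>) ((graph_on K \<rho>\<^sub>t\<^sub>h)\<inverse> O graph_on K \<rho>) O graph_on K \<rho>\<^sub>t\<^sub>h)"

definition admissible ::
    "('x, 'y, 'z) scattering \<Rightarrow> ('z list ell2 \<Rightarrow> ('x + 'y) list ell2)
      \<Rightarrow> ('z list ell2 \<Rightarrow> 'z list ell2) \<Rightarrow> bool" where
  "admissible D S \<rho> \<longleftrightarrow>
     commute \<rho> (thermal D (in_state D)) \<and>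
     commute (evolve S \<rho>) (thermal D (out_state D)) \<and>
     rel_abs_convergent (F_in D) (thermal D (in_state D)) \<rho>"

text \<open>Diagonal in the number states, with a bounded number of excitations, all of them in
  finitely many modes. Without the second restriction the trace in \<open>rel_abs_convergent\<close> can
  diverge.\<close>

definition finite_diagonal ::
    "('x, 'y, 'z) scattering \<Rightarrow> ('z list ell2 \<Rightarrow> 'z list ell2) \<Rightarrow> bool" where
  "finite_diagonal D \<rho> \<longleftrightarrow> (\<exists>p I k. finite I \<and> \<rho> = diag_op (in_state D) p \<and>
     (\<forall>n. p n \<noteq> 0 \<longrightarrow> Poly_Mapping.keys n \<subseteq> I \<and> (\<Sum>i\<in>Poly_Mapping.keys n. Poly_Mapping.lookup n i) \<le> k))"

end

theory Submission
  imports Defs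
begin

text \<open>The out-vacuum is the two-mode squeezed vacuum of the pairs \<open>\<lambda>\<^sub>i, \<tau>\<^sub>i\<close>, and
  \<open>S\<close> maps the number state of \<open>\<gamma>\<close>-quanta with occupation \<open>n\<close> to its product with
  \<open>N \<Sum>\<^sub>c x\<^sup>c |c\<rangle>\<^sub>\<lambda> |c\<rangle>\<^sub>\<tau>\<close>. Passing from the modes
  \<open>\<gamma>, \<lambda>\<close> to \<open>\<rho>, \<sigma>\<close> is a unitary that mixes only modes of equal index, so its matrix
  elements between number states conserve the occupation of each index. Hence the weights \<open>x\<^sup>2\<^sup>n\<close>
  of a thermal in-state and \<open>x\<^sup>2\<^sup>c\<close> of the vacuum pairs combine to the weights of the
  \<open>\<rho>\<close>- and \<open>\<sigma>\<close>-quanta, and tracing out the horizon shows that thermal states evolve to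
  thermal states; states diagonal in the number states stay diagonal.

  A density matrix that commutes with the thermal state, whose eigenspaces are finite-dimensional,
  has a joint eigenbasis with it. Between the joint eigenbases of \<open>\<rho>\<^sub>0\<close> and of \<open>T(\<rho>\<^sub>0)\<close> the evolution
  acts on eigenvalues by a stochastic matrix that preserves the thermal weights, and convexity of \<open>x ln x\<close>
  makes the relative entropy to the thermal state decrease. Up to the constant \<open>ln Z\<close>, this
  relative entropy is \<open>- U\<close>.\<close>

section \<open>Hilbert space preliminaries\<close>

text \<open>Three obstacles shape the proof. The relation for \<open>S\<close> applies creation
  operators to states of unbounded particle number, where \<open>create\<close> may return its
  default value. So the coefficients of the scattered states are found together with a proof that
  these states lie in the domain; this rests on the finiteness of the sum of particle number times
  Gibbs weight. Isometry of \<open>S\<close> is not among its defining relations. It follows from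
  the coefficients, which also identify the squared modulus of \<open>N\<close> as the reciprocal of
  \<open>Z_part D\<close>. The amplitudes between the two mode bases are never computed: unitarity
  and the conservation of each charge suffice, and conservation also removes the coherences under
  the partial trace. Energy and angular momentum need not be constant on a thermal eigenspace; only
  the combination in the Gibbs exponent is. Entropy and energy therefore enter as one operator,
  whose trace exists by absolute convergence of the relative entropy, and the separate traces are
  compared with it where they converge.\<close>

lemma coord_mk_ell2: "(\<lambda>x. (cmod (f x))\<^sup>2) summable_on UNIV \<Longrightarrow> coord (mk_ell2 f) = f"
  by (simp add: mk_ell2_def Abs_ell2_inverse)

lemma mk_ell2_coord [simp]: "mk_ell2 (coord f) = f"
  by (simp add: mk_ell2_def coord_summable coord_inverse)

lemma ell2_eqI: "(\<And>x. coord f x = coord g x) \<Longrightarrow> f = g"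
  by (simp add: coord_inject[symmetric] fun_eq_iff)

lemma coord_add [simp]: "coord (f + g) x = coord f x + coord g x"
  by (simp add: plus_ell2.rep_eq)

lemma coord_zero [simp]: "coord 0 x = 0"
  by (simp add: zero_ell2.rep_eq)

lemma coord_scaleC [simp]: "coord (c *\<^sub>C f) x = c * coord f x"
  by (simp add: scaleC.rep_eq)

lemma coord_scaleR [simp]: "coord (r *\<^sub>R f) x = of_real r * coord f x"
  by (simp add: scaleR_ell2.rep_eq)

lemma coord_uminus [simp]: "coord (- f) x = - coord f x"
  by (simp add: uminus_ell2.rep_eq)

lemma coord_diff [simp]: "coord (f - g) x = coord f x - coord g x"
  by (simp add: diff_conv_add_uminus del: add_uminus_conv_diff)

lemma coord_sum: "coord (sum f I) x = (\<Sum>i\<in>I. coord (f i) x)"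
  by (induction I rule: infinite_finite_induct) auto

lemma scaleC_add_right: "c *\<^sub>C (f + g) = c *\<^sub>C f + c *\<^sub>C g"
  and scaleC_add_left: "(c + d) *\<^sub>C f = c *\<^sub>C f + d *\<^sub>C f"
  and scaleC_diff_right: "c *\<^sub>C (f - g) = c *\<^sub>C f - c *\<^sub>C g"
  and scaleC_scaleC [simp]: "c *\<^sub>C d *\<^sub>C f = (c * d) *\<^sub>C f"
  and scaleC_one [simp]: "1 *\<^sub>C f = f"
  and scaleC_zero_left [simp]: "0 *\<^sub>C f = 0"
  and scaleC_zero_right [simp]: "c *\<^sub>C 0 = 0"
  and scaleR_conv_scaleC: "r *\<^sub>R f = of_real r *\<^sub>C f"
  and scaleR_scaleC: "r *\<^sub>R c *\<^sub>C f = c *\<^sub>C r *\<^sub>R f"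
  by (rule ell2_eqI; simp add: algebra_simps)+

lemma cinner_commute: "cinner f g = cnj (cinner g f)"
  unfolding cinner_def infsum_cnj[symmetric] by (simp add: mult.commute)

lemma cinner_add_right: "cinner f (g + h) = cinner f g + cinner f h"
  unfolding cinner_def
  by (subst infsum_add[symmetric, OF cinner_summable cinner_summable]) (simp add: algebra_simps)

lemma cinner_scaleC_right [simp]: "cinner f (c *\<^sub>C g) = c * cinner f g"
  unfolding cinner_def
  by (subst infsum_cmult_right[symmetric, OF cinner_summable]) (simp add: algebra_simps)

lemma cinner_scaleR_right [simp]: "cinner f (c *\<^sub>R g) = c * cinner f g"
  by (simp add: scaleR_conv_scaleC)

lemma cinner_add_left: "cinner (f + g) h = cinner f h + cinner g h"
  by (subst (1 2 3) cinner_commute) (simp add: cinner_add_right)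

lemma cinner_scaleC_left [simp]: "cinner (c *\<^sub>C f) g = cnj c * cinner f g"
  by (subst (1 2) cinner_commute) simp

lemma cinner_scaleR_left [simp]: "cinner (c *\<^sub>R f) g = c * cinner f g"
  by (simp add: scaleR_conv_scaleC)

lemma cinner_zero_right [simp]: "cinner f 0 = 0"
  using cinner_scaleC_right[of f 0 0] by (simp del: cinner_scaleC_right)

lemma cinner_zero_left [simp]: "cinner 0 f = 0"
  by (subst cinner_commute) simp

lemma cinner_diff_right: "cinner f (g - h) = cinner f g - cinner f h"
  using cinner_add_right[of f "g - h" h] by simp

lemma cinner_sum_right: "cinner f (sum g I) = (\<Sum>i\<in>I. cinner f (g i))"
  by (induction I rule: infinite_finite_induct) (auto simp: cinner_add_right)

lemma cinner_sum_left: "cinner (sum g I) f = (\<Sum>i\<in>I. cinner (g i) f)"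
  by (induction I rule: infinite_finite_induct) (auto simp: cinner_add_left)

lemma cinner_norm: "cinner f f = of_real ((norm f)\<^sup>2)"
proof -
  have "Re (cinner f f) = (norm f)\<^sup>2"
    using dot_square_norm[of f] by (simp add: inner_ell2_def)
  then show ?thesis by (simp add: cinner_self)
qed

lemma norm_ell2_infsum: "(norm f)\<^sup>2 = (\<Sum>\<^sub>\<infinity>x. (cmod (coord f x))\<^sup>2)"
  using cinner_norm[of f] by (simp only: cinner_self of_real_eq_iff)

lemma norm_ell2_has_sum: "((\<lambda>x. (cmod (coord f x))\<^sup>2) has_sum (norm f)\<^sup>2) UNIV"
  by (simp add: norm_ell2_infsum coord_summable)

lemma norm_scaleC [simp]: "norm (c *\<^sub>C f) = cmod c * norm f"
proof -
  have "complex_of_real ((norm (c *\<^sub>C f))\<^sup>2) = of_real ((cmod c * norm f)\<^sup>2)"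
    by (simp add: cinner_norm[symmetric] power_mult_distrib complex_norm_square
        flip: of_real_power)
  then show ?thesis by (simp only: of_real_eq_iff) simp
qed

text \<open>Rotating \<open>g\<close> by the phase \<open>c\<close> makes the inner product real and
  nonnegative, so the real Cauchy-Schwarz inequality bounds its modulus.\<close>

lemma cinner_Cauchy_Schwarz: "cmod (cinner f g) \<le> norm f * norm g"
proof (cases "cinner f g = 0")
  case False
  define c where "c = cnj (cinner f g) / cmod (cinner f g)"
  have "cinner f (c *\<^sub>C g) = cmod (cinner f g)"
    using False complex_norm_square[of "cinner f g"]
    by (simp add: c_def divide_simps power2_eq_square mult.commute)
  then have "cmod (cinner f g) = inner f (c *\<^sub>C g)" by (simp add: inner_ell2_def)
  also have "\<dots> \<le> norm f * norm (c *\<^sub>C g)" by (rule norm_cauchy_schwarz)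
  also have "norm (c *\<^sub>C g) = norm g" using False by (simp add: c_def norm_divide)
  finally show ?thesis .
qed simp

lemma bounded_linear_cinner_right: "bounded_linear (cinner f)"
  by (rule bounded_linear_intro[of _ "norm f"])
    (auto simp: cinner_add_right scaleR_conv_of_real mult.commute[of "norm _" "norm f"] cinner_Cauchy_Schwarz)

lemma bounded_linear_cinner_left: "bounded_linear (\<lambda>f. cinner f g)"
  by (rule bounded_linear_intro[of _ "norm g"])
    (auto simp: cinner_add_left scaleR_conv_of_real cinner_Cauchy_Schwarz)

lemma bounded_linear_scaleC: "bounded_linear (scaleC c :: 'a ell2 \<Rightarrow> _)"
  by (rule bounded_linear_intro[of _ "cmod c"]) (auto simp: scaleC_add_right scaleR_scaleC)

lemma bounded_linear_scaleC_left: "bounded_linear (\<lambda>c. c *\<^sub>C f)"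
  by (rule bounded_linear_intro[of _ "norm f"])
    (auto simp: scaleC_add_left scaleR_conv_of_real scaleR_conv_scaleC)

lemmas has_sum_cinner_right = has_sum_bounded_linear[OF bounded_linear_cinner_right]
lemmas has_sum_cinner_left = has_sum_bounded_linear[OF bounded_linear_cinner_left]
lemmas has_sum_scaleC = has_sum_bounded_linear[OF bounded_linear_scaleC]

lemma coord_ket: "coord (ket a) x = (if x = a then 1 else 0)"
proof -
  have "(\<lambda>x. (cmod (if x = a then 1 else 0))\<^sup>2) summable_on UNIV"
    by (rule finite_nonzero_values_imp_summable_on) (auto intro: finite_subset[of _ "{a}"])
  then show ?thesis by (simp add: ket_def coord_mk_ell2)
qed

lemma cinner_ket_left [simp]: "cinner (ket a) f = coord f a"
proof -
  have "((\<lambda>x. cnj (coord (ket a) x) * coord f x) has_sum coord f a) UNIV"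
    by (rule has_sum_finite_neutralI[of "{a}"]) (auto simp: coord_ket)
  then show ?thesis by (simp add: cinner_def infsumI)
qed

lemma cinner_ket_right [simp]: "cinner f (ket a) = cnj (coord f a)"
  by (subst cinner_commute) simp

lemma bounded_linear_coord: "bounded_linear (\<lambda>f. coord f x)"
proof -
  have "cinner (ket x) = (\<lambda>f. coord f x)" by (simp add: fun_eq_iff)
  then show ?thesis using bounded_linear_cinner_right[of "ket x"] by simp
qed

lemmas has_sum_coord = has_sum_bounded_linear[OF bounded_linear_coord]

lemma norm_ket [simp]: "norm (ket a) = 1"
proof -
  have "complex_of_real ((norm (ket a))\<^sup>2) = of_real 1"
    unfolding cinner_norm[symmetric] by (simp add: coord_ket)
  then have "(norm (ket a))\<^sup>2 = 1" by (simp only: of_real_eq_iff)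
  then show ?thesis using norm_ge_zero[of "ket a"] by (auto simp: power2_eq_1_iff)
qed

lemma norm_coord_le: "cmod (coord f x) \<le> norm f"
  using cinner_Cauchy_Schwarz[of "ket x" f] by simp

lemma cinner_has_sum: "((\<lambda>x. cnj (coord f x) * coord g x) has_sum cinner f g) UNIV"
  unfolding cinner_def by (intro has_sum_infsum cinner_summable)

section \<open>Completeness and unconditional summation\<close>

lemma ell2_summable_bound:
  assumes "\<And>F. finite F \<Longrightarrow> (\<Sum>x\<in>F. (cmod (f x))\<^sup>2) \<le> B"
  shows "(\<lambda>x. (cmod (f x))\<^sup>2) summable_on UNIV" "(norm (mk_ell2 f))\<^sup>2 \<le> B"
proof -
  show *: "(\<lambda>x. (cmod (f x))\<^sup>2) summable_on UNIV"
    by (rule nonneg_bdd_above_summable_on) (use assms in \<open>auto intro!: bdd_aboveI2\<close>)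
  show "(norm (mk_ell2 f))\<^sup>2 \<le> B"
    unfolding norm_ell2_infsum coord_mk_ell2[OF *]
    by (rule infsum_le_finite_sums[OF *]) (use assms in auto)
qed

text \<open>The limit is taken coordinatewise. \<open>close\<close> carries the Cauchy estimate over
  each finite set of coordinates to the limit, and \<open>ell2_summable_bound\<close> turns these
  uniform bounds into membership and convergence in norm.\<close>

instance ell2 :: (type) banach
proof
  fix X :: "nat \<Rightarrow> 'a ell2" assume X: "Cauchy X"
  have "Cauchy (\<lambda>n. coord (X n) x)" for x
  proof (rule metric_CauchyI)
    fix e :: real assume "e > 0"
    with X obtain M where "\<forall>m\<ge>M. \<forall>n\<ge>M. dist (X m) (X n) < e" by (meson metric_CauchyD)
    then show "\<exists>M. \<forall>m\<ge>M. \<forall>n\<ge>M. dist (coord (X m) x) (coord (X n) x) < e"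
      using norm_coord_le[of "X _ - X _" x] unfolding dist_norm by (metis coord_diff order_le_less_trans)
  qed
  then have "\<forall>x. \<exists>l. (\<lambda>n. coord (X n) x) \<longlonglongrightarrow> l"
    using Cauchy_convergent convergent_def by blast
  then obtain l where l: "\<And>x. (\<lambda>n. coord (X n) x) \<longlonglongrightarrow> l x" by metis
  have close: "(\<Sum>x\<in>F. (cmod (l x - coord (X n) x))\<^sup>2) \<le> e\<^sup>2"
    if M: "\<forall>m\<ge>M. \<forall>n\<ge>M. dist (X m) (X n) < e" and n: "n \<ge> M" and F: "finite F" for e M n F
  proof (rule LIMSEQ_le_const2)
    show "(\<lambda>m. \<Sum>x\<in>F. (cmod (coord (X m) x - coord (X n) x))\<^sup>2) \<longlonglongrightarrow> (\<Sum>x\<in>F. (cmod (l x - coord (X n) x))\<^sup>2)"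
      by (intro tendsto_intros l)
    have "(\<Sum>x\<in>F. (cmod (coord (X m) x - coord (X n) x))\<^sup>2) \<le> e\<^sup>2" if "m \<ge> M" for m
    proof -
      have "(\<Sum>x\<in>F. (cmod (coord (X m) x - coord (X n) x))\<^sup>2) \<le> (norm (X m - X n))\<^sup>2"
        using finite_sum_le_has_sum[OF norm_ell2_has_sum[of "X m - X n"], of F] F by simp
      also have "\<dots> \<le> e\<^sup>2" using M n that by (intro power_mono) (auto simp: dist_norm intro: less_imp_le)
      finally show ?thesis .
    qed
    then show "\<exists>N. \<forall>m\<ge>N. (\<Sum>x\<in>F. (cmod (coord (X m) x - coord (X n) x))\<^sup>2) \<le> e\<^sup>2" by blast
  qed
  have L: "(\<lambda>x. (cmod (l x))\<^sup>2) summable_on UNIV"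
  proof -
    obtain M where "\<forall>m\<ge>M. \<forall>n\<ge>M. dist (X m) (X n) < 1" using metric_CauchyD[OF X, of 1] by auto
    from close[OF this order_refl] have "(\<lambda>x. (cmod (l x - coord (X M) x))\<^sup>2) summable_on UNIV"
      by (rule ell2_summable_bound)
    from ell2_add_summable[OF this coord_summable[of "X M"]] show ?thesis by simp
  qed
  have "X \<longlonglongrightarrow> mk_ell2 l"
  proof (rule metric_LIMSEQ_I)
    fix e :: real assume e: "e > 0"
    obtain M where M: "\<forall>m\<ge>M. \<forall>n\<ge>M. dist (X m) (X n) < e/2" using metric_CauchyD[OF X, of "e/2"] e by auto
    have "norm (X n - mk_ell2 l) < e" if "n \<ge> M" for n
    proof -
      have "mk_ell2 l - X n = mk_ell2 (\<lambda>x. l x - coord (X n) x)"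
        by (rule ell2_eqI) (simp add: coord_mk_ell2 L ell2_summable_bound(1)[OF close[OF M that]])
      then have "(norm (mk_ell2 l - X n))\<^sup>2 \<le> (e/2)\<^sup>2"
        using ell2_summable_bound(2)[OF close[OF M that]] by simp
      then have "norm (mk_ell2 l - X n) \<le> e/2" using e by (simp add: power2_le_iff_abs_le)
      then show ?thesis using e by (simp add: norm_minus_commute)
    qed
    then show "\<exists>N. \<forall>n\<ge>N. dist (X n) (mk_ell2 l) < e" by (auto simp: dist_norm)
  qed
  then show "convergent X" by (auto simp: convergent_def)
qed

text \<open>Two finite sets that contain \<open>F0\<close> differ only outside of it, so their sums
  differ by less than \<open>e\<close>. The criterion serves orthonormal series, which converge
  unconditionally but in general not absolutely, so that comparison of norms does not apply.\<close>

lemma summable_on_CauchyI: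
  fixes f :: "'i \<Rightarrow> 'b::banach"
  assumes "\<And>e. e > 0 \<Longrightarrow> \<exists>F0. finite F0 \<and> F0 \<subseteq> A \<and> (\<forall>F. finite F \<longrightarrow> F \<subseteq> A - F0 \<longrightarrow> norm (sum f F) < e)"
  shows "f summable_on A"
proof -
  have "\<exists>P. eventually P (finite_subsets_at_top A) \<and> (\<forall>F F'. P F \<and> P F' \<longrightarrow> dist (sum f F) (sum f F') < e)"
    if "e > 0" for e
  proof -
    obtain F0 where F0: "finite F0" "F0 \<subseteq> A" "\<And>F. finite F \<Longrightarrow> F \<subseteq> A - F0 \<Longrightarrow> norm (sum f F) < e/2"
      using assms[of "e/2"] \<open>e > 0\<close> by auto
    define P where "P F \<longleftrightarrow> finite F \<and> F0 \<subseteq> F \<and> F \<subseteq> A" for F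
    have "eventually P (finite_subsets_at_top A)"
      unfolding P_def eventually_finite_subsets_at_top using F0 by auto
    moreover have "dist (sum f F) (sum f F') < e" if "P F" "P F'" for F F'
    proof -
      have s: "sum f G = sum f (G - F0) + sum f F0" if "P G" for G
        using that by (auto simp: P_def intro: sum.subset_diff)
      have "dist (sum f F) (sum f F') = norm (sum f (F - F0) - sum f (F' - F0))"
        using s[OF that(1)] s[OF that(2)] by (simp add: dist_norm)
      also have "\<dots> \<le> norm (sum f (F - F0)) + norm (sum f (F' - F0))" by (rule norm_triangle_ineq4)
      also have "\<dots> < e/2 + e/2" using that by (intro add_strict_mono F0(3)) (auto simp: P_def)
      finally show ?thesis by simp
    qed
    ultimately show ?thesis by blast
  qed
  then have "cauchy_filter (filtermap (sum f) (finite_subsets_at_top A))"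
    by (simp add: cauchy_filter_metric_filtermap)
  moreover have "complete (UNIV::'b set)"
    by (meson Cauchy_convergent UNIV_I complete_def convergent_def)
  ultimately obtain L' where "(sum f \<longlongrightarrow> L') (finite_subsets_at_top A)"
    using complete_uniform[where S=UNIV] by (force simp add: filterlim_def)
  then show ?thesis using summable_on_def has_sum_def by blast
qed

subsection \<open>Orthonormal families\<close>

text \<open>Relative to an index set, so that it covers both the set-indexed bases of
  \<open>onb\<close> and the finite blocks of an eigenspace.\<close>

definition orthonormal_on :: "('i \<Rightarrow> 'a ell2) \<Rightarrow> 'i set \<Rightarrow> bool" where
  "orthonormal_on b I \<longleftrightarrow> (\<forall>i\<in>I. \<forall>j\<in>I. cinner (b i) (b j) = (if i = j then 1 else 0))"

lemma orthonormal_onD: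
  "orthonormal_on b I \<Longrightarrow> i \<in> I \<Longrightarrow> j \<in> I \<Longrightarrow> cinner (b i) (b j) = (if i = j then 1 else 0)"
  by (simp add: orthonormal_on_def)

lemma orthonormal_family_on: "orthonormal_family b \<longleftrightarrow> orthonormal_on b UNIV"
  by (simp add: orthonormal_family_def orthonormal_on_def)

lemma onb_orthonormal_on: "onb K B \<longleftrightarrow> orthonormal_on (\<lambda>b. b) B \<and> closed_cspan B = K"
  by (simp add: onb_def orthonormal_on_def)

lemma orthonormal_on_inj: "orthonormal_on b I \<Longrightarrow> inj_on b I"
  by (rule inj_onI) (metis orthonormal_onD zero_neq_one)

lemma orthonormal_onb: "orthonormal_family b \<Longrightarrow> onb (closed_cspan (range b)) (range b)"
  unfolding onb_def orthonormal_family_def by (auto; metis zero_neq_one)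

lemma orthonormal_norm:
  assumes "orthonormal_on b I" "i \<in> I" shows "norm (b i) = 1"
proof -
  have "complex_of_real ((norm (b i))\<^sup>2) = of_real 1"
    unfolding cinner_norm[symmetric] using assms by (simp add: orthonormal_onD)
  then have "(norm (b i))\<^sup>2 = 1" by (simp only: of_real_eq_iff)
  then show ?thesis using norm_ge_zero[of "b i"] by (auto simp: power2_eq_1_iff)
qed

lemma norm_orthonormal_sum:
  assumes "orthonormal_on b I" "finite F" "F \<subseteq> I"
  shows "(norm (\<Sum>i\<in>F. c i *\<^sub>C b i))\<^sup>2 = (\<Sum>i\<in>F. (cmod (c i))\<^sup>2)"
proof -
  have "complex_of_real ((norm (\<Sum>i\<in>F. c i *\<^sub>C b i))\<^sup>2) = (\<Sum>i\<in>F. \<Sum>j\<in>F. cnj (c i) * (c j * cinner (b i) (b j)))"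
    unfolding cinner_norm[symmetric] cinner_sum_left unfolding cinner_sum_right
    by (simp add: sum_distrib_left mult.left_commute)
  also have "\<dots> = (\<Sum>i\<in>F. \<Sum>j\<in>F. if i = j then cnj (c i) * c i else 0)"
    by (intro sum.cong refl) (use assms in \<open>auto simp: orthonormal_onD subset_iff\<close>)
  also have "\<dots> = (\<Sum>i\<in>F. of_real ((cmod (c i))\<^sup>2))"
    using assms(2) by (simp add: complex_norm_square mult.commute flip: of_real_power)
  finally show ?thesis by (simp only: of_real_sum[symmetric] of_real_eq_iff)
qed

text \<open>The squared distance of \<open>v\<close> from its projection \<open>u\<close> is
  nonnegative.\<close>

lemma Bessel_finite:
  assumes "orthonormal_on b I" "finite F" "F \<subseteq> I"
  shows "(\<Sum>i\<in>F. (cmod (cinner (b i) v))\<^sup>2) \<le> (norm v)\<^sup>2"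
proof -
  define u where "u = (\<Sum>i\<in>F. cinner (b i) v *\<^sub>C b i)"
  have u: "(norm u)\<^sup>2 = (\<Sum>i\<in>F. (cmod (cinner (b i) v))\<^sup>2)"
    unfolding u_def by (rule norm_orthonormal_sum[OF assms])
  have "cinner u v = of_real ((norm u)\<^sup>2)"
    unfolding u by (simp add: u_def cinner_sum_left complex_norm_square mult.commute del: of_real_power)
  then have "inner u v = (norm u)\<^sup>2" by (simp add: inner_ell2_def)
  moreover have "(norm (v - u))\<^sup>2 = (norm v)\<^sup>2 + (norm u)\<^sup>2 - 2 * inner u v"
    by (simp add: power2_norm_eq_inner inner_diff inner_commute)
  ultimately show ?thesis using u zero_le_power2[of "norm (v - u)"] by simp
qed

lemma Bessel_summable:
  assumes "orthonormal_on b I"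
  shows "(\<lambda>i. (cmod (cinner (b i) v))\<^sup>2) summable_on I"
  by (rule nonneg_bdd_above_summable_on) (use Bessel_finite[OF assms] in \<open>auto intro!: bdd_aboveI2\<close>)

text \<open>By Pythagoras the squared norm of a finite piece of the series is the sum of the squared
  coefficients in it, so the Cauchy criterion carries over from the coefficients.\<close>

lemma orthonormal_summable:
  assumes b: "orthonormal_on b I" and c: "(\<lambda>i. (cmod (c i))\<^sup>2) summable_on I"
  shows "(\<lambda>i. c i *\<^sub>C b i) summable_on I"
proof (rule summable_on_CauchyI)
  fix e :: real assume "e > 0"
  then obtain F0 where F0: "finite F0" "F0 \<subseteq> I"
    "dist (\<Sum>i\<in>F0. (cmod (c i))\<^sup>2) (\<Sum>\<^sub>\<infinity>i\<in>I. (cmod (c i))\<^sup>2) \<le> e\<^sup>2 / 2"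
    using infsum_finite_approximation[OF c, of "e\<^sup>2/2"] by auto
  have "norm (\<Sum>i\<in>F. c i *\<^sub>C b i) < e" if F: "finite F" "F \<subseteq> I - F0" for F
  proof -
    have "(\<Sum>i\<in>F. (cmod (c i))\<^sup>2) + (\<Sum>i\<in>F0. (cmod (c i))\<^sup>2) = (\<Sum>i\<in>F \<union> F0. (cmod (c i))\<^sup>2)"
      using F F0 by (subst sum.union_disjoint) auto
    also have "\<dots> \<le> (\<Sum>\<^sub>\<infinity>i\<in>I. (cmod (c i))\<^sup>2)"
      using F F0 by (intro finite_sum_le_infsum c) auto
    finally have "(\<Sum>i\<in>F. (cmod (c i))\<^sup>2) \<le> e\<^sup>2/2" using F0(3) unfolding dist_real_def by linarith
    then have "(norm (\<Sum>i\<in>F. c i *\<^sub>C b i))\<^sup>2 < e\<^sup>2"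
    proof (subst norm_orthonormal_sum[OF b])
      show "(\<Sum>i\<in>F. (cmod (c i))\<^sup>2) < e\<^sup>2"
        using \<open>(\<Sum>i\<in>F. (cmod (c i))\<^sup>2) \<le> e\<^sup>2/2\<close> zero_less_power[OF \<open>e > 0\<close>, of 2] by linarith
    qed (use F in auto)
    then show ?thesis using \<open>e > 0\<close> by (simp add: power_less_imp_less_base)
  qed
  then show "\<exists>F0. finite F0 \<and> F0 \<subseteq> I \<and> (\<forall>F. finite F \<longrightarrow> F \<subseteq> I - F0 \<longrightarrow> norm (\<Sum>i\<in>F. c i *\<^sub>C b i) < e)"
    using F0 by blast
qed

lemma orthonormal_coeff:
  assumes b: "orthonormal_on b I" and v: "((\<lambda>i. c i *\<^sub>C b i) has_sum v) I" and "j \<in> I"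
  shows "cinner (b j) v = c j"
proof -
  have "((\<lambda>i. cinner (b j) (c i *\<^sub>C b i)) has_sum cinner (b j) v) I"
    by (rule has_sum_cinner_right[OF v])
  moreover have "((\<lambda>i. cinner (b j) (c i *\<^sub>C b i)) has_sum c j) I"
    by (rule has_sum_finite_neutralI[of "{j}"]) (use assms in \<open>auto simp: orthonormal_onD\<close>)
  ultimately show ?thesis by (rule has_sum_unique)
qed

subsection \<open>Closed complex spans\<close>

lemma subspace_closure:
  fixes S :: "'a::real_normed_vector set"
  assumes "subspace S" shows "subspace (closure S)"
proof (rule subspaceI)
  show "0 \<in> closure S" using assms closure_subset subspace_0 by blast
next
  fix x y assume "x \<in> closure S" "y \<in> closure S"
  then obtain X Y where "\<And>n. X n \<in> S" "X \<longlonglongrightarrow> x" "\<And>n. Y n \<in> S" "Y \<longlonglongrightarrow> y"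
    unfolding closure_sequential by metis
  then show "x + y \<in> closure S"
    unfolding closure_sequential using assms
    by (intro exI[of _ "\<lambda>n. X n + Y n"]) (auto intro!: tendsto_add subspace_add)
next
  fix x c assume "x \<in> closure S"
  then obtain X where "\<And>n. X n \<in> S" "X \<longlonglongrightarrow> x" unfolding closure_sequential by metis
  then show "c *\<^sub>R x \<in> closure S"
    unfolding closure_sequential using assms
    by (intro exI[of _ "\<lambda>n. c *\<^sub>R X n"]) (auto intro!: tendsto_scaleR subspace_scale)
qed

lemma in_closed_cspanI: "b \<in> B \<Longrightarrow> c *\<^sub>C b \<in> closed_cspan B"
  unfolding closed_cspan_def by (rule subsetD[OF closure_subset]) (auto intro: span_base)

lemma closed_cspan_base: "b \<in> B \<Longrightarrow> b \<in> closed_cspan B"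
  using in_closed_cspanI[of b B 1] by simp

lemma subspace_closed_cspan: "subspace (closed_cspan B)"
  unfolding closed_cspan_def by (intro subspace_closure subspace_span)

lemma closed_closed_cspan: "closed (closed_cspan B)"
  by (simp add: closed_cspan_def)

lemma closed_cspan_minimal:
  assumes "closed K" "subspace K" "\<And>c b. b \<in> B \<Longrightarrow> c *\<^sub>C b \<in> K"
  shows "closed_cspan B \<subseteq> K"
  unfolding closed_cspan_def by (intro closure_minimal span_minimal) (use assms in auto)

text \<open>\<open>closed_cspan\<close> is the closure of a real span, so invariance under complex
  scalars has to be derived: its preimage under \<open>scaleC c\<close> is a closed real subspace
  that contains the generators.\<close>

lemma closed_cspan_scaleC: "v \<in> closed_cspan B \<Longrightarrow> c *\<^sub>C v \<in> closed_cspan B"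
proof -
  have "closed_cspan B \<subseteq> scaleC c -` closed_cspan B"
  proof (rule closed_cspan_minimal)
    show "closed (scaleC c -` closed_cspan B)"
      by (intro closed_vimage closed_closed_cspan linear_continuous_on bounded_linear_scaleC)
    show "subspace (scaleC c -` closed_cspan B)"
      by (intro linear_subspace_vimage subspace_closed_cspan bounded_linear.linear bounded_linear_scaleC)
  qed (auto intro: in_closed_cspanI)
  then show "v \<in> closed_cspan B \<Longrightarrow> c *\<^sub>C v \<in> closed_cspan B" by auto
qed

lemma has_sum_in_closed_subspace:
  fixes K :: "'a::real_normed_vector set"
  assumes "closed K" "subspace K" "(f has_sum s) I" "\<And>i. i \<in> I \<Longrightarrow> f i \<in> K"
  shows "s \<in> K"
proof (rule Lim_in_closed_set[OF assms(1) _ _ assms(3)[unfolded has_sum_def]])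
  show "\<forall>\<^sub>F F in finite_subsets_at_top I. sum f F \<in> K"
    by (rule eventually_finite_subsets_at_top_weakI) (use assms in \<open>auto intro!: subspace_sum\<close>)
qed (rule finite_subsets_at_top_neq_bot)

lemma closed_cspan_orth:
  assumes "v \<in> closed_cspan B" "\<And>b. b \<in> B \<Longrightarrow> cinner b u = 0"
  shows "cinner v u = 0"
proof -
  have "closed_cspan B \<subseteq> (\<lambda>v. cinner v u) -` {0}"
  proof (rule closed_cspan_minimal)
    show "closed ((\<lambda>v. cinner v u) -` {0})"
      by (intro closed_vimage linear_continuous_on bounded_linear_cinner_left) simp
    show "subspace ((\<lambda>v. cinner v u) -` {0})"
      by (intro linear_subspace_vimage bounded_linear.linear bounded_linear_cinner_left subspace_single_0)
  qed (use assms(2) in auto)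
  then show ?thesis using assms(1) by auto
qed

text \<open>The series converges by Bessel. The difference of \<open>v\<close> and its sum lies in
  the closed span and is orthogonal to the generators, hence to itself.\<close>

lemma closed_cspan_Fourier:
  assumes b: "orthonormal_on b I" and v: "v \<in> closed_cspan (b ` I)"
  shows "((\<lambda>i. cinner (b i) v *\<^sub>C b i) has_sum v) I"
proof -
  obtain u where u: "((\<lambda>i. cinner (b i) v *\<^sub>C b i) has_sum u) I"
    using orthonormal_summable[OF b Bessel_summable[OF b]] by (auto simp: summable_on_def)
  have "u \<in> closed_cspan (b ` I)"
    by (rule has_sum_in_closed_subspace[OF closed_closed_cspan subspace_closed_cspan u])
      (auto intro: in_closed_cspanI)
  then have vu: "v - u \<in> closed_cspan (b ` I)" using v by (simp add: subspace_diff subspace_closed_cspan)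
  have "cinner (v - u) (v - u) = 0"
    by (rule closed_cspan_orth[OF vu]) (use orthonormal_coeff[OF b u] in \<open>auto simp: cinner_diff_right\<close>)
  then have "v = u" by (simp add: cinner_norm)
  then show ?thesis using u by simp
qed

lemma Parseval:
  assumes b: "orthonormal_on b I" and v: "v \<in> closed_cspan (b ` I)"
  shows "((\<lambda>i. cinner u (b i) * cinner (b i) v) has_sum cinner u v) I"
  using has_sum_cinner_right[OF closed_cspan_Fourier[OF assms], of u] by (simp add: mult.commute)

lemma Parseval_norm:
  assumes b: "orthonormal_on b I" and v: "v \<in> closed_cspan (b ` I)"
  shows "((\<lambda>i. (cmod (cinner (b i) v))\<^sup>2) has_sum (norm v)\<^sup>2) I"
proof -
  have "((\<lambda>i. cinner v (b i) * cinner (b i) v) has_sum cinner v v) I" by (rule Parseval[OF assms])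
  moreover have "cinner v (b i) * cinner (b i) v = complex_of_real ((cmod (cinner (b i) v))\<^sup>2)" for i
    by (subst cinner_commute) (simp add: complex_norm_square mult.commute del: of_real_power)
  ultimately show ?thesis by (simp only: cinner_norm has_sum_of_real_iff)
qed

text \<open>Completeness is reduced to the absence of a nonzero orthogonal vector: subtracting its
  Fourier series from a vector of \<open>K\<close> leaves something orthogonal to the whole family.
  All bases below are shown to be complete in this form.\<close>

lemma closed_cspan_eqI:
  assumes b: "orthonormal_on b I" and "closed K" "subspace K" "\<And>c v. v \<in> K \<Longrightarrow> c *\<^sub>C v \<in> K" "b ` I \<subseteq> K"
    and orth: "\<And>v. v \<in> K \<Longrightarrow> (\<And>i. i \<in> I \<Longrightarrow> cinner (b i) v = 0) \<Longrightarrow> v = 0"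
  shows "closed_cspan (b ` I) = K"
proof
  show sub: "closed_cspan (b ` I) \<subseteq> K" by (rule closed_cspan_minimal) (use assms in auto)
  show "K \<subseteq> closed_cspan (b ` I)"
  proof
    fix v assume v: "v \<in> K"
    obtain u where u: "((\<lambda>i. cinner (b i) v *\<^sub>C b i) has_sum u) I"
      using orthonormal_summable[OF b Bessel_summable[OF b]] by (auto simp: summable_on_def)
    have u': "u \<in> closed_cspan (b ` I)"
      by (rule has_sum_in_closed_subspace[OF closed_closed_cspan subspace_closed_cspan u])
        (auto intro: in_closed_cspanI)
    have "v - u = 0"
      by (rule orth) (use sub u' v assms(3) orthonormal_coeff[OF b u] in \<open>auto simp: subspace_diff cinner_diff_right\<close>)
    then show "v \<in> closed_cspan (b ` I)" using u' by simp
  qed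
qed

lemma closed_cspan_eqD:
  assumes b: "orthonormal_on b I" and v: "v \<in> closed_cspan (b ` I)" and w: "w \<in> closed_cspan (b ` I)"
    and "\<And>i. i \<in> I \<Longrightarrow> cinner (b i) v = cinner (b i) w"
  shows "v = w"
proof -
  have "((\<lambda>i. cinner (b i) w *\<^sub>C b i) has_sum v) I"
    using closed_cspan_Fourier[OF b v] assms(4) by (simp cong: has_sum_cong)
  then show ?thesis using closed_cspan_Fourier[OF b w] has_sum_unique by blast
qed

section \<open>Fock space\<close>

subsection \<open>Symmetrization\<close>

text \<open>The averaging inside \<open>symmetrize\<close>, for bare functions with real or complex
  values, so that it also applies to squared moduli and to products of wave functions.\<close>

definition perm_avg :: "('a list \<Rightarrow> 'b::{banach,real_normed_field}) \<Rightarrow> 'a list \<Rightarrow> 'b" where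
  "perm_avg h l = (\<Sum>\<pi> | \<pi> permutes {..<length l}. h (permute_list \<pi> l)) / fact (length l)"

lemma perm_avg_invariant:
  assumes "\<And>l'. mset l' = mset l \<Longrightarrow> h l' = c"
  shows "perm_avg h l = c"
proof -
  have "(\<Sum>\<pi> | \<pi> permutes {..<length l}. h (permute_list \<pi> l)) = (\<Sum>\<pi> | \<pi> permutes {..<length l}. c)"
    by (intro sum.cong refl assms mset_permute_list) auto
  then show ?thesis by (simp add: perm_avg_def card_permutations[OF refl])
qed

lemma perm_avg_permute:
  assumes "mset l = mset l'"
  shows "perm_avg h l = perm_avg h l'"
proof -
  obtain p where p: "p permutes {..<length l'}" "permute_list p l' = l"
    using assms mset_eq_permutation by blast
  have len: "length l = length l'" using assms mset_eq_length by blast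
  have "(\<Sum>\<pi> | \<pi> permutes {..<length l'}. h (permute_list \<pi> l))
      = (\<Sum>\<pi> | \<pi> permutes {..<length l'}. h (permute_list (p \<circ> \<pi>) l'))"
    by (intro sum.cong refl) (simp add: permute_list_compose p)
  also have "\<dots> = (\<Sum>\<pi> | \<pi> permutes {..<length l'}. h (permute_list \<pi> l'))"
    by (rule setum_permutations_compose_left[OF p(1), symmetric])
  finally show ?thesis by (simp add: perm_avg_def len)
qed

text \<open>The weight \<open>h l\<close> is spread evenly over the pairs of \<open>l\<close> and a
  permutation of its positions. Permuting the list in each pair is a bijection of these pairs that
  keeps the length, and thus the share; summing over the permutations afterwards gives the
  average.\<close>

lemma perm_avg_has_sum:
  fixes h :: "'a list \<Rightarrow> 'b::{banach,real_normed_field}"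
  assumes h: "(\<lambda>l. norm (h l)) summable_on UNIV"
  shows "(perm_avg h has_sum infsum h UNIV) UNIV"
proof -
  define P where "P l = {\<pi>. \<pi> permutes {..<length (l :: 'a list)}}" for l
  have fin: "finite (P l)" for l
    by (auto simp: P_def finite_permutations)
  have card: "card (P l) = fact (length l)" for l
    unfolding P_def by (rule card_permutations) auto
  have hs: "(h has_sum infsum h UNIV) UNIV" using abs_summable_summable[OF h] by simp
  have 1: "((\<lambda>(l, \<pi>). h l / fact (length l)) has_sum infsum h UNIV) (Sigma UNIV P)"
  proof (rule has_sum_SigmaI[where g = h, OF _ hs])
    show "((\<lambda>\<pi>. case (l, \<pi>) of (l, \<pi>) \<Rightarrow> h l / fact (length l)) has_sum h l) (P l)" for l
      by (rule has_sum_finiteI) (simp_all add: fin card)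
    have "(\<lambda>(l, \<pi>). norm (h l / fact (length l))) summable_on (Sigma UNIV P)"
    proof (rule summable_on_SigmaI[where g = "\<lambda>l. norm (h l)", OF _ h])
      show "((\<lambda>\<pi>. case (l, \<pi>) of (l, \<pi>) \<Rightarrow> norm (h l / fact (length l))) has_sum norm (h l)) (P l)" for l
        by (rule has_sum_finiteI) (simp_all add: fin card norm_divide)
    qed auto
    then show "(\<lambda>(l, \<pi>). h l / fact (length l)) summable_on (Sigma UNIV P)"
      by (rule abs_summable_summable[OF summable_on_cong[THEN iffD1, rotated]]) (simp add: case_prod_unfold)
  qed
  have bij: "bij_betw (\<lambda>(l, \<pi>). (permute_list \<pi> l, \<pi>)) (Sigma UNIV P) (Sigma UNIV P)"
  proof -
    have 1: "permute_list (inv \<pi>) (permute_list \<pi> l) = l" "permute_list \<pi> (permute_list (inv \<pi>) l) = l"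
      if "\<pi> permutes {..<length l}" for l :: "'a list" and \<pi>
      using permute_list_compose[OF permutes_inv[OF that], of \<pi>] permute_list_compose[OF that, of "inv \<pi>"]
      by (simp_all add: permutes_inv_o[OF that])
    have mem: "(l, \<pi>) \<in> Sigma UNIV P \<longleftrightarrow> \<pi> permutes {..<length l}" for l \<pi>
      by (simp add: P_def)
    show ?thesis
    proof (rule bij_betw_byWitness[where f' = "\<lambda>(l, \<pi>). (permute_list (inv \<pi>) l, \<pi>)"])
      show "\<forall>x\<in>Sigma UNIV P. (case case x of (l, \<pi>) \<Rightarrow> (permute_list \<pi> l, \<pi>) of (l, \<pi>) \<Rightarrow> (permute_list (inv \<pi>) l, \<pi>)) = x"
        using 1(1) by (simp only: Ball_def split_paired_All mem prod.case) blast
      show "\<forall>x\<in>Sigma UNIV P. (case case x of (l, \<pi>) \<Rightarrow> (permute_list (inv \<pi>) l, \<pi>) of (l, \<pi>) \<Rightarrow> (permute_list \<pi> l, \<pi>)) = x"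
        using 1(2) by (simp only: Ball_def split_paired_All mem prod.case) blast
      show "(\<lambda>(l, \<pi>). (permute_list \<pi> l, \<pi>)) ` Sigma UNIV P \<subseteq> Sigma UNIV P"
        "(\<lambda>(l, \<pi>). (permute_list (inv \<pi>) l, \<pi>)) ` Sigma UNIV P \<subseteq> Sigma UNIV P"
        by (simp_all only: image_subset_iff Ball_def split_paired_All mem prod.case length_permute_list) blast+
    qed
  qed
  have 2: "((\<lambda>x. h (permute_list (snd x) (fst x)) / fact (length (fst x))) has_sum infsum h UNIV) (Sigma UNIV P)"
    using has_sum_reindex_bij_betw[OF bij, of "\<lambda>(l, \<pi>). h l / fact (length l)" "infsum h UNIV"] 1
    by (simp add: case_prod_unfold)
  show ?thesis
  proof (rule has_sum_SigmaD[OF 2])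
    fix l :: "'a list"
    have "((\<lambda>\<pi>. h (permute_list \<pi> l) / fact (length l)) has_sum perm_avg h l) (P l)"
      by (rule has_sum_finiteI[OF fin]) (simp add: perm_avg_def sum_divide_distrib P_def)
    then show "((\<lambda>\<pi>. h (permute_list (snd (l, \<pi>)) (fst (l, \<pi>))) / fact (length (fst (l, \<pi>)))) has_sum perm_avg h l) (P l)"
      by simp
  qed
qed

text \<open>The squared modulus of an average is at most the average of the squared moduli, and
  averaging preserves the total by \<open>perm_avg_has_sum\<close>.\<close>

lemma symmetrize_summable: "(\<lambda>l. (cmod (perm_avg (coord \<psi>) l))\<^sup>2) summable_on UNIV"
  and norm_symmetrize_le: "norm (symmetrize \<psi>) \<le> norm \<psi>"
proof -
  have le: "(cmod (perm_avg (coord \<psi>) l))\<^sup>2 \<le> perm_avg (\<lambda>l. (cmod (coord \<psi> l))\<^sup>2) l" for l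
  proof -
    let ?P = "{\<pi>. \<pi> permutes {..<length l}}"
    have "(cmod (\<Sum>\<pi>\<in>?P. coord \<psi> (permute_list \<pi> l)))\<^sup>2 \<le> (\<Sum>\<pi>\<in>?P. cmod (coord \<psi> (permute_list \<pi> l)))\<^sup>2"
      by (intro power_mono norm_sum) simp
    also have "\<dots> \<le> (\<Sum>\<pi>\<in>?P. (cmod (coord \<psi> (permute_list \<pi> l)))\<^sup>2) * fact (length l)"
      using sum_squared_le_sum_of_squares[of "\<lambda>\<pi>. cmod (coord \<psi> (permute_list \<pi> l))" ?P]
      by (simp add: card_permutations[OF refl])
    finally show ?thesis
      by (simp add: perm_avg_def norm_divide power_divide divide_simps power2_eq_square)
  qed
  have sm: "(perm_avg (\<lambda>l. (cmod (coord \<psi> l))\<^sup>2) has_sum (norm \<psi>)\<^sup>2) UNIV"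
    using perm_avg_has_sum[of "\<lambda>l. (cmod (coord \<psi> l))\<^sup>2"] coord_summable[of \<psi>]
    by (simp add: norm_ell2_infsum)
  show s: "(\<lambda>l. (cmod (perm_avg (coord \<psi>) l))\<^sup>2) summable_on UNIV"
    by (rule summable_on_comparison_test[OF has_sum_imp_summable[OF sm]]) (auto simp: le)
  have eq: "symmetrize \<psi> = mk_ell2 (perm_avg (coord \<psi>))"
    by (simp add: symmetrize_def perm_avg_def[abs_def])
  have "(norm (symmetrize \<psi>))\<^sup>2 \<le> (norm \<psi>)\<^sup>2"
    unfolding eq norm_ell2_infsum[of "mk_ell2 _"] coord_mk_ell2[OF s]
    by (rule has_sum_mono[OF has_sum_infsum[OF s] sm le])
  then show "norm (symmetrize \<psi>) \<le> norm \<psi>" by (simp add: power2_le_iff_abs_le)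
qed

lemma coord_symmetrize: "coord (symmetrize \<psi>) l = perm_avg (coord \<psi>) l"
  using coord_mk_ell2[OF symmetrize_summable[of \<psi>]]
  by (simp add: symmetrize_def perm_avg_def[abs_def])

lemma symmetrize_in_fock: "symmetrize \<psi> \<in> fock"
  unfolding fock_def mem_Collect_eq
proof (rule ell2_eqI)
  fix l
  have "perm_avg (coord (symmetrize \<psi>)) l = perm_avg (coord \<psi>) l"
    by (rule perm_avg_invariant) (simp only: coord_symmetrize, rule perm_avg_permute)
  then show "coord (symmetrize (symmetrize \<psi>)) l = coord (symmetrize \<psi>) l"
    by (simp add: coord_symmetrize)
qed

lemma fock_iff: "\<psi> \<in> fock \<longleftrightarrow> (\<forall>l l'. mset l = mset l' \<longrightarrow> coord \<psi> l = coord \<psi> l')"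
proof
  assume "\<psi> \<in> fock"
  then have "coord \<psi> l = perm_avg (coord \<psi>) l" for l
    by (simp add: fock_def flip: coord_symmetrize)
  then show "\<forall>l l'. mset l = mset l' \<longrightarrow> coord \<psi> l = coord \<psi> l'"
    using perm_avg_permute by metis
next
  assume *: "\<forall>l l'. mset l = mset l' \<longrightarrow> coord \<psi> l = coord \<psi> l'"
  show "\<psi> \<in> fock"
    unfolding fock_def mem_Collect_eq
    by (rule ell2_eqI, unfold coord_symmetrize, rule perm_avg_invariant) (use * in blast)
qed

lemma fockD: "\<psi> \<in> fock \<Longrightarrow> mset l = mset l' \<Longrightarrow> coord \<psi> l = coord \<psi> l'"
  unfolding fock_iff by (elim allE impE)

lemma fockI: "(\<And>l l'. mset l = mset l' \<Longrightarrow> coord \<psi> l = coord \<psi> l') \<Longrightarrow> \<psi> \<in> fock"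
  unfolding fock_iff by (intro allI impI)

lemma symmetrize_fock: "\<psi> \<in> fock \<Longrightarrow> symmetrize \<psi> = \<psi>"
  by (simp add: fock_def)

lemma fock_scaleC: "\<psi> \<in> fock \<Longrightarrow> c *\<^sub>C \<psi> \<in> fock"
  by (rule fockI, simp only: coord_scaleC, drule (1) fockD, simp only:)

lemma fock_scaleR: "\<psi> \<in> fock \<Longrightarrow> c *\<^sub>R \<psi> \<in> fock"
  unfolding scaleR_conv_scaleC by (rule fock_scaleC)

lemma fock_add: "\<psi> \<in> fock \<Longrightarrow> \<phi> \<in> fock \<Longrightarrow> \<psi> + \<phi> \<in> fock"
proof (rule fockI)
  fix l l' :: "'a list" assume a: "\<psi> \<in> fock" "\<phi> \<in> fock" "mset l = mset l'"
  show "coord (\<psi> + \<phi>) l = coord (\<psi> + \<phi>) l'"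
    unfolding coord_add fockD[OF a(1,3)] fockD[OF a(2,3)] ..
qed

lemma subspace_fock: "subspace fock"
proof (rule subspaceI)
  show "0 \<in> fock" by (rule fockI) simp
qed (simp_all add: fock_add fock_scaleR)

lemma closed_fock: "closed fock"
proof -
  have "fock = (\<Inter>(l, l')\<in>{(l, l' :: 'a list). mset l = mset l'}. {\<psi>. coord \<psi> l - coord \<psi> l' = 0})" (is "_ = ?R")
  proof (intro equalityI subsetI)
    fix \<psi> :: "'a list ell2" assume "\<psi> \<in> fock"
    then show "\<psi> \<in> ?R" by (auto dest: fockD)
  next
    fix \<psi> :: "'a list ell2" assume a: "\<psi> \<in> ?R"
    show "\<psi> \<in> fock"
    proof (rule fockI)
      fix l l' :: "'a list" assume "mset l = mset l'"
      then have "\<psi> \<in> {\<psi>. coord \<psi> l - coord \<psi> l' = 0}" using a by blast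
      then show "coord \<psi> l = coord \<psi> l'" by simp
    qed
  qed
  moreover have cl: "closed {\<psi>. coord \<psi> l - coord \<psi> l' = 0}" for l l' :: "'a list"
    by (intro closed_Collect_eq linear_continuous_on bounded_linear_sub bounded_linear_coord continuous_on_const)
  have "closed ?R" by (intro closed_INT) (simp only: split_paired_Ball_Sigma case_prod_unfold cl Ball_def, simp)
  ultimately show ?thesis by simp
qed

text \<open>A symmetric \<open>\<phi>\<close> factors out of the average of the products, and
  averaging does not change their sum.\<close>

lemma cinner_symmetrize:
  assumes "\<phi> \<in> fock"
  shows "cinner \<phi> (symmetrize \<psi>) = cinner \<phi> \<psi>"
proof -
  let ?h = "\<lambda>l. cnj (coord \<phi> l) * coord \<psi> l"
  have "perm_avg ?h l = cnj (coord \<phi> l) * coord (symmetrize \<psi>) l" for l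
    unfolding coord_symmetrize perm_avg_def sum_divide_distrib sum_distrib_left
    by (intro sum.cong refl)
      (auto simp: fockD[OF assms mset_permute_list])
  then have "((\<lambda>l. cnj (coord \<phi> l) * coord (symmetrize \<psi>) l) has_sum infsum ?h UNIV) UNIV"
    using perm_avg_has_sum[of ?h] cinner_summable[of \<phi> \<psi>]
    by (simp add: summable_on_iff_abs_summable_on_complex cong: has_sum_cong)
  then show ?thesis unfolding cinner_def by (simp add: infsumI)
qed

subsection \<open>Homogeneous vectors and tensor products\<close>

text \<open>The sector of particle number \<open>k\<close>. On it the degree-dependent roots in
  \<open>create\<close> are constants, and all domain questions disappear.\<close>

definition hom :: "nat \<Rightarrow> 'a list ell2 set" where
  "hom k = {\<psi>. \<forall>l. length l \<noteq> k \<longrightarrow> coord \<psi> l = 0}"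

lemma homD: "\<psi> \<in> hom k \<Longrightarrow> length l \<noteq> k \<Longrightarrow> coord \<psi> l = 0"
  by (auto simp: hom_def)

lemma hom_scaleC: "\<psi> \<in> hom k \<Longrightarrow> c *\<^sub>C \<psi> \<in> hom k"
  and hom_scaleR: "\<psi> \<in> hom k \<Longrightarrow> r *\<^sub>R \<psi> \<in> hom k"
  by (auto simp: hom_def)

lemma hom_orthogonal: "\<psi> \<in> hom j \<Longrightarrow> \<phi> \<in> hom k \<Longrightarrow> j \<noteq> k \<Longrightarrow> cinner \<psi> \<phi> = 0"
  unfolding cinner_def by (intro infsum_0) (metis complex_cnj_zero homD mult_zero_left mult_zero_right)

lemma hom_symmetrize: "\<psi> \<in> hom k \<Longrightarrow> symmetrize \<psi> \<in> hom k"
  by (auto simp: hom_def coord_symmetrize perm_avg_def)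

lemma product_summable:
  fixes f :: "'a \<Rightarrow> complex" and g :: "'b \<Rightarrow> complex"
  assumes "(\<lambda>x. (cmod (f x))\<^sup>2) summable_on UNIV" "(\<lambda>x. (cmod (g x))\<^sup>2) summable_on UNIV"
  shows "(\<lambda>(x, y). (cmod (f x * g y))\<^sup>2) summable_on UNIV"
proof -
  have "(\<lambda>(x, y). (cmod (f x * g y))\<^sup>2) summable_on Sigma UNIV (\<lambda>_. UNIV)"
  proof (rule summable_on_SigmaI[where g = "\<lambda>x. (cmod (f x))\<^sup>2 * (\<Sum>\<^sub>\<infinity>y. (cmod (g y))\<^sup>2)"])
    show "((\<lambda>y. case (x, y) of (x, y) \<Rightarrow> (cmod (f x * g y))\<^sup>2) has_sum (cmod (f x))\<^sup>2 * (\<Sum>\<^sub>\<infinity>y. (cmod (g y))\<^sup>2)) UNIV" for x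
      unfolding case_prod_conv norm_mult power_mult_distrib
      by (intro has_sum_cmult_right has_sum_infsum assms)
  qed (auto intro: summable_on_cmult_left assms)
  then show ?thesis by simp
qed

lemma inj_on_append: "inj_on (\<lambda>(a, l). a @ l) ({a. length a = d} \<times> UNIV)"
  by (auto simp: inj_on_def)

lemma image_append: "(\<lambda>(a, l). a @ l) ` ({a :: 'a list. length a = d} \<times> UNIV) = {l. d \<le> length l}"
proof safe
  fix l :: "'a list" assume "d \<le> length l"
  then show "l \<in> (\<lambda>(a, l). a @ l) ` ({a. length a = d} \<times> UNIV)"
    by (intro image_eqI[of _ _ "(take d l, drop d l)"]) auto
qed auto

lemma bij_append: "bij_betw (\<lambda>(a, l). a @ l) ({a :: 'a list. length a = d} \<times> UNIV) {l. d \<le> length l}"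
  unfolding bij_betw_def using inj_on_append image_append by blast

text \<open>Only the splitting after \<open>d\<close> arguments contributes, so the coordinates are
  products reindexed by concatenation and are square-summable. For two inhomogeneous factors this
  can fail, and then \<open>tensor\<close> has the default value of \<open>mk_ell2\<close>.\<close>

lemma coord_tensor:
  assumes "\<psi> \<in> hom d"
  shows "coord (tensor \<psi> \<phi>) l = (if d \<le> length l then coord \<psi> (take d l) * coord \<phi> (drop d l) else 0)"
proof -
  let ?f = "\<lambda>l. if d \<le> length l then coord \<psi> (take d l) * coord \<phi> (drop d l) else 0"
  have eq: "(\<Sum>k\<le>length l. coord \<psi> (take k l) * coord \<phi> (drop k l)) = ?f l" for l
  proof -
    have "(\<Sum>k\<le>length l. coord \<psi> (take k l) * coord \<phi> (drop k l))
        = (\<Sum>k\<le>length l. if k = d then coord \<psi> (take d l) * coord \<phi> (drop d l) else 0)"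
      by (intro sum.cong refl) (auto simp: homD[OF assms])
    then show ?thesis by simp
  qed
  have "(\<lambda>(a, l). (cmod (coord \<psi> a * coord \<phi> l))\<^sup>2) summable_on ({a. length a = d} \<times> UNIV)"
    by (rule summable_on_subset[OF product_summable[OF coord_summable coord_summable]]) simp
  then have "(\<lambda>x. (cmod (?f ((\<lambda>(a, l). a @ l) x)))\<^sup>2) summable_on ({a. length a = d} \<times> UNIV)"
    by (rule summable_on_cong[THEN iffD1, rotated]) auto
  then have "(\<lambda>l. (cmod (?f l))\<^sup>2) summable_on {l. d \<le> length l}"
    by (subst (asm) summable_on_reindex_bij_betw[OF bij_append, where f = "\<lambda>l. (cmod (?f l))\<^sup>2"])
  then have "(\<lambda>l. (cmod (?f l))\<^sup>2) summable_on UNIV"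
    by (subst summable_on_cong_neutral[where T = "{l. d \<le> length l}" and g = "\<lambda>l. (cmod (?f l))\<^sup>2"]) auto
  from coord_mk_ell2[OF this] show ?thesis
    unfolding tensor_def eq by simp
qed

section \<open>Contraction, the adjoint of tensoring with a homogeneous vector\<close>

definition contract :: "'a list ell2 \<Rightarrow> 'a list ell2 \<Rightarrow> 'a list ell2" where
  "contract \<psi> \<phi> = mk_ell2 (\<lambda>l. \<Sum>\<^sub>\<infinity>a. cnj (coord \<psi> a) * coord \<phi> (a @ l))"

definition slice :: "'a list ell2 \<Rightarrow> 'a list \<Rightarrow> 'a list ell2" where
  "slice \<phi> l = mk_ell2 (\<lambda>a. coord \<phi> (a @ l))"

lemma slice_summable: "(\<lambda>a. (cmod (coord \<phi> (a @ l)))\<^sup>2) summable_on UNIV"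
proof -
  have "(\<lambda>l. (cmod (coord \<phi> l))\<^sup>2) summable_on (\<lambda>a. a @ l) ` UNIV"
    by (rule summable_on_subset[OF coord_summable]) simp
  then show ?thesis by (subst (asm) summable_on_reindex) (auto simp: inj_on_def o_def)
qed

lemma coord_slice: "coord (slice \<phi> l) a = coord \<phi> (a @ l)"
  by (simp add: slice_def coord_mk_ell2[OF slice_summable])

lemma slice_fock: "\<phi> \<in> fock \<Longrightarrow> slice \<phi> l \<in> fock"
  by (rule fockI, unfold coord_slice, erule fockD) simp

text \<open>The bound is Cauchy-Schwarz on each slice. The slices are first cut down to arguments of
  length \<open>d\<close>: a list has at most one splitting with a first part of that length,
  whereas over all splittings the squared slice norms could add up to infinity.\<close>

lemma contract_summable:
  assumes "\<psi> \<in> hom d"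
  shows "(\<lambda>l. (cmod (cinner \<psi> (slice \<phi> l)))\<^sup>2) summable_on UNIV"
proof -
  let ?A = "{a :: 'a list. length a = d}"
  have "(\<lambda>l. (cmod (coord \<phi> l))\<^sup>2) summable_on {l. d \<le> length l}"
    by (rule summable_on_subset[OF coord_summable]) simp
  then have "(\<lambda>x. (cmod (coord \<phi> ((\<lambda>(a, l). a @ l) x)))\<^sup>2) summable_on (?A \<times> UNIV)"
    by (subst summable_on_reindex_bij_betw[OF bij_append, where f = "\<lambda>l. (cmod (coord \<phi> l))\<^sup>2"])
  then have s: "(\<lambda>(l, a). (cmod (coord \<phi> (a @ l)))\<^sup>2) summable_on (UNIV \<times> ?A)"
    by (subst (asm) summable_on_swap) (simp add: case_prod_unfold)
  have inner: "((\<lambda>a. (cmod (coord \<phi> (a @ l)))\<^sup>2) has_sum (\<Sum>\<^sub>\<infinity>a\<in>?A. (cmod (coord \<phi> (a @ l)))\<^sup>2)) ?A" for l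
    by (intro has_sum_infsum summable_on_subset[OF slice_summable]) simp
  have "(\<lambda>l. \<Sum>\<^sub>\<infinity>a\<in>?A. (cmod (coord \<phi> (a @ l)))\<^sup>2) summable_on UNIV"
    by (rule has_sum_imp_summable[OF has_sum_SigmaD[OF has_sum_infsum[OF s]]]) (simp add: inner del: has_sum_infsum)
  then have "(\<lambda>l. (norm \<psi>)\<^sup>2 * (\<Sum>\<^sub>\<infinity>a\<in>?A. (cmod (coord \<phi> (a @ l)))\<^sup>2)) summable_on UNIV"
    by (rule summable_on_cmult_right)
  then show ?thesis
  proof (rule summable_on_comparison_test)
    fix l
    let ?s = "mk_ell2 (\<lambda>a. if a \<in> ?A then coord \<phi> (a @ l) else 0)"
    have s0: "(\<lambda>a. (cmod (if a \<in> ?A then coord \<phi> (a @ l) else 0))\<^sup>2) summable_on UNIV"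
      by (rule summable_on_comparison_test[OF slice_summable]) auto
    have "cinner \<psi> (slice \<phi> l) = cinner \<psi> ?s"
      unfolding cinner_def coord_mk_ell2[OF s0] coord_slice
      by (intro infsum_cong) (auto simp: homD[OF assms])
    then have "cmod (cinner \<psi> (slice \<phi> l)) \<le> norm \<psi> * norm ?s" using cinner_Cauchy_Schwarz by metis
    then have "(cmod (cinner \<psi> (slice \<phi> l)))\<^sup>2 \<le> (norm \<psi>)\<^sup>2 * (norm ?s)\<^sup>2"
      unfolding power_mult_distrib[symmetric] by (intro power_mono) auto
    also have "(norm ?s)\<^sup>2 = (\<Sum>\<^sub>\<infinity>a\<in>?A. (cmod (coord \<phi> (a @ l)))\<^sup>2)"
      unfolding norm_ell2_infsum coord_mk_ell2[OF s0] by (rule infsum_cong_neutral) auto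
    finally show "(cmod (cinner \<psi> (slice \<phi> l)))\<^sup>2 \<le> (norm \<psi>)\<^sup>2 * (\<Sum>\<^sub>\<infinity>a\<in>?A. (cmod (coord \<phi> (a @ l)))\<^sup>2)" .
  qed auto
qed

lemma coord_contract: "\<psi> \<in> hom d \<Longrightarrow> coord (contract \<psi> \<phi>) l = cinner \<psi> (slice \<phi> l)"
  using coord_mk_ell2[OF contract_summable[of \<psi> d \<phi>]]
  by (simp add: contract_def cinner_def coord_slice)

lemma cinner_tensor:
  assumes "\<psi> \<in> hom d"
  shows "cinner \<phi> (tensor \<psi> \<xi>) = cinner (contract \<psi> \<phi>) \<xi>"
proof -
  let ?A = "{a :: 'a list. length a = d}"
  have "((\<lambda>l. cnj (coord \<phi> l) * coord (tensor \<psi> \<xi>) l) has_sum cinner \<phi> (tensor \<psi> \<xi>)) {l. d \<le> length l}"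
    by (subst has_sum_cong_neutral[where T = UNIV and g = "\<lambda>l. cnj (coord \<phi> l) * coord (tensor \<psi> \<xi>) l"])
      (use cinner_has_sum[of \<phi> "tensor \<psi> \<xi>"] in \<open>auto simp: coord_tensor[OF assms]\<close>)
  then have "((\<lambda>x. cnj (coord \<phi> ((\<lambda>(a, l). a @ l) x)) * coord (tensor \<psi> \<xi>) ((\<lambda>(a, l). a @ l) x))
      has_sum cinner \<phi> (tensor \<psi> \<xi>)) (?A \<times> UNIV)"
    by (subst has_sum_reindex_bij_betw[OF bij_append, where f = "\<lambda>l. cnj (coord \<phi> l) * coord (tensor \<psi> \<xi>) l"])
  then have "((\<lambda>(l, a). cnj (coord \<phi> (a @ l)) * coord (tensor \<psi> \<xi>) (a @ l)) has_sum cinner \<phi> (tensor \<psi> \<xi>)) (UNIV \<times> ?A)"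
    by (subst has_sum_swap) (simp add: case_prod_unfold)
  then have "((\<lambda>l. cnj (coord (contract \<psi> \<phi>) l) * coord \<xi> l) has_sum cinner \<phi> (tensor \<psi> \<xi>)) UNIV"
  proof (rule has_sum_SigmaD)
    fix l
    have "((\<lambda>a. cnj (coord (slice \<phi> l) a) * coord \<psi> a * coord \<xi> l) has_sum cinner (slice \<phi> l) \<psi> * coord \<xi> l) UNIV"
      by (intro has_sum_cmult_left cinner_has_sum)
    also have "?this \<longleftrightarrow> ((\<lambda>a. cnj (coord \<phi> (a @ l)) * coord (tensor \<psi> \<xi>) (a @ l)) has_sum cinner (slice \<phi> l) \<psi> * coord \<xi> l) ?A"
      by (rule has_sum_cong_neutral) (auto simp: homD[OF assms] coord_slice coord_tensor[OF assms])
    also have "cinner (slice \<phi> l) \<psi> = cnj (coord (contract \<psi> \<phi>) l)"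
      by (subst cinner_commute) (simp add: coord_contract[OF assms])
    finally show "((\<lambda>a. case (l, a) of (l, a) \<Rightarrow> cnj (coord \<phi> (a @ l)) * coord (tensor \<psi> \<xi>) (a @ l)) has_sum
        cnj (coord (contract \<psi> \<phi>) l) * coord \<xi> l) ?A" by simp
  qed
  then show ?thesis by (rule has_sum_unique[OF _ cinner_has_sum])
qed

lemma contract_fock: "\<psi> \<in> hom d \<Longrightarrow> \<phi> \<in> fock \<Longrightarrow> contract \<psi> \<phi> \<in> fock"
proof (rule fockI)
  fix l l' :: "'a list"
  assume a: "\<psi> \<in> hom d" "\<phi> \<in> fock" "mset l = mset l'"
  have "slice \<phi> l = slice \<phi> l'"
    by (rule ell2_eqI, unfold coord_slice, rule fockD[OF a(2)]) (simp add: a(3))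
  then show "coord (contract \<psi> \<phi>) l = coord (contract \<psi> \<phi>) l'" by (simp add: coord_contract[OF a(1)])
qed

lemma contract_hom:
  assumes "\<psi> \<in> hom d" "\<phi> \<in> hom k"
  shows "contract \<psi> \<phi> \<in> hom (k - d)"
  unfolding hom_def
proof safe
  fix l :: "'a list" assume l: "length l \<noteq> k - d"
  have "cnj (coord \<psi> a) * coord \<phi> (a @ l) = 0" for a
    using l homD[OF assms(1), of a] homD[OF assms(2), of "a @ l"] by (cases "length a = d") auto
  then show "coord (contract \<psi> \<phi>) l = 0"
    unfolding coord_contract[OF assms(1)] cinner_def coord_slice by (intro infsum_0) simp
qed

section \<open>One-particle vectors\<close>

lemma coord_one_particle: "coord (one_particle f) l = (case l of [a] \<Rightarrow> coord f a | _ \<Rightarrow> 0)"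
proof -
  let ?g = "\<lambda>l. case l of [a] \<Rightarrow> coord f a | _ \<Rightarrow> 0"
  have "(\<lambda>l. (cmod (?g l))\<^sup>2) summable_on (\<lambda>a. [a]) ` UNIV"
    by (subst summable_on_reindex) (auto simp: inj_on_def o_def coord_summable)
  then have "(\<lambda>l. (cmod (?g l))\<^sup>2) summable_on UNIV"
    by (subst summable_on_cong_neutral[where T = "(\<lambda>a. [a]) ` UNIV" and g = "\<lambda>l. (cmod (?g l))\<^sup>2"])
      (auto split: list.splits)
  from coord_mk_ell2[OF this] show ?thesis by (simp add: one_particle_def)
qed

lemma one_particle_hom: "one_particle f \<in> hom 1"
  by (auto simp: hom_def coord_one_particle split: list.splits)

lemma one_particle_fock: "one_particle f \<in> fock"
proof (rule fockI)
  fix l l' :: "'a list" assume m: "mset l = mset l'"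
  show "coord (one_particle f) l = coord (one_particle f) l'"
  proof (cases "length l = 1")
    case True
    then obtain a where "l = [a]" by (auto simp: length_Suc_conv)
    then show ?thesis using m by simp
  next
    case False
    moreover have "length l' = length l" using m by (metis size_mset)
    ultimately show ?thesis using homD[OF one_particle_hom, of l f] homD[OF one_particle_hom, of l' f]
      by simp
  qed
qed

definition slice1 :: "'a list ell2 \<Rightarrow> 'a list \<Rightarrow> 'a ell2" where
  "slice1 \<phi> l = mk_ell2 (\<lambda>x. coord \<phi> (x # l))"

lemma coord_slice1: "coord (slice1 \<phi> l) x = coord \<phi> (x # l)"
proof -
  have "(\<lambda>l. (cmod (coord \<phi> l))\<^sup>2) summable_on (\<lambda>x. x # l) ` UNIV"
    by (rule summable_on_subset[OF coord_summable]) simp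
  then have "(\<lambda>x. (cmod (coord \<phi> (x # l)))\<^sup>2) summable_on UNIV"
    by (subst (asm) summable_on_reindex) (auto simp: inj_on_def o_def)
  from coord_mk_ell2[OF this] show ?thesis by (simp add: slice1_def)
qed

lemma coord_contract1: "coord (contract (one_particle f) \<phi>) l = cinner f (slice1 \<phi> l)"
proof -
  have "((\<lambda>a. cnj (coord (one_particle f) a) * coord (slice \<phi> l) a) has_sum cinner f (slice1 \<phi> l)) ((\<lambda>x. [x]) ` UNIV)"
    by (subst has_sum_reindex) (auto simp: inj_on_def o_def coord_one_particle coord_slice coord_slice1[symmetric] cinner_has_sum)
  also have "?this \<longleftrightarrow> ((\<lambda>a. cnj (coord (one_particle f) a) * coord (slice \<phi> l) a) has_sum cinner f (slice1 \<phi> l)) UNIV"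
    by (rule has_sum_cong_neutral) (auto simp: coord_one_particle split: list.splits)
  finally show ?thesis
    unfolding coord_contract[OF one_particle_hom] by (rule has_sum_unique[OF cinner_has_sum])
qed

subsection \<open>Creation operators\<close>

text \<open>The domain of the square root of the number operator. Outside of it \<open>create\<close> may take the
  junk value \<open>0\<close>.\<close>

definition create_dom :: "'a list ell2 set" where
  "create_dom = {\<psi>. (\<lambda>l. (cmod (of_real (sqrt (real (length l + 1))) * coord \<psi> l))\<^sup>2) summable_on UNIV}"

text \<open>Multiplication by the root of the particle number plus one. Tensoring with one particle
  raises the degree by one, so \<open>wt\<close> applied beforehand produces the root of the length
  in \<open>create\<close>.\<close>

definition wt :: "'a list ell2 \<Rightarrow> 'a list ell2" where
  "wt \<psi> = mk_ell2 (\<lambda>l. of_real (sqrt (real (length l + 1))) * coord \<psi> l)"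

lemma coord_wt: "\<psi> \<in> create_dom \<Longrightarrow> coord (wt \<psi>) l = of_real (sqrt (real (length l + 1))) * coord \<psi> l"
  unfolding wt_def create_dom_def by (simp add: coord_mk_ell2)

lemma hom_create_dom: "\<psi> \<in> hom k \<Longrightarrow> \<psi> \<in> create_dom"
proof -
  assume h: "\<psi> \<in> hom k"
  have "(\<lambda>l. (cmod (of_real (sqrt (real (k + 1))) * coord \<psi> l))\<^sup>2) summable_on UNIV"
    by (rule ell2_scale_summable[OF coord_summable])
  also have "?this \<longleftrightarrow> \<psi> \<in> create_dom"
    unfolding create_dom_def mem_Collect_eq
  proof (rule summable_on_cong)
    fix l :: "'a list"
    show "(cmod (of_real (sqrt (real (k + 1))) * coord \<psi> l))\<^sup>2
        = (cmod (of_real (sqrt (real (length l + 1))) * coord \<psi> l))\<^sup>2"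
      by (cases "length l = k") (simp_all add: homD[OF h])
  qed
  finally show ?thesis .
qed

lemma wt_hom: "\<psi> \<in> hom k \<Longrightarrow> wt \<psi> = sqrt (real (k + 1)) *\<^sub>R \<psi>"
proof (rule ell2_eqI)
  fix l assume h: "\<psi> \<in> hom k"
  show "coord (wt \<psi>) l = coord (sqrt (real (k + 1)) *\<^sub>R \<psi>) l"
    by (cases "length l = k") (simp_all add: homD[OF h] coord_wt[OF hom_create_dom[OF h]])
qed

lemma cinner_wt_hom:
  assumes "\<phi> \<in> hom k" "\<psi> \<in> create_dom"
  shows "cinner \<phi> (wt \<psi>) = cinner (wt \<phi>) \<psi>"
  unfolding cinner_def
  by (intro infsum_cong) (simp add: coord_wt assms hom_create_dom[OF assms(1)] ac_simps)

lemma create_dom_scaleC: "\<psi> \<in> create_dom \<Longrightarrow> c *\<^sub>C \<psi> \<in> create_dom"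
proof -
  assume "\<psi> \<in> create_dom"
  then have "(\<lambda>l. (cmod (c * (of_real (sqrt (real (length l + 1))) * coord \<psi> l)))\<^sup>2) summable_on UNIV"
    unfolding create_dom_def mem_Collect_eq by (rule ell2_scale_summable)
  then show ?thesis by (simp add: create_dom_def ac_simps)
qed

text \<open>Permutations keep the length, so the root moves inside the symmetrization. On
  \<open>create_dom\<close> the vector \<open>wt \<psi>\<close> is a true element of the space, and
  the right side consists of maps without default values.\<close>

lemma create_eq:
  assumes "\<psi> \<in> create_dom"
  shows "create f \<psi> = symmetrize (tensor (one_particle f) (wt \<psi>))"
proof -
  have "of_real (sqrt (real (length l))) * coord (symmetrize (tensor (one_particle f) \<psi>)) l
      = coord (symmetrize (tensor (one_particle f) (wt \<psi>))) l" for l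
    unfolding coord_symmetrize perm_avg_def sum_divide_distrib sum_distrib_left
  proof (intro sum.cong refl)
    fix \<pi>
    show "of_real (sqrt (real (length l))) * (coord (tensor (one_particle f) \<psi>) (permute_list \<pi> l) / fact (length l))
      = coord (tensor (one_particle f) (wt \<psi>)) (permute_list \<pi> l) / fact (length l)"
      by (cases "length l") (simp_all add: coord_tensor[OF one_particle_hom] coord_wt[OF assms])
  qed
  then show ?thesis by (simp add: create_def)
qed

lemma create_fock: "\<psi> \<in> create_dom \<Longrightarrow> create f \<psi> \<in> fock"
  by (simp add: create_eq symmetrize_in_fock)

lemma create_hom: "\<psi> \<in> hom k \<Longrightarrow> create f \<psi> \<in> hom (Suc k)"
  unfolding create_eq[OF hom_create_dom]
  by (rule hom_symmetrize) (auto simp: hom_def coord_tensor[OF one_particle_hom] wt_hom)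

lemma coord_create:
  assumes "\<psi> \<in> create_dom"
  shows "coord (create f \<psi>) l = of_real (sqrt (real (length l))) *
    perm_avg (\<lambda>l. case l of [] \<Rightarrow> 0 | x # l' \<Rightarrow> coord f x * coord \<psi> l') l"
proof -
  have "coord (tensor (one_particle f) (wt \<psi>)) l' =
      of_real (sqrt (real (length l'))) * (case l' of [] \<Rightarrow> 0 | x # l'' \<Rightarrow> coord f x * coord \<psi> l'')" for l'
    by (cases l') (simp_all add: coord_tensor[OF one_particle_hom] coord_wt[OF assms] coord_one_particle)
  then show ?thesis
    unfolding create_eq[OF assms] coord_symmetrize perm_avg_def sum_divide_distrib sum_distrib_left
    by (intro sum.cong refl) simp
qed

lemma perm_avg_add: "perm_avg (\<lambda>l. f l + g l) l = perm_avg f l + perm_avg g l"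
  and perm_avg_mult: "perm_avg (\<lambda>l. c * f l) l = c * perm_avg f l"
  by (simp_all add: perm_avg_def sum.distrib add_divide_distrib sum_distrib_left)

lemma create_scaleC_right: "\<psi> \<in> create_dom \<Longrightarrow> create f (c *\<^sub>C \<psi>) = c *\<^sub>C create f \<psi>"
proof (rule ell2_eqI)
  fix l assume h: "\<psi> \<in> create_dom"
  have "(\<lambda>l. case l of [] \<Rightarrow> 0 | x # l' \<Rightarrow> coord f x * (c * coord \<psi> l'))
      = (\<lambda>l. c * (case l of [] \<Rightarrow> 0 | x # l' \<Rightarrow> coord f x * coord \<psi> l'))"
    by (auto simp: fun_eq_iff split: list.splits)
  then show "coord (create f (c *\<^sub>C \<psi>)) l = coord (c *\<^sub>C create f \<psi>) l"
    by (simp add: coord_create create_dom_scaleC h perm_avg_mult)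
qed

lemma create_scaleR_right: "\<psi> \<in> create_dom \<Longrightarrow> create f (c *\<^sub>R \<psi>) = c *\<^sub>R create f \<psi>"
  by (simp add: scaleR_conv_scaleC create_scaleC_right)

lemma create_scaleC_left: "\<psi> \<in> create_dom \<Longrightarrow> create (c *\<^sub>C f) \<psi> = c *\<^sub>C create f \<psi>"
proof (rule ell2_eqI)
  fix l assume h: "\<psi> \<in> create_dom"
  have "(\<lambda>l. case l of [] \<Rightarrow> 0 | x # l' \<Rightarrow> c * coord f x * coord \<psi> l')
      = (\<lambda>l. c * (case l of [] \<Rightarrow> 0 | x # l' \<Rightarrow> coord f x * coord \<psi> l'))"
    by (auto simp: fun_eq_iff split: list.splits)
  then show "coord (create (c *\<^sub>C f) \<psi>) l = coord (c *\<^sub>C create f \<psi>) l"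
    by (simp add: coord_create h perm_avg_mult)
qed

lemma create_add_left: "\<psi> \<in> create_dom \<Longrightarrow> create (f + g) \<psi> = create f \<psi> + create g \<psi>"
proof (rule ell2_eqI)
  fix l assume h: "\<psi> \<in> create_dom"
  have "(\<lambda>l. case l of [] \<Rightarrow> 0 | x # l' \<Rightarrow> coord (f + g) x * coord \<psi> l')
      = (\<lambda>l. (case l of [] \<Rightarrow> 0 | x # l' \<Rightarrow> coord f x * coord \<psi> l') + (case l of [] \<Rightarrow> 0 | x # l' \<Rightarrow> coord g x * coord \<psi> l'))"
    by (auto simp: fun_eq_iff algebra_simps split: list.splits)
  then show "coord (create (f + g) \<psi>) l = coord (create f \<psi> + create g \<psi>) l"
    by (simp add: coord_create h perm_avg_add distrib_left)
qed

text \<open>A symmetric wave function depends only on the multiset of its arguments.\<close>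

definition mcoord :: "'a list ell2 \<Rightarrow> 'a multiset \<Rightarrow> complex" where
  "mcoord \<psi> M = coord \<psi> (SOME l. mset l = M)"

lemma mcoord: "\<psi> \<in> fock \<Longrightarrow> coord \<psi> l = mcoord \<psi> (mset l)"
  unfolding mcoord_def by (rule fockD) (auto intro: someI2[of _ l])

text \<open>Composing with a transposition shows that the image of 0 may be replaced by the image of
  any \<open>j\<close>; averaging over \<open>j\<close>, each permutation runs through all
  points.\<close>

lemma sum_permutes_point:
  fixes F :: "nat \<Rightarrow> complex"
  assumes "0 < k"
  shows "(\<Sum>\<pi> | \<pi> permutes {..<k}. F (\<pi> 0)) / fact k = (\<Sum>j<k. F j) / of_nat k"
proof -
  let ?P = "{\<pi>. \<pi> permutes {..<k}}"
  have *: "(\<Sum>\<pi>\<in>?P. F (\<pi> 0)) = (\<Sum>\<pi>\<in>?P. F (\<pi> j))" if "j < k" for j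
  proof -
    have "Transposition.transpose 0 j permutes {..<k}" using that assms by (simp add: permutes_swap_id)
    from sum_permutations_compose_right[OF this, of "\<lambda>\<pi>. F (\<pi> 0)"] show ?thesis by simp
  qed
  have "of_nat k * (\<Sum>\<pi>\<in>?P. F (\<pi> 0)) = (\<Sum>j<k. \<Sum>\<pi>\<in>?P. F (\<pi> 0))" by simp
  also have "\<dots> = (\<Sum>j<k. \<Sum>\<pi>\<in>?P. F (\<pi> j))" by (rule sum.cong[OF refl], rule *) simp
  also have "\<dots> = (\<Sum>\<pi>\<in>?P. \<Sum>j<k. F (\<pi> j))" by (rule sum.swap)
  also have "\<dots> = (\<Sum>\<pi>\<in>?P. \<Sum>j<k. F j)"
    by (rule sum.cong[OF refl]) (simp add: sum.permute[of _ "{..<k}" F] o_def)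
  also have "\<dots> = fact k * (\<Sum>j<k. F j)" by (simp add: card_permutations[OF refl])
  finally show ?thesis using assms by (simp add: field_simps)
qed

text \<open>Under a uniform permutation the argument in front is uniform, so the average collapses
  to a sum over which argument carries \<open>f\<close>. The root of the length, divided by the
  length, leaves the root in the denominator.\<close>

lemma coord_create_list:
  assumes "\<psi> \<in> fock" "\<psi> \<in> create_dom"
  shows "coord (create f \<psi>) l =
    (\<Sum>j<length l. coord f (l ! j) * mcoord \<psi> (mset l - {#l ! j#})) / of_real (sqrt (real (length l)))"
proof (cases "length l = 0")
  case True
  then show ?thesis using assms by (simp add: coord_create)
next
  case False
  then have pos: "0 < length l" by simp
  let ?k = "length l" and ?F = "\<lambda>j. coord f (l ! j) * mcoord \<psi> (mset l - {#l ! j#})"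
  have "perm_avg (\<lambda>l. case l of [] \<Rightarrow> 0 | x # l' \<Rightarrow> coord f x * coord \<psi> l') l
      = (\<Sum>\<pi> | \<pi> permutes {..<?k}. ?F (\<pi> 0)) / fact ?k"
    unfolding perm_avg_def
  proof (rule arg_cong[of _ _ "\<lambda>z. z / _"], intro sum.cong refl)
    fix \<pi> assume "\<pi> \<in> {\<pi>. \<pi> permutes {..<?k}}"
    then have \<pi>: "\<pi> permutes {..<?k}" by simp
    have "permute_list \<pi> l \<noteq> []" using False by (metis length_0_conv length_permute_list)
    then obtain x l' where xl: "permute_list \<pi> l = x # l'" by (cases "permute_list \<pi> l") auto
    have x: "x = l ! \<pi> 0" using permute_list_nth[OF \<pi> pos] xl by simp
    have "mset l = add_mset x (mset l')" using mset_permute_list[OF \<pi>] xl by simp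
    then have "mset l' = mset l - {#l ! \<pi> 0#}" by (simp add: x)
    then show "(case permute_list \<pi> l of [] \<Rightarrow> 0 | x # l' \<Rightarrow> coord f x * coord \<psi> l') = ?F (\<pi> 0)"
      by (simp add: xl x mcoord[OF assms(1)])
  qed
  also have "\<dots> = (\<Sum>j<?k. ?F j) / of_nat ?k" by (rule sum_permutes_point[OF pos])
  finally have "coord (create f \<psi>) l = of_real (sqrt (real ?k)) * ((\<Sum>j<?k. ?F j) / of_nat ?k)"
    by (simp add: coord_create[OF assms(2)])
  also have "\<dots> = (\<Sum>j<?k. ?F j) / of_real (sqrt (real ?k))"
  proof -
    have "complex_of_real (sqrt (real ?k)) * of_real (sqrt (real ?k)) = of_nat ?k"
      by (simp flip: of_real_mult)
    moreover have "complex_of_real (sqrt (real ?k)) \<noteq> 0" using False by simp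
    ultimately show ?thesis using False by (simp add: field_simps)
  qed
  finally show ?thesis .
qed

lemma sum_list_nth_mset:
  fixes g :: "'a \<Rightarrow> 'b::comm_monoid_add"
  shows "(\<Sum>j<length l. g (l ! j)) = (\<Sum>x\<in>#mset l. g x)"
proof -
  have "(\<Sum>x\<in>#mset l. g x) = sum_list (map g l)" by (simp flip: sum_mset_sum_list)
  also have "\<dots> = (\<Sum>j<length l. g (l ! j))" by (simp add: sum_list_sum_nth atLeast0LessThan)
  finally show ?thesis ..
qed

lemma mcoord_create:
  assumes "\<psi> \<in> fock" "\<psi> \<in> create_dom"
  shows "mcoord (create f \<psi>) M = (\<Sum>x\<in>#M. coord f x * mcoord \<psi> (M - {#x#})) / of_real (sqrt (real (size M)))"
proof -
  obtain l where l: "mset l = M" using ex_mset by blast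
  have "mcoord (create f \<psi>) M = coord (create f \<psi>) l"
    by (simp add: mcoord[OF create_fock[OF assms(2)]] l)
  also have "\<dots> = (\<Sum>x\<in>#mset l. coord f x * mcoord \<psi> (mset l - {#x#})) / of_real (sqrt (real (length l)))"
    unfolding coord_create_list[OF assms] using sum_list_nth_mset[of "\<lambda>x. coord f x * mcoord \<psi> (mset l - {#x#})" l] by simp
  finally show ?thesis by (simp add: l flip: size_mset)
qed

text \<open>Both sides sum over pairs of distinct arguments. Written as the full double sum minus
  its diagonal, this is symmetric in \<open>f\<close> and \<open>g\<close>.\<close>

lemma create_commute:
  assumes "\<psi> \<in> fock" "\<psi> \<in> hom k"
  shows "create f (create g \<psi>) = create g (create f \<psi>)"
proof (rule ell2_eqI)
  note D = hom_create_dom[OF assms(2)]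
  have *: "coord (create f (create g \<psi>)) l = (\<Sum>x\<in>#mset l. \<Sum>y\<in>#mset l. coord f x * coord g y * mcoord \<psi> (mset l - {#x#} - {#y#}))
      / (of_real (sqrt (real (length l))) * of_real (sqrt (real (length l - 1))))
      - (\<Sum>x\<in>#mset l. coord f x * coord g x * mcoord \<psi> (mset l - {#x#} - {#x#}))
      / (of_real (sqrt (real (length l))) * of_real (sqrt (real (length l - 1))))" for l f g
  proof -
    let ?M = "mset l"
    have F: "create g \<psi> \<in> fock" "create g \<psi> \<in> create_dom"
      using create_fock[OF D] hom_create_dom[OF create_hom[OF assms(2)]] by auto
    have "coord (create f (create g \<psi>)) l
       = (\<Sum>x\<in>#?M. coord f x * mcoord (create g \<psi>) (?M - {#x#})) / of_real (sqrt (real (length l)))"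
      unfolding mcoord[OF create_fock[OF F(2)]] mcoord_create[OF F] by simp
    also have "(\<Sum>x\<in>#?M. coord f x * mcoord (create g \<psi>) (?M - {#x#}))
       = (\<Sum>x\<in>#?M. ((\<Sum>y\<in>#?M. coord f x * coord g y * mcoord \<psi> (?M - {#x#} - {#y#}))
            - coord f x * coord g x * mcoord \<psi> (?M - {#x#} - {#x#})) / of_real (sqrt (real (length l - 1))))"
    proof (rule arg_cong[of _ _ sum_mset], rule image_mset_cong)
      fix x assume x: "x \<in># ?M"
      have s: "(\<Sum>y\<in>#?M - {#x#}. h y) = (\<Sum>y\<in>#?M. h y) - h x" for h :: "'a \<Rightarrow> complex"
        using x by (metis add_diff_cancel_left' image_mset_add_mset insert_DiffM sum_mset.add_mset)
      have "coord f x * mcoord (create g \<psi>) (?M - {#x#})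
        = (\<Sum>y\<in>#?M - {#x#}. coord f x * coord g y * mcoord \<psi> (?M - {#x#} - {#y#})) / of_real (sqrt (real (length l - 1)))"
        unfolding mcoord_create[OF assms(1) D] using x
        by (simp add: size_Diff_singleton sum_mset_distrib_left mult.assoc)
      then show "coord f x * mcoord (create g \<psi>) (?M - {#x#}) =
        ((\<Sum>y\<in>#?M. coord f x * coord g y * mcoord \<psi> (?M - {#x#} - {#y#}))
            - coord f x * coord g x * mcoord \<psi> (?M - {#x#} - {#x#})) / of_real (sqrt (real (length l - 1)))"
        unfolding s .
    qed
    finally show ?thesis
      by (simp add: sum_list_nth_mset[symmetric] sum_subtractf diff_divide_distrib sum_divide_distrib mult.commute)
  qed
  fix l
  have "(\<Sum>x\<in>#mset l. \<Sum>y\<in>#mset l. coord f x * coord g y * mcoord \<psi> (mset l - {#x#} - {#y#}))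
    = (\<Sum>x\<in>#mset l. \<Sum>y\<in>#mset l. coord g x * coord f y * mcoord \<psi> (mset l - {#x#} - {#y#}))"
    by (subst sum_mset.swap) (simp add: mult.commute add_mset_commute)
  then show "coord (create f (create g \<psi>)) l = coord (create g (create f \<psi>)) l"
    unfolding * by (simp add: mult.commute mult.left_commute)
qed

subsection \<open>Annihilation operators\<close>

text \<open>The adjoint of \<open>create f\<close>. For \<open>k \<ge> 1\<close> a vector of degree
  \<open>k\<close> is contracted to degree \<open>k - 1\<close>, where \<open>wt\<close> contributes
  the root of \<open>k\<close>.\<close>

definition annih :: "'a ell2 \<Rightarrow> 'a list ell2 \<Rightarrow> 'a list ell2" where
  "annih f \<phi> = wt (contract (one_particle f) \<phi>)"

lemma annih_hom: "\<phi> \<in> hom k \<Longrightarrow> annih f \<phi> \<in> hom (k - 1)"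
  unfolding annih_def using contract_hom[OF one_particle_hom] by (metis wt_hom hom_scaleR)

lemma coord_annih:
  assumes "\<phi> \<in> hom k"
  shows "coord (annih f \<phi>) l = of_real (sqrt (real (length l + 1))) * cinner f (slice1 \<phi> l)"
  unfolding annih_def
  by (simp add: coord_wt[OF hom_create_dom[OF contract_hom[OF one_particle_hom assms]]] coord_contract1)

lemma annih_fock: "\<phi> \<in> fock \<Longrightarrow> \<phi> \<in> hom k \<Longrightarrow> annih f \<phi> \<in> fock"
  unfolding annih_def using contract_hom[OF one_particle_hom] contract_fock[OF one_particle_hom]
  by (metis wt_hom fock_scaleR)

lemma cinner_create:
  assumes "\<phi> \<in> fock" "\<phi> \<in> hom k" "\<psi> \<in> create_dom"
  shows "cinner \<phi> (create f \<psi>) = cinner (annih f \<phi>) \<psi>"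
  unfolding create_eq[OF assms(3)] cinner_symmetrize[OF assms(1)] cinner_tensor[OF one_particle_hom] annih_def
  by (rule cinner_wt_hom[OF contract_hom[OF one_particle_hom assms(2)] assms(3)])

lemma annih_scaleR:
  assumes "\<phi> \<in> hom k" shows "annih f (c *\<^sub>R \<phi>) = c *\<^sub>R annih f \<phi>"
proof (rule ell2_eqI)
  fix l
  have "slice1 (c *\<^sub>R \<phi>) l = c *\<^sub>R slice1 \<phi> l" by (rule ell2_eqI) (simp add: coord_slice1)
  then show "coord (annih f (c *\<^sub>R \<phi>)) l = coord (c *\<^sub>R annih f \<phi>) l"
    by (simp add: coord_annih[OF assms] coord_annih[OF hom_scaleR[OF assms]])
qed

text \<open>The canonical commutation relation. A new argument \<open>x\<close> is put in front of
  \<open>l\<close> and contracted with \<open>f\<close>: if \<open>x\<close> is the argument that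
  carries \<open>g\<close>, this gives \<open>cinner f g\<close>; otherwise \<open>g\<close> sits on
  one of the arguments in \<open>l\<close>, and the contraction acts on
  \<open>\<phi>\<close>.\<close>

lemma annih_create:
  fixes \<phi> :: "'a list ell2"
  assumes "\<phi> \<in> fock" "\<phi> \<in> hom k"
  shows "annih f (create g \<phi>) = cinner f g *\<^sub>C \<phi> + create g (annih f \<phi>)"
proof (rule ell2_eqI)
  fix l :: "'a list"
  note D = hom_create_dom[OF assms(2)]
  let ?k = "length l" and ?w = "\<lambda>n. complex_of_real (sqrt (real n))"
  have w: "?w (Suc ?k) \<noteq> 0" by (simp del: of_nat_Suc)
  have s: "?w (Suc ?k) *\<^sub>C slice1 (create g \<phi>) l = coord \<phi> l *\<^sub>C g + (\<Sum>j<?k. coord g (l ! j) *\<^sub>C slice1 \<phi> (remove1 (l ! j) l))"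
  proof (rule ell2_eqI)
    fix x
    have "(\<Sum>j<Suc ?k. coord g ((x # l) ! j) * mcoord \<phi> (mset (x # l) - {#(x # l) ! j#}))
      = coord g x * mcoord \<phi> (mset l) + (\<Sum>j<?k. coord g (l ! j) * mcoord \<phi> (add_mset x (mset l) - {#l ! j#}))"
      by (subst sum.lessThan_Suc_shift) simp
    also have "(\<Sum>j<?k. coord g (l ! j) * mcoord \<phi> (add_mset x (mset l) - {#l ! j#}))
      = (\<Sum>j<?k. coord g (l ! j) * coord \<phi> (x # remove1 (l ! j) l))"
    proof (intro sum.cong refl)
      fix j assume "j \<in> {..<?k}"
      then have "l ! j \<in># mset l" by simp
      then show "coord g (l ! j) * mcoord \<phi> (add_mset x (mset l) - {#l ! j#}) = coord g (l ! j) * coord \<phi> (x # remove1 (l ! j) l)"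
        by (simp add: mcoord[OF assms(1)] del: in_multiset_in_set set_mset_mset nth_mem)
    qed
    finally show "coord (?w (Suc ?k) *\<^sub>C slice1 (create g \<phi>) l) x
        = coord (coord \<phi> l *\<^sub>C g + (\<Sum>j<?k. coord g (l ! j) *\<^sub>C slice1 \<phi> (remove1 (l ! j) l))) x"
      using w by (simp add: coord_slice1 coord_create_list[OF assms(1) D] coord_sum mcoord[OF assms(1), of l] del: of_nat_Suc sum.lessThan_Suc)
  qed
  have "coord (annih f (create g \<phi>)) l = cinner f (?w (Suc ?k) *\<^sub>C slice1 (create g \<phi>) l)"
    by (simp add: coord_annih[OF create_hom[OF assms(2)]])
  also have "\<dots> = coord \<phi> l * cinner f g + (\<Sum>j<?k. coord g (l ! j) * cinner f (slice1 \<phi> (remove1 (l ! j) l)))"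
    unfolding s by (simp add: cinner_add_right cinner_sum_right)
  also have "(\<Sum>j<?k. coord g (l ! j) * cinner f (slice1 \<phi> (remove1 (l ! j) l)))
      = coord (create g (annih f \<phi>)) l"
  proof -
    have "(\<Sum>j<?k. coord g (l ! j) * mcoord (annih f \<phi>) (mset l - {#l ! j#}))
       = ?w ?k * (\<Sum>j<?k. coord g (l ! j) * cinner f (slice1 \<phi> (remove1 (l ! j) l)))"
      unfolding sum_distrib_left
    proof (intro sum.cong refl)
      fix j assume j: "j \<in> {..<?k}"
      then have len: "length (remove1 (l ! j) l) + 1 = ?k"
        by (simp add: length_remove1)
      have "mcoord (annih f \<phi>) (mset l - {#l ! j#}) = coord (annih f \<phi>) (remove1 (l ! j) l)"
        by (simp add: mcoord[OF annih_fock[OF assms]])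
      also have "\<dots> = ?w ?k * cinner f (slice1 \<phi> (remove1 (l ! j) l))"
        unfolding coord_annih[OF assms(2)] len ..
      finally show "coord g (l ! j) * mcoord (annih f \<phi>) (mset l - {#l ! j#})
        = ?w ?k * (coord g (l ! j) * cinner f (slice1 \<phi> (remove1 (l ! j) l)))" by simp
    qed
    then show ?thesis
      unfolding coord_create_list[OF annih_fock[OF assms] hom_create_dom[OF annih_hom[OF assms(2)]]]
      by (cases "?k = 0") simp_all
  qed
  finally show "coord (annih f (create g \<phi>)) l = coord (cinner f g *\<^sub>C \<phi> + create g (annih f \<phi>)) l"
    by (simp add: mult.commute)
qed

lemma vac_fock: "vac \<in> fock" and vac_hom: "vac \<in> hom 0"
  by (rule fockI) (auto simp: vac_def coord_ket hom_def)

lemma annih_vac: "annih f vac = (0 :: 'a list ell2)"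
proof (rule ell2_eqI)
  fix l :: "'a list"
  have "slice1 vac l = 0" by (rule ell2_eqI) (simp add: coord_slice1 vac_def coord_ket)
  then show "coord (annih f vac) l = coord 0 l" by (simp add: coord_annih[OF vac_hom])
qed

subsection \<open>Number states\<close>

definition product_state :: "'a ell2 list \<Rightarrow> 'a list ell2" where
  "product_state fs = foldr create fs vac"

lemma product_state_Nil [simp]: "product_state [] = vac"
  and product_state_Cons: "product_state (f # fs) = create f (product_state fs)"
  by (simp_all add: product_state_def)

lemma product_state_hom: "product_state fs \<in> hom (length fs)"
  by (induction fs) (simp_all add: vac_hom product_state_Cons create_hom)

lemma product_state_dom: "product_state fs \<in> create_dom"
  by (rule hom_create_dom[OF product_state_hom])

lemma product_state_fock: "product_state fs \<in> fock"
  by (cases fs) (simp_all add: vac_fock product_state_Cons create_fock product_state_dom)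

lemma product_state_move: "product_state (fs @ f # gs) = product_state (f # fs @ gs)"
  by (induction fs)
    (simp_all add: product_state_Cons create_commute[OF product_state_fock product_state_hom])

lemma product_state_mset: "mset fs = mset gs \<Longrightarrow> product_state fs = product_state gs"
proof (induction fs arbitrary: gs)
  case (Cons f fs)
  then have "f \<in> set gs" by (metis list.set_intros(1) set_mset_mset)
  then obtain g1 g2 where gs: "gs = g1 @ f # g2" by (auto simp: in_set_conv_decomp)
  with Cons.prems have "mset fs = mset (g1 @ g2)" by simp
  from Cons.IH[OF this] show ?case by (simp add: gs product_state_move) (simp add: product_state_Cons)
qed simp

text \<open>The squared norm of a product state in orthonormal modes.\<close>

definition mfact :: "'i multiset \<Rightarrow> real" where
  "mfact M = (\<Prod>i\<in>set_mset M. fact (count M i))"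

lemma mfact_pos: "0 < mfact M"
  unfolding mfact_def by (intro prod_pos) simp

lemma mfact_add: "mfact (add_mset i M) = real (count M i + 1) * mfact M"
proof -
  have "mfact (add_mset i M) = (\<Prod>j\<in>insert i (set_mset M). fact (count (add_mset i M) j))"
    by (simp add: mfact_def)
  also have "\<dots> = fact (count M i + 1) * (\<Prod>j\<in>set_mset M - {i}. fact (count M j))"
  proof -
    have "(\<Prod>j\<in>set_mset M - {i}. fact (count (add_mset i M) j)) = (\<Prod>j\<in>set_mset M - {i}. fact (count M j) :: real)"
      by (rule prod.cong) auto
    then show ?thesis by (subst prod.insert_remove) auto
  qed
  also have "\<dots> = real (count M i + 1) * (fact (count M i) * (\<Prod>j\<in>set_mset M - {i}. fact (count M j)))"
    by (simp add: algebra_simps)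
  also have "fact (count M i) * (\<Prod>j\<in>set_mset M - {i}. fact (count M j)) = mfact M"
    unfolding mfact_def by (cases "i \<in># M") (auto simp: prod.remove[of _ i] not_in_iff)
  finally show ?thesis .
qed

text \<open>In contrast to \<open>number_state\<close>, the mode labels may be of any type, such as the sum types
  that label the modes of future null infinity and the horizon together.\<close>

definition mstate :: "('i \<Rightarrow> 'a ell2) \<Rightarrow> 'i multiset \<Rightarrow> 'a list ell2" where
  "mstate e M = (1 / sqrt (mfact M)) *\<^sub>R product_state (map e (SOME l. mset l = M))"

text \<open>Creation operators commute, so any enumeration of the multiset may replace the chosen
  one.\<close>

lemma mstate: "mstate e (mset l) = (1 / sqrt (mfact (mset l))) *\<^sub>R product_state (map e l)"
proof -
  have "mset (SOME l'. mset l' = mset l) = mset l" by (rule someI_ex) blast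
  then have "product_state (map e (SOME l'. mset l' = mset l)) = product_state (map e l)"
    by (intro product_state_mset) simp
  then show ?thesis by (simp add: mstate_def)
qed

lemma mstate_empty [simp]: "mstate e {#} = vac"
  using mstate[of e "[]"] by (simp add: mfact_def)

lemma mstate_fock: "mstate e M \<in> fock"
  unfolding mstate_def by (intro fock_scaleR product_state_fock)

lemma mstate_hom: "mstate e M \<in> hom (size M)"
proof -
  obtain l where "M = mset l" by (metis ex_mset)
  then show ?thesis using product_state_hom[of "map e l"] by (simp add: mstate hom_scaleR)
qed

lemma mstate_dom: "mstate e M \<in> create_dom"
  by (rule hom_create_dom[OF mstate_hom])

lemma create_mstate: "create (e i) (mstate e M) = sqrt (real (count M i + 1)) *\<^sub>R mstate e (add_mset i M)"
proof -
  obtain l where l: "M = mset l" by (metis ex_mset)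
  have "mstate e (mset (i # l)) = (1 / sqrt (mfact (add_mset i M))) *\<^sub>R create (e i) (product_state (map e l))"
    unfolding mstate by (simp add: product_state_Cons l)
  then show ?thesis using mfact_pos[of M]
    by (simp add: l mstate create_scaleR_right product_state_dom mfact_add real_sqrt_mult del: of_nat_add)
qed

lemma mstate_add: "mstate e (add_mset i M) = (1 / sqrt (real (count M i + 1))) *\<^sub>R create (e i) (mstate e M)"
  by (simp add: create_mstate del: of_nat_add of_nat_Suc)

text \<open>The commutation relation moves the annihilator past the outermost creator. If the modes
  agree and \<open>i\<close> occurs in \<open>M\<close>, both resulting terms are multiples of
  \<open>mstate e M\<close> with total factor \<open>1 + count M i\<close>; division by the root of
  this number leaves the root.\<close>

lemma annih_mstate:
  assumes e: "orthonormal_family e"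
  shows "annih (e i) (mstate e M) = sqrt (real (count M i)) *\<^sub>R mstate e (M - {#i#})"
proof (induction M)
  case empty
  then show ?case by (simp add: annih_vac)
next
  case (add j M)
  let ?c = "sqrt (real (count M j + 1))"
  have c: "?c \<noteq> 0" by (simp del: of_nat_add)
  have "annih (e i) (create (e j) (mstate e M))
      = cinner (e i) (e j) *\<^sub>C mstate e M + create (e j) (annih (e i) (mstate e M))"
    by (rule annih_create[OF mstate_fock mstate_hom])
  also have "create (e j) (annih (e i) (mstate e M))
      = (sqrt (real (count M i)) * sqrt (real (count (M - {#i#}) j + 1))) *\<^sub>R mstate e (add_mset j (M - {#i#}))"
    unfolding add.IH by (simp add: create_scaleR_right mstate_dom create_mstate del: of_nat_add)
  finally have "annih (e i) (mstate e (add_mset j M)) = (1 / ?c) *\<^sub>R (cinner (e i) (e j) *\<^sub>C mstate e M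
     + (sqrt (real (count M i)) * sqrt (real (count (M - {#i#}) j + 1))) *\<^sub>R mstate e (add_mset j (M - {#i#})))"
    unfolding mstate_add annih_scaleR[OF create_hom[OF mstate_hom]] by simp
  moreover have "\<dots> = sqrt (real (count (add_mset j M) i)) *\<^sub>R mstate e (add_mset j M - {#i#})"
  proof (cases "i = j")
    case True
    have o: "cinner (e i) (e j) = 1" using e True by (simp add: orthonormal_family_def)
    show ?thesis
    proof (cases "i \<in># M")
      case False
      then show ?thesis using o True by (simp add: not_in_iff)
    next
      case im: True
      then have m: "add_mset j (M - {#i#}) = M" using True by simp
      obtain n where n: "count M j = Suc n" using im True by (metis count_greater_zero_iff gr0_implies_Suc)
      have "(1 / ?c) *\<^sub>R (mstate e M + (sqrt (real (Suc n)) * sqrt (real (Suc n))) *\<^sub>R mstate e M)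
        = ((1 / ?c) * (1 + sqrt (real (Suc n)) * sqrt (real (Suc n)))) *\<^sub>R mstate e M"
        by (simp only: scaleR_add_left scaleR_scaleR scaleR_add_right distrib_left mult_1_right)
      also have "(1 / ?c) * (1 + sqrt (real (Suc n)) * sqrt (real (Suc n))) = sqrt (real (Suc (Suc n)))"
      proof -
        have "sqrt (real (Suc n)) * sqrt (real (Suc n)) = real (Suc n)" by simp
        moreover have "?c = sqrt (real (Suc (Suc n)))" by (simp add: n)
        ultimately show ?thesis by (simp add: real_div_sqrt)
      qed
      finally show ?thesis using o True m n by simp
    qed
  next
    case False
    have o: "cinner (e i) (e j) = 0" using e False by (simp add: orthonormal_family_def)
    have cm: "count (M - {#i#}) j = count M j" using False by simp
    show ?thesis
    proof (cases "i \<in># M")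
      case True
      then have "add_mset j (M - {#i#}) = add_mset j M - {#i#}" using False by simp
      then show ?thesis using False o c by (simp add: cm del: of_nat_add of_nat_Suc)
    next
      case nm: False
      then show ?thesis using False o by (simp add: not_in_iff)
    qed
  qed
  ultimately show ?case by simp
qed

lemma cinner_mstate_create:
  assumes "orthonormal_family e" "\<psi> \<in> create_dom"
  shows "cinner (mstate e M) (create (e i) \<psi>) = sqrt (real (count M i)) * cinner (mstate e (M - {#i#})) \<psi>"
  by (simp add: cinner_create[OF mstate_fock mstate_hom assms(2)] annih_mstate[OF assms(1)])

text \<open>The outermost creation operator on the right, moved to the left side, takes the same
  quantum out of \<open>M\<close> with the same root, or gives 0 if \<open>M\<close> has
  none.\<close>

lemma orthonormal_mstate:
  assumes e: "orthonormal_family e"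
  shows "orthonormal_family (mstate e)"
proof -
  have "cinner (mstate e M) (mstate e M') = (if M = M' then 1 else 0)" for M M'
  proof (induction M' arbitrary: M)
    case empty
    show ?case
    proof (cases "M = {#}")
      case True
      then show ?thesis using norm_ket[of "[]"] by (simp add: cinner_norm vac_def)
    next
      case False
      then show ?thesis using hom_orthogonal[OF mstate_hom vac_hom] by simp
    qed
  next
    case (add i M')
    have c: "sqrt (real (count M' i + 1)) \<noteq> 0" by (simp del: of_nat_add)
    have *: "cinner (mstate e M) (mstate e (add_mset i M')) =
        (sqrt (real (count M i)) * (if M - {#i#} = M' then 1 else 0)) / sqrt (real (count M' i + 1))"
      unfolding mstate_add cinner_scaleR_right cinner_mstate_create[OF e mstate_dom] add.IH by simp
    show ?case
    proof (cases "i \<in># M")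
      case True
      then have "M - {#i#} = M' \<longleftrightarrow> M = add_mset i M'" by (metis add_mset_remove_trivial insert_DiffM)
      then show ?thesis unfolding * using c by (auto simp del: of_nat_add of_nat_Suc)
    next
      case False
      then have "M \<noteq> add_mset i M'" by auto
      then show ?thesis using False unfolding * by (simp add: not_in_iff)
    qed
  qed
  then show ?thesis by (simp add: orthonormal_family_def)
qed

text \<open>Suppose that \<open>v\<close> is orthogonal to all number states with as many quanta as
  \<open>x # l\<close> has entries. Its contraction with any mode is then orthogonal to all number
  states with one quantum less, so by induction on the list \<open>slice1 v l\<close> is orthogonal
  to every mode. Completeness of the modes makes this slice vanish, and with it the coordinate of
  \<open>v\<close>.\<close>

lemma mstate_complete:
  fixes e :: "'i \<Rightarrow> 'a ell2"
  assumes e: "orthonormal_family e" and c: "closed_cspan (range e) = UNIV"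
  shows "closed_cspan (range (mstate e)) = fock"
proof (rule closed_cspan_eqI)
  show "orthonormal_on (mstate e) UNIV"
    using orthonormal_mstate[OF e] by (simp add: orthonormal_family_on)
  have *: "coord v l = 0" if "v \<in> fock" "\<And>M. size M = length l \<Longrightarrow> cinner (mstate e M) v = 0" for l v
    using that
  proof (induction l arbitrary: v)
    case Nil
    from Nil(2)[of "{#}"] show ?case by (simp add: vac_def)
  next
    case (Cons x l)
    have "cinner (e i) (slice1 v l) = 0" for i
    proof -
      have "coord (contract (one_particle (e i)) v) l = 0"
      proof (rule Cons.IH)
        show "contract (one_particle (e i)) v \<in> fock" by (rule contract_fock[OF one_particle_hom Cons.prems(1)])
        fix M :: "'i multiset" assume M: "size M = length l"
        have "cinner v (create (e i) (mstate e M)) = sqrt (real (size M + 1)) * cinner v (tensor (one_particle (e i)) (mstate e M))"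
        proof -
          have "tensor (one_particle (e i)) (wt (mstate e M)) = sqrt (real (size M + 1)) *\<^sub>R tensor (one_particle (e i)) (mstate e M)"
            unfolding wt_hom[OF mstate_hom] by (rule ell2_eqI) (simp add: coord_tensor[OF one_particle_hom])
          then show ?thesis
            by (simp add: create_eq[OF mstate_dom] cinner_symmetrize[OF Cons.prems(1)] del: of_nat_add of_nat_Suc)
        qed
        moreover have "cinner v (create (e i) (mstate e M)) = 0"
          using Cons.prems(2)[of "add_mset i M"] M
          by (subst cinner_commute) (simp add: create_mstate del: of_nat_add of_nat_Suc)
        ultimately have "cinner v (tensor (one_particle (e i)) (mstate e M)) = 0" by (simp del: of_nat_add of_nat_Suc)
        then show "cinner (mstate e M) (contract (one_particle (e i)) v) = 0"
          unfolding cinner_tensor[OF one_particle_hom] by (subst cinner_commute) simp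
      qed
      then show ?thesis by (simp add: coord_contract1)
    qed
    moreover have "slice1 v l \<in> closed_cspan (range e)" using c by simp
    ultimately have "cinner (slice1 v l) (slice1 v l) = 0"
      by - (rule closed_cspan_orth[of _ "range e"], auto)
    then have "slice1 v l = 0" by (simp add: cinner_norm)
    then show ?case using coord_slice1[of v l x] by simp
  qed
  show "v = 0" if "v \<in> fock" "\<And>i. i \<in> UNIV \<Longrightarrow> cinner (mstate e i) v = 0" for v
  proof (rule ell2_eqI)
    fix l show "coord v l = coord 0 l" using *[OF that(1), of l] that(2) by simp
  qed
qed (auto simp: closed_fock subspace_fock fock_scaleC mstate_fock)

text \<open>Multisets hold the same data as occupation numbers, but adding one quantum is
  \<open>add_mset\<close>, and induction is available.\<close>

definition occ_mset :: "occ \<Rightarrow> nat multiset" where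
  "occ_mset n = Abs_multiset (Poly_Mapping.lookup n)"

lemma count_occ_mset [simp]: "count (occ_mset n) = Poly_Mapping.lookup n"
proof -
  have "{i. 0 < Poly_Mapping.lookup n i} = Poly_Mapping.keys n" by (auto simp: in_keys_iff)
  then show ?thesis by (simp add: occ_mset_def Abs_multiset_inverse)
qed

lemma set_occ_mset [simp]: "set_mset (occ_mset n) = Poly_Mapping.keys n"
  by (auto simp: set_mset_def in_keys_iff)

lemma bij_occ_mset: "bij occ_mset"
proof (rule bijI)
  show "inj occ_mset"
    by (rule injI) (metis count_occ_mset poly_mapping_eqI)
  show "surj occ_mset"
  proof (rule surjI)
    fix M :: "nat multiset"
    have "finite {i. count M i \<noteq> 0}" by simp
    then have "Poly_Mapping.lookup (Abs_poly_mapping (count M)) = count M"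
      by (simp add: Abs_poly_mapping_inverse)
    then show "occ_mset (Abs_poly_mapping (count M)) = M" by (simp add: multiset_eq_iff)
  qed
qed

text \<open>The powers of creation operators form one product state over a list with repetitions,
  and the nested normalizations multiply to the root of \<open>mfact\<close>.\<close>

lemma number_state_mstate: "number_state e n = mstate e (occ_mset n)"
proof -
  define c where "c = Poly_Mapping.lookup n"
  have pow: "(create (e i) ^^ k) (r *\<^sub>R product_state fs) = r *\<^sub>R product_state (replicate k (e i) @ fs)" for i k r fs
    by (induction k) (simp_all add: create_scaleR_right product_state_dom product_state_Cons)
  have "foldr (\<lambda>i \<psi>. (1 / sqrt (fact (c i))) *\<^sub>R (create (e i) ^^ c i) \<psi>) is vac
     = (1 / sqrt (\<Prod>i\<in>set is. fact (c i))) *\<^sub>R product_state (concat (map (\<lambda>i. replicate (c i) (e i)) is))"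
    if "distinct is" for "is"
    using that by (induction "is") (simp_all add: pow real_sqrt_mult)
  from this[of "sorted_list_of_set (Poly_Mapping.keys n)"]
  have "number_state e n = (1 / sqrt (mfact (occ_mset n))) *\<^sub>R
      product_state (concat (map (\<lambda>i. replicate (c i) (e i)) (sorted_list_of_set (Poly_Mapping.keys n))))"
    by (simp add: number_state_def c_def mfact_def)
  moreover have "concat (map (\<lambda>i. replicate (c i) (e i)) is) = map e (concat (map (\<lambda>i. replicate (c i) i) is))" for "is"
    by (induction "is") simp_all
  moreover have eq: "occ_mset n = mset (concat (map (\<lambda>i. replicate (c i) i) (sorted_list_of_set (Poly_Mapping.keys n))))"
  proof -
    have *: "count (mset (concat (map (\<lambda>i. replicate (c i) i) is))) j = (if j \<in> set is then c j else 0)" if "distinct is" for "is" j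
      using that by (induction "is") (auto simp: count_replicate_mset)
    show ?thesis unfolding multiset_eq_iff *[OF distinct_sorted_list_of_set] by (simp add: c_def in_keys_iff)
  qed
  ultimately show ?thesis by (simp only: eq mstate)
qed

section \<open>Tensor products and direct sums\<close>

lemma coord_tensor2: "coord (tensor2 f g) (x, y) = coord f x * coord g y"
  using coord_mk_ell2[of "\<lambda>(x, y). coord f x * coord g y"] product_summable[OF coord_summable coord_summable, of f g]
  by (simp add: tensor2_def case_prod_unfold)

definition slice2 :: "('a \<times> 'b) ell2 \<Rightarrow> 'b \<Rightarrow> 'a ell2" where
  "slice2 \<Phi> y = mk_ell2 (\<lambda>x. coord \<Phi> (x, y))"

lemma coord_slice2: "coord (slice2 \<Phi> y) x = coord \<Phi> (x, y)"
proof -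
  have "(\<lambda>p. (cmod (coord \<Phi> p))\<^sup>2) summable_on (\<lambda>x. (x, y)) ` UNIV"
    by (rule summable_on_subset[OF coord_summable]) simp
  then have "(\<lambda>x. (cmod (coord \<Phi> (x, y)))\<^sup>2) summable_on UNIV"
    by (subst (asm) summable_on_reindex) (auto simp: inj_on_def o_def)
  from coord_mk_ell2[OF this] show ?thesis by (simp add: slice2_def)
qed

lemma slice2_norm: "((\<lambda>y. (norm (slice2 \<Phi> y))\<^sup>2) has_sum (norm \<Phi>)\<^sup>2) UNIV"
proof (rule has_sum_SigmaD)
  have "((\<lambda>p. (cmod (coord \<Phi> p))\<^sup>2) has_sum (norm \<Phi>)\<^sup>2) (UNIV \<times> UNIV)"
    using norm_ell2_has_sum[of \<Phi>] by simp
  then show "((\<lambda>(y, x). (cmod (coord \<Phi> (x, y)))\<^sup>2) has_sum (norm \<Phi>)\<^sup>2) (Sigma UNIV (\<lambda>_. UNIV))"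
    by (subst (asm) has_sum_swap) simp
  fix y
  show "((\<lambda>x. case (y, x) of (y, x) \<Rightarrow> (cmod (coord \<Phi> (x, y)))\<^sup>2) has_sum (norm (slice2 \<Phi> y))\<^sup>2) UNIV"
    using norm_ell2_has_sum[of "slice2 \<Phi> y"] by (simp add: coord_slice2)
qed

text \<open>The partial inner product \<open>\<langle>u| \<otimes> 1\<close>, applied to \<open>\<Phi>\<close>.\<close>

definition pinner :: "'a ell2 \<Rightarrow> ('a \<times> 'b) ell2 \<Rightarrow> 'b ell2" where
  "pinner u \<Phi> = mk_ell2 (\<lambda>y. cinner u (slice2 \<Phi> y))"

lemma coord_pinner: "coord (pinner u \<Phi>) y = cinner u (slice2 \<Phi> y)"
proof -
  have "(\<lambda>y. (cmod (cinner u (slice2 \<Phi> y)))\<^sup>2) summable_on UNIV"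
  proof (rule summable_on_comparison_test)
    show "(\<lambda>y. (norm u)\<^sup>2 * (norm (slice2 \<Phi> y))\<^sup>2) summable_on UNIV"
      by (intro summable_on_cmult_right has_sum_imp_summable[OF slice2_norm])
    show "(cmod (cinner u (slice2 \<Phi> y)))\<^sup>2 \<le> (norm u)\<^sup>2 * (norm (slice2 \<Phi> y))\<^sup>2" for y
      unfolding power_mult_distrib[symmetric] by (intro power_mono cinner_Cauchy_Schwarz) simp
  qed simp
  from coord_mk_ell2[OF this] show ?thesis by (simp add: pinner_def)
qed

lemma cinner_tensor2: "cinner (tensor2 u w) \<Phi> = cinner w (pinner u \<Phi>)"
proof -
  have "((\<lambda>p. cnj (coord (tensor2 u w) p) * coord \<Phi> p) has_sum cinner (tensor2 u w) \<Phi>) (UNIV \<times> UNIV)"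
    using cinner_has_sum by simp
  then have "((\<lambda>(y, x). cnj (coord (tensor2 u w) (x, y)) * coord \<Phi> (x, y)) has_sum cinner (tensor2 u w) \<Phi>) (Sigma UNIV (\<lambda>_. UNIV))"
    by (subst (asm) has_sum_swap) simp
  then have "((\<lambda>y. cnj (coord w y) * coord (pinner u \<Phi>) y) has_sum cinner (tensor2 u w) \<Phi>) UNIV"
  proof (rule has_sum_SigmaD)
    fix y
    have "((\<lambda>x. cnj (coord w y) * (cnj (coord u x) * coord (slice2 \<Phi> y) x)) has_sum cnj (coord w y) * cinner u (slice2 \<Phi> y)) UNIV"
      by (intro has_sum_cmult_right cinner_has_sum)
    then show "((\<lambda>x. case (y, x) of (y, x) \<Rightarrow> cnj (coord (tensor2 u w) (x, y)) * coord \<Phi> (x, y))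
        has_sum cnj (coord w y) * coord (pinner u \<Phi>) y) UNIV"
      by (simp add: coord_tensor2 coord_slice2 coord_pinner ac_simps)
  qed
  then show ?thesis by (rule has_sum_unique[OF _ cinner_has_sum])
qed

lemma cinner_tensor2_ket: "cinner (tensor2 u (ket y)) \<Phi> = cinner u (slice2 \<Phi> y)"
  by (simp add: cinner_tensor2 coord_pinner)

subsection \<open>Direct sums\<close>

lemma summable_on_case_sum:
  fixes f :: "'a \<Rightarrow> real"
  assumes "f summable_on UNIV" "g summable_on UNIV"
  shows "case_sum f g summable_on UNIV"
proof -
  have "case_sum f g summable_on range Inl" "case_sum f g summable_on range Inr"
    by (subst summable_on_reindex; simp add: o_def assms)+
  then have "case_sum f g summable_on (range Inl \<union> range Inr)"
    by (rule summable_on_Un_disjoint) auto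
  then show ?thesis by (simp add: UNIV_sum)
qed

lemma coord_dsum_left: "coord (dsum_left f) s = case_sum (coord f) (\<lambda>_. 0) s"
proof -
  have "case_sum (\<lambda>x. (cmod (coord f x))\<^sup>2) (\<lambda>_. 0) summable_on UNIV"
    by (rule summable_on_case_sum[OF coord_summable summable_on_0_simp])
  then have "(\<lambda>s. (cmod (case_sum (coord f) (\<lambda>_. 0) s))\<^sup>2) summable_on UNIV"
    by (rule summable_on_cong[THEN iffD1, rotated]) (auto split: sum.splits)
  from coord_mk_ell2[OF this] show ?thesis unfolding dsum_left_def by (rule fun_cong)
qed

lemma coord_dsum_right: "coord (dsum_right g) s = case_sum (\<lambda>_. 0) (coord g) s"
proof -
  have "case_sum (\<lambda>_. 0) (\<lambda>x. (cmod (coord g x))\<^sup>2) summable_on UNIV"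
    by (rule summable_on_case_sum[OF summable_on_0_simp coord_summable])
  then have "(\<lambda>s. (cmod (case_sum (\<lambda>_. 0) (coord g) s))\<^sup>2) summable_on UNIV"
    by (rule summable_on_cong[THEN iffD1, rotated]) (auto split: sum.splits)
  from coord_mk_ell2[OF this] show ?thesis unfolding dsum_right_def by (rule fun_cong)
qed

definition lpart :: "('a + 'b) ell2 \<Rightarrow> 'a ell2" where
  "lpart v = mk_ell2 (\<lambda>a. coord v (Inl a))"

definition rpart :: "('a + 'b) ell2 \<Rightarrow> 'b ell2" where
  "rpart v = mk_ell2 (\<lambda>a. coord v (Inr a))"

lemma coord_lpart: "coord (lpart v) a = coord v (Inl a)"
proof -
  have "(\<lambda>s. (cmod (coord v s))\<^sup>2) summable_on range Inl"
    by (rule summable_on_subset[OF coord_summable]) simp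
  then have "(\<lambda>a. (cmod (coord v (Inl a)))\<^sup>2) summable_on UNIV"
    by (subst (asm) summable_on_reindex) (auto simp: o_def)
  from coord_mk_ell2[OF this] show ?thesis by (simp add: lpart_def)
qed

lemma coord_rpart: "coord (rpart v) a = coord v (Inr a)"
proof -
  have "(\<lambda>s. (cmod (coord v s))\<^sup>2) summable_on range Inr"
    by (rule summable_on_subset[OF coord_summable]) simp
  then have "(\<lambda>a. (cmod (coord v (Inr a)))\<^sup>2) summable_on UNIV"
    by (subst (asm) summable_on_reindex) (auto simp: o_def)
  from coord_mk_ell2[OF this] show ?thesis by (simp add: rpart_def)
qed

lemma cinner_dsum_left: "cinner (dsum_left f) v = cinner f (lpart v)"
proof -
  have "((\<lambda>s. cnj (coord (dsum_left f) s) * coord v s) has_sum cinner f (lpart v)) (range Inl)"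
    using cinner_has_sum[of f "lpart v"]
    by (subst has_sum_reindex) (auto simp: o_def coord_dsum_left coord_lpart)
  then have "((\<lambda>s. cnj (coord (dsum_left f) s) * coord v s) has_sum cinner f (lpart v)) UNIV"
    by (rule has_sum_cong_neutral[THEN iffD1, rotated -1]) (auto simp: coord_dsum_left split: sum.splits)
  then show ?thesis by (rule has_sum_unique[OF cinner_has_sum])
qed

lemma cinner_dsum_right: "cinner (dsum_right f) v = cinner f (rpart v)"
proof -
  have "((\<lambda>s. cnj (coord (dsum_right f) s) * coord v s) has_sum cinner f (rpart v)) (range Inr)"
    using cinner_has_sum[of f "rpart v"]
    by (subst has_sum_reindex) (auto simp: o_def coord_dsum_right coord_rpart)
  then have "((\<lambda>s. cnj (coord (dsum_right f) s) * coord v s) has_sum cinner f (rpart v)) UNIV"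
    by (rule has_sum_cong_neutral[THEN iffD1, rotated -1]) (auto simp: coord_dsum_right split: sum.splits)
  then show ?thesis by (rule has_sum_unique[OF cinner_has_sum])
qed

lemma parts_dsum [simp]: "lpart (dsum_left f) = f" "lpart (dsum_right g) = 0"
    "rpart (dsum_left f) = 0" "rpart (dsum_right g) = g"
  by (rule ell2_eqI; simp add: coord_lpart coord_rpart coord_dsum_left coord_dsum_right)+

lemma dsum_modes:
  fixes e :: "'i \<Rightarrow> 'a ell2" and e' :: "'j \<Rightarrow> 'b ell2"
  assumes e: "orthonormal_family e" "closed_cspan (range e) = UNIV"
    and e': "orthonormal_family e'" "closed_cspan (range e') = UNIV"
  defines "E \<equiv> case_sum (\<lambda>i. dsum_left (e i)) (\<lambda>j. dsum_right (e' j))"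
  shows "orthonormal_family E" "closed_cspan (range E) = UNIV"
proof -
  show o: "orthonormal_family E"
    using e(1) e'(1) unfolding orthonormal_family_def
    by (auto simp: E_def cinner_dsum_left cinner_dsum_right split: sum.splits)
  show "closed_cspan (range E) = UNIV"
  proof (rule closed_cspan_eqI)
    show "orthonormal_on E UNIV" using o by (simp add: orthonormal_family_on)
    fix v :: "('a + 'b) ell2" assume v: "\<And>i. i \<in> UNIV \<Longrightarrow> cinner (E i) v = 0"
    have "cinner (e i) (lpart v) = 0" for i using v[of "Inl i"] by (simp add: E_def cinner_dsum_left)
    then have "lpart v = 0"
      using e closed_cspan_eqD[of e UNIV "lpart v" 0] by (simp add: orthonormal_family_on)
    moreover have "cinner (e' i) (rpart v) = 0" for i using v[of "Inr i"] by (simp add: E_def cinner_dsum_right)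
    then have "rpart v = 0"
      using e' closed_cspan_eqD[of e' UNIV "rpart v" 0] by (simp add: orthonormal_family_on)
    ultimately show "v = 0"
      by (intro ell2_eqI) (metis coord_lpart coord_rpart coord_zero old.sum.exhaust)
  qed auto
qed

subsection \<open>Splitting the Fock space of a direct sum\<close>

definition unshuffle :: "('a + 'b) list \<Rightarrow> 'a list \<times> 'b list" where
  "unshuffle L = (map projl (filter isl L), map projr (filter (\<lambda>x. \<not> isl x) L))"

lemma unshuffle_mset:
  "unshuffle L = (l, l') \<Longrightarrow> mset L = mset (map Inl l @ map Inr l')"
proof -
  assume "unshuffle L = (l, l')"
  then have l: "l = map projl (filter isl L)" and l': "l' = map projr (filter (\<lambda>x. \<not> isl x) L)"
    by (simp_all add: unshuffle_def)
  have "map Inl l = filter isl L" unfolding l by (auto intro!: map_idI)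
  moreover have "map Inr l' = filter (\<lambda>x. \<not> isl x) L" unfolding l' by (auto intro!: map_idI)
  ultimately show ?thesis unfolding mset_append by (simp only: mset_filter) (rule multiset_partition)
qed

lemma unshuffle_fibre: "unshuffle -` {(l, l')} = shuffles (map Inl l) (map Inr l')"
proof -
  have "unshuffle L = (l, l') \<longleftrightarrow> partition isl L = (map Inl l, map Inr l')" for L
  proof
    assume "unshuffle L = (l, l')"
    then have l: "l = map projl (filter isl L)" and l': "l' = map projr (filter (\<lambda>x. \<not> isl x) L)"
      by (simp_all add: unshuffle_def)
    have "map Inl l = filter isl L" unfolding l by (auto intro!: map_idI)
    moreover have "map Inr l' = filter (\<lambda>x. \<not> isl x) L" unfolding l' by (auto intro!: map_idI)
    ultimately show "partition isl L = (map Inl l, map Inr l')" by (simp add: o_def)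
  next
    assume "partition isl L = (map Inl l, map Inr l')"
    then have "filter isl L = map Inl l" "filter (\<lambda>x. \<not> isl x) L = map Inr l'" by (simp_all add: o_def)
    then show "unshuffle L = (l, l')" by (simp add: unshuffle_def o_def)
  qed
  then have "unshuffle -` {(l, l')} = partition isl -` {(map Inl l, map Inr l')}" by auto
  also have "\<dots> = shuffles (map Inl l) (map Inr l')" by (rule inv_image_partition) auto
  finally show ?thesis .
qed

text \<open>A list over the sum type consists of two sublists and a way to interleave them. The
  fibre over \<open>(l, l')\<close> is the set of shuffles, counted by the binomial coefficient
  whose root is the factor in \<open>fock_split\<close>; this makes \<open>fock_split\<close>
  isometric on symmetric vectors.\<close>

lemma unshuffle_has_sum:
  fixes h :: "('a + 'b) list \<Rightarrow> 'c::real_normed_field"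
  assumes h: "(h has_sum s) UNIV" and k: "\<And>L. h L = k (unshuffle L)"
  shows "((\<lambda>(l, l'). of_nat ((length l + length l') choose length l) * k (l, l')) has_sum s) UNIV"
proof -
  have "bij_betw (\<lambda>L. (unshuffle L, L)) UNIV (Sigma UNIV (\<lambda>p. unshuffle -` {p}))"
    by (rule bij_betwI[where g = snd]) auto
  from has_sum_reindex_bij_betw[OF this, of "\<lambda>x. h (snd x)" s]
  have "((\<lambda>x. h (snd x)) has_sum s) (Sigma UNIV (\<lambda>p. unshuffle -` {p}))" using h by simp
  then show ?thesis
  proof (rule has_sum_SigmaD)
    fix p :: "'a list \<times> 'b list"
    obtain l l' where p: "p = (l, l')" by (cases p)
    have "card (shuffles (map Inl l :: ('a + 'b) list) (map Inr l')) = (length l + length l') choose length l"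
      by (subst card_disjoint_shuffles) auto
    moreover have "(\<Sum>L\<in>unshuffle -` {p}. h L) = (\<Sum>L\<in>unshuffle -` {p}. k p)"
      by (rule sum.cong[OF refl]) (simp add: k)
    ultimately show "((\<lambda>y. h (snd (p, y))) has_sum (case p of (l, l') \<Rightarrow> of_nat ((length l + length l') choose length l) * k (l, l')))
        (unshuffle -` {p})"
      by (intro has_sum_finiteI) (simp_all add: p unshuffle_fibre)
  qed
qed

lemma fock_unshuffle:
  "\<psi> \<in> fock \<Longrightarrow> coord \<psi> L = (\<lambda>(l, l'). coord \<psi> (map Inl l @ map Inr l')) (unshuffle L)"
  by (cases "unshuffle L") (auto intro!: fockD unshuffle_mset)

lemma coord_fock_split:
  assumes "\<psi> \<in> fock"
  shows "coord (fock_split \<psi>) (l, l') =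
    of_real (sqrt (real ((length l + length l') choose length l))) * coord \<psi> (map Inl l @ map Inr l')"
proof -
  let ?f = "\<lambda>(l, l'). of_real (sqrt (real ((length l + length l') choose length l))) * coord \<psi> (map Inl l @ map Inr l')"
  have "((\<lambda>(l, l'). real ((length l + length l') choose length l) *
      (\<lambda>(l, l'). (cmod (coord \<psi> (map Inl l @ map Inr l')))\<^sup>2) (l, l')) has_sum (norm \<psi>)\<^sup>2) UNIV"
    by (rule unshuffle_has_sum[OF norm_ell2_has_sum], subst fock_unshuffle[OF assms]) (simp add: case_prod_unfold)
  then have "(\<lambda>p. (cmod (?f p))\<^sup>2) summable_on UNIV"
    by (intro has_sum_imp_summable) (simp add: case_prod_unfold norm_mult power_mult_distrib)
  from coord_mk_ell2[OF this] show ?thesis by (simp add: fock_split_def)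
qed

lemma cinner_fock_split:
  assumes "\<phi> \<in> fock" "\<psi> \<in> fock"
  shows "cinner (fock_split \<phi>) (fock_split \<psi>) = cinner \<phi> \<psi>"
proof -
  have "((\<lambda>(l, l'). of_nat ((length l + length l') choose length l) *
      (\<lambda>(l, l'). cnj (coord \<phi> (map Inl l @ map Inr l')) * coord \<psi> (map Inl l @ map Inr l')) (l, l')) has_sum cinner \<phi> \<psi>) UNIV"
    by (rule unshuffle_has_sum[OF cinner_has_sum], subst fock_unshuffle[OF assms(1)], subst fock_unshuffle[OF assms(2)])
      (simp add: case_prod_unfold)
  moreover have "cnj (coord (fock_split \<phi>) p) * coord (fock_split \<psi>) p = (case p of (l, l') \<Rightarrow>
      of_nat ((length l + length l') choose length l) *
      (\<lambda>(l, l'). cnj (coord \<phi> (map Inl l @ map Inr l')) * coord \<psi> (map Inl l @ map Inr l')) (l, l'))" for p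
  proof (cases p)
    case (Pair l l')
    have "of_nat ((length l + length l') choose length l) =
        complex_of_real (sqrt (real ((length l + length l') choose length l))) * of_real (sqrt (real ((length l + length l') choose length l)))"
      by (simp flip: of_real_mult)
    then show ?thesis by (simp add: Pair coord_fock_split assms)
  qed
  ultimately have "((\<lambda>p. cnj (coord (fock_split \<phi>) p) * coord (fock_split \<psi>) p) has_sum cinner \<phi> \<psi>) UNIV"
    by (simp only:)
  then show ?thesis by (rule has_sum_unique[OF cinner_has_sum])
qed

lemma norm_fock_split: "\<psi> \<in> fock \<Longrightarrow> norm (fock_split \<psi>) = norm \<psi>"
  using cinner_fock_split[of \<psi> \<psi>] by (simp add: cinner_norm power2_eq_iff_nonneg del: of_real_power)

lemma fock_split_add: "\<phi> \<in> fock \<Longrightarrow> \<psi> \<in> fock \<Longrightarrow> fock_split (\<phi> + \<psi>) = fock_split \<phi> + fock_split \<psi>"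
  by (rule ell2_eqI) (auto simp: coord_fock_split fock_add distrib_left)

lemma fock_split_scaleC: "\<psi> \<in> fock \<Longrightarrow> fock_split (c *\<^sub>C \<psi>) = c *\<^sub>C fock_split \<psi>"
  by (rule ell2_eqI) (auto simp: coord_fock_split fock_scaleC)

lemma slice2_fock_split: "\<psi> \<in> fock \<Longrightarrow> slice2 (fock_split \<psi>) l' \<in> fock"
proof (rule fockI)
  fix l1 l2 :: "'a list" assume a: "\<psi> \<in> fock" "mset l1 = mset l2"
  have "length l1 = length l2" using a(2) by (metis size_mset)
  moreover have "coord \<psi> (map Inl l1 @ map Inr l') = coord \<psi> (map Inl l2 @ map Inr l')"
    by (rule fockD[OF a(1)]) (use a(2) in simp)
  ultimately show "coord (slice2 (fock_split \<psi>) l') l1 = coord (slice2 (fock_split \<psi>) l') l2"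
    by (simp add: coord_slice2 coord_fock_split[OF a(1)])
qed

lemma pinner_fock_split: "\<psi> \<in> fock \<Longrightarrow> pinner u (fock_split \<psi>) \<in> fock"
proof (rule fockI)
  fix l1 l2 :: "'b list" assume a: "\<psi> \<in> fock" "mset l1 = mset l2"
  have "length l1 = length l2" using a(2) by (metis size_mset)
  moreover have "coord \<psi> (map Inl l @ map Inr l1) = coord \<psi> (map Inl l @ map Inr l2)" for l
    by (rule fockD[OF a(1)]) (use a(2) in simp)
  ultimately have "slice2 (fock_split \<psi>) l1 = slice2 (fock_split \<psi>) l2"
    by (intro ell2_eqI) (simp add: coord_slice2 coord_fock_split[OF a(1)])
  then show "coord (pinner u (fock_split \<psi>)) l1 = coord (pinner u (fock_split \<psi>)) l2"
    by (simp add: coord_pinner)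
qed

text \<open>Only an argument of the left kind can carry \<open>dsum_left f\<close>, so the sum over
  arguments reduces to that of \<open>create f u\<close>. When one argument is removed, the binomial
  factor changes exactly so as to trade normalization by the total length for normalization by the
  left length.\<close>

lemma fock_split_create_left:
  fixes \<psi> :: "('a + 'b) list ell2"
  assumes \<psi>: "\<psi> \<in> fock" "\<psi> \<in> hom n" and u: "u \<in> fock" "u \<in> hom m" and s: "fock_split \<psi> = tensor2 u w"
  shows "fock_split (create (dsum_left f) \<psi>) = tensor2 (create f u) w"
proof (rule ell2_eqI)
  fix p :: "'a list \<times> 'b list"
  obtain l l' where p: "p = (l, l')" by (cases p)
  let ?k = "length l" and ?k' = "length l'" and ?L = "map Inl l @ map Inr l'"
  let ?c = "\<lambda>a b. complex_of_real (sqrt (real (a choose b)))"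
  note D = hom_create_dom[OF \<psi>(2)] and Du = hom_create_dom[OF u(2)]
  have "coord (fock_split (create (dsum_left f) \<psi>)) (l, l') =
      ?c (?k + ?k') ?k * ((\<Sum>j<?k + ?k'. coord (dsum_left f) (?L ! j) * mcoord \<psi> (mset ?L - {#?L ! j#})) / of_real (sqrt (real (?k + ?k'))))"
    by (simp only: coord_fock_split[OF create_fock[OF D]] coord_create_list[OF \<psi>(1) D] length_append length_map)
  also have "(\<Sum>j<?k + ?k'. coord (dsum_left f) (?L ! j) * mcoord \<psi> (mset ?L - {#?L ! j#}))
      = (\<Sum>j<?k. coord (dsum_left f) (?L ! j) * mcoord \<psi> (mset ?L - {#?L ! j#}))"
    by (rule sum.mono_neutral_right) (auto simp: coord_dsum_left nth_append)
  also have "\<dots> = (\<Sum>j<?k. coord f (l ! j) * (mcoord u (mset l - {#l ! j#}) * coord w l' / ?c (?k - 1 + ?k') (?k - 1)))"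
  proof (intro sum.cong refl)
    fix j assume j: "j \<in> {..<?k}"
    let ?r = "remove1 (l ! j) l"
    have len: "length ?r = ?k - 1" using j by (simp add: length_remove1)
    have "mset (map Inl ?r @ map Inr l') = mset ?L - {#?L ! j#}"
      using j by (simp add: nth_append image_mset_Diff)
    then have "mcoord \<psi> (mset ?L - {#?L ! j#}) = coord \<psi> (map Inl ?r @ map Inr l')"
      by (simp only: mcoord[OF \<psi>(1)])
    also have "\<dots> = coord (fock_split \<psi>) (?r, l') / ?c (?k - 1 + ?k') (?k - 1)"
      unfolding coord_fock_split[OF \<psi>(1)] len by (simp add: binomial_eq_0_iff)
    also have "coord (fock_split \<psi>) (?r, l') = mcoord u (mset l - {#l ! j#}) * coord w l'"
      unfolding s coord_tensor2 by (simp add: mcoord[OF u(1)])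
    finally show "coord (dsum_left f) (?L ! j) * mcoord \<psi> (mset ?L - {#?L ! j#}) =
        coord f (l ! j) * (mcoord u (mset l - {#l ! j#}) * coord w l' / ?c (?k - 1 + ?k') (?k - 1))"
      using j by (simp add: nth_append coord_dsum_left)
  qed
  also have "\<dots> = (\<Sum>j<?k. coord f (l ! j) * mcoord u (mset l - {#l ! j#})) * coord w l' / ?c (?k - 1 + ?k') (?k - 1)"
    by (simp only: sum_distrib_right sum_divide_distrib times_divide_eq_right mult.assoc)
  also have "?c (?k + ?k') ?k * ((\<Sum>j<?k. coord f (l ! j) * mcoord u (mset l - {#l ! j#})) * coord w l' / ?c (?k - 1 + ?k') (?k - 1) / of_real (sqrt (real (?k + ?k'))))
      = (\<Sum>j<?k. coord f (l ! j) * mcoord u (mset l - {#l ! j#})) / of_real (sqrt (real ?k)) * coord w l'"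
  proof (cases ?k)
    case (Suc k)
    \<comment> \<open>Absorption identity for binomial coefficients. Its root trades
      \<open>sqrt (Suc k + ?k')\<close> for \<open>sqrt (Suc k)\<close>.\<close>
    have "real (Suc k) * real ((Suc k + ?k') choose Suc k) = real (Suc k + ?k') * real ((k + ?k') choose k)"
      using Suc_times_binomial_eq[of "k + ?k'" k] by (simp only: add_Suc flip: of_nat_mult) (simp add: mult.commute)
    then have "sqrt (real (Suc k)) * sqrt (real ((Suc k + ?k') choose Suc k)) = sqrt (real (Suc k + ?k')) * sqrt (real ((k + ?k') choose k))"
      by (simp only: real_sqrt_mult[symmetric])
    then have e: "complex_of_real (sqrt (real (Suc k))) * ?c (Suc k + ?k') (Suc k) = of_real (sqrt (real (Suc k + ?k'))) * ?c (k + ?k') k"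
      by (simp only: of_real_mult[symmetric])
    have nz: "complex_of_real (sqrt (real (Suc k))) \<noteq> 0" "complex_of_real (sqrt (real (Suc k + ?k'))) \<noteq> 0" "?c (k + ?k') k \<noteq> 0"
      by (simp_all add: binomial_eq_0_iff del: of_nat_Suc)
    have *: "C * (X * W / c / q) = X / r * W" if "r * C = q * c" "r \<noteq> 0" "q \<noteq> 0" "c \<noteq> 0" for C X W c q r :: complex
      using that by (simp add: divide_simps) (metis (no_types, lifting) mult.assoc mult.commute)
    show ?thesis using *[OF e nz] by (simp only: Suc diff_Suc_1)
  qed simp
  also have "\<dots> = coord (create f u) l * coord w l'" by (simp only: coord_create_list[OF u(1) Du])
  finally show "coord (fock_split (create (dsum_left f) \<psi>)) p = coord (tensor2 (create f u) w) p"
    by (simp only: p coord_tensor2)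
qed

lemma fock_split_create_right:
  fixes \<psi> :: "('a + 'b) list ell2"
  assumes \<psi>: "\<psi> \<in> fock" "\<psi> \<in> hom n" and w: "w \<in> fock" "w \<in> hom m" and s: "fock_split \<psi> = tensor2 u w"
  shows "fock_split (create (dsum_right f) \<psi>) = tensor2 u (create f w)"
proof (rule ell2_eqI)
  fix p :: "'a list \<times> 'b list"
  obtain l l' where p: "p = (l, l')" by (cases p)
  let ?k = "length l" and ?k' = "length l'" and ?L = "map Inl l @ map Inr l'"
  let ?c = "\<lambda>a b. complex_of_real (sqrt (real (a choose b)))"
  note D = hom_create_dom[OF \<psi>(2)] and Dw = hom_create_dom[OF w(2)]
  let ?F = "\<lambda>j. coord (dsum_right f) (?L ! j) * mcoord \<psi> (mset ?L - {#?L ! j#})"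
  have "coord (fock_split (create (dsum_right f) \<psi>)) (l, l') =
      ?c (?k + ?k') ?k * ((\<Sum>j<?k + ?k'. ?F j) / of_real (sqrt (real (?k + ?k'))))"
    by (simp only: coord_fock_split[OF create_fock[OF D]] coord_create_list[OF \<psi>(1) D] length_append length_map)
  also have "(\<Sum>j<?k + ?k'. ?F j) = (\<Sum>j\<in>(\<lambda>j. ?k + j) ` {..<?k'}. ?F j)"
  proof (rule sum.mono_neutral_right)
    show "\<forall>i\<in>{..<?k + ?k'} - (\<lambda>j. ?k + j) ` {..<?k'}. ?F i = 0"
    proof
      fix i assume i: "i \<in> {..<?k + ?k'} - (\<lambda>j. ?k + j) ` {..<?k'}"
      have "i < ?k"
      proof (rule ccontr)
        assume "\<not> i < ?k"
        then have "i = ?k + (i - ?k)" "i - ?k < ?k'" using i by auto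
        then show False using i by blast
      qed
      then show "?F i = 0" by (simp add: coord_dsum_right nth_append)
    qed
  qed auto
  also have "\<dots> = (\<Sum>j<?k'. ?F (?k + j))" by (subst sum.reindex) (auto simp: inj_on_def)
  also have "\<dots> = (\<Sum>j<?k'. coord f (l' ! j) * (mcoord w (mset l' - {#l' ! j#}) * coord u l / ?c (?k + (?k' - 1)) ?k))"
  proof (intro sum.cong refl)
    fix j assume j: "j \<in> {..<?k'}"
    let ?r = "remove1 (l' ! j) l'"
    have len: "length ?r = ?k' - 1" using j by (simp add: length_remove1)
    have Lj: "?L ! (?k + j) = Inr (l' ! j)" using j by (simp add: nth_append)
    have "mset (map Inl l @ map Inr ?r) = mset ?L - {#?L ! (?k + j)#}"
      unfolding Lj using j by (simp add: image_mset_Diff)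
    then have "mcoord \<psi> (mset ?L - {#?L ! (?k + j)#}) = coord \<psi> (map Inl l @ map Inr ?r)"
      by (simp only: mcoord[OF \<psi>(1)])
    also have "\<dots> = coord (fock_split \<psi>) (l, ?r) / ?c (?k + (?k' - 1)) ?k"
      unfolding coord_fock_split[OF \<psi>(1)] len by (simp add: binomial_eq_0_iff)
    also have "coord (fock_split \<psi>) (l, ?r) = mcoord w (mset l' - {#l' ! j#}) * coord u l"
      unfolding s coord_tensor2 by (simp add: mcoord[OF w(1)])
    finally show "?F (?k + j) = coord f (l' ! j) * (mcoord w (mset l' - {#l' ! j#}) * coord u l / ?c (?k + (?k' - 1)) ?k)"
      by (simp only: Lj coord_dsum_right sum.case)
  qed
  also have "\<dots> = (\<Sum>j<?k'. coord f (l' ! j) * mcoord w (mset l' - {#l' ! j#})) * coord u l / ?c (?k + (?k' - 1)) ?k"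
    by (simp only: sum_distrib_right sum_divide_distrib times_divide_eq_right mult.assoc)
  also have "?c (?k + ?k') ?k * ((\<Sum>j<?k'. coord f (l' ! j) * mcoord w (mset l' - {#l' ! j#})) * coord u l / ?c (?k + (?k' - 1)) ?k / of_real (sqrt (real (?k + ?k'))))
      = (\<Sum>j<?k'. coord f (l' ! j) * mcoord w (mset l' - {#l' ! j#})) / of_real (sqrt (real ?k')) * coord u l"
  proof (cases ?k')
    case (Suc k)
    have "real (Suc k) * real ((?k + Suc k) choose ?k) = real (?k + Suc k) * real ((?k + k) choose ?k)"
    proof -
      \<comment> \<open>The binomial coefficient in \<open>fock_split\<close> counts by the left
        length; by symmetry it is one in the right length, to which absorption applies.\<close>
      have "(?k + Suc k) choose ?k = (?k + Suc k) choose Suc k" "(?k + k) choose ?k = (?k + k) choose k"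
        by (subst binomial_symmetric; simp)+
      then show ?thesis using Suc_times_binomial_eq[of "?k + k" k]
        by (simp only: add_Suc_right flip: of_nat_mult) (simp add: mult.commute)
    qed
    then have "sqrt (real (Suc k)) * sqrt (real ((?k + Suc k) choose ?k)) = sqrt (real (?k + Suc k)) * sqrt (real ((?k + k) choose ?k))"
      by (simp only: real_sqrt_mult[symmetric])
    then have e: "complex_of_real (sqrt (real (Suc k))) * ?c (?k + Suc k) ?k = of_real (sqrt (real (?k + Suc k))) * ?c (?k + k) ?k"
      by (simp only: of_real_mult[symmetric])
    have nz: "complex_of_real (sqrt (real (Suc k))) \<noteq> 0" "complex_of_real (sqrt (real (?k + Suc k))) \<noteq> 0" "?c (?k + k) ?k \<noteq> 0"
      by (simp_all add: binomial_eq_0_iff del: of_nat_Suc)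
    have *: "C * (X * W / c / q) = X / r * W" if "r * C = q * c" "r \<noteq> 0" "q \<noteq> 0" "c \<noteq> 0" for C X W c q r :: complex
      using that by (simp add: divide_simps) (metis (no_types, lifting) mult.assoc mult.commute)
    show ?thesis using *[OF e nz] by (simp only: Suc diff_Suc_1)
  qed simp
  also have "\<dots> = coord u l * coord (create f w) l'" by (simp only: coord_create_list[OF w(1) Dw] mult.commute)
  finally show "coord (fock_split (create (dsum_right f) \<psi>)) p = coord (tensor2 u (create f w)) p"
    by (simp only: p coord_tensor2)
qed

lemma fock_split_vac: "fock_split vac = tensor2 vac vac"
proof (rule ell2_eqI)
  fix p :: "'a list \<times> 'b list"
  show "coord (fock_split vac) p = coord (tensor2 vac vac) p"
    by (cases p, simp only: coord_fock_split[OF vac_fock] coord_tensor2) (auto simp: vac_def coord_ket)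
qed

lemma tensor2_scaleR: "tensor2 (r *\<^sub>R u) w = r *\<^sub>R tensor2 u w" "tensor2 u (r *\<^sub>R w) = r *\<^sub>R tensor2 u w"
  by (rule ell2_eqI, auto simp: coord_tensor2 split_paired_all)+

lemma fock_split_scaleR: "\<psi> \<in> fock \<Longrightarrow> fock_split (c *\<^sub>R \<psi>) = c *\<^sub>R fock_split \<psi>"
  by (simp add: scaleR_conv_scaleC fock_split_scaleC)

lemma count_image_inj: "inj f \<Longrightarrow> count (image_mset f M) (f x) = count M x"
  by (induction M) (auto simp: inj_eq)

text \<open>Induction over both multisets with the two creation rules. The normalizing roots agree
  because a label occurs in the union as often as in its own part.\<close>

lemma fock_split_mstate:
  fixes e :: "'i \<Rightarrow> 'a ell2" and e' :: "'j \<Rightarrow> 'b ell2"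
  defines "E \<equiv> case_sum (\<lambda>i. dsum_left (e i)) (\<lambda>j. dsum_right (e' j))"
  shows "fock_split (mstate E (image_mset Inl A + image_mset Inr B)) = tensor2 (mstate e A) (mstate e' B)"
proof (induction A)
  case empty
  show ?case
  proof (induction B)
    case empty
    show ?case by (simp add: fock_split_vac)
  next
    case (add j B)
    have "count (image_mset Inr B :: ('i + 'j) multiset) (Inr j) = count B j"
      by (simp add: count_image_inj)
    then show ?case
      using fock_split_create_right[OF mstate_fock mstate_hom mstate_fock mstate_hom add, of "e' j"]
      by (simp add: mstate_add fock_split_scaleR create_fock mstate_dom tensor2_scaleR E_def del: of_nat_add of_nat_Suc)
  qed
next
  case (add i A)
  have "count (image_mset Inl A + image_mset Inr B :: ('i + 'j) multiset) (Inl i) = count A i"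
    by (simp add: count_image_inj count_eq_zero_iff image_iff)
  then show ?case
    using fock_split_create_left[OF mstate_fock mstate_hom mstate_fock mstate_hom add, of "e i"]
    by (simp add: mstate_add fock_split_scaleR create_fock mstate_dom tensor2_scaleR E_def del: of_nat_add of_nat_Suc)
qed

section \<open>The scattered states\<close>

lemma one_particle_create: "one_particle (g :: 'a ell2) = create g vac"
proof -
  have "wt vac = (vac :: 'a list ell2)" by (simp add: wt_hom[OF vac_hom])
  moreover have "tensor (one_particle g) vac = one_particle g"
  proof (rule ell2_eqI)
    fix l show "coord (tensor (one_particle g) vac) l = coord (one_particle g) l"
      by (cases l) (auto simp: coord_tensor[OF one_particle_hom] coord_one_particle vac_def coord_ket split: list.splits)
  qed
  ultimately show ?thesis
    by (simp add: create_eq[OF hom_create_dom[OF vac_hom]] symmetrize_fock[OF one_particle_fock])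
qed

lemma tensor_scaleR_right: "\<psi> \<in> hom d \<Longrightarrow> tensor \<psi> (r *\<^sub>R \<phi>) = r *\<^sub>R tensor \<psi> \<phi>"
  by (rule ell2_eqI) (simp add: coord_tensor)

lemma symmetrize_scaleR: "symmetrize (r *\<^sub>R \<psi>) = r *\<^sub>R symmetrize \<psi>"
proof (rule ell2_eqI)
  fix l
  have "coord (r *\<^sub>R \<psi>) = (\<lambda>l. of_real r * coord \<psi> l)" by (simp add: fun_eq_iff)
  then show "coord (symmetrize (r *\<^sub>R \<psi>)) l = coord (r *\<^sub>R symmetrize \<psi>) l"
    by (simp add: coord_symmetrize perm_avg_mult)
qed

lemma create_one_particle:
  "create f (one_particle g) = sqrt 2 *\<^sub>R symmetrize (tensor (one_particle f) (one_particle g))"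
proof -
  have "wt (one_particle g) = sqrt 2 *\<^sub>R one_particle g"
    using wt_hom[OF one_particle_hom[of g]] by simp
  then show ?thesis
    by (simp add: create_eq[OF hom_create_dom[OF one_particle_hom]] tensor_scaleR_right[OF one_particle_hom] symmetrize_scaleR)
qed

text \<open>Slices of symmetric vectors are symmetric and absorb the symmetrizer; what remains is
  one one-particle contraction after the other.\<close>

lemma contract_pair:
  assumes "\<phi> \<in> fock"
  shows "cinner (symmetrize (tensor (one_particle f) (one_particle g))) (slice \<phi> l)
    = coord (contract (one_particle g) (contract (one_particle f) \<phi>)) l"
proof -
  have "cinner (symmetrize (tensor (one_particle f) (one_particle g))) (slice \<phi> l)
      = cnj (cinner (slice \<phi> l) (tensor (one_particle f) (one_particle g)))"
    by (subst cinner_commute) (simp add: cinner_symmetrize[OF slice_fock[OF assms]])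
  also have "\<dots> = cinner (one_particle g) (contract (one_particle f) (slice \<phi> l))"
    unfolding cinner_tensor[OF one_particle_hom] by (rule cinner_commute[symmetric])
  also have "contract (one_particle f) (slice \<phi> l) = slice (contract (one_particle f) \<phi>) l"
  proof (rule ell2_eqI)
    fix a
    have "slice1 (slice \<phi> l) a = slice1 \<phi> (a @ l)" by (rule ell2_eqI) (simp add: coord_slice1 coord_slice)
    then show "coord (contract (one_particle f) (slice \<phi> l)) a = coord (slice (contract (one_particle f) \<phi>) l) a"
      by (simp add: coord_contract1 coord_slice)
  qed
  finally show ?thesis by (simp add: coord_contract[OF one_particle_hom])
qed

text \<open>Number states are homogeneous, so \<open>wt\<close> multiplies their coefficients by
  constants, and the weighted series converges to the required vector. The criterion is for
  scattered states, which contain arbitrarily many pairs and lie in no single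
  \<open>hom k\<close>.\<close>

lemma create_domI:
  assumes E: "orthonormal_family E" "closed_cspan (range E) = UNIV" and \<psi>: "\<psi> \<in> fock"
    and s: "(\<lambda>M. (cmod (of_real (sqrt (real (size M + 1))) * cinner (mstate E M) \<psi>))\<^sup>2) summable_on UNIV"
  shows "\<psi> \<in> create_dom"
proof -
  let ?c = "\<lambda>M. cinner (mstate E M) \<psi>" and ?w = "\<lambda>n. complex_of_real (sqrt (real (n + 1)))"
  have o: "orthonormal_on (mstate E) UNIV" using orthonormal_mstate[OF E(1)] by (simp add: orthonormal_family_on)
  obtain \<psi>' where \<psi>': "((\<lambda>M. (?w (size M) * ?c M) *\<^sub>C mstate E M) has_sum \<psi>') UNIV"
    using orthonormal_summable[OF o s] by (auto simp: summable_on_def)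
  have "((\<lambda>M. ?c M *\<^sub>C mstate E M) has_sum \<psi>) UNIV"
    by (rule closed_cspan_Fourier[OF o]) (simp add: mstate_complete[OF E] \<psi>)
  have "coord \<psi>' l = ?w (length l) * coord \<psi> l" for l
  proof -
    have "((\<lambda>M. ?w (length l) * coord (?c M *\<^sub>C mstate E M) l) has_sum ?w (length l) * coord \<psi> l) UNIV"
      by (intro has_sum_cmult_right has_sum_coord) fact
    moreover have "?w (length l) * coord (?c M *\<^sub>C mstate E M) l = coord ((?w (size M) * ?c M) *\<^sub>C mstate E M) l" for M
      by (cases "length l = size M") (simp_all add: homD[OF mstate_hom])
    ultimately show ?thesis using has_sum_coord[OF \<psi>', of l] by (simp only: has_sum_unique)
  qed
  then show ?thesis using coord_summable[of \<psi>'] by (simp add: create_dom_def)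
qed

text \<open>In the mixed basis \<open>Inl i\<close>, \<open>Inr (Inl i)\<close> and
  \<open>Inr (Inr i)\<close> label the modes \<gamma>, \<lambda> and \<tau> of index
  \<open>i\<close>. Vacuum excitations come in pairs of \<lambda> and \<tau> with equal
  index.\<close>

definition pair_mset :: "nat multiset \<Rightarrow> (nat + (nat + nat)) multiset" where
  "pair_mset c = image_mset (Inr \<circ> Inl) c + image_mset (Inr \<circ> Inr) c"

definition triple_mset :: "nat multiset \<Rightarrow> nat multiset \<Rightarrow> (nat + (nat + nat)) multiset" where
  "triple_mset A c = image_mset Inl A + pair_mset c"

lemma count_triple [simp]:
  "count (triple_mset A c) (Inl i) = count A i"
  "count (triple_mset A c) (Inr (Inl i)) = count c i"
  "count (triple_mset A c) (Inr (Inr i)) = count c i"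
proof -
  show "count (triple_mset A c) (Inl i) = count A i"
    using count_image_inj[of "Inl :: nat \<Rightarrow> nat + (nat + nat)" A i]
    by (simp add: triple_mset_def pair_mset_def inj_def count_eq_zero_iff image_iff)
  show "count (triple_mset A c) (Inr (Inl i)) = count c i"
    using count_image_inj[of "(Inr \<circ> Inl) :: nat \<Rightarrow> nat + (nat + nat)" c i]
    by (simp add: triple_mset_def pair_mset_def inj_def count_eq_zero_iff image_iff)
  show "count (triple_mset A c) (Inr (Inr i)) = count c i"
    using count_image_inj[of "(Inr \<circ> Inr) :: nat \<Rightarrow> nat + (nat + nat)" c i]
    by (simp add: triple_mset_def pair_mset_def inj_def count_eq_zero_iff image_iff)
qed

lemma triple_mset_inject: "triple_mset A c = triple_mset B d \<longleftrightarrow> A = B \<and> c = d"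
  by (metis count_triple(1,2) multiset_eqI)

lemma triple_empty: "triple_mset {#} c = pair_mset c"
  by (simp add: triple_mset_def)

lemma size_triple: "size (triple_mset A c) = size A + 2 * size c"
  by (simp add: triple_mset_def pair_mset_def)

lemma pair_mset_add: "pair_mset (add_mset i c) = add_mset (Inr (Inl i)) (add_mset (Inr (Inr i)) (pair_mset c))"
  by (simp add: pair_mset_def)

section \<open>The mode bases of a collapse background\<close>

locale collapse =
  fixes D :: "('x, 'y, 'z) scattering"
    and S :: "'z list ell2 \<Rightarrow> ('x + 'y) list ell2"
    and N :: complex
  assumes coll: "collapse_scattering D" and Smat: "S_matrix D N S"
begin

lemma coeffs: "(cmod (T_coeff D i))\<^sup>2 + (cmod (R_coeff D i))\<^sup>2 = 1" "T_coeff D i \<noteq> 0"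
    "t_coeff D i = T_coeff D i" "r_coeff D i = - cnj (R_coeff D i) * T_coeff D i / cnj (T_coeff D i)"
proof -
  have c: "(cmod (t_coeff D i))\<^sup>2 + (cmod (r_coeff D i))\<^sup>2 = 1" "t_coeff D i = T_coeff D i"
    "r_coeff D i = - cnj (R_coeff D i) * T_coeff D i / cnj (T_coeff D i)"
    "(cmod (T_coeff D i))\<^sup>2 + (cmod (R_coeff D i))\<^sup>2 = 1"
    using coll unfolding collapse_scattering_def by blast+
  \<comment> \<open>If it were 0, both \<open>t_coeff D i\<close> and the quotient for
    \<open>r_coeff D i\<close> would be 0, against the unit sum of their squared moduli.\<close>
  then show "T_coeff D i \<noteq> 0" by auto
  show "(cmod (T_coeff D i))\<^sup>2 + (cmod (R_coeff D i))\<^sup>2 = 1" "t_coeff D i = T_coeff D i"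
    "r_coeff D i = - cnj (R_coeff D i) * T_coeff D i / cnj (T_coeff D i)"
    using c by auto
qed

lemma TR_cnj: "T_coeff D i * cnj (T_coeff D i) + R_coeff D i * cnj (R_coeff D i) = 1"
  using arg_cong[OF coeffs(1)[of i], of complex_of_real] by (simp add: complex_norm_square del: of_real_power)

definition st_mode :: "nat + nat \<Rightarrow> 'y ell2" where
  "st_mode = case_sum (sigma_mode D) (tau_mode D)"

definition out_modes :: "nat + (nat + nat) \<Rightarrow> ('x + 'y) ell2" where
  "out_modes = case_sum (\<lambda>i. dsum_left (rho_mode D i)) (\<lambda>j. dsum_right (st_mode j))"

definition mixed_modes :: "nat + (nat + nat) \<Rightarrow> ('x + 'y) ell2" where
  "mixed_modes = case_sum (gamma_mode D) (case_sum (lambda_mode D) (\<lambda>i. dsum_right (tau_mode D i)))"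

lemma rho_mode: "orthonormal_family (rho_mode D)" "closed_cspan (range (rho_mode D)) = UNIV"
  using coll by (auto simp: collapse_scattering_def)

lemma st_mode: "orthonormal_family st_mode" "closed_cspan (range st_mode) = UNIV"
proof -
  have "range st_mode = range (sigma_mode D) \<union> range (tau_mode D)"
    unfolding st_mode_def UNIV_sum[where 'a = nat and 'b = nat] image_Un image_image by simp
  then show "orthonormal_family st_mode" "closed_cspan (range st_mode) = UNIV"
    using coll by (auto simp: collapse_scattering_def st_mode_def)
qed

lemma in_mode_orthonormal: "orthonormal_family (in_mode D)"
  using coll by (auto simp: collapse_scattering_def)

lemma out_modes: "orthonormal_family out_modes" "closed_cspan (range out_modes) = UNIV"
  using dsum_modes[OF rho_mode st_mode] by (simp_all add: out_modes_def)

lemma mode_expansions: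
  "gamma_mode D i = T_coeff D i *\<^sub>C out_modes (Inr (Inl i)) + R_coeff D i *\<^sub>C out_modes (Inl i)"
  "lambda_mode D i = t_coeff D i *\<^sub>C out_modes (Inl i) + r_coeff D i *\<^sub>C out_modes (Inr (Inl i))"
  "dsum_right (tau_mode D i) = out_modes (Inr (Inr i))"
  by (simp_all add: gamma_mode_def lambda_mode_def out_modes_def st_mode_def)

lemma out_modes_cinner: "cinner (out_modes j) (out_modes k) = (if j = k then 1 else 0)"
  using out_modes(1) by (simp add: orthonormal_family_def)

text \<open>The matrix from \<sigma>, \<rho> of index \<open>i\<close> to \<gamma>, \<lambda> is
  unitary by the relations between the coefficients. Its conjugate transpose expresses \<rho> and
  \<sigma> by \<gamma> and \<lambda>, so a vector orthogonal to all mixed modes is orthogonal to all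
  out modes.\<close>

lemma mixed_modes: "orthonormal_family mixed_modes" "closed_cspan (range mixed_modes) = UNIV"
proof -
  have T: "cnj (T_coeff D i) \<noteq> 0" for i using coeffs(2)[of i] by simp
  have TR: "R_coeff D i * cnj (R_coeff D i) + T_coeff D i * cnj (T_coeff D i) = 1" for i
    using TR_cnj[of i] by (simp add: add.commute)
  have gg: "cinner (gamma_mode D i) (gamma_mode D j) = (if i = j then 1 else 0)" for i j
    by (simp add: mode_expansions cinner_add_left cinner_add_right out_modes_cinner algebra_simps TR)
  have ll: "cinner (lambda_mode D i) (lambda_mode D j) = (if i = j then 1 else 0)" for i j
    by (simp add: mode_expansions cinner_add_left cinner_add_right out_modes_cinner coeffs algebra_simps TR)
  have gl: "cinner (gamma_mode D i) (lambda_mode D j) = 0" for i j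
    using T[of i] coeffs(2)[of i]
    by (simp add: mode_expansions cinner_add_left cinner_add_right out_modes_cinner coeffs(3,4) algebra_simps)
  have lg: "cinner (lambda_mode D j) (gamma_mode D i) = 0" for i j
    by (subst cinner_commute) (simp add: gl)
  have t: "cinner (gamma_mode D i) (out_modes (Inr (Inr j))) = 0" "cinner (out_modes (Inr (Inr j))) (gamma_mode D i) = 0"
    "cinner (lambda_mode D i) (out_modes (Inr (Inr j))) = 0" "cinner (out_modes (Inr (Inr j))) (lambda_mode D i) = 0" for i j
    by (simp_all add: mode_expansions cinner_add_left cinner_add_right out_modes_cinner)
  show o: "orthonormal_family mixed_modes"
    unfolding orthonormal_family_def
    by (auto simp: mixed_modes_def gg ll gl lg t mode_expansions(3) out_modes_cinner split: sum.splits)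
  show "closed_cspan (range mixed_modes) = UNIV"
  proof (rule closed_cspan_eqI)
    show "orthonormal_on mixed_modes UNIV" using o by (simp add: orthonormal_family_on)
    fix v :: "('x + 'y) ell2" assume v: "\<And>i. i \<in> UNIV \<Longrightarrow> cinner (mixed_modes i) v = 0"
    have g: "cinner (gamma_mode D i) v = 0" and l: "cinner (lambda_mode D i) v = 0"
      and ta: "cinner (out_modes (Inr (Inr i))) v = 0" for i
      using v[of "Inl i"] v[of "Inr (Inl i)"] v[of "Inr (Inr i)"] by (simp_all add: mixed_modes_def mode_expansions(3))
    have "out_modes (Inl i) = cnj (R_coeff D i) *\<^sub>C gamma_mode D i + cnj (T_coeff D i) *\<^sub>C lambda_mode D i" for i
    proof (rule ell2_eqI)
      fix x
      have "cnj (R_coeff D i) * (T_coeff D i * s + R_coeff D i * p) + cnj (T_coeff D i) * (T_coeff D i * p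
          + (- cnj (R_coeff D i) * T_coeff D i / cnj (T_coeff D i)) * s)
          = (T_coeff D i * cnj (T_coeff D i) + R_coeff D i * cnj (R_coeff D i)) * p" for s p
        using T[of i] by (simp add: algebra_simps)
      then show "coord (out_modes (Inl i)) x = coord (cnj (R_coeff D i) *\<^sub>C gamma_mode D i + cnj (T_coeff D i) *\<^sub>C lambda_mode D i) x"
        by (simp add: mode_expansions coeffs(3,4) TR_cnj)
    qed
    then have 1: "cinner (out_modes (Inl i)) v = 0" for i by (simp add: cinner_add_left g l)
    have "out_modes (Inr (Inl i)) = cnj (T_coeff D i) *\<^sub>C gamma_mode D i + cnj (r_coeff D i) *\<^sub>C lambda_mode D i" for i
    proof (rule ell2_eqI)
      fix x
      have "cnj (T_coeff D i) * (T_coeff D i * s + R_coeff D i * p) + (- R_coeff D i * cnj (T_coeff D i) / T_coeff D i) * (T_coeff D i * p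
          + (- cnj (R_coeff D i) * T_coeff D i / cnj (T_coeff D i)) * s)
          = (T_coeff D i * cnj (T_coeff D i) + R_coeff D i * cnj (R_coeff D i)) * s" for s p
        using T[of i] coeffs(2)[of i] by (simp add: algebra_simps)
      then show "coord (out_modes (Inr (Inl i))) x = coord (cnj (T_coeff D i) *\<^sub>C gamma_mode D i + cnj (r_coeff D i) *\<^sub>C lambda_mode D i) x"
        by (simp add: mode_expansions coeffs(3,4) TR_cnj)
    qed
    then have 2: "cinner (out_modes (Inr (Inl i))) v = 0" for i by (simp add: cinner_add_left g l)
    have "cinner (out_modes j) v = 0" for j
      using 1 2 ta by (cases j rule: sum.exhaust) (metis old.sum.exhaust)+
    then show "v = 0"
      using out_modes closed_cspan_eqD[of out_modes UNIV v 0] by (simp add: orthonormal_family_on)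
  qed auto
qed

abbreviation mixed_state :: "(nat + (nat + nat)) multiset \<Rightarrow> ('x + 'y) list ell2" where
  "mixed_state \<equiv> mstate mixed_modes"

lemma mixed_state: "orthonormal_on mixed_state UNIV" "closed_cspan (range mixed_state) = fock"
  using orthonormal_mstate[OF mixed_modes(1)] mstate_complete[OF mixed_modes]
  by (simp_all add: orthonormal_family_on)

section \<open>Boltzmann factors and the partition function\<close>

definition boltz_prod :: "nat multiset \<Rightarrow> real" where
  "boltz_prod c = (\<Prod>i\<in>#c. boltz D i)"

lemma boltz_prod_simps [simp]: "boltz_prod {#} = 1" "boltz_prod (add_mset i c) = boltz D i * boltz_prod c"
    "boltz_prod (c + d) = boltz_prod c * boltz_prod d"
  by (simp_all add: boltz_prod_def)

text \<open>\<open>boltz D i\<close> is the square root of the Boltzmann factor of one quantum: its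
  exponent has \<pi> / \<kappa> where \<open>beta_BH D\<close> is 2 \<pi> / \<kappa>.\<close>

lemma gibbs_boltz: "gibbs_weight D n = (boltz_prod (occ_mset n))\<^sup>2"
proof -
  let ?e = "\<lambda>i. freq D i - Omega_BH D * azim D i"
  have "(boltz_prod (occ_mset n))\<^sup>2 = (\<Prod>i\<in>Poly_Mapping.keys n. ((boltz D i)\<^sup>2) ^ Poly_Mapping.lookup n i)"
    by (simp add: boltz_prod_def image_prod_mset_multiplicity prod_power_distrib power_mult[symmetric] mult.commute)
  also have "\<dots> = (\<Prod>i\<in>Poly_Mapping.keys n. exp (- beta_BH D * (real (Poly_Mapping.lookup n i) * ?e i)))"
  proof (rule prod.cong[OF refl])
    fix i
    have "(boltz D i)\<^sup>2 = exp (- beta_BH D * ?e i)"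
      by (simp add: boltz_def beta_BH_def power2_eq_square flip: exp_add)
    then show "((boltz D i)\<^sup>2) ^ Poly_Mapping.lookup n i = exp (- beta_BH D * (real (Poly_Mapping.lookup n i) * ?e i))"
      by (simp add: exp_of_nat_mult[symmetric] ac_simps)
  qed
  also have "\<dots> = gibbs_weight D n"
    by (simp add: gibbs_weight_def occ_sum_def exp_sum sum_distrib_left)
  finally show ?thesis ..
qed

lemma boltz_prod_has_sum: "((\<lambda>c. (boltz_prod c)\<^sup>2) has_sum Z_part D) UNIV"
proof -
  have "(gibbs_weight D has_sum Z_part D) UNIV"
    using coll unfolding Z_part_def by (intro has_sum_infsum) (simp add: collapse_scattering_def)
  then show ?thesis
    unfolding gibbs_boltz[abs_def]
    using has_sum_reindex_bij_betw[OF bij_occ_mset, of "\<lambda>c. (boltz_prod c)\<^sup>2"] by simp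
qed

lemmas boltz_prod_summable = has_sum_imp_summable[OF boltz_prod_has_sum]

text \<open>The occupations with a single quantum are part of the partition function. This makes the
  series of \<open>eps_pair\<close> converge.\<close>

lemma boltz_summable: "(\<lambda>i. (boltz D i)\<^sup>2) summable_on UNIV"
proof -
  have "(\<lambda>c. (boltz_prod c)\<^sup>2) summable_on range (\<lambda>i. {#i#})"
    by (rule summable_on_subset[OF boltz_prod_summable]) simp
  then show ?thesis by (subst (asm) summable_on_reindex) (auto simp: inj_def o_def)
qed

text \<open>\<open>size c\<close> counts the pairs \<open>(i, m)\<close> with \<open>1 \<le> m \<le> count c i\<close>, and splitting off \<open>m\<close> copies
  of \<open>i\<close> embeds the triples \<open>(c, i, m)\<close> into pairs of multisets.\<close>

lemma boltz_prod_size_summable: "(\<lambda>c. real (size c) * (boltz_prod c)\<^sup>2) summable_on UNIV"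
proof -
  define F where "F c = Sigma (set_mset c) (\<lambda>i. {1..count c i})" for c :: "nat multiset"
  have fin: "finite (F c)" for c by (simp add: F_def)
  have card: "card (F c) = size c" for c by (simp add: F_def size_multiset_overloaded_eq)
  define j where "j = (\<lambda>(c, i, m). (c - replicate_mset m i, replicate_mset m i :: nat multiset))"
  have le: "replicate_mset m i \<subseteq># c" if "(i, m) \<in> F c" for i m c
    using that by (auto simp: F_def count_le_replicate_mset_subset_eq[symmetric])
  have inj: "inj_on j (Sigma UNIV F)"
  proof (rule inj_onI)
    fix p q assume pq: "p \<in> Sigma UNIV F" "q \<in> Sigma UNIV F" "j p = j q"
    obtain c i m c' i' m' where p: "p = (c, i, m)" and q: "q = (c', i', m')" by (metis prod_cases3)
    have F: "(i, m) \<in> F c" "(i', m') \<in> F c'" using pq by (auto simp: p q)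
    have e: "replicate_mset m i = replicate_mset m' i'" "c - replicate_mset m i = c' - replicate_mset m' i'"
      using pq(3) by (auto simp: p q j_def)
    have m: "m = m'" using arg_cong[OF e(1), of size] by simp
    have "m \<noteq> 0" using F by (auto simp: F_def)
    then have "i = i'" using arg_cong[OF e(1), of set_mset] m by simp
    moreover have "c = c'" using e le[OF F(1)] le[OF F(2)] by (metis subset_mset.diff_add)
    ultimately show "p = q" using m by (simp add: p q)
  qed
  have "(\<lambda>(a, b). (boltz_prod a)\<^sup>2 * (boltz_prod b)\<^sup>2) summable_on Sigma UNIV (\<lambda>_. UNIV)"
  proof (rule summable_on_SigmaI[where g = "\<lambda>a. (boltz_prod a)\<^sup>2 * Z_part D"])
    show "((\<lambda>b. case (a, b) of (a, b) \<Rightarrow> (boltz_prod a)\<^sup>2 * (boltz_prod b)\<^sup>2) has_sum (boltz_prod a)\<^sup>2 * Z_part D) UNIV" for a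
      unfolding prod.case by (intro has_sum_cmult_right boltz_prod_has_sum)
  qed (auto intro: summable_on_cmult_left boltz_prod_summable)
  then have "(\<lambda>(a, b). (boltz_prod a)\<^sup>2 * (boltz_prod b)\<^sup>2) summable_on j ` Sigma UNIV F"
    by (rule summable_on_subset) auto
  then have "((\<lambda>(a, b). (boltz_prod a)\<^sup>2 * (boltz_prod b)\<^sup>2) \<circ> j) summable_on Sigma UNIV F"
    by (subst (asm) summable_on_reindex[OF inj])
  also have "?this \<longleftrightarrow> (\<lambda>(c, im). (boltz_prod c)\<^sup>2) summable_on Sigma UNIV F"
  proof (rule summable_on_cong)
    fix p assume "p \<in> Sigma UNIV F"
    then obtain c i m where p: "p = (c, i, m)" "(i, m) \<in> F c" by (cases p) auto
    have "boltz_prod c = boltz_prod (c - replicate_mset m i) * boltz_prod (replicate_mset m i)"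
      unfolding boltz_prod_simps(3)[symmetric] by (simp add: le[OF p(2)])
    then show "((\<lambda>(a, b). (boltz_prod a)\<^sup>2 * (boltz_prod b)\<^sup>2) \<circ> j) p = (case p of (c, im) \<Rightarrow> (boltz_prod c)\<^sup>2)"
      by (simp add: p j_def power_mult_distrib)
  qed
  finally have "((\<lambda>(c, im). (boltz_prod c)\<^sup>2) has_sum infsum (\<lambda>(c, im). (boltz_prod c)\<^sup>2) (Sigma UNIV F)) (Sigma UNIV F)"
    by (rule has_sum_infsum)
  then have "((\<lambda>c. real (size c) * (boltz_prod c)\<^sup>2) has_sum infsum (\<lambda>(c, im). (boltz_prod c)\<^sup>2) (Sigma UNIV F)) UNIV"
    by (rule has_sum_SigmaD) (auto intro!: has_sum_finiteI simp: fin card)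
  then show ?thesis by (rule has_sum_imp_summable)
qed

subsection \<open>The out-vacuum\<close>

abbreviation lm :: "nat \<Rightarrow> nat + (nat + nat)" where "lm i \<equiv> Inr (Inl i)"
abbreviation tm :: "nat \<Rightarrow> nat + (nat + nat)" where "tm i \<equiv> Inr (Inr i)"

lemma pair_state:
  "mixed_state {#lm i, tm i#} = sqrt 2 *\<^sub>R symmetrize (tensor (one_particle (lambda_mode D i)) (one_particle (dsum_right (tau_mode D i))))"
proof -
  have "mixed_state {#lm i, tm i#} = create (mixed_modes (lm i)) (create (mixed_modes (tm i)) vac)"
    using mstate_add[of mixed_modes "lm i" "{#tm i#}"] mstate_add[of mixed_modes "tm i" "{#}"] by simp
  then show ?thesis by (simp add: mixed_modes_def create_one_particle flip: one_particle_create)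
qed

text \<open>By \<open>pair_state\<close> a symmetrized pair has norm \<open>1 / sqrt 2\<close>, so
  the prefactor 2 of \<open>eps_pair\<close> becomes \<open>sqrt 2\<close> on unit vectors.\<close>

lemma eps_has_sum: "((\<lambda>i. (sqrt 2 * boltz D i) *\<^sub>R mixed_state {#lm i, tm i#}) has_sum eps_pair D) UNIV"
proof -
  have o: "orthonormal_on (\<lambda>i. mixed_state {#lm i, tm i#}) UNIV"
    using mixed_state(1) by (simp add: orthonormal_on_def add_mset_eq_single add_eq_conv_ex)
  have "(\<lambda>i. (cmod (complex_of_real (boltz D i / sqrt 2)))\<^sup>2) summable_on UNIV"
    using summable_on_cmult_right[OF boltz_summable, of "1/2"] by (simp add: power_divide norm_divide)
  from orthonormal_summable[OF o this]
  have "(\<lambda>i. (boltz D i / sqrt 2) *\<^sub>R mixed_state {#lm i, tm i#}) summable_on UNIV"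
    by (simp add: scaleR_conv_scaleC)
  moreover have "(boltz D i / sqrt 2) *\<^sub>R mixed_state {#lm i, tm i#} =
      boltz D i *\<^sub>R symmetrize (tensor (one_particle (lambda_mode D i)) (one_particle (dsum_right (tau_mode D i))))" for i
    by (simp add: pair_state)
  ultimately have "((\<lambda>i. boltz D i *\<^sub>R symmetrize (tensor (one_particle (lambda_mode D i)) (one_particle (dsum_right (tau_mode D i)))))
      has_sum (\<Sum>\<^sub>\<infinity>i. boltz D i *\<^sub>R symmetrize (tensor (one_particle (lambda_mode D i)) (one_particle (dsum_right (tau_mode D i)))))) UNIV"
    by (intro has_sum_infsum) simp
  from has_sum_bounded_linear[OF bounded_linear_scaleR_right this, of 2]
  moreover have e: "sqrt 2 * boltz D i * sqrt 2 = 2 * boltz D i" for i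
    by (simp add: mult.assoc mult.left_commute[of "sqrt 2"])
  ultimately show ?thesis by (simp add: eps_pair_def pair_state e)
qed

lemma eps_hom: "eps_pair D \<in> hom 2"
  unfolding hom_def
proof safe
  fix l :: "('x + 'y) list" assume "length l \<noteq> 2"
  then have "coord ((sqrt 2 * boltz D i) *\<^sub>R mixed_state {#lm i, tm i#}) l = 0" for i
    using homD[OF mstate_hom[of mixed_modes "{#lm i, tm i#}"], of l] by simp
  then have "((\<lambda>i :: nat. 0) has_sum coord (eps_pair D) l) UNIV"
    using has_sum_coord[OF eps_has_sum, of l] by (simp only:)
  then show "coord (eps_pair D) l = 0" by (rule has_sum_unique[OF _ has_sum_0_simp])
qed

lemma annih_pair:
  "annih (dsum_right (tau_mode D i)) (annih (lambda_mode D i) (mixed_state M)) =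
    (sqrt (real (count M (lm i))) * sqrt (real (count M (tm i)))) *\<^sub>R mixed_state (M - {#lm i, tm i#})"
proof -
  have "annih (mixed_modes (tm i)) (annih (mixed_modes (lm i)) (mixed_state M)) =
    (sqrt (real (count M (lm i))) * sqrt (real (count M (tm i)))) *\<^sub>R mixed_state (M - {#lm i, tm i#})"
    by (simp add: annih_mstate[OF mixed_modes(1)] annih_scaleR[OF mstate_hom] add_mset_commute)
  then show ?thesis by (simp add: mixed_modes_def)
qed

lemma contract_annih:
  assumes "\<phi> \<in> hom k" "k \<noteq> 0"
  shows "annih f \<phi> = sqrt (real k) *\<^sub>R contract (one_particle f) \<phi>"
  using wt_hom[OF contract_hom[OF one_particle_hom assms(1)], of f] assms(2) by (simp add: annih_def)

lemma contract_contract_annih: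
  assumes "\<phi> \<in> hom k" "2 \<le> k"
  shows "contract (one_particle g) (contract (one_particle f) \<phi>)
    = (1 / sqrt (real (k * (k - 1)))) *\<^sub>R annih g (annih f \<phi>)"
proof -
  have h: "contract (one_particle f) \<phi> \<in> hom (k - 1)" by (rule contract_hom[OF one_particle_hom assms(1)])
  have "annih g (annih f \<phi>) = sqrt (real k) *\<^sub>R annih g (contract (one_particle f) \<phi>)"
    using assms by (simp add: contract_annih[OF assms(1)] annih_scaleR[OF h])
  also have "annih g (contract (one_particle f) \<phi>) = sqrt (real (k - 1)) *\<^sub>R contract (one_particle g) (contract (one_particle f) \<phi>)"
    using assms by (intro contract_annih[OF h]) simp
  finally show ?thesis using assms by (simp add: real_sqrt_mult)
qed

text \<open>Tensoring with \<open>eps_pair D\<close> becomes contraction on the other side, and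
  contraction with one pair annihilates a \<lambda>- and a \<tau>-quantum of equal index. The root
  in the denominator converts contractions in degree \<open>size M\<close> to annihilations; the 2
  combines the factors \<open>sqrt 2\<close> of \<open>eps_has_sum\<close> and
  \<open>pair_state\<close>. The sum is finite because \<open>M\<close> is.\<close>

lemma eps_contract:
  assumes "2 \<le> size M"
  shows "cinner (mixed_state M) (tensor (eps_pair D) \<xi>) =
    (2 / sqrt (real (size M * (size M - 1)))) * (\<Sum>i | lm i \<in># M \<and> tm i \<in># M.
      boltz D i * (sqrt (real (count M (lm i))) * sqrt (real (count M (tm i)))) * cinner (mixed_state (M - {#lm i, tm i#})) \<xi>)"
proof -
  let ?I = "{i. lm i \<in># M \<and> tm i \<in># M}" and ?K = "sqrt (real (size M * (size M - 1)))"
  define a where "a i = boltz D i * (sqrt (real (count M (lm i))) * sqrt (real (count M (tm i))))" for i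
  have fin: "finite ?I"
    by (rule finite_subset[of _ "lm -` set_mset M"]) (auto intro!: finite_vimageI simp: inj_def)
  have s2: "complex_of_real (sqrt 2) * complex_of_real (sqrt 2) = 2" by (simp flip: of_real_mult)
  have a0: "a i = 0" if "i \<notin> ?I" for i using that by (auto simp: a_def not_in_iff)
  have "contract (eps_pair D) (mixed_state M) = (2 / ?K) *\<^sub>R (\<Sum>i\<in>?I. a i *\<^sub>R mixed_state (M - {#lm i, tm i#}))"
  proof (rule ell2_eqI)
    fix l
    have eq: "cinner ((sqrt 2 * boltz D i) *\<^sub>R mixed_state {#lm i, tm i#}) (slice (mixed_state M) l)
       = of_real (2 / ?K) * (of_real (a i) * coord (mixed_state (M - {#lm i, tm i#})) l)" for i
    proof -
      have "cinner ((sqrt 2 * boltz D i) *\<^sub>R mixed_state {#lm i, tm i#}) (slice (mixed_state M) l)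
        = of_real (2 * boltz D i) * coord (contract (one_particle (dsum_right (tau_mode D i)))
            (contract (one_particle (lambda_mode D i)) (mixed_state M))) l"
        using s2 by (simp add: pair_state contract_pair[OF mstate_fock])
      also have "\<dots> = of_real (2 / ?K) * (of_real (a i) * coord (mixed_state (M - {#lm i, tm i#})) l)"
        unfolding contract_contract_annih[OF mstate_hom assms] annih_pair by (simp add: a_def)
      finally show ?thesis .
    qed
    have "((\<lambda>i. cinner ((sqrt 2 * boltz D i) *\<^sub>R mixed_state {#lm i, tm i#}) (slice (mixed_state M) l))
      has_sum cinner (eps_pair D) (slice (mixed_state M) l)) UNIV"
      by (rule has_sum_cinner_left[OF eps_has_sum])
    moreover have "((\<lambda>i. cinner ((sqrt 2 * boltz D i) *\<^sub>R mixed_state {#lm i, tm i#}) (slice (mixed_state M) l))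
      has_sum (\<Sum>i\<in>?I. of_real (2 / ?K) * (of_real (a i) * coord (mixed_state (M - {#lm i, tm i#})) l))) UNIV"
      unfolding eq by (rule has_sum_finite_neutralI[OF fin]) (auto simp: a0)
    ultimately show "coord (contract (eps_pair D) (mixed_state M)) l
       = coord ((2 / ?K) *\<^sub>R (\<Sum>i\<in>?I. a i *\<^sub>R mixed_state (M - {#lm i, tm i#}))) l"
      by (simp add: coord_contract[OF eps_hom] coord_sum sum_distrib_left has_sum_unique)
  qed
  then show ?thesis
    unfolding cinner_tensor[OF eps_hom] by (simp add: cinner_sum_left a_def)
qed

text \<open>Left unsymmetrized: inner products with symmetric vectors do not see the
  symmetrization.\<close>

definition eps_power :: "nat \<Rightarrow> ('x + 'y) list ell2" where
  "eps_power k = (tensor (eps_pair D) ^^ k) vac"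

lemma eps_power_hom: "eps_power k \<in> hom (2 * k)"
proof (induction k)
  case (Suc k)
  have "tensor (eps_pair D) (eps_power k) \<in> hom (2 * Suc k)"
    unfolding hom_def
  proof safe
    fix l :: "('x + 'y) list" assume "length l \<noteq> 2 * Suc k"
    then show "coord (tensor (eps_pair D) (eps_power k)) l = 0"
      using homD[OF Suc, of "drop 2 l"] by (auto simp: coord_tensor[OF eps_hom])
  qed
  then show ?case by (simp add: eps_power_def)
qed (simp add: eps_power_def vac_hom)

text \<open>The coefficient of a state of \<open>k\<close> pairs in \<open>eps_power k\<close>,
  apart from the Boltzmann factors. It is the reciprocal of the prefactor in
  \<open>out_vacuum_series\<close>.\<close>

definition pair_norm :: "nat \<Rightarrow> real" where
  "pair_norm k = 2 ^ k * fact k / sqrt (fact (2 * k))"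

lemma pair_norm_Suc: "pair_norm (Suc k) = 2 * real (Suc k) / sqrt (real (2 * Suc k * (2 * Suc k - 1))) * pair_norm k"
proof -
  have 1: "fact (2 * Suc k) = real (2 * Suc k * (2 * Suc k - 1)) * fact (2 * k)"
    by (simp add: algebra_simps)
  have 2: "2 ^ Suc k * fact (Suc k) = 2 * real (Suc k) * (2 ^ k * fact k)" by simp
  show ?thesis unfolding pair_norm_def 1 2 real_sqrt_mult by (simp only: times_divide_times_eq)
qed

text \<open>The outermost factor removes one pair of some index \<open>i\<close>. The two roots
  multiply to \<open>count c i\<close>, and \<open>boltz D i\<close> restores
  \<open>boltz_prod c\<close>, so the terms differ only in \<open>count c i\<close>. These numbers
  add up to \<open>Suc k\<close>, which gives the recursion \<open>pair_norm_Suc\<close>.\<close>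

lemma eps_power_coeff:
  shows "size c = k \<Longrightarrow> cinner (mixed_state (pair_mset c)) (eps_power k) = pair_norm k * boltz_prod c"
    and "M \<notin> range pair_mset \<Longrightarrow> cinner (mixed_state M) (eps_power k) = 0"
proof (induction k arbitrary: c M)
  case 0
  {
    case 1
    then show ?case using norm_ket[of "[]"] by (simp add: eps_power_def pair_norm_def cinner_norm vac_def pair_mset_def)
  next
    case 2
    have "pair_mset {#} = {#}" by (simp add: pair_mset_def)
    then have "M \<noteq> {#}" using 2 by (metis rangeI)
    then show ?case using hom_orthogonal[OF mstate_hom vac_hom, of M] by (simp add: eps_power_def)
  }
next
  case (Suc k)
  have step: "cinner (mixed_state M) (eps_power (Suc k)) = cinner (mixed_state M) (tensor (eps_pair D) (eps_power k))" for M
    by (simp add: eps_power_def)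
  {
    case 1
    let ?M = "pair_mset c"
    have sz: "size ?M = 2 * Suc k" using 1 size_triple[of "{#}" c] by (simp add: triple_empty)
    have cnt: "count ?M (lm i) = count c i" "count ?M (tm i) = count c i" for i
      using count_triple(2,3)[of "{#}" c i] by (simp_all add: triple_empty)
    have I: "{i. lm i \<in># ?M \<and> tm i \<in># ?M} = set_mset c"
      using cnt by (auto simp: set_mset_def simp del: count_greater_zero_iff)
    have t: "boltz D i * (sqrt (real (count ?M (lm i))) * sqrt (real (count ?M (tm i)))) * cinner (mixed_state (?M - {#lm i, tm i#})) (eps_power k)
      = of_real (real (count c i) * (pair_norm k * boltz_prod c))" if i: "i \<in># c" for i
    proof -
      obtain d where d: "c = add_mset i d" using i by (metis insert_DiffM)
      have "?M - {#lm i, tm i#} = pair_mset d" by (simp add: d pair_mset_add)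
      moreover have "size d = k" using 1 d by simp
      ultimately show ?thesis unfolding cnt using Suc.IH(1)[of d] by (simp add: d)
    qed
    have "cinner (mixed_state ?M) (eps_power (Suc k)) = complex_of_real (2 / sqrt (real (2 * Suc k * (2 * Suc k - 1)))) *
       (\<Sum>i\<in>set_mset c. complex_of_real (real (count c i) * (pair_norm k * boltz_prod c)))"
    proof -
      have "(\<Sum>i\<in>set_mset c. boltz D i * (sqrt (real (count ?M (lm i))) * sqrt (real (count ?M (tm i)))) * cinner (mixed_state (?M - {#lm i, tm i#})) (eps_power k))
        = (\<Sum>i\<in>set_mset c. complex_of_real (real (count c i) * (pair_norm k * boltz_prod c)))"
        by (rule sum.cong[OF refl t])
      moreover have "2 \<le> size ?M" using sz by simp
      ultimately show ?thesis unfolding step by (simp only: eps_contract sz I)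
    qed
    also have "(\<Sum>i\<in>set_mset c. complex_of_real (real (count c i) * (pair_norm k * boltz_prod c))) = of_real (real (Suc k) * (pair_norm k * boltz_prod c))"
      using 1 by (simp add: size_multiset_overloaded_eq sum_distrib_right[symmetric] flip: of_real_sum of_nat_sum del: of_nat_Suc of_real_mult)
    finally show ?case by (simp add: pair_norm_Suc del: of_nat_Suc of_nat_mult)
  next
    case 2
    show ?case
    proof (cases "size M = 2 * Suc k")
      case True
      have "cinner (mixed_state (M - {#lm i, tm i#})) (eps_power k) = 0" if "lm i \<in># M" "tm i \<in># M" for i
      proof (rule Suc.IH(2))
        show "M - {#lm i, tm i#} \<notin> range pair_mset"
        proof
          assume "M - {#lm i, tm i#} \<in> range pair_mset"
          then obtain d where d: "M - {#lm i, tm i#} = pair_mset d" by blast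
          have "{#lm i, tm i#} \<subseteq># M" using that by (auto simp: insert_subset_eq_iff in_diff_count)
          then have "M = {#lm i, tm i#} + pair_mset d" using d by (metis subset_mset.add_diff_inverse)
          then have "M = pair_mset (add_mset i d)" by (simp add: pair_mset_add)
          then show False using 2 by blast
        qed
      qed
      then show ?thesis unfolding step using True by (subst eps_contract) auto
    next
      case False
      then show ?thesis using hom_orthogonal[OF mstate_hom eps_power_hom] by blast
    qed
  }
qed

text \<open>An \<open>infsum\<close> without a limit has the default value 0. As
  \<open>S vac\<close> is a unit vector, the series is nonzero and must converge.\<close>

lemma out_vacuum_has_sum:
  "((\<lambda>n. (1 / pair_norm n) *\<^sub>R symmetrize (eps_power n)) has_sum out_vacuum_series D) UNIV"
proof -
  have eq: "sqrt (fact (2 * n)) / (2 ^ n * fact n) = 1 / pair_norm n" for n by (simp add: pair_norm_def)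
  have "out_vacuum_series D \<noteq> 0" using Smat by (auto simp: S_matrix_def)
  then have "(\<lambda>n. (1 / pair_norm n) *\<^sub>R symmetrize (eps_power n)) summable_on UNIV"
    unfolding out_vacuum_series_def eq eps_power_def by (rule contrapos_np) (rule infsum_not_exists)
  then show ?thesis unfolding out_vacuum_series_def eq eps_power_def by (rule has_sum_infsum)
qed

text \<open>Only the power \<open>size c\<close> has the degree of \<open>pair_mset c\<close>, and
  there the prefactor of the series cancels \<open>pair_norm\<close>. What remains are the
  coefficients of a product of two-mode squeezed vacua.\<close>

lemma S_vac_coeff:
  "cinner (mixed_state (pair_mset c)) (S vac) = N * boltz_prod c"
  "M \<notin> range pair_mset \<Longrightarrow> cinner (mixed_state M) (S vac) = 0"
proof -
  have Sv: "S vac = N *\<^sub>C out_vacuum_series D" using Smat by (simp add: S_matrix_def)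
  have h: "((\<lambda>n. (1 / pair_norm n) * cinner (mixed_state M) (eps_power n)) has_sum cinner (mixed_state M) (out_vacuum_series D)) UNIV" for M
    using has_sum_cinner_right[OF out_vacuum_has_sum, of "mixed_state M"] by (simp add: cinner_symmetrize[OF mstate_fock])
  have "((\<lambda>n. (1 / pair_norm n) * cinner (mixed_state (pair_mset c)) (eps_power n)) has_sum of_real (boltz_prod c)) UNIV"
  proof (rule has_sum_finite_neutralI[of "{size c}"])
    fix n assume "n \<in> UNIV - {size c}"
    then have "size (pair_mset c) \<noteq> 2 * n" using size_triple[of "{#}" c] by (simp add: triple_empty)
    then have "cinner (mixed_state (pair_mset c)) (eps_power n) = 0"
      by (rule hom_orthogonal[OF mstate_hom eps_power_hom])
    then show "complex_of_real (1 / pair_norm n) * cinner (mixed_state (pair_mset c)) (eps_power n) = 0" by simp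
  qed (auto simp: eps_power_coeff pair_norm_def)
  then show "cinner (mixed_state (pair_mset c)) (S vac) = N * boltz_prod c"
    using h[of "pair_mset c"] by (simp add: Sv has_sum_unique)
  assume "M \<notin> range pair_mset"
  then show "cinner (mixed_state M) (S vac) = 0"
    using h[of M] by (simp add: Sv eps_power_coeff(2)) (metis has_sum_0_simp has_sum_unique)
qed

subsection \<open>Images of the number states\<close>

definition S_state :: "nat multiset \<Rightarrow> ('x + 'y) list ell2" where
  "S_state A = S (mstate (in_mode D) A)"

lemma S_linear: "S (c *\<^sub>R v) = c *\<^sub>R S v" "S (c *\<^sub>C v) = c *\<^sub>C S v"
  using Smat by (simp_all add: S_matrix_def bounded_clinear_def clinear_def linear_cmul)

lemma S_fock: "S v \<in> fock"
  using Smat by (auto simp: S_matrix_def)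

text \<open>With these coefficients the particle number is \<open>size A + 2 * size c\<close> with
  weight \<open>(boltz_prod c)\<^sup>2\<close>, so \<open>boltz_prod_size_summable\<close> applies.
  The coefficients are hypotheses because the domain is needed inside the induction that proves
  them.\<close>

lemma S_state_domI:
  assumes "\<And>c. cinner (mixed_state (triple_mset A c)) (S_state A) = N * boltz_prod c"
    and "\<And>M. M \<notin> range (triple_mset A) \<Longrightarrow> cinner (mixed_state M) (S_state A) = 0"
  shows "S_state A \<in> create_dom"
proof (rule create_domI[OF mixed_modes])
  show "S_state A \<in> fock" by (simp add: S_state_def S_fock)
  let ?f = "\<lambda>M. (cmod (of_real (sqrt (real (size M + 1))) * cinner (mixed_state M) (S_state A)))\<^sup>2"
  have "(\<lambda>c. (cmod N)\<^sup>2 * (real (size A + 1) * (boltz_prod c)\<^sup>2) + (cmod N)\<^sup>2 * (2 * (real (size c) * (boltz_prod c)\<^sup>2))) summable_on UNIV"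
    by (intro summable_on_add summable_on_cmult_right boltz_prod_summable boltz_prod_size_summable)
  also have "(\<lambda>c. (cmod N)\<^sup>2 * (real (size A + 1) * (boltz_prod c)\<^sup>2) + (cmod N)\<^sup>2 * (2 * (real (size c) * (boltz_prod c)\<^sup>2)))
      = ?f \<circ> triple_mset A"
    by (simp add: fun_eq_iff assms(1) size_triple norm_mult power_mult_distrib algebra_simps)
  finally have "?f summable_on range (triple_mset A)"
    by (subst summable_on_reindex) (simp_all add: inj_def triple_mset_inject o_def)
  then show "?f summable_on UNIV"
    by (rule summable_on_cong_neutral[THEN iffD1, rotated -1]) (auto simp: assms(2))
qed

text \<open>\<open>S\<close> maps the in-state \<open>A\<close> to the \<open>\<gamma>\<close>-quanta \<open>A\<close> times the out-vacuum of the
  \<open>\<lambda>\<close>- and \<open>\<tau>\<close>-modes.\<close>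

lemma S_state_coeff:
  "cinner (mixed_state (triple_mset A c)) (S_state A) = N * boltz_prod c"
  "M \<notin> range (triple_mset A) \<Longrightarrow> cinner (mixed_state M) (S_state A) = 0"
proof (induction A arbitrary: c M)
  case empty
  {
    case 1 then show ?case using S_vac_coeff(1) by (simp add: S_state_def triple_empty)
  next
    case 2 then show ?case using S_vac_coeff(2) by (simp add: S_state_def triple_empty[abs_def])
  }
next
  case (add i A)
  \<comment> \<open>Required before \<open>create\<close> may be split over the \<rho>- and
    \<sigma>-parts of \<gamma>; the induction hypothesis supplies the coefficients.\<close>
  have dom: "S_state A \<in> create_dom" by (rule S_state_domI) (use add in auto)
  obtain n where n: "occ_mset n = A" using bij_occ_mset by (metis bij_pointE)
  let ?w = "sqrt (real (count A i + 1))"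
  have w: "?w \<noteq> 0" by (simp del: of_nat_add)
  have "S (create (in_mode D i) (in_state D n)) =
        R_coeff D i *\<^sub>C create (dsum_left (rho_mode D i)) (S (in_state D n))
        + T_coeff D i *\<^sub>C create (dsum_right (sigma_mode D i)) (S (in_state D n))"
    using Smat by (simp add: S_matrix_def)
  moreover have "in_state D n = mstate (in_mode D) A" by (simp add: in_state_def number_state_mstate n)
  ultimately have "?w *\<^sub>R S_state (add_mset i A) = create (mixed_modes (Inl i)) (S_state A)"
    by (simp add: create_mstate S_linear mixed_modes_def gamma_mode_def create_add_left create_scaleC_left dom add.commute flip: S_state_def del: of_nat_add of_nat_Suc)
  then have "?w * cinner (mixed_state M) (S_state (add_mset i A)) = cinner (mixed_state M) (create (mixed_modes (Inl i)) (S_state A))" for M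
    by (metis cinner_scaleR_right)
  then have step: "cinner (mixed_state M) (S_state (add_mset i A))
      = sqrt (real (count M (Inl i))) * cinner (mixed_state (M - {#Inl i#})) (S_state A) / ?w" for M
    using w by (simp add: cinner_mstate_create[OF mixed_modes(1) dom] nonzero_eq_divide_eq mult.commute del: of_nat_add)
  {
    case 1
    have "triple_mset (add_mset i A) c - {#Inl i#} = triple_mset A c" by (simp add: triple_mset_def)
    then show ?case using w by (simp add: step add.IH(1) del: of_nat_add of_nat_Suc)
  next
    case 2
    show ?case
    proof (cases "Inl i \<in># M")
      case True
      have "M - {#Inl i#} \<notin> range (triple_mset A)"
      proof
        assume "M - {#Inl i#} \<in> range (triple_mset A)"
        then obtain c where "M - {#Inl i#} = triple_mset A c" by blast
        then have "M = triple_mset (add_mset i A) c" using True by (metis add_mset_add_single image_mset_add_mset insert_DiffM triple_mset_def union_mset_add_mset_left)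
        then show False using 2 by blast
      qed
      then show ?thesis by (simp add: step add.IH(2))
    next
      case False
      then show ?thesis by (simp add: step not_in_iff)
    qed
  }
qed

lemma S_state_has_sum:
  "((\<lambda>c. cinner u (mixed_state (triple_mset A c)) * (N * boltz_prod c)) has_sum cinner u (S_state A)) UNIV"
proof -
  have "((\<lambda>M. cinner u (mixed_state M) * cinner (mixed_state M) (S_state A)) has_sum cinner u (S_state A)) UNIV"
    by (rule Parseval[OF mixed_state(1)]) (simp add: mixed_state(2) S_state_def S_fock)
  also have "?this \<longleftrightarrow> ((\<lambda>M. cinner u (mixed_state M) * cinner (mixed_state M) (S_state A)) has_sum cinner u (S_state A)) (range (triple_mset A))"
    by (rule has_sum_cong_neutral) (auto simp: S_state_coeff)
  finally show ?thesis
    by (subst (asm) has_sum_reindex) (auto simp: inj_def triple_mset_inject o_def S_state_coeff)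
qed

lemma S_state_inner:
  "((\<lambda>c. (cmod N)\<^sup>2 * (boltz_prod c)\<^sup>2) has_sum (norm (S_state A))\<^sup>2) UNIV"
  "A \<noteq> B \<Longrightarrow> cinner (S_state A) (S_state B) = 0"
proof -
  have c: "cinner (S_state A) (mixed_state M) = cnj (cinner (mixed_state M) (S_state A))" for A M
    by (rule cinner_commute)
  have "((\<lambda>c. complex_of_real ((cmod N)\<^sup>2 * (boltz_prod c)\<^sup>2)) has_sum of_real ((norm (S_state A))\<^sup>2)) UNIV"
  proof -
    have "cinner (S_state A) (mixed_state (triple_mset A d)) * (N * boltz_prod d) = complex_of_real ((cmod N)\<^sup>2 * (boltz_prod d)\<^sup>2)" for d
      unfolding of_real_mult complex_norm_square by (simp add: c S_state_coeff power2_eq_square)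
    then show ?thesis using S_state_has_sum[of "S_state A" A] by (simp only: cinner_norm)
  qed
  then show "((\<lambda>c. (cmod N)\<^sup>2 * (boltz_prod c)\<^sup>2) has_sum (norm (S_state A))\<^sup>2) UNIV"
    by (simp only: has_sum_of_real_iff)
  assume "A \<noteq> B"
  then have "triple_mset B c \<notin> range (triple_mset A)" for c by (auto simp: triple_mset_inject)
  then have "cinner (S_state A) (mixed_state (triple_mset B c)) = 0" for c by (simp add: c S_state_coeff(2))
  then show "cinner (S_state A) (S_state B) = 0"
    using S_state_has_sum[of "S_state A" B] by (simp add: has_sum_unique)
qed

text \<open>The squared coefficients of the out-vacuum are the Gibbs weights times the squared
  modulus of \<open>N\<close>, so its unit norm fixes this modulus.\<close>

lemma N_norm: "(cmod N)\<^sup>2 * Z_part D = 1"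
proof -
  have "((\<lambda>c. (cmod N)\<^sup>2 * (boltz_prod c)\<^sup>2) has_sum (cmod N)\<^sup>2 * Z_part D) UNIV"
    by (intro has_sum_cmult_right boltz_prod_has_sum)
  moreover have "norm (S vac) = 1" using Smat unfolding S_matrix_def by blast
  then have "norm (S_state {#}) = 1" by (simp add: S_state_def)
  ultimately show ?thesis using S_state_inner(1)[of "{#}"] by (simp add: has_sum_unique)
qed

text \<open>\<open>S_state A\<close> has the coefficients of the out-vacuum, moved to labels
  \<open>triple_mset A c\<close>. All norms therefore agree with that of \<open>S vac\<close>, and
  the supports for different \<open>A\<close> are disjoint.\<close>

lemma S_state_orthonormal: "orthonormal_family S_state"
proof -
  have "((\<lambda>c. (cmod N)\<^sup>2 * (boltz_prod c)\<^sup>2) has_sum 1) UNIV"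
    using has_sum_cmult_right[OF boltz_prod_has_sum, of "(cmod N)\<^sup>2"] by (simp add: N_norm)
  then have "(norm (S_state A))\<^sup>2 = 1" for A using S_state_inner(1) has_sum_unique by blast
  then show ?thesis using S_state_inner(2) by (auto simp: orthonormal_family_def cinner_norm)
qed

end

subsection \<open>Transition amplitudes between the two mode bases\<close>

text \<open>\<open>\<gamma>\<^sub>i\<close> and \<open>\<lambda>\<^sub>i\<close> are combinations of \<open>\<rho>\<^sub>i\<close> and \<open>\<sigma>\<^sub>i\<close>, so the number of quanta of
  each charge is the same on both sides of a nonzero transition amplitude.\<close>

definition mode_charge :: "nat + (nat + nat) \<Rightarrow> nat + nat" where
  "mode_charge = case_sum Inl (case_sum Inl Inr)"

text \<open>The labels serve both bases: \<open>a\<close> counts \<rho>- or \<gamma>-quanta and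
  \<open>b\<close> counts \<sigma>- or \<lambda>-quanta. The \<tau>-quanta, common to both, are kept
  apart in \<open>tau_mset\<close>.\<close>

definition pq_mset :: "nat multiset \<Rightarrow> nat multiset \<Rightarrow> (nat + (nat + nat)) multiset" where
  "pq_mset a b = image_mset Inl a + image_mset (\<lambda>i. Inr (Inl i)) b"

definition tau_mset :: "nat multiset \<Rightarrow> (nat + (nat + nat)) multiset" where
  "tau_mset c = image_mset (\<lambda>i. Inr (Inr i)) c"

text \<open>A horizon occupation, \<open>b\<close> of \<sigma> and \<open>c\<close> of \<tau>.
  Multisets of charges have the same form.\<close>

definition plus_mset :: "nat multiset \<Rightarrow> nat multiset \<Rightarrow> (nat + nat) multiset" where
  "plus_mset b c = image_mset Inl b + image_mset Inr c"

lemma count_pq_tau: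
  "count (pq_mset a b + tau_mset c) (Inl i) = count a i"
  "count (pq_mset a b + tau_mset c) (Inr (Inl i)) = count b i"
  "count (pq_mset a b + tau_mset c) (Inr (Inr i)) = count c i"
proof -
  show "count (pq_mset a b + tau_mset c) (Inl i) = count a i"
    using count_image_inj[of "Inl :: nat \<Rightarrow> nat + (nat + nat)" a i]
    by (simp add: pq_mset_def tau_mset_def inj_def count_eq_zero_iff image_iff)
  show "count (pq_mset a b + tau_mset c) (Inr (Inl i)) = count b i"
    using count_image_inj[of "\<lambda>i. Inr (Inl i) :: nat + (nat + nat)" b i]
    by (simp add: pq_mset_def tau_mset_def inj_def count_eq_zero_iff image_iff)
  show "count (pq_mset a b + tau_mset c) (Inr (Inr i)) = count c i"
    using count_image_inj[of "\<lambda>i. Inr (Inr i) :: nat + (nat + nat)" c i]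
    by (simp add: pq_mset_def tau_mset_def inj_def count_eq_zero_iff image_iff)
qed

lemma pq_mset_inject: "pq_mset a b = pq_mset a' b' \<longleftrightarrow> a = a' \<and> b = b'"
proof -
  have "pq_mset a b = pq_mset a b + tau_mset {#}" for a b by (simp add: tau_mset_def)
  then show ?thesis by (metis count_pq_tau(1,2) multiset_eqI)
qed

lemma plus_mset_inject: "plus_mset a b = plus_mset a' b' \<longleftrightarrow> a = a' \<and> b = b'"
proof -
  have "count (plus_mset a b) (Inl i) = count a i" "count (plus_mset a b) (Inr i) = count b i" for a b i
    using count_image_inj[of "Inl :: nat \<Rightarrow> nat + nat" a i] count_image_inj[of "Inr :: nat \<Rightarrow> nat + nat" b i]
    by (simp_all add: plus_mset_def inj_def count_eq_zero_iff image_iff)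
  then show ?thesis by (metis multiset_eqI)
qed

lemma plus_mset_exhaust: "\<exists>b c. B = plus_mset b c"
proof (induction B)
  case empty
  have "{#} = plus_mset {#} {#}" by (simp add: plus_mset_def)
  then show ?case by blast
next
  case (add j B)
  then obtain b c where "B = plus_mset b c" by blast
  then have "add_mset j B = (case j of Inl i \<Rightarrow> plus_mset (add_mset i b) c | Inr i \<Rightarrow> plus_mset b (add_mset i c))"
    by (simp add: plus_mset_def split: sum.splits)
  then show ?case by (cases j) auto
qed

lemma pq_tau_exhaust: "\<exists>a b c. M = pq_mset a b + tau_mset c"
proof (induction M)
  case empty
  have "{#} = pq_mset {#} {#} + tau_mset {#}" by (simp add: pq_mset_def tau_mset_def)
  then show ?case by blast
next
  case (add j M)
  then obtain a b c where M: "M = pq_mset a b + tau_mset c" by blast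
  show ?case
  proof (cases j)
    case (Inl i)
    then have "add_mset j M = pq_mset (add_mset i a) b + tau_mset c" by (simp add: M pq_mset_def)
    then show ?thesis by blast
  next
    case (Inr k)
    show ?thesis
    proof (cases k)
      case (Inl i)
      then have "add_mset j M = pq_mset a (add_mset i b) + tau_mset c" using Inr by (simp add: M pq_mset_def)
      then show ?thesis by blast
    next
      case j: (Inr i)
      then have "add_mset j M = pq_mset a b + tau_mset (add_mset i c)"
        using Inr by (simp add: M tau_mset_def)
      then show ?thesis by blast
    qed
  qed
qed

lemma triple_pq: "triple_mset n c = pq_mset n c + tau_mset c"
  by (simp add: triple_mset_def pair_mset_def pq_mset_def tau_mset_def o_def)

lemma pq_plus: "image_mset Inl a + image_mset Inr (plus_mset b c) = pq_mset a b + tau_mset c"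
  by (simp add: plus_mset_def pq_mset_def tau_mset_def multiset.map_comp o_def)

lemma charge_pq_tau: "image_mset mode_charge (pq_mset a b + tau_mset c) = plus_mset (a + b) c"
  by (simp add: plus_mset_def pq_mset_def tau_mset_def multiset.map_comp o_def mode_charge_def)

context collapse
begin

abbreviation ost :: "(nat + (nat + nat)) multiset \<Rightarrow> ('x + 'y) list ell2" where
  "ost \<equiv> mstate out_modes"

definition overlap :: "(nat + (nat + nat)) multiset \<Rightarrow> (nat + (nat + nat)) multiset \<Rightarrow> complex" where
  "overlap M M' = cinner (ost M) (mixed_state M')"

text \<open>A mixed mode is a combination of out modes of its own charge, so by linearity of
  \<open>create\<close> in the mode one of the terms does not vanish.\<close>

lemma create_mixed_charge:
  assumes \<psi>: "\<psi> \<in> create_dom" and nz: "cinner \<phi> (create (mixed_modes j) \<psi>) \<noteq> 0"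
  shows "\<exists>j'. mode_charge j' = mode_charge j \<and> cinner \<phi> (create (out_modes j') \<psi>) \<noteq> 0"
proof (cases j)
  case (Inl i)
  then have "cinner \<phi> (create (out_modes (Inl i)) \<psi>) \<noteq> 0 \<or> cinner \<phi> (create (out_modes (Inr (Inl i))) \<psi>) \<noteq> 0"
    using nz by (auto simp: mixed_modes_def mode_expansions create_add_left create_scaleC_left \<psi> cinner_add_right)
  then show ?thesis
  proof
    assume "cinner \<phi> (create (out_modes (Inl i)) \<psi>) \<noteq> 0"
    then show ?thesis using Inl by (intro exI[of _ "Inl i"]) (simp add: mode_charge_def)
  next
    assume "cinner \<phi> (create (out_modes (Inr (Inl i))) \<psi>) \<noteq> 0"
    then show ?thesis using Inl by (intro exI[of _ "Inr (Inl i)"]) (simp add: mode_charge_def)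
  qed
next
  case (Inr k)
  show ?thesis
  proof (cases k)
    case (Inl i)
    then have "cinner \<phi> (create (out_modes (Inl i)) \<psi>) \<noteq> 0 \<or> cinner \<phi> (create (out_modes (Inr (Inl i))) \<psi>) \<noteq> 0"
      using nz Inr by (auto simp: mixed_modes_def mode_expansions create_add_left create_scaleC_left \<psi> cinner_add_right)
    then show ?thesis
    proof
      assume "cinner \<phi> (create (out_modes (Inl i)) \<psi>) \<noteq> 0"
      then show ?thesis using Inl Inr by (intro exI[of _ "Inl i"]) (simp add: mode_charge_def)
    next
      assume "cinner \<phi> (create (out_modes (Inr (Inl i))) \<psi>) \<noteq> 0"
      then show ?thesis using Inl Inr by (intro exI[of _ "Inr (Inl i)"]) (simp add: mode_charge_def)
    qed
  next
    case j: (Inr i)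
    then have "cinner \<phi> (create (out_modes (Inr (Inr i))) \<psi>) \<noteq> 0"
      using nz Inr by (simp add: mixed_modes_def mode_expansions)
    then show ?thesis using j Inr by (intro exI[of _ "Inr (Inr i)"]) (simp add: mode_charge_def)
  qed
qed

text \<open>Taking one mixed quantum off \<open>M'\<close> leaves a nonzero matrix element of an
  out-creation operator of equal charge; moved to the left, it takes a quantum of that charge off
  \<open>M\<close>.\<close>

lemma overlap_charge: "overlap M M' \<noteq> 0 \<Longrightarrow> image_mset mode_charge M = image_mset mode_charge M'"
proof (induction M' arbitrary: M)
  case empty
  have "cinner (ost M) (ost {#}) \<noteq> 0" using empty by (simp add: overlap_def)
  then have "M = {#}" using orthonormal_mstate[OF out_modes(1)] unfolding orthonormal_family_def by metis
  then show ?case by simp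
next
  case (add j M')
  have "cinner (ost M) (create (mixed_modes j) (mixed_state M')) \<noteq> 0"
    using add.prems by (auto simp: overlap_def mstate_add)
  then obtain j' where j': "mode_charge j' = mode_charge j" "cinner (ost M) (create (out_modes j') (mixed_state M')) \<noteq> 0"
    using create_mixed_charge[OF mstate_dom] by blast
  then have "count M j' \<noteq> 0" "overlap (M - {#j'#}) M' \<noteq> 0"
    by (auto simp: cinner_mstate_create[OF out_modes(1) mstate_dom] overlap_def)
  then have m: "j' \<in># M" "image_mset mode_charge (M - {#j'#}) = image_mset mode_charge M'"
    using add.IH by (auto simp: count_eq_zero_iff)
  then have "image_mset mode_charge M = add_mset (mode_charge j') (image_mset mode_charge (M - {#j'#}))"
    by (metis image_mset_add_mset insert_DiffM)
  then show ?case using m j' by simp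
qed

text \<open>\<tau> belongs to both bases: the creation operator for the added quantum on the right
  removes the added quantum on the left, and equal counts make the roots cancel.\<close>

lemma overlap_add_tau:
  assumes "count M (Inr (Inr i)) = count M' (Inr (Inr i))"
  shows "overlap (add_mset (Inr (Inr i)) M) (add_mset (Inr (Inr i)) M') = overlap M M'"
proof -
  let ?t = "Inr (Inr i) :: nat + (nat + nat)" and ?w = "sqrt (real (count M' (Inr (Inr i)) + 1))"
  have w: "?w \<noteq> 0" by (simp del: of_nat_add)
  have "mixed_modes ?t = out_modes ?t" by (simp add: mixed_modes_def mode_expansions)
  then have "overlap (add_mset ?t M) (add_mset ?t M') = (1 / ?w) * cinner (ost (add_mset ?t M)) (create (out_modes ?t) (mixed_state M'))"
    by (simp add: overlap_def mstate_add[of mixed_modes ?t M'])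
  also have "\<dots> = overlap M M'"
    using w by (simp add: cinner_mstate_create[OF out_modes(1) mstate_dom] overlap_def assms add.commute del: of_nat_add)
  finally show ?thesis .
qed

lemma overlap_tau: "overlap (pq_mset a b + tau_mset c) (pq_mset n l + tau_mset c) = overlap (pq_mset a b) (pq_mset n l)"
proof (induction c)
  case empty
  then show ?case by (simp add: tau_mset_def)
next
  case (add i c)
  have "overlap (add_mset (Inr (Inr i)) (pq_mset a b + tau_mset c)) (add_mset (Inr (Inr i)) (pq_mset n l + tau_mset c))
    = overlap (pq_mset a b + tau_mset c) (pq_mset n l + tau_mset c)"
    by (rule overlap_add_tau) (simp only: count_pq_tau)
  then show ?case using add by (simp add: tau_mset_def)
qed

lemma overlap_pq_charge: "overlap (pq_mset a b + tau_mset c) (pq_mset n l + tau_mset d) \<noteq> 0 \<Longrightarrow> a + b = n + l \<and> c = d"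
  using overlap_charge[of "pq_mset a b + tau_mset c" "pq_mset n l + tau_mset d"]
  by (simp only: charge_pq_tau plus_mset_inject simp_thms)

text \<open>Parseval for the unit vector \<open>ost (pq_mset a b)\<close> in the mixed number
  states. Conservation of charge discards the states that contain \<tau>-quanta.\<close>

lemma overlap_norm: "((\<lambda>(n, l). (cmod (overlap (pq_mset a b) (pq_mset n l)))\<^sup>2) has_sum 1) UNIV"
proof -
  let ?M = "pq_mset a b"
  have o: "norm (ost ?M) = 1"
    by (rule orthonormal_norm[of _ UNIV]) (simp_all add: orthonormal_mstate[OF out_modes(1)] flip: orthonormal_family_on)
  have "((\<lambda>M'. (cmod (cinner (mixed_state M') (ost ?M)))\<^sup>2) has_sum (norm (ost ?M))\<^sup>2) UNIV"
    by (rule Parseval_norm[OF mixed_state(1)]) (simp add: mixed_state(2) mstate_fock)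
  moreover have "cmod (cinner (mixed_state M') (ost ?M)) = cmod (overlap ?M M')" for M'
    unfolding overlap_def by (subst cinner_commute) simp
  ultimately have "((\<lambda>M'. (cmod (overlap ?M M'))\<^sup>2) has_sum 1) UNIV" by (simp add: o)
  also have "?this \<longleftrightarrow> ((\<lambda>M'. (cmod (overlap ?M M'))\<^sup>2) has_sum 1) (range (\<lambda>(n, l). pq_mset n l))"
  proof (rule has_sum_cong_neutral)
    fix M' assume M': "M' \<in> UNIV - range (\<lambda>(n, l). pq_mset n l)"
    obtain n l d where d: "M' = pq_mset n l + tau_mset d" using pq_tau_exhaust by blast
    have t0: "tau_mset {#} = {#}" by (simp add: tau_mset_def)
    have "overlap ?M M' = 0"
    proof (rule ccontr)
      assume "overlap ?M M' \<noteq> 0"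
      then have "{#} = d" using overlap_pq_charge[of a b "{#}" n l d] by (simp add: d t0)
      then have "M' = (\<lambda>(n, l). pq_mset n l) (n, l)" using d t0 by simp
      then show False using M' by blast
    qed
    then show "(cmod (overlap ?M M'))\<^sup>2 = 0" by simp
  qed auto
  finally show ?thesis
    by (subst (asm) has_sum_reindex) (auto simp: inj_def pq_mset_inject o_def case_prod_unfold)
qed

text \<open>The amplitude for the in-state \<open>n\<close> to end as \<open>a\<close> \<rho>-quanta
  outside and the horizon number state \<open>B\<close>.\<close>

definition amplitude :: "nat multiset \<Rightarrow> (nat + nat) multiset \<Rightarrow> nat multiset \<Rightarrow> complex" where
  "amplitude a B n = cinner (ost (image_mset Inl a + image_mset Inr B)) (S_state n)"

text \<open>\<open>S_state n\<close> is a sum over vacuum pairs. As \<tau>-quanta are conserved,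
  only the term with the pairs \<open>c\<close> meets a horizon state with \<tau>-occupation
  \<open>c\<close>.\<close>

lemma amplitude_eq: "amplitude a (plus_mset b c) n = overlap (pq_mset a b) (pq_mset n c) * (N * boltz_prod c)"
proof -
  let ?M = "pq_mset a b + tau_mset c"
  have "((\<lambda>d. overlap ?M (triple_mset n d) * (N * boltz_prod d)) has_sum amplitude a (plus_mset b c) n) UNIV"
    using S_state_has_sum[of "ost ?M" n] by (simp add: amplitude_def pq_plus overlap_def)
  moreover have "((\<lambda>d. overlap ?M (triple_mset n d) * (N * boltz_prod d)) has_sum overlap ?M (triple_mset n c) * (N * boltz_prod c)) UNIV"
  proof (rule has_sum_finite_neutralI[of "{c}"])
    fix d assume "d \<in> UNIV - {c}"
    then show "overlap ?M (triple_mset n d) * (N * boltz_prod d) = 0"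
      using overlap_pq_charge[of a b c n d d] by (auto simp: triple_pq)
  qed auto
  ultimately show ?thesis by (simp add: has_sum_unique triple_pq overlap_tau)
qed

text \<open>Conservation gives \<open>a + b = n + c\<close>, so the in-state and the horizon state
  determine the outgoing occupation. The horizon thus records it, and tracing out the horizon leaves
  no coherence between different outgoing number states.\<close>

lemma amplitude_unique:
  assumes "amplitude a B n \<noteq> 0" "amplitude a' B n \<noteq> 0"
  shows "a = a'"
proof -
  obtain b c where B: "B = plus_mset b c" using plus_mset_exhaust by blast
  have t0: "tau_mset {#} = {#}" by (simp add: tau_mset_def)
  have "overlap (pq_mset a b) (pq_mset n c) \<noteq> 0" "overlap (pq_mset a' b) (pq_mset n c) \<noteq> 0"
    using assms by (auto simp: B amplitude_eq)
  then have "a + b = n + c" "a' + b = n + c"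
    using overlap_pq_charge[of a b "{#}" n c "{#}"] overlap_pq_charge[of a' b "{#}" n c "{#}"] by (simp_all add: t0)
  then show ?thesis by (metis add_right_cancel)
qed

text \<open>Thermality: the Boltzmann factors of the \<open>\<gamma>\<close>- and \<open>\<lambda>\<close>-quanta combine to those of the
  \<open>\<rho>\<close>- and \<open>\<sigma>\<close>-quanta because the overlaps conserve the occupation of each index.\<close>

lemma amplitude_thermal:
  "((\<lambda>(n, B). (boltz_prod n)\<^sup>2 * (cmod (amplitude a B n))\<^sup>2) has_sum (boltz_prod a)\<^sup>2) UNIV"
proof -
  let ?v = "\<lambda>b n c. (cmod (overlap (pq_mset a b) (pq_mset n c)))\<^sup>2"
  have t0: "tau_mset {#} = {#}" by (simp add: tau_mset_def)
  have inner: "((\<lambda>nc. case (b, nc) of (b, n, c) \<Rightarrow> (cmod N)\<^sup>2 * (boltz_prod a)\<^sup>2 * (boltz_prod b)\<^sup>2 * ?v b n c)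
      has_sum (cmod N)\<^sup>2 * (boltz_prod a)\<^sup>2 * (boltz_prod b)\<^sup>2) UNIV" for b
    using has_sum_cmult_right[OF overlap_norm[of a b], of "(cmod N)\<^sup>2 * (boltz_prod a)\<^sup>2 * (boltz_prod b)\<^sup>2"]
    by (simp add: case_prod_unfold)
  have NZ: "(cmod N)\<^sup>2 * A * Z_part D = A" for A
    using N_norm by (metis mult.assoc mult.commute mult_1)
  have outer: "((\<lambda>b. (cmod N)\<^sup>2 * (boltz_prod a)\<^sup>2 * (boltz_prod b)\<^sup>2) has_sum (boltz_prod a)\<^sup>2) UNIV"
    using has_sum_cmult_right[OF boltz_prod_has_sum, of "(cmod N)\<^sup>2 * (boltz_prod a)\<^sup>2"] NZ by (simp only:)
  have "((\<lambda>(b, n, c). (cmod N)\<^sup>2 * (boltz_prod a)\<^sup>2 * (boltz_prod b)\<^sup>2 * ?v b n c) has_sum (boltz_prod a)\<^sup>2) (Sigma UNIV (\<lambda>_. UNIV))"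
  proof (rule has_sum_SigmaI[OF inner outer])
    show "(\<lambda>(b, n, c). (cmod N)\<^sup>2 * (boltz_prod a)\<^sup>2 * (boltz_prod b)\<^sup>2 * ?v b n c) summable_on Sigma UNIV (\<lambda>_. UNIV)"
      by (rule summable_on_SigmaI[OF inner has_sum_imp_summable[OF outer]]) (simp add: case_prod_unfold)
  qed
  moreover have "(cmod N)\<^sup>2 * (boltz_prod a)\<^sup>2 * (boltz_prod b)\<^sup>2 * ?v b n c
      = (boltz_prod n)\<^sup>2 * (cmod (amplitude a (plus_mset b c) n))\<^sup>2" for b n c
  proof (cases "overlap (pq_mset a b) (pq_mset n c) = 0")
    case False
    then have "a + b = n + c" using overlap_pq_charge[of a b "{#}" n c "{#}"] by (simp add: t0)
    then have "boltz_prod a * boltz_prod b = boltz_prod n * boltz_prod c" by (metis boltz_prod_simps(3))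
    then have "(boltz_prod a)\<^sup>2 * (boltz_prod b)\<^sup>2 = (boltz_prod n)\<^sup>2 * (boltz_prod c)\<^sup>2" by (metis power_mult_distrib)
    then show ?thesis by (simp add: amplitude_eq norm_mult power_mult_distrib)
  qed (simp add: amplitude_eq)
  ultimately have *: "((\<lambda>x. (\<lambda>(n, B). (boltz_prod n)\<^sup>2 * (cmod (amplitude a B n))\<^sup>2) ((\<lambda>(b, n, c). (n, plus_mset b c)) x))
      has_sum (boltz_prod a)\<^sup>2) UNIV"
    by (simp add: case_prod_unfold)
  have "bij (\<lambda>(b, n :: nat multiset, c). (n, plus_mset b c))"
  proof (rule bijI)
    show "inj (\<lambda>(b, n :: nat multiset, c). (n, plus_mset b c))" by (auto simp: inj_def plus_mset_inject)
    show "surj (\<lambda>(b, n :: nat multiset, c). (n, plus_mset b c))"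
      unfolding surj_def
    proof
      fix p :: "nat multiset \<times> (nat + nat) multiset"
      obtain n B where p: "p = (n, B)" by (cases p)
      obtain b c where "B = plus_mset b c" using plus_mset_exhaust by blast
      then show "\<exists>x. p = (\<lambda>(b, n, c). (n, plus_mset b c)) x" by (intro exI[of _ "(b, n, c)"]) (simp add: p)
    qed
  qed
  from has_sum_reindex_bij_betw[OF this, THEN iffD1, OF *] show ?thesis .
qed

end

section \<open>Diagonal operators and traces\<close>

lemma Bessel: 
  assumes "orthonormal_on b I"
  shows "(\<Sum>\<^sub>\<infinity>i\<in>I. (cmod (cinner (b i) v))\<^sup>2) \<le> (norm v)\<^sup>2"
  by (rule infsum_le_finite_sums[OF Bessel_summable[OF assms]]) (use Bessel_finite[OF assms] in auto)

lemma diag_op_summable: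
  assumes b: "orthonormal_family b" and w: "\<forall>n. \<bar>w n\<bar> \<le> C"
  shows "(\<lambda>n. (cmod (of_real (w n) * cinner (b n) v))\<^sup>2) summable_on UNIV"
    "(\<Sum>\<^sub>\<infinity>n. (cmod (of_real (w n) * cinner (b n) v))\<^sup>2) \<le> C\<^sup>2 * (norm v)\<^sup>2"
proof -
  have o: "orthonormal_on b UNIV" using b by (simp add: orthonormal_family_on)
  have le: "(cmod (of_real (w n) * cinner (b n) v))\<^sup>2 \<le> C\<^sup>2 * (cmod (cinner (b n) v))\<^sup>2" for n
    unfolding norm_mult power_mult_distrib
    by (intro mult_right_mono power_mono) (use w in auto)
  have s: "(\<lambda>n. C\<^sup>2 * (cmod (cinner (b n) v))\<^sup>2) summable_on UNIV"
    by (intro summable_on_cmult_right Bessel_summable[OF o])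
  show s': "(\<lambda>n. (cmod (of_real (w n) * cinner (b n) v))\<^sup>2) summable_on UNIV"
    by (rule summable_on_comparison_test[OF s]) (use le in auto)
  have "(\<Sum>\<^sub>\<infinity>n. (cmod (of_real (w n) * cinner (b n) v))\<^sup>2) \<le> (\<Sum>\<^sub>\<infinity>n. C\<^sup>2 * (cmod (cinner (b n) v))\<^sup>2)"
    by (rule infsum_mono[OF s' s le])
  also have "\<dots> = C\<^sup>2 * (\<Sum>\<^sub>\<infinity>n. (cmod (cinner (b n) v))\<^sup>2)"
    by (rule infsum_cmult_right[OF Bessel_summable[OF o]])
  also have "\<dots> \<le> C\<^sup>2 * (norm v)\<^sup>2" by (intro mult_left_mono Bessel[OF o]) simp
  finally show "(\<Sum>\<^sub>\<infinity>n. (cmod (of_real (w n) * cinner (b n) v))\<^sup>2) \<le> C\<^sup>2 * (norm v)\<^sup>2" .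
qed

lemma diag_op_has_sum:
  assumes b: "orthonormal_family b" and w: "\<forall>n. \<bar>w n\<bar> \<le> C"
  shows "((\<lambda>n. (of_real (w n) * cinner (b n) v) *\<^sub>C b n) has_sum diag_op b w v) UNIV"
  unfolding diag_op_def
  by (intro has_sum_infsum orthonormal_summable diag_op_summable(1)[OF assms])
    (use b in \<open>simp add: orthonormal_family_on\<close>)

lemma diag_op_coeff:
  assumes b: "orthonormal_family b" and w: "\<forall>n. \<bar>w n\<bar> \<le> C"
  shows "cinner (b n) (diag_op b w v) = of_real (w n) * cinner (b n) v"
  by (rule orthonormal_coeff[OF _ diag_op_has_sum[OF assms]]) (use b in \<open>simp_all add: orthonormal_family_on\<close>)

lemma diag_op_in:
  assumes b: "orthonormal_family b" and w: "\<forall>n. \<bar>w n\<bar> \<le> C"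
  shows "diag_op b w v \<in> closed_cspan (range b)"
  by (rule has_sum_in_closed_subspace[OF closed_closed_cspan subspace_closed_cspan diag_op_has_sum[OF assms]])
    (auto intro: in_closed_cspanI)

lemma diag_op_eqI:
  assumes b: "orthonormal_family b" and w: "\<forall>n. \<bar>w n\<bar> \<le> C"
    and u: "u \<in> closed_cspan (range b)" "\<And>n. cinner (b n) u = of_real (w n) * cinner (b n) v"
  shows "diag_op b w v = u"
  using closed_cspan_eqD[of b UNIV, OF _ diag_op_in[OF b w] u(1)] b
  by (simp add: orthonormal_family_on diag_op_coeff[OF b w] u(2))

lemma bounded_clinearI:
  assumes "\<And>u v. W (u + v) = W u + W v" "\<And>c v. W (c *\<^sub>C v) = c *\<^sub>C W v" "\<And>v. norm (W v) \<le> norm v * C"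
  shows "bounded_clinear W"
  unfolding bounded_clinear_def clinear_def
proof (intro conjI allI)
  show "bounded_linear W"
    by (rule bounded_linear_intro[of _ C]) (use assms in \<open>auto simp: scaleR_conv_scaleC\<close>)
  then show "linear W" by (rule bounded_linear.linear)
qed (rule assms)

lemma bounded_clinear_diag_op:
  assumes b: "orthonormal_family b" and w: "\<forall>n. \<bar>w n\<bar> \<le> C"
  shows "bounded_clinear (diag_op b w)"
proof (rule bounded_clinearI)
  note h = diag_op_has_sum[OF b w]
  show "diag_op b w (u + v) = diag_op b w u + diag_op b w v" for u v
    using has_sum_add[OF h[of u] h[of v]] h[of "u + v"]
    by (simp add: cinner_add_right distrib_left scaleC_add_left has_sum_unique)
  show "diag_op b w (c *\<^sub>C v) = c *\<^sub>C diag_op b w v" for c v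
    using has_sum_scaleC[OF h[of v], of c] h[of "c *\<^sub>C v"]
    by (simp add: mult.left_commute has_sum_unique)
  fix v
  have o: "orthonormal_on b UNIV" using b by (simp add: orthonormal_family_on)
  have "((\<lambda>n. (cmod (cinner (b n) (diag_op b w v)))\<^sup>2) has_sum (norm (diag_op b w v))\<^sup>2) UNIV"
    by (rule Parseval_norm[OF o diag_op_in[OF b w]])
  then have "(norm (diag_op b w v))\<^sup>2 \<le> C\<^sup>2 * (norm v)\<^sup>2"
    using diag_op_summable(2)[OF b w, of v] by (simp add: diag_op_coeff[OF b w] infsumI)
  also have "\<dots> = (norm v * C)\<^sup>2" by (simp add: power_mult_distrib)
  finally show "norm (diag_op b w v) \<le> norm v * C"
    using w[rule_format, of undefined] by (simp add: power2_le_iff_abs_le)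
qed

lemma diag_op_base:
  assumes b: "orthonormal_family b" and w: "\<forall>n. \<bar>w n\<bar> \<le> C"
  shows "diag_op b w (b n) = w n *\<^sub>R b n"
proof (rule diag_op_eqI[OF b w])
  show "w n *\<^sub>R b n \<in> closed_cspan (range b)" by (simp add: scaleR_conv_scaleC in_closed_cspanI)
  show "cinner (b m) (w n *\<^sub>R b n) = of_real (w m) * cinner (b m) (b n)" for m
    using b by (simp add: orthonormal_family_def)
qed

lemma cinner_diag_op:
  assumes b: "orthonormal_family b" and w: "\<forall>n. \<bar>w n\<bar> \<le> C"
  shows "((\<lambda>n. of_real (w n) * cnj (cinner (b n) u) * cinner (b n) v) has_sum cinner u (diag_op b w v)) UNIV"
  using has_sum_cinner_right[OF diag_op_has_sum[OF b w, of v], of u] 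
  by (simp add: cinner_commute[of u "b _"] ac_simps)

lemma diag_op_selfadjoint:
  assumes b: "orthonormal_family b" and w: "\<forall>n. \<bar>w n\<bar> \<le> C"
  shows "cinner u (diag_op b w v) = cinner (diag_op b w u) v"
proof -
  have "((\<lambda>n. cnj (of_real (w n) * cnj (cinner (b n) v) * cinner (b n) u)) has_sum cnj (cinner v (diag_op b w u))) UNIV"
    unfolding has_sum_cnj_iff by (rule cinner_diag_op[OF b w])
  then have "((\<lambda>n. of_real (w n) * cnj (cinner (b n) u) * cinner (b n) v) has_sum cinner (diag_op b w u) v) UNIV"
    by (simp add: cinner_commute[of "diag_op b w u" v] ac_simps)
  then show ?thesis using cinner_diag_op[OF b w] has_sum_unique by blast
qed

section \<open>Traces in arbitrary orthonormal bases\<close>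

lemma summable_bounded:
  fixes w :: "'i \<Rightarrow> real"
  assumes "(\<lambda>n. \<bar>w n\<bar>) summable_on UNIV"
  shows "\<forall>n. \<bar>w n\<bar> \<le> (\<Sum>\<^sub>\<infinity>n. \<bar>w n\<bar>)"
  using finite_sum_le_infsum[OF assms, of "{n}" for n] by simp

text \<open>The products of \<open>w n\<close> with the squared overlaps are summed in both orders.
  Over \<open>b\<close> first, Parseval gives 1 because \<open>\<psi> n\<close> is a unit vector of
  \<open>K\<close>; absolute summability of \<open>w\<close> permits the exchange.\<close>

lemma trace_sum:
  assumes B: "onb K B" and \<psi>: "orthonormal_family \<psi>" "range \<psi> \<subseteq> K" and w: "(\<lambda>n. \<bar>w n\<bar>) summable_on UNIV"
  shows "((\<lambda>b. cinner b (diag_op \<psi> w b)) has_sum of_real (\<Sum>\<^sub>\<infinity>n. w n)) B"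
proof -
  have B': "orthonormal_on (\<lambda>b. b) B" "closed_cspan ((\<lambda>b. b) ` B) = K" using B by (simp_all add: onb_orthonormal_on)
  note bd = summable_bounded[OF w]
  have n1: "norm (\<psi> n) = 1" for n
    by (rule orthonormal_norm[of _ UNIV]) (use \<psi>(1) in \<open>simp_all add: orthonormal_family_on\<close>)
  have one: "((\<lambda>b. (cmod (cinner b (\<psi> n)))\<^sup>2) has_sum 1) B" for n
    using Parseval_norm[OF B'(1), of "\<psi> n"] B'(2) \<psi>(2) n1[of n] by auto
  have sw: "(\<lambda>n. w n) summable_on UNIV" by (rule abs_summable_summable) (use w in simp)
  have "(\<lambda>(n, b). \<bar>w n\<bar> * (cmod (cinner b (\<psi> n)))\<^sup>2) summable_on Sigma UNIV (\<lambda>_. B)"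
  proof (rule summable_on_SigmaI[OF _ w])
    show "((\<lambda>b. case (n, b) of (n, b) \<Rightarrow> \<bar>w n\<bar> * (cmod (cinner b (\<psi> n)))\<^sup>2) has_sum \<bar>w n\<bar>) B" for n
      using has_sum_cmult_right[OF one, of "\<bar>w n\<bar>" n] by simp
  qed auto
  then have "(\<lambda>x. norm (case x of (n, b) \<Rightarrow> w n * (cmod (cinner b (\<psi> n)))\<^sup>2)) summable_on Sigma UNIV (\<lambda>_. B)"
    by (simp add: case_prod_unfold abs_mult)
  then have s: "(\<lambda>(n, b). w n * (cmod (cinner b (\<psi> n)))\<^sup>2) summable_on Sigma UNIV (\<lambda>_. B)"
    by (rule abs_summable_summable)
  have "((\<lambda>(n, b). w n * (cmod (cinner b (\<psi> n)))\<^sup>2) has_sum (\<Sum>\<^sub>\<infinity>n. w n)) (UNIV \<times> B)"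
  proof (rule has_sum_SigmaI[where g = w, OF _ _ s])
    show "((\<lambda>b. case (n, b) of (n, b) \<Rightarrow> w n * (cmod (cinner b (\<psi> n)))\<^sup>2) has_sum w n) B" for n
      using has_sum_cmult_right[OF one, of "w n" n] by simp
  qed (rule has_sum_infsum[OF sw])
  then have "((\<lambda>(b, n). w n * (cmod (cinner b (\<psi> n)))\<^sup>2) has_sum (\<Sum>\<^sub>\<infinity>n. w n)) (B \<times> UNIV)"
    by (subst (asm) has_sum_swap) simp
  then have "((\<lambda>x. complex_of_real (case x of (b, n) \<Rightarrow> w n * (cmod (cinner b (\<psi> n)))\<^sup>2)) has_sum of_real (\<Sum>\<^sub>\<infinity>n. w n)) (B \<times> UNIV)"
    by (rule has_sum_of_real)
  then show ?thesis
  proof (rule has_sum_SigmaD)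
    fix b
    have "((\<lambda>n. of_real (w n) * cnj (cinner (\<psi> n) b) * cinner (\<psi> n) b) has_sum cinner b (diag_op \<psi> w b)) UNIV"
      by (rule cinner_diag_op[OF \<psi>(1) bd])
    moreover have "of_real (w n) * cnj (cinner (\<psi> n) b) * cinner (\<psi> n) b = complex_of_real (w n * (cmod (cinner b (\<psi> n)))\<^sup>2)" for n
      unfolding of_real_mult complex_norm_square by (simp add: cinner_commute[of "\<psi> n" b])
    ultimately show "((\<lambda>n. complex_of_real (case (b, n) of (b, n) \<Rightarrow> w n * (cmod (cinner b (\<psi> n)))\<^sup>2)) has_sum cinner b (diag_op \<psi> w b)) UNIV"
      by simp
  qed
qed

text \<open>\<open>X\<close> may be defined on a dense subspace only; the bounded extension that
  \<open>has_trace\<close> asks for is \<open>diag_op \<psi> w\<close>.\<close>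

lemma has_trace_diag:
  assumes \<psi>: "orthonormal_family \<psi>" "closed_cspan (range \<psi>) = K" and w: "(\<lambda>n. \<bar>w n\<bar>) summable_on UNIV"
    and X: "\<And>v u. (v, u) \<in> X \<Longrightarrow> diag_op \<psi> w v = u" and dense: "K \<subseteq> closure (Domain X)"
  shows "has_trace K X (of_real (\<Sum>\<^sub>\<infinity>n. w n))"
  unfolding has_trace_def
proof (intro conjI dense exI[of _ "diag_op \<psi> w"] allI impI)
  show "bounded_clinear (diag_op \<psi> w)" by (rule bounded_clinear_diag_op[OF \<psi>(1) summable_bounded[OF w]])
  show "\<forall>(v, u)\<in>X. diag_op \<psi> w v = u" using X by auto
  fix B assume "onb K B"
  then show "((\<lambda>b. cinner b (diag_op \<psi> w b)) has_sum of_real (\<Sum>\<^sub>\<infinity>n. w n)) B"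
    by (rule trace_sum[OF _ \<psi>(1) _ w]) (use \<psi>(2) in \<open>auto intro: closed_cspan_base\<close>)
qed

text \<open>A basis inside the domain of \<open>X\<close> determines the diagonal sum whatever
  extension \<open>W\<close> is used. This makes traces unique and \<open>Tr\<close>
  computable.\<close>

lemma has_trace_eval:
  assumes t: "has_trace K X t" and \<psi>: "orthonormal_family \<psi>" "closed_cspan (range \<psi>) = K"
    and X: "\<And>n. (\<psi> n, \<phi> n) \<in> X"
  shows "((\<lambda>n. cinner (\<psi> n) (\<phi> n)) has_sum t) UNIV"
proof -
  obtain W where W: "\<forall>(v, w)\<in>X. W v = w" "\<forall>B. onb K B \<longrightarrow> ((\<lambda>b. cinner b (W b)) has_sum t) B"
    using t by (auto simp: has_trace_def)
  have "onb K (range \<psi>)" using orthonormal_onb[OF \<psi>(1)] \<psi>(2) by simp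
  then have "((\<lambda>b. cinner b (W b)) has_sum t) (range \<psi>)" using W(2) by blast
  moreover have "inj \<psi>" using \<psi>(1) orthonormal_on_inj[of \<psi> UNIV] by (simp add: orthonormal_family_on)
  ultimately have "((\<lambda>n. cinner (\<psi> n) (W (\<psi> n))) has_sum t) UNIV"
    by (subst (asm) has_sum_reindex) (simp_all add: o_def)
  moreover have "W (\<psi> n) = \<phi> n" for n using bspec[OF W(1) X[of n]] by simp
  ultimately show ?thesis by simp
qed

lemma Tr_eqI:
  assumes "has_trace K X t" and \<psi>: "orthonormal_family \<psi>" "closed_cspan (range \<psi>) = K"
    and X: "\<And>n. (\<psi> n, \<phi> n) \<in> X"
  shows "Tr K X = t"
  unfolding Tr_def
proof (rule the_equality)
  show "has_trace K X t" by fact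
  fix t' assume "has_trace K X t'"
  from has_trace_eval[OF this \<psi> X] has_trace_eval[OF assms(1) \<psi> X] show "t' = t" by (rule has_sum_unique)
qed

text \<open>In an eigenbasis the diagonal sum is the series of eigenvalues. Unconditional
  convergence of a real series is absolute, which is how a trace hypothesis yields
  summability.\<close>

lemma has_trace_weights:
  assumes t: "has_trace K X t" and \<psi>: "orthonormal_family \<psi>" "closed_cspan (range \<psi>) = K"
    and X: "\<And>n. (\<psi> n, w n *\<^sub>R \<psi> n) \<in> X"
  shows "(w has_sum Re t) UNIV" "t = of_real (Re t)" "(\<lambda>n. \<bar>w n\<bar>) summable_on UNIV"
proof -
  have "cinner (\<psi> n) (w n *\<^sub>R \<psi> n) = of_real (w n)" for n using \<psi>(1) by (simp add: orthonormal_family_def)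
  then have h: "((\<lambda>n. complex_of_real (w n)) has_sum t) UNIV" using has_trace_eval[OF t \<psi> X] by (simp only:)
  show r: "(w has_sum Re t) UNIV" using has_sum_Re[OF h] by simp
  show "t = of_real (Re t)" by (rule has_sum_unique[OF h has_sum_of_real[OF r]])
  show "(\<lambda>n. \<bar>w n\<bar>) summable_on UNIV"
    using summable_on_iff_abs_summable_on_real[THEN iffD1, OF has_sum_imp_summable[OF r]] by (simp only: real_norm_def)
qed

text \<open>The graph of a bounded operator is a closed subspace, so it contains
  \<open>fun_of_op f X\<close> once it contains the generating eigenpairs.\<close>

lemma fun_of_op_subset:
  assumes W: "bounded_clinear W" and X: "\<And>v a. (v, a *\<^sub>R v) \<in> X \<Longrightarrow> W v = f a *\<^sub>R v"
  shows "(v, u) \<in> fun_of_op f X \<Longrightarrow> W v = u"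
proof -
  have lin: "bounded_linear W" using W by (simp add: bounded_clinear_def)
  let ?G = "{p. W (fst p) = snd p}"
  have "closed ?G"
    by (intro closed_Collect_eq continuous_on_compose2[OF linear_continuous_on[OF lin, of UNIV]] continuous_on_fst continuous_on_snd continuous_on_id) auto
  moreover have "subspace ?G"
    by (rule subspaceI) (auto simp: linear_add linear_scale linear_0 bounded_linear.linear[OF lin])
  ultimately have "fun_of_op f X \<subseteq> ?G"
    unfolding fun_of_op_def by (intro closure_minimal span_minimal) (use X in auto)
  then show "(v, u) \<in> fun_of_op f X \<Longrightarrow> W v = u" by auto
qed

lemma fun_of_op_base: "(v, a *\<^sub>R v) \<in> X \<Longrightarrow> (v, f a *\<^sub>R v) \<in> fun_of_op f X"
  unfolding fun_of_op_def by (rule subsetD[OF closure_subset], rule span_base) blast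

lemma subspace_fun_of_op: "subspace (fun_of_op f X)"
  unfolding fun_of_op_def by (intro subspace_closure subspace_span)

lemma dense_Domain:
  assumes "subspace X" "\<And>n c. c *\<^sub>C \<psi> n \<in> Domain X"
  shows "closed_cspan (range \<psi>) \<subseteq> closure (Domain X)"
proof -
  have "Domain X = fst ` X" by force
  then have "subspace (Domain X)"
    using linear_subspace_image[OF linear_fst assms(1)] by simp
  then show ?thesis
    unfolding closed_cspan_def by (intro closure_mono span_minimal) (use assms(2) in auto)
qed

section \<open>Adjoints and gram operators\<close>

lemma cinner_inner: "cinner u v = Complex (inner u v) (inner (\<i> *\<^sub>C u) v)"
  by (simp add: inner_ell2_def complex_eq_iff)

text \<open>The coordinate at \<open>x\<close> of the adjoint applied to \<open>y\<close> is forced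
  to be \<open>cinner (V (ket x)) y\<close>. Square-summability follows by applying \<open>V\<close>
  to the finite vector \<open>u\<close> with these very coefficients: boundedness of
  \<open>V\<close> then bounds their squares.\<close>

lemma adjoint_exists:
  assumes V: "bounded_clinear V"
  shows "\<exists>V'. \<forall>x y. cinner (V x) y = cinner x (V' y)"
proof -
  have lin: "bounded_linear V" and sc: "\<And>c v. V (c *\<^sub>C v) = c *\<^sub>C V v"
    using V by (simp_all add: bounded_clinear_def clinear_def)
  obtain C where C: "\<And>v. norm (V v) \<le> norm v * C" using bounded_linear.bounded[OF lin] by blast
  have s: "(\<lambda>x. (cmod (cinner (V (ket x)) y))\<^sup>2) summable_on UNIV" for y
  proof (rule ell2_summable_bound(1)[where B = "(C * norm y)\<^sup>2"])
    fix F :: "'a set" assume F: "finite F"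
    define t where "t = (\<Sum>x\<in>F. (cmod (cinner (V (ket x)) y))\<^sup>2)"
    define u where "u = (\<Sum>x\<in>F. cinner (V (ket x)) y *\<^sub>C ket x)"
    have o: "orthonormal_on ket UNIV" by (auto simp: orthonormal_on_def coord_ket)
    have nu: "(norm u)\<^sup>2 = t" unfolding u_def t_def by (rule norm_orthonormal_sum[OF o F]) simp
    have "V u = (\<Sum>x\<in>F. cinner (V (ket x)) y *\<^sub>C V (ket x))"
      unfolding u_def by (simp add: linear_sum[OF bounded_linear.linear[OF lin]] sc)
    then have "cinner (V u) y = of_real t"
      by (simp add: cinner_sum_left t_def complex_norm_square mult.commute del: of_real_power)
    then have "t \<le> norm (V u) * norm y" using cinner_Cauchy_Schwarz[of "V u" y] by simp
    also have "\<dots> \<le> norm u * C * norm y" by (intro mult_right_mono C) simp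
    finally have le: "t \<le> norm u * (C * norm y)" by (simp add: mult.assoc)
    show "(\<Sum>x\<in>F. (cmod (cinner (V (ket x)) y))\<^sup>2) \<le> (C * norm y)\<^sup>2"
    proof (cases "norm u = 0")
      case True
      then show ?thesis using nu by (simp add: t_def)
    next
      case False
      moreover have "norm u * norm u \<le> norm u * (C * norm y)" using le nu by (simp add: power2_eq_square)
      ultimately have "norm u \<le> C * norm y" by (simp add: mult_le_cancel_left)
      then have "(norm u)\<^sup>2 \<le> (C * norm y)\<^sup>2" by (intro power_mono) auto
      then show ?thesis using nu t_def by simp
    qed
  qed
  define V' where "V' y = mk_ell2 (\<lambda>x. cinner (V (ket x)) y)" for y
  have V': "coord (V' y) x = cinner (V (ket x)) y" for x y
    using coord_mk_ell2[OF s] by (simp add: V'_def)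
  have "cinner (V v) y = cinner v (V' y)" for v y
  proof -
    have o: "orthonormal_on ket UNIV" by (auto simp: orthonormal_on_def coord_ket)
    have "closed_cspan (range (ket :: 'a \<Rightarrow> 'a ell2)) = UNIV"
      by (rule closed_cspan_eqI[OF o]) (auto intro: ell2_eqI)
    then have "((\<lambda>x. coord v x *\<^sub>C ket x) has_sum v) UNIV"
      using closed_cspan_Fourier[OF o, of v] by simp
    from has_sum_cinner_left[OF has_sum_bounded_linear[OF lin this], of y]
    have "((\<lambda>x. cnj (coord v x) * coord (V' y) x) has_sum cinner (V v) y) UNIV"
      by (simp add: sc V')
    then show ?thesis by (rule has_sum_unique[OF _ cinner_has_sum])
  qed
  then show ?thesis by blast
qed

text \<open>\<open>cinner_inner\<close> writes the imaginary part as a real inner product with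
  \<open>\<i> *\<^sub>C u\<close>, and complex linearity moves this factor past
  \<open>V\<close>.\<close>

lemma cinner_adjoint:
  assumes V: "bounded_clinear V"
  shows "cinner (V x) y = cinner x (adjoint V y)"
proof -
  have sc: "\<And>c v. V (c *\<^sub>C v) = c *\<^sub>C V v" using V by (simp add: bounded_clinear_def clinear_def)
  obtain V' where V': "\<forall>x y. cinner (V x) y = cinner x (V' y)" using adjoint_exists[OF V] by blast
  then have "\<exists>V'. \<forall>x y. inner (V x) y = inner x (V' y)" by (auto simp: inner_ell2_def)
  then have "\<forall>x y. inner (V x) y = inner x (adjoint V y)" unfolding adjoint_def by (rule someI_ex)
  then have *: "inner (V x) y = inner x (adjoint V y)" for x y by blast
  show ?thesis unfolding cinner_inner sc[symmetric] by (simp only: *)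
qed

text \<open>A positive combination of rank-one operators. It is applied to the horizon slices of
  scattered states, which are neither orthogonal nor normalized. The numbers
  \<open>p j * (norm (s j))\<^sup>2\<close> dominate the series, and by Parseval their sum is the
  trace in every basis.\<close>

lemma gram_operator:
  fixes K :: "'a ell2 set"
  assumes G: "\<And>f. ((\<lambda>j. (of_real (p j) * cinner (s j) f) *\<^sub>C s j) has_sum G f) UNIV"
    and p: "\<And>j. 0 \<le> p j" and t: "((\<lambda>j. p j * (norm (s j))\<^sup>2) has_sum t) UNIV"
    and K: "closed K" "subspace K" "\<And>c v. v \<in> K \<Longrightarrow> c *\<^sub>C v \<in> K" "\<And>j. s j \<in> K"
  shows "bounded_clinear G" "range G \<subseteq> K" "cinner u (G v) = cinner (G u) v" "0 \<le> Re (cinner v (G v))"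
    and "onb K B \<Longrightarrow> ((\<lambda>b. cinner b (G b)) has_sum of_real t) B"
proof -
  have c: "((\<lambda>j. of_real (p j) * cinner (s j) v * cnj (cinner (s j) u)) has_sum cinner u (G v)) UNIV" for u v
    using has_sum_cinner_right[OF G[of v], of u] by (simp add: cinner_commute[of u "s _"])
  show "bounded_clinear G"
  proof (rule bounded_clinearI)
    show "G (u + v) = G u + G v" for u v
      using has_sum_add[OF G[of u] G[of v]] G[of "u + v"]
      by (simp add: cinner_add_right distrib_left scaleC_add_left has_sum_unique)
    show "G (c *\<^sub>C v) = c *\<^sub>C G v" for c v
      using has_sum_scaleC[OF G[of v], of c] G[of "c *\<^sub>C v"] by (simp add: mult.left_commute has_sum_unique)
    fix v
    have le: "norm ((of_real (p j) * cinner (s j) v) *\<^sub>C s j) \<le> norm v * (p j * (norm (s j))\<^sup>2)" for j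
    proof -
      have "p j * cmod (cinner (s j) v) * norm (s j) \<le> p j * (norm (s j) * norm v) * norm (s j)"
        by (intro mult_right_mono mult_left_mono cinner_Cauchy_Schwarz p) simp
      then show ?thesis using p[of j] by (simp add: norm_mult power2_eq_square ac_simps)
    qed
    have "((\<lambda>j. norm v * (p j * (norm (s j))\<^sup>2)) has_sum norm v * t) UNIV" by (rule has_sum_cmult_right[OF t])
    then show "norm (G v) \<le> norm v * t" using norm_infsum_le[OF G[of v] _ le] by blast
  qed
  show "range G \<subseteq> K"
  proof safe
    fix v
    show "G v \<in> K" by (rule has_sum_in_closed_subspace[OF K(1,2) G]) (use K in auto)
  qed
  have "((\<lambda>j. of_real (p j) * cinner (s j) v * cnj (cinner (s j) u)) has_sum cinner (G u) v) UNIV" for u v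
  proof -
    have "((\<lambda>j. cnj (of_real (p j) * cinner (s j) u * cnj (cinner (s j) v))) has_sum cnj (cinner v (G u))) UNIV"
      unfolding has_sum_cnj_iff by (rule c)
    then show ?thesis by (simp add: cinner_commute[of "G u" v] ac_simps)
  qed
  then show "cinner u (G v) = cinner (G u) v" using c has_sum_unique by blast
  have sq: "of_real (p j) * cinner (s j) v * cnj (cinner (s j) v) = complex_of_real (p j * (cmod (cinner (s j) v))\<^sup>2)" for j v
    unfolding of_real_mult complex_norm_square by simp
  have r: "((\<lambda>j. complex_of_real (p j * (cmod (cinner (s j) v))\<^sup>2)) has_sum cinner v (G v)) UNIV" for v
    using c[of v v] by (simp only: sq)
  show "0 \<le> Re (cinner v (G v))"
    by (rule has_sum_nonneg[OF has_sum_Re[OF r]]) (simp add: p)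
  show "((\<lambda>b. cinner b (G b)) has_sum of_real t) B" if B: "onb K B"
  proof -
    have B': "orthonormal_on (\<lambda>b. b) B" "closed_cspan ((\<lambda>b. b) ` B) = K" using B by (simp_all add: onb_orthonormal_on)
    have inner: "((\<lambda>b. case (j, b) of (j, b) \<Rightarrow> p j * (cmod (cinner b (s j)))\<^sup>2) has_sum p j * (norm (s j))\<^sup>2) B" for j
      using has_sum_cmult_right[OF Parseval_norm[OF B'(1), of "s j"], of "p j"] B'(2) K(4) by simp
    have "((\<lambda>(j, b). p j * (cmod (cinner b (s j)))\<^sup>2) has_sum t) (UNIV \<times> B)"
      by (rule has_sum_SigmaI[OF inner t], rule summable_on_SigmaI[OF inner has_sum_imp_summable[OF t]]) (use p in auto)
    then have "((\<lambda>(b, j). p j * (cmod (cinner b (s j)))\<^sup>2) has_sum t) (B \<times> UNIV)"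
      by (subst (asm) has_sum_swap) simp
    then have "((\<lambda>x. complex_of_real (case x of (b, j) \<Rightarrow> p j * (cmod (cinner b (s j)))\<^sup>2)) has_sum of_real t) (B \<times> UNIV)"
      by (rule has_sum_of_real)
    then show ?thesis
    proof (rule has_sum_SigmaD)
      fix b
      have "cmod (cinner (s j) b) = cmod (cinner b (s j))" for j by (subst cinner_commute) simp
      then show "((\<lambda>j. complex_of_real (case (b, j) of (b, j) \<Rightarrow> p j * (cmod (cinner b (s j)))\<^sup>2)) has_sum cinner b (G b)) UNIV"
        using r[of b] by simp
    qed
  qed
qed

section \<open>The evolution map\<close>

text \<open>The operator before the partial trace is a weighted sum of the projections on the
  vectors \<open>fock_split (S (\<psi> k))\<close>; tracing out the horizon cuts each vector into
  its slices. The second sum dominates the first in norm, so \<open>k\<close> and \<open>y\<close>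
  may be summed in either order.\<close>

lemma evolve_has_sum:
  fixes S :: "'z list ell2 \<Rightarrow> ('x + 'y) list ell2" and \<psi> :: "'k \<Rightarrow> 'z list ell2"
  assumes V: "bounded_clinear (fock_split \<circ> S)" and \<psi>: "orthonormal_family \<psi>"
    and w: "\<forall>k. 0 \<le> w k" "w summable_on UNIV" and iso: "\<And>k. norm (fock_split (S (\<psi> k))) = 1"
  shows "((\<lambda>(k, y). (of_real (w k) * cinner (slice2 (fock_split (S (\<psi> k))) y) f) *\<^sub>C slice2 (fock_split (S (\<psi> k))) y)
      has_sum evolve S (diag_op \<psi> w) f) UNIV"
    and "((\<lambda>(k, y). w k * (norm (slice2 (fock_split (S (\<psi> k))) y))\<^sup>2) has_sum (\<Sum>\<^sub>\<infinity>k. w k)) UNIV"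
proof -
  let ?V = "fock_split \<circ> S" and ?s = "\<lambda>k y. slice2 (fock_split (S (\<psi> k))) y"
  have lin: "bounded_linear ?V" and sc: "\<And>c v. ?V (c *\<^sub>C v) = c *\<^sub>C ?V v"
    using V by (simp_all add: bounded_clinear_def clinear_def)
  have inner: "((\<lambda>y. case (k, y) of (k, y) \<Rightarrow> w k * (norm (?s k y))\<^sup>2) has_sum w k) UNIV" for k
    using has_sum_cmult_right[OF slice2_norm[of "fock_split (S (\<psi> k))"], of "w k"] by (simp add: iso)
  show t: "((\<lambda>(k, y). w k * (norm (?s k y))\<^sup>2) has_sum (\<Sum>\<^sub>\<infinity>k. w k)) UNIV"
    unfolding UNIV_Times_UNIV[symmetric]
    by (rule has_sum_SigmaI[OF inner has_sum_infsum[OF w(2)]], rule summable_on_SigmaI[OF inner w(2)]) (use w in auto)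
  let ?g = "\<lambda>(k, y). (of_real (w k) * cinner (?s k y) f) *\<^sub>C ?s k y"
  have "(\<lambda>x. norm (?g x)) summable_on UNIV"
  proof (rule summable_on_comparison_test)
    show "(\<lambda>x. norm f * (case x of (k, y) \<Rightarrow> w k * (norm (?s k y))\<^sup>2)) summable_on UNIV"
      by (intro summable_on_cmult_right has_sum_imp_summable[OF t])
    fix x :: "'k \<times> 'y list"
    obtain k y where x: "x = (k, y)" by (cases x)
    have "w k * cmod (cinner (?s k y) f) * norm (?s k y) \<le> w k * (norm (?s k y) * norm f) * norm (?s k y)"
      by (intro mult_right_mono mult_left_mono cinner_Cauchy_Schwarz w(1)[rule_format]) simp
    then show "norm (?g x) \<le> norm f * (case x of (k, y) \<Rightarrow> w k * (norm (?s k y))\<^sup>2)"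
      using w(1)[rule_format, of k] by (simp add: x norm_mult power2_eq_square ac_simps)
  qed simp
  then have "?g summable_on UNIV" by (rule abs_summable_summable)
  then obtain G where G: "(?g has_sum G) UNIV" by (auto simp: summable_on_def)
  have wb: "\<forall>k. \<bar>w k\<bar> \<le> (\<Sum>\<^sub>\<infinity>k. \<bar>w k\<bar>)"
    by (rule summable_bounded) (use w in simp)
  have W: "((\<lambda>k. (of_real (w k) * cinner (fock_split (S (\<psi> k))) u) *\<^sub>C fock_split (S (\<psi> k))) has_sum
      (?V \<circ> diag_op \<psi> w \<circ> adjoint ?V) u) UNIV" for u
  proof -
    have "((\<lambda>k. ?V ((of_real (w k) * cinner (\<psi> k) (adjoint ?V u)) *\<^sub>C \<psi> k)) has_sum ?V (diag_op \<psi> w (adjoint ?V u))) UNIV"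
      by (rule has_sum_bounded_linear[OF lin diag_op_has_sum[OF \<psi> wb]])
    then show ?thesis unfolding sc cinner_adjoint[OF V, symmetric] by simp
  qed
  have "coord G x = (\<Sum>\<^sub>\<infinity>y. coord ((?V \<circ> diag_op \<psi> w \<circ> adjoint ?V) (tensor2 f (ket y))) (x, y))" for x
  proof -
    have "((\<lambda>p. coord (?g p) x) has_sum coord G x) (UNIV \<times> UNIV)" using has_sum_coord[OF G] by simp
    then have "((\<lambda>(y, k). coord (?g (k, y)) x) has_sum coord G x) (UNIV \<times> UNIV)" by (subst (asm) has_sum_swap)
    then have "((\<lambda>y. coord ((?V \<circ> diag_op \<psi> w \<circ> adjoint ?V) (tensor2 f (ket y))) (x, y)) has_sum coord G x) UNIV"
    proof (rule has_sum_SigmaD)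
      fix y
      have "cinner (fock_split (S (\<psi> k))) (tensor2 f (ket y)) = cinner (?s k y) f" for k
        by (subst (1 2) cinner_commute) (simp add: cinner_tensor2_ket)
      then show "((\<lambda>k. case (y, k) of (y, k) \<Rightarrow> coord (?g (k, y)) x) has_sum
          coord ((?V \<circ> diag_op \<psi> w \<circ> adjoint ?V) (tensor2 f (ket y))) (x, y)) UNIV"
        using has_sum_coord[OF W[of "tensor2 f (ket y)"], of "(x, y)"] by (simp add: coord_slice2)
    qed
    then show ?thesis by (simp add: infsumI)
  qed
  \<comment> \<open>The coordinates computed by \<open>partial_trace\<close> are those of the vector
    \<open>G\<close>, so \<open>mk_ell2\<close> returns \<open>G\<close> and not its default
    value.\<close>
  then have "(\<lambda>x. \<Sum>\<^sub>\<infinity>y. coord ((?V \<circ> diag_op \<psi> w \<circ> adjoint ?V) (tensor2 f (ket y))) (x, y)) = coord G"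
    by (intro ext) (rule sym)
  then have "evolve S (diag_op \<psi> w) f = G"
    unfolding evolve_def partial_trace_def by (simp only: mk_ell2_coord)
  then show "(?g has_sum evolve S (diag_op \<psi> w) f) UNIV" using G by simp
qed

section \<open>Simultaneous diagonalization\<close>

lemma proj_norm:
  assumes "orthonormal_on b I" "finite F" "F \<subseteq> I"
  shows "(norm (v - (\<Sum>i\<in>F. cinner (b i) v *\<^sub>C b i)))\<^sup>2 = (norm v)\<^sup>2 - (\<Sum>i\<in>F. (cmod (cinner (b i) v))\<^sup>2)"
proof -
  define u where "u = (\<Sum>i\<in>F. cinner (b i) v *\<^sub>C b i)"
  have u: "(norm u)\<^sup>2 = (\<Sum>i\<in>F. (cmod (cinner (b i) v))\<^sup>2)"
    unfolding u_def by (rule norm_orthonormal_sum[OF assms])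
  have "cinner u v = of_real ((norm u)\<^sup>2)"
    unfolding u by (simp add: u_def cinner_sum_left complex_norm_square mult.commute del: of_real_power)
  then have "inner u v = (norm u)\<^sup>2" by (simp add: inner_ell2_def)
  moreover have "(norm (v - u))\<^sup>2 = (norm v)\<^sup>2 + (norm u)\<^sup>2 - 2 * inner u v"
    by (simp add: power2_norm_eq_inner inner_diff inner_commute)
  ultimately show ?thesis using u by (simp add: u_def)
qed

lemma proj_orthogonal:
  assumes b: "orthonormal_on b I" and F: "finite F" "F \<subseteq> I" and j: "j \<in> F"
  shows "cinner (b j) (v - (\<Sum>i\<in>F. cinner (b i) v *\<^sub>C b i)) = 0"
proof -
  have "(\<Sum>i\<in>F. cinner (b i) v * cinner (b j) (b i)) = (\<Sum>i\<in>F. if i = j then cinner (b j) v else 0)"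
    by (intro sum.cong refl) (use F j in \<open>auto simp: orthonormal_onD[OF b] subset_iff\<close>)
  then show ?thesis using F j by (simp add: cinner_diff_right cinner_sum_right)
qed

text \<open>One coordinate at a time, the box is the continuous image of a closed disc times a
  smaller box. The unit sphere of a finite-dimensional eigenspace is a closed subset of such a box,
  hence compact.\<close>

lemma compact_orthonormal_box:
  fixes b :: "'i \<Rightarrow> 'a ell2"
  assumes "finite L"
  shows "compact {\<Sum>i\<in>L. c i *\<^sub>C b i | c. \<forall>i\<in>L. cmod (c i) \<le> 1}"
  using assms
proof (induction L)
  case (insert i L)
  let ?C = "\<lambda>L. {\<Sum>i\<in>L. c i *\<^sub>C b i | c. \<forall>i\<in>L. cmod (c i) \<le> 1}"
  have "?C (insert i L) = (\<lambda>(z, w). z *\<^sub>C b i + w) ` (cball 0 1 \<times> ?C L)" (is "?A = ?B")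
  proof (intro equalityI subsetI)
    fix v assume "v \<in> ?A"
    then obtain c where "\<forall>i\<in>insert i L. cmod (c i) \<le> 1" "v = (\<Sum>i\<in>insert i L. c i *\<^sub>C b i)" by blast
    then show "v \<in> ?B" using insert.hyps
      by (intro image_eqI[of _ _ "(c i, \<Sum>i\<in>L. c i *\<^sub>C b i)"]) auto
  next
    fix v assume "v \<in> ?B"
    then obtain z c where zc: "cmod z \<le> 1" "\<forall>i\<in>L. cmod (c i) \<le> 1" "v = z *\<^sub>C b i + (\<Sum>i\<in>L. c i *\<^sub>C b i)" by auto
    have "(\<Sum>j\<in>L. (c(i := z)) j *\<^sub>C b j) = (\<Sum>j\<in>L. c j *\<^sub>C b j)"
      using insert.hyps by (intro sum.cong refl) auto
    then have "v = (\<Sum>j\<in>insert i L. (c(i := z)) j *\<^sub>C b j)" using insert.hyps zc by simp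
    then show "v \<in> ?A" using zc insert.hyps by (intro CollectI exI[of _ "c(i := z)"]) auto
  qed
  moreover have "continuous_on (cball 0 1 \<times> ?C L) (\<lambda>(z, w). z *\<^sub>C b i + w)"
    unfolding case_prod_unfold
    by (intro continuous_intros continuous_on_compose2[OF linear_continuous_on[OF bounded_linear_scaleC_left, of UNIV]]) auto
  then have "compact ((\<lambda>(z, w). z *\<^sub>C b i + w) ` (cball 0 1 \<times> ?C L))"
    by (intro compact_continuous_image compact_Times compact_cball insert.IH)
  ultimately show ?case by simp
qed simp

text \<open>A maximizer of the quadratic form on the unit sphere is an eigenvector.\<close>

lemma eigenvector_exists:
  fixes R :: "'a ell2 \<Rightarrow> 'a ell2"
  assumes R: "bounded_clinear R" and sa: "\<And>u v. cinner u (R v) = cinner (R u) v"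
    and F: "subspace F" "\<And>v. v \<in> F \<Longrightarrow> R v \<in> F"
    and comp: "compact {v \<in> F. norm v = 1}" and ne: "\<exists>v\<in>F. v \<noteq> 0"
  shows "\<exists>v\<in>F. norm v = 1 \<and> (\<exists>a. R v = a *\<^sub>R v)"
proof -
  have lin: "bounded_linear R" using R by (simp add: bounded_clinear_def)
  note lR = bounded_linear.linear[OF lin]
  define f where "f v = inner v (R v)" for v
  obtain v0 where v0: "v0 \<in> F" "v0 \<noteq> 0" using ne by blast
  then have "(1 / norm v0) *\<^sub>R v0 \<in> {v \<in> F. norm v = 1}" using F(1) by (auto intro: subspace_scale)
  then have nonempty: "{v \<in> F. norm v = 1} \<noteq> {}" by blast
  have "continuous_on {v \<in> F. norm v = 1} f"
    unfolding f_def by (intro continuous_intros linear_continuous_on lin)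
  then obtain v where v: "v \<in> F" "norm v = 1" and max: "\<And>u. u \<in> F \<Longrightarrow> norm u = 1 \<Longrightarrow> f u \<le> f v"
    using continuous_attains_sup[OF comp nonempty, of f] by auto
  define M where "M = f v"
  have Q: "0 \<le> M * (norm w)\<^sup>2 - f w" if "w \<in> F" for w
  proof (cases "w = 0")
    case True
    then show ?thesis by (simp add: f_def)
  next
    case False
    have "f ((1 / norm w) *\<^sub>R w) \<le> M" unfolding M_def
      by (rule max) (use False that F(1) in \<open>auto intro: subspace_scale\<close>)
    moreover have "f ((1 / norm w) *\<^sub>R w) = f w / (norm w)\<^sup>2"
      by (simp add: f_def linear_scale[OF lR] power2_eq_square)
    ultimately show ?thesis using False by (simp add: divide_simps mult.commute split: if_splits)
  qed
  have sym: "inner x (R y) = inner y (R x)" for x y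
    using sa[of x y] by (simp add: inner_ell2_def) (metis inner_commute inner_ell2_def)
  \<comment> \<open>Half the gradient at \<open>v\<close> of the form
    \<open>M * (norm w)\<^sup>2 - f w\<close>, which is nonnegative on \<open>F\<close> by
    \<open>Q\<close> and vanishes at \<open>v\<close>. A nonzero gradient would lead to negative
    values.\<close>
  define z where "z = M *\<^sub>R v - R v"
  have z: "z \<in> F" unfolding z_def using v(1) F by (intro subspace_diff subspace_scale) auto
  have quad: "0 \<le> 2 * t * inner z z + t\<^sup>2 * (M * (norm z)\<^sup>2 - f z)" for t
  proof -
    have "v + t *\<^sub>R z \<in> F" using v(1) z F(1) by (intro subspace_add subspace_scale)
    from Q[OF this] have "0 \<le> M * (norm (v + t *\<^sub>R z))\<^sup>2 - f (v + t *\<^sub>R z)" .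
    also have "(norm (v + t *\<^sub>R z))\<^sup>2 = (norm v)\<^sup>2 + 2 * t * inner z v + t\<^sup>2 * (norm z)\<^sup>2"
      unfolding power2_norm_eq_inner
      by (simp add: inner_add_left inner_add_right inner_commute[of z v] power2_eq_square algebra_simps)
    also have "f (v + t *\<^sub>R z) = f v + 2 * t * inner z (R v) + t\<^sup>2 * f z"
      by (simp add: f_def linear_add[OF lR] linear_scale[OF lR] inner_add sym[of v z] power2_eq_square algebra_simps)
    also have "M * ((norm v)\<^sup>2 + 2 * t * inner z v + t\<^sup>2 * (norm z)\<^sup>2) - (f v + 2 * t * inner z (R v) + t\<^sup>2 * f z)
        = 2 * t * (M * inner z v - inner z (R v)) + t\<^sup>2 * (M * (norm z)\<^sup>2 - f z)"
      using v(2) by (simp add: M_def algebra_simps)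
    also have "M * inner z v - inner z (R v) = inner z z" by (simp add: z_def inner_diff_right inner_diff_left algebra_simps)
    finally show ?thesis .
  qed
  have "inner z z \<le> 0"
  proof (rule ccontr)
    assume "\<not> inner z z \<le> 0"
    then have pos: "0 < inner z z" by linarith
    define C where "C = M * (norm z)\<^sup>2 - f z"
    have C: "0 \<le> C" unfolding C_def by (rule Q[OF z])
    \<comment> \<open>A step so short that the quadratic term is at most half of the linear one;
      \<open>C + 1\<close> avoids a zero denominator.\<close>
    define u where "u = inner z z / (C + 1)"
    have u: "0 < u" "u * C \<le> inner z z" using pos C by (simp_all add: u_def field_simps)
    have "u * (u * C) \<le> u * inner z z" using u by (intro mult_left_mono) auto
    moreover have "0 < u * inner z z" using u pos by simp
    ultimately show False using quad[of "- u"] by (simp add: C_def power2_eq_square mult.assoc)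
  qed
  then have "z = 0" by (metis inner_gt_zero_iff not_le)
  then have "R v = M *\<^sub>R v" by (simp add: z_def)
  then show ?thesis using v by blast
qed

text \<open>Enough equal positive terms would exceed the total. For the thermal weights this makes
  the eigenspaces finite-dimensional.\<close>

lemma finite_level_set:
  fixes q :: "'i \<Rightarrow> real"
  assumes q: "\<And>n. 0 < q n" "q summable_on UNIV" shows "finite {m. q m = c}"
proof (rule ccontr)
  assume inf: "infinite {m. q m = c}"
  then obtain m where "q m = c" by (metis (mono_tags, lifting) empty_Collect_eq finite.emptyI)
  then have c: "0 < c" using q(1) by metis
  obtain k :: nat where k: "infsum q UNIV < of_nat k * c" using c ex_less_of_nat_mult by blast
  obtain F where F: "F \<subseteq> {m. q m = c}" "finite F" "card F = k" using inf infinite_arbitrarily_large by blast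
  have "of_nat k * c = (\<Sum>m\<in>F. q m)" using F by (simp add: subset_iff)
  also have "\<dots> \<le> infsum q UNIV" by (rule finite_sum_le_infsum[OF q(2) F(2)]) (use q(1) in \<open>auto intro: less_imp_le\<close>)
  finally show False using k by simp
qed

text \<open>The eigenspaces \<open>E c\<close> of \<open>diag_op b q\<close> are spanned by finitely
  many \<open>b m\<close> and are invariant under \<open>R\<close>, which commutes with it. Inside
  each, \<open>block\<close> collects eigenvectors of \<open>R\<close> one by one from the
  orthogonal complement of those already found. Sums of squared overlaps with the \<open>b m\<close>
  take the place of dimensions.\<close>

lemma simultaneous_eigenbasis:
  fixes b :: "'i \<Rightarrow> 'a ell2" and R :: "'a ell2 \<Rightarrow> 'a ell2"
  assumes b: "orthonormal_family b" and q: "\<And>n. 0 < q n" "q summable_on UNIV"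
    and R: "bounded_clinear R" "range R \<subseteq> closed_cspan (range b)" "\<And>u v. cinner u (R v) = cinner (R u) v"
    and com: "R \<circ> diag_op b q = diag_op b q \<circ> R"
  shows "\<exists>\<psi> p. orthonormal_family \<psi> \<and> closed_cspan (range \<psi>) = closed_cspan (range b) \<and>
    (\<forall>n. R (\<psi> n) = p n *\<^sub>R \<psi> n) \<and> (\<forall>m n. q m \<noteq> q n \<longrightarrow> cinner (b m) (\<psi> n) = 0)"
proof -
  define K where "K = closed_cspan (range b)"
  define L where "L c = {m. q m = c}" for c
  define E where "E c = {v \<in> K. \<forall>m. q m \<noteq> c \<longrightarrow> cinner (b m) v = 0}" for c
  have o: "orthonormal_on b UNIV" using b by (simp add: orthonormal_family_on)
  have oL: "orthonormal_on b A" for A using o by (auto simp: orthonormal_on_def)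
  have finL: "finite (L c)" for c unfolding L_def by (rule finite_level_set[OF q])
  have lin: "bounded_linear R" and sc: "\<And>c v. R (c *\<^sub>C v) = c *\<^sub>C R v"
    using R(1) by (simp_all add: bounded_clinear_def clinear_def)
  have qb: "\<forall>n. \<bar>q n\<bar> \<le> (\<Sum>\<^sub>\<infinity>n. \<bar>q n\<bar>)"
    by (rule summable_bounded) (use q in \<open>simp add: less_imp_le\<close>)
  have Esub: "subspace (E c)" for c
    by (rule subspaceI)
      (auto simp: E_def K_def cinner_add_right subspace_0 subspace_add subspace_scale subspace_closed_cspan)
  have EscC: "a *\<^sub>C v \<in> E c" if "v \<in> E c" for a v c using that by (simp add: E_def K_def closed_cspan_scaleC)
  have Eclosed: "closed (E c)" for c
  proof -
    have "E c = K \<inter> (\<Inter>m\<in>{m. q m \<noteq> c}. {v. cinner (b m) v = 0})" by (auto simp: E_def)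
    moreover have "closed {v. cinner (b m) v = 0}" for m
      by (intro closed_Collect_eq linear_continuous_on bounded_linear_cinner_right continuous_on_const)
    ultimately show ?thesis unfolding K_def by (auto intro!: closed_Int closed_INT closed_closed_cspan)
  qed
  have Rinv: "R v \<in> E c" if v: "v \<in> E c" for v c
  proof -
    have "diag_op b q v = c *\<^sub>R v"
    proof (rule diag_op_eqI[OF b qb])
      show "c *\<^sub>R v \<in> closed_cspan (range b)" using v by (simp add: E_def K_def subspace_scale subspace_closed_cspan)
      show "cinner (b n) (c *\<^sub>R v) = of_real (q n) * cinner (b n) v" for n
        using v by (cases "q n = c") (auto simp: E_def)
    qed
    then have "diag_op b q (R v) = c *\<^sub>R R v"
      using fun_cong[OF com, of v] by (simp add: linear_scale[OF bounded_linear.linear[OF lin]])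
    then have "of_real (q m) * cinner (b m) (R v) = of_real c * cinner (b m) (R v)" for m
      using diag_op_coeff[OF b qb, of m "R v"] by auto
    then have "cinner (b m) (R v) = 0" if "q m \<noteq> c" for m using that by (metis mult_cancel_right of_real_eq_iff)
    then show ?thesis using R(2) by (auto simp: E_def K_def)
  qed
  have Eb: "b m \<in> E (q m)" for m
    using b by (auto simp: E_def K_def closed_cspan_base orthonormal_family_def)
  have Efin: "v = (\<Sum>m\<in>L c. cinner (b m) v *\<^sub>C b m)" if v: "v \<in> E c" for v c
  proof -
    have "((\<lambda>m. cinner (b m) v *\<^sub>C b m) has_sum v) UNIV"
      by (rule closed_cspan_Fourier[OF o]) (use v in \<open>simp add: E_def K_def\<close>)
    moreover have "((\<lambda>m. cinner (b m) v *\<^sub>C b m) has_sum (\<Sum>m\<in>L c. cinner (b m) v *\<^sub>C b m)) UNIV"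
      by (rule has_sum_finite_neutralI[OF finL]) (use v in \<open>auto simp: E_def L_def\<close>)
    ultimately show ?thesis by (rule has_sum_unique)
  qed
  have Enorm: "(\<Sum>m\<in>L c. (cmod (cinner (b m) v))\<^sup>2) = (norm v)\<^sup>2" if v: "v \<in> E c" for v c
    using norm_orthonormal_sum[OF o finL[of c], of "\<lambda>m. cinner (b m) v"] Efin[OF v] by simp
  have swap: "cmod (cinner u v) = cmod (cinner v u)" for u v :: "'a ell2"
    by (subst cinner_commute) simp
  \<comment> \<open>Each unit vector of \<open>E c\<close> has total squared overlap 1 with the
    \<open>b m\<close> of its level, so the double sum counts the vectors.\<close>
  have count: "(\<Sum>m\<in>L c. \<Sum>n\<in>A. (cmod (cinner (\<psi> n) (b m)))\<^sup>2) = card A"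
    if "orthonormal_on \<psi> A" "\<And>n. n \<in> A \<Longrightarrow> \<psi> n \<in> E c" for \<psi> A c
  proof -
    have "(\<Sum>m\<in>L c. \<Sum>n\<in>A. (cmod (cinner (\<psi> n) (b m)))\<^sup>2) = (\<Sum>n\<in>A. \<Sum>m\<in>L c. (cmod (cinner (b m) (\<psi> n)))\<^sup>2)"
      by (subst sum.swap) (simp add: swap[of "\<psi> _"])
    also have "\<dots> = (\<Sum>n\<in>A. 1)"
      by (intro sum.cong refl) (simp add: Enorm[OF that(2)] orthonormal_norm[OF that(1)])
    finally show ?thesis by simp
  qed
  have block: "\<exists>\<psi> p. orthonormal_on \<psi> A \<and> (\<forall>n\<in>A. \<psi> n \<in> E c \<and> R (\<psi> n) = p n *\<^sub>R \<psi> n)" if "finite A" "A \<subseteq> L c" for A c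
    using that
  proof (induction A)
    case empty
    then show ?case by (auto simp: orthonormal_on_def)
  next
    case (insert a A)
    then obtain \<psi> p where \<psi>: "orthonormal_on \<psi> A" and \<psi>E: "\<And>n. n \<in> A \<Longrightarrow> \<psi> n \<in> E c"
      and ev: "\<And>n. n \<in> A \<Longrightarrow> R (\<psi> n) = p n *\<^sub>R \<psi> n" by blast
    define F where "F = {v \<in> E c. \<forall>n\<in>A. cinner (\<psi> n) v = 0}"
    have Fsub: "subspace F"
      by (rule subspaceI) (auto simp: F_def cinner_add_right subspace_0[OF Esub] subspace_add[OF Esub] subspace_scale[OF Esub])
    have FR: "R v \<in> F" if "v \<in> F" for v
      using that Rinv by (auto simp: F_def R(3) ev)
    have "closed F"
    proof -
      have "F = E c \<inter> (\<Inter>n\<in>A. {v. cinner (\<psi> n) v = 0})" by (auto simp: F_def)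
      moreover have "closed {v. cinner (\<psi> n) v = 0}" for n
        by (intro closed_Collect_eq linear_continuous_on bounded_linear_cinner_right continuous_on_const)
      ultimately show ?thesis by (auto intro!: closed_Int closed_INT Eclosed)
    qed
    then have cl: "closed {v \<in> F. norm v = 1}"
      by (intro closed_Collect_conj[of "\<lambda>v. v \<in> F", simplified] closed_Collect_eq continuous_intros) simp
    have sub: "{v \<in> F. norm v = 1} \<subseteq> {\<Sum>i\<in>L c. z i *\<^sub>C b i | z. \<forall>i\<in>L c. cmod (z i) \<le> 1}"
    proof
      fix v assume v: "v \<in> {v \<in> F. norm v = 1}"
      then have "v = (\<Sum>m\<in>L c. cinner (b m) v *\<^sub>C b m)" by (intro Efin) (simp add: F_def)
      moreover have "cmod (cinner (b m) v) \<le> 1" for m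
        using cinner_Cauchy_Schwarz[of "b m" v] v orthonormal_norm[OF o, of m] by simp
      ultimately show "v \<in> {\<Sum>i\<in>L c. z i *\<^sub>C b i | z. \<forall>i\<in>L c. cmod (z i) \<le> 1}"
        by (intro CollectI exI[of _ "\<lambda>m. cinner (b m) v"] conjI ballI)
    qed
    have comp: "compact {v \<in> F. norm v = 1}"
      using closed_Int_compact[OF cl compact_orthonormal_box[OF finL[of c], of b]] unfolding inf.absorb1[OF sub] .
    \<comment> \<open>With fewer vectors than indices in \<open>L c\<close>, the average squared
      overlap is below 1, so some \<open>b m\<close> leaves a nonzero remainder orthogonal to all of
      them.\<close>
    have ne: "\<exists>v\<in>F. v \<noteq> 0"
    proof -
      have "card A < card (L c)"
        using insert.prems insert.hyps finL by (metis card_mono card_insert_disjoint Suc_le_lessD)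
      then have "(\<Sum>m\<in>L c. \<Sum>n\<in>A. (cmod (cinner (\<psi> n) (b m)))\<^sup>2) < (\<Sum>m\<in>L c. 1)"
        using count[OF \<psi> \<psi>E] by simp
      then obtain m where m: "m \<in> L c" "(\<Sum>n\<in>A. (cmod (cinner (\<psi> n) (b m)))\<^sup>2) < 1"
        by (metis (mono_tags, lifting) linorder_not_le sum_mono)
      let ?v = "b m - (\<Sum>n\<in>A. cinner (\<psi> n) (b m) *\<^sub>C \<psi> n)"
      have "b m \<in> E c" using Eb[of m] m(1) by (simp add: L_def)
      then have "?v \<in> E c"
        by (intro subspace_diff subspace_sum Esub EscC \<psi>E) 
      then have "?v \<in> F" using proj_orthogonal[OF \<psi> insert.hyps(1)] by (simp add: F_def)
      moreover have "(norm ?v)\<^sup>2 > 0"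
        using proj_norm[OF \<psi> insert.hyps(1) order_refl, of "b m"] m(2) orthonormal_norm[OF o, of m] by simp
      then have "?v \<noteq> 0" by auto
      ultimately show ?thesis by blast
    qed
    obtain v r where v: "v \<in> F" "norm v = 1" "R v = r *\<^sub>R v"
      using eigenvector_exists[OF R(1,3) Fsub FR comp ne] by blast
    have vv: "cinner v v = 1" using v(2) by (simp add: cinner_norm)
    have perp: "cinner (\<psi> n) v = 0" "cinner v (\<psi> n) = 0" if "n \<in> A" for n
      using v(1) that by (auto simp: F_def cinner_commute[of v])
    have "orthonormal_on (\<psi>(a := v)) (insert a A)"
      unfolding orthonormal_on_def using insert.hyps(2) perp vv
      by (auto simp: orthonormal_onD[OF \<psi>])
    moreover have "\<forall>n\<in>insert a A. (\<psi>(a := v)) n \<in> E c \<and> R ((\<psi>(a := v)) n) = (p(a := r)) n *\<^sub>R (\<psi>(a := v)) n"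
      using v insert.hyps(2) \<psi>E ev by (auto simp: F_def)
    ultimately show ?case by blast
  qed
  have "\<forall>c. \<exists>\<psi> p. orthonormal_on \<psi> (L c) \<and> (\<forall>n\<in>L c. \<psi> n \<in> E c \<and> R (\<psi> n) = p n *\<^sub>R \<psi> n)"
    using block finL by blast
  then obtain \<Psi> P where \<Psi>: "\<And>c. orthonormal_on (\<Psi> c) (L c)" "\<And>c n. n \<in> L c \<Longrightarrow> \<Psi> c n \<in> E c"
    "\<And>c n. n \<in> L c \<Longrightarrow> R (\<Psi> c n) = P c n *\<^sub>R \<Psi> c n"
    by metis
  \<comment> \<open>Eigenvectors of level \<open>c\<close> are numbered by \<open>L c\<close>
    itself, so the index type is kept and \<open>\<psi> n\<close> belongs to the eigenvalue
    \<open>q n\<close> of \<open>diag_op b q\<close>.\<close>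
  define \<psi> where "\<psi> n = \<Psi> (q n) n" for n
  define p where "p n = P (q n) n" for n
  have inL: "n \<in> L (q n)" for n by (simp add: L_def)
  have \<psi>E: "\<psi> n \<in> E (q n)" for n unfolding \<psi>_def by (rule \<Psi>(2)[OF inL])
  have on: "orthonormal_family \<psi>"
    unfolding orthonormal_family_def
  proof (intro allI)
    fix i j
    show "cinner (\<psi> i) (\<psi> j) = (if i = j then 1 else 0)"
    proof (cases "q i = q j")
      case True
      then show ?thesis using orthonormal_onD[OF \<Psi>(1)[of "q i"], of i j] by (simp add: \<psi>_def L_def)
    next
      case False
      have "((\<lambda>n. cinner (\<psi> i) (b n) * cinner (b n) (\<psi> j)) has_sum cinner (\<psi> i) (\<psi> j)) UNIV"
        by (rule Parseval[OF o]) (use \<psi>E[of j] in \<open>simp add: E_def K_def\<close>)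
      moreover have "cinner (\<psi> i) (b n) * cinner (b n) (\<psi> j) = 0" for n
        using \<psi>E[of i] \<psi>E[of j] False by (cases "q n = q i") (auto simp: E_def cinner_commute[of "\<psi> i"])
      ultimately show ?thesis using False by (auto simp: has_sum_unique[OF _ has_sum_0_simp])
    qed
  qed
  \<comment> \<open>There are as many vectors as indices in \<open>L (q m)\<close>. The overlaps sum
    to this number while Bessel bounds the share of each \<open>b m\<close> by 1, so every bound is
    attained and \<open>b m\<close> equals its projection.\<close>
  have full: "(norm (b m - (\<Sum>n\<in>L (q m). cinner (\<psi> n) (b m) *\<^sub>C \<psi> n)))\<^sup>2 = 0" for m
  proof -
    have \<psi>L: "orthonormal_on \<psi> (L (q m))" using on by (auto simp: orthonormal_on_def orthonormal_family_def)
    have "(\<Sum>k\<in>L (q m). 1 - (\<Sum>n\<in>L (q m). (cmod (cinner (\<psi> n) (b k)))\<^sup>2)) = 0"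
    proof -
      have "\<psi> n \<in> E (q m)" if "n \<in> L (q m)" for n using \<psi>E[of n] that by (simp add: L_def)
      from count[OF \<psi>L this] show ?thesis by (simp add: sum_subtractf)
    qed
    moreover have "0 \<le> 1 - (\<Sum>n\<in>L (q m). (cmod (cinner (\<psi> n) (b k)))\<^sup>2)" for k
      using Bessel_finite[OF \<psi>L finL order_refl, of "b k"] orthonormal_norm[OF o, of k] by simp
    ultimately have "1 - (\<Sum>n\<in>L (q m). (cmod (cinner (\<psi> n) (b m)))\<^sup>2) = 0"
      using sum_nonneg_eq_0_iff[OF finL[of "q m"], of "\<lambda>k. 1 - (\<Sum>n\<in>L (q m). (cmod (cinner (\<psi> n) (b k)))\<^sup>2)"] inL by simp
    then show ?thesis using proj_norm[OF \<psi>L finL order_refl, of "b m"] orthonormal_norm[OF o, of m] by simp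
  qed
  have "closed_cspan (range \<psi>) = K"
  proof (rule closed_cspan_eqI)
    show "orthonormal_on \<psi> UNIV" using on by (simp add: orthonormal_family_on)
    show "\<psi> ` UNIV \<subseteq> K" using \<psi>E by (auto simp: E_def)
    fix v assume v: "v \<in> K" "\<And>i. i \<in> UNIV \<Longrightarrow> cinner (\<psi> i) v = 0"
    have "cinner (b m) v = 0" for m
    proof -
      have "b m = (\<Sum>n\<in>L (q m). cinner (\<psi> n) (b m) *\<^sub>C \<psi> n)" using full[of m] by simp
      then have "cinner (b m) v = cinner (\<Sum>n\<in>L (q m). cinner (\<psi> n) (b m) *\<^sub>C \<psi> n) v" by simp
      then show ?thesis using v(2) by (simp add: cinner_sum_left)
    qed
    then show "v = 0"
      using closed_cspan_eqD[OF o, of v 0] v(1) by (simp add: K_def subspace_0 subspace_closed_cspan)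
  qed (auto simp: K_def closed_closed_cspan subspace_closed_cspan closed_cspan_scaleC)
  moreover have "R (\<psi> n) = p n *\<^sub>R \<psi> n" for n unfolding \<psi>_def p_def by (rule \<Psi>(3)[OF inL])
  moreover have "cinner (b m) (\<psi> n) = 0" if "q m \<noteq> q n" for m n using \<psi>E[of n] that by (simp add: E_def)
  ultimately show ?thesis using on unfolding K_def by blast
qed

text \<open>Each \<open>\<psi> n\<close> is built from vectors \<open>b m\<close> with
  \<open>q m = q n\<close>, so it is an eigenvector for \<open>q n\<close>.\<close>

lemma diag_op_change_basis:
  assumes b: "orthonormal_family b" and q: "\<forall>n. \<bar>q n\<bar> \<le> C"
    and \<psi>: "orthonormal_family \<psi>" "closed_cspan (range \<psi>) = closed_cspan (range b)"
    and l: "\<And>m n. q m \<noteq> q n \<Longrightarrow> cinner (b m) (\<psi> n) = 0"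
  shows "diag_op \<psi> q = diag_op b q"
proof
  fix v
  have base: "diag_op b q (\<psi> n) = q n *\<^sub>R \<psi> n" for n
  proof (rule diag_op_eqI[OF b q])
    have "\<psi> n \<in> closed_cspan (range b)" unfolding \<psi>(2)[symmetric] by (rule closed_cspan_base) simp
    then show "q n *\<^sub>R \<psi> n \<in> closed_cspan (range b)" by (rule subspace_scale[OF subspace_closed_cspan])
    show "cinner (b m) (q n *\<^sub>R \<psi> n) = of_real (q m) * cinner (b m) (\<psi> n)" for m
      by (cases "q m = q n") (auto simp: l)
  qed
  show "diag_op \<psi> q v = diag_op b q v"
  proof (rule diag_op_eqI[OF \<psi>(1) q])
    show "diag_op b q v \<in> closed_cspan (range \<psi>)" unfolding \<psi>(2) by (rule diag_op_in[OF b q])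
    show "cinner (\<psi> n) (diag_op b q v) = of_real (q n) * cinner (\<psi> n) v" for n
      unfolding diag_op_selfadjoint[OF b q] base by simp
  qed
qed

lemma diag_op_of_eigenbasis:
  assumes \<psi>: "orthonormal_family \<psi>" and R: "range R \<subseteq> closed_cspan (range \<psi>)" "\<And>u v. cinner u (R v) = cinner (R u) v"
    and ev: "\<And>n. R (\<psi> n) = p n *\<^sub>R \<psi> n" and p: "\<forall>n. \<bar>p n\<bar> \<le> C"
  shows "R = diag_op \<psi> p"
proof
  fix v
  have "diag_op \<psi> p v = R v"
    by (rule diag_op_eqI[OF \<psi> p]) (use R(1) in \<open>auto simp: R(2) ev\<close>)
  then show "R v = diag_op \<psi> p v" ..
qed

lemma diag_op_commute:
  assumes b: "orthonormal_family b" and w: "\<forall>n. \<bar>w n\<bar> \<le> C" and w': "\<forall>n. \<bar>w' n\<bar> \<le> C'"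
  shows "commute (diag_op b w) (diag_op b w')"
  unfolding commute_def
proof
  fix v
  have "diag_op b w (diag_op b w' v) = diag_op b w' (diag_op b w v)"
    by (rule diag_op_eqI[OF b w diag_op_in[OF b w']]) (simp add: diag_op_coeff[OF b w] diag_op_coeff[OF b w'])
  then show "(diag_op b w \<circ> diag_op b w') v = (diag_op b w' \<circ> diag_op b w) v" by simp
qed

section \<open>Relative entropy under stochastic maps\<close>

text \<open>The tangent at \<open>y\<close> to the convex function x ln x, evaluated at
  \<open>p / q\<close> and multiplied by \<open>q\<close>. It reduces to
  \<open>ln s \<le> s - 1\<close> with \<open>s = q * y / p\<close>.\<close>

lemma xlnx_tangent:
  fixes p q y :: real
  assumes "0 \<le> p" "0 < q" "0 < y"
  shows "p * ln y + p - q * y \<le> p * ln (p / q)"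
proof (cases "p = 0")
  case True
  then show ?thesis using assms by simp
next
  case False
  then have p: "0 < p" using assms by simp
  have "ln (q * y / p) \<le> q * y / p - 1" using p assms by (intro ln_le_minus_one) simp
  then have "p * ln (q * y / p) \<le> q * y - p"
    using p by (simp add: field_simps)
  moreover have "ln (q * y / p) = ln y - ln (p / q)" using p assms by (simp add: ln_div ln_mult)
  ultimately show ?thesis by (simp add: algebra_simps)
qed

text \<open>Adding \<open>q - p\<close> to the terms of the relative entropy makes them nonnegative.\<close>

lemma relative_entropy_monotone:
  fixes p q :: "'k \<Rightarrow> real" and M :: "'j \<Rightarrow> 'k \<Rightarrow> real"
  assumes p: "\<And>k. 0 \<le> p k" "(p has_sum sp) UNIV" and q: "\<And>k. 0 < q k" "(q has_sum sq) UNIV"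
    and M: "\<And>j k. 0 \<le> M j k" "\<And>k. ((\<lambda>j. M j k) has_sum 1) UNIV"
    and P: "\<And>j. ((\<lambda>k. M j k * p k) has_sum P j) UNIV" and Q: "\<And>j. ((\<lambda>k. M j k * q k) has_sum Q j) UNIV" "\<And>j. 0 < Q j"
    and PQ: "(P has_sum sp) UNIV" "(Q has_sum sq) UNIV"
    and r: "((\<lambda>k. p k * ln (p k / q k)) has_sum r) UNIV"
  shows "(\<lambda>j. P j * ln (P j / Q j)) summable_on UNIV" "(\<Sum>\<^sub>\<infinity>j. P j * ln (P j / Q j)) \<le> r"
proof -
  define a where "a k = p k * ln (p k / q k) - p k + q k" for k
  define A where "A j = P j * ln (P j / Q j) - P j + Q j" for j
  have a: "(a has_sum (r - sp + sq)) UNIV"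
    unfolding a_def diff_conv_add_uminus by (intro has_sum_add r has_sum_uminusI p(2) q(2))
  have a0: "0 \<le> a k" for k
    using xlnx_tangent[of "p k" "q k" 1] p(1) q(1) by (simp add: a_def)
  have P0: "0 \<le> P j" for j by (rule has_sum_nonneg[OF P]) (simp add: M p)
  have A0: "0 \<le> A j" for j
    using xlnx_tangent[of "P j" "Q j" 1] P0 Q(2) by (simp add: A_def)
  have inner: "((\<lambda>j. case (k, j) of (k, j) \<Rightarrow> M j k * a k) has_sum a k) UNIV" for k
    using has_sum_cmult_left[OF M(2)[of k], of "a k"] by simp
  have "((\<lambda>(k, j). M j k * a k) has_sum (r - sp + sq)) (Sigma UNIV (\<lambda>_. UNIV))"
    by (rule has_sum_SigmaI[OF inner a], rule summable_on_SigmaI[OF inner has_sum_imp_summable[OF a]])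
      (simp add: M a0)
  then have tot: "((\<lambda>(j, k). M j k * a k) has_sum (r - sp + sq)) (UNIV \<times> UNIV)"
    by (subst has_sum_swap) simp
  have M1: "M j k \<le> 1" for j k
    using finite_sum_le_has_sum[OF M(2)[of k], of "{j}"] M(1) by simp
  have row: "((\<lambda>k. M j k * a k) has_sum (\<Sum>\<^sub>\<infinity>k. M j k * a k)) UNIV" for j
  proof (rule has_sum_infsum, rule summable_on_comparison_test[OF has_sum_imp_summable[OF a]])
    show "M j k * a k \<le> a k" for k using mult_right_mono[OF M1 a0, of j k k] by simp
  qed (simp add: M a0)
  have rows: "((\<lambda>j. \<Sum>\<^sub>\<infinity>k. M j k * a k) has_sum (r - sp + sq)) UNIV"
    by (rule has_sum_SigmaD[OF tot]) (use row in simp)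
  have le: "A j \<le> (\<Sum>\<^sub>\<infinity>k. M j k * a k)" for j
  proof (cases "P j = 0")
    case True
    \<comment> \<open>The tangent point would be 0 here. Instead all weighted \<open>p k\<close>
      vanish, and both sides reduce to \<open>Q j\<close>.\<close>
    have "M j k * p k = 0" for k
      using nonneg_has_sum_le_0D[OF P[of j], of k] True M p by simp
    then have eq: "M j k * a k = M j k * q k" for k by (auto simp: a_def algebra_simps)
    show ?thesis using True Q(1)[of j] unfolding eq by (simp add: A_def infsumI)
  next
    case False
    \<comment> \<open>The tangent is taken at the averaged ratio; weighted with \<open>M j k\<close>
      and summed over \<open>k\<close>, the tangent inequalities give Jensen's inequality.\<close>
    let ?y = "P j / Q j"
    have y: "0 < ?y" using False P0[of j] Q(2)[of j] by simp
    have "((\<lambda>k. M j k * p k * ln ?y + M j k * q k + - (?y * (M j k * q k))) has_sum (P j * ln ?y + Q j + - (?y * Q j))) UNIV"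
      by (intro has_sum_add has_sum_uminusI has_sum_cmult_left has_sum_cmult_right P Q)
    then have "P j * ln ?y + Q j + - (?y * Q j) \<le> (\<Sum>\<^sub>\<infinity>k. M j k * a k)"
    proof (rule has_sum_mono[OF _ row[of j]])
      fix k
      have "p k * ln ?y + q k - q k * ?y \<le> a k"
        using xlnx_tangent[OF p(1) q(1) y, of k k] by (simp add: a_def)
      from mult_left_mono[OF this M(1)[of j k]]
      show "M j k * p k * ln ?y + M j k * q k + - (?y * (M j k * q k)) \<le> M j k * a k" by (simp add: algebra_simps)
    qed
    moreover have "?y * Q j = P j" using Q(2)[of j] by simp
    ultimately show ?thesis unfolding A_def by linarith
  qed
  have sA: "A summable_on UNIV"
    by (rule summable_on_comparison_test[OF has_sum_imp_summable[OF rows] le A0])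
  have Aeq: "A j + P j - Q j = P j * ln (P j / Q j)" for j by (simp add: A_def)
  have "((\<lambda>j. A j + P j + - Q j) has_sum (infsum A UNIV + sp + - sq)) UNIV"
    by (intro has_sum_add has_sum_uminusI PQ has_sum_infsum sA)
  then have h: "((\<lambda>j. P j * ln (P j / Q j)) has_sum (infsum A UNIV + sp - sq)) UNIV" by (simp add: Aeq)
  show "(\<lambda>j. P j * ln (P j / Q j)) summable_on UNIV" using h by (rule has_sum_imp_summable)
  have "infsum A UNIV \<le> r - sp + sq" using has_sum_mono[OF has_sum_infsum[OF sA] rows le] .
  then show "(\<Sum>\<^sub>\<infinity>j. P j * ln (P j / Q j)) \<le> r" using infsumI[OF h] by simp
qed

section \<open>The generalized second law\<close>

lemma subspace_gop_add: "subspace X \<Longrightarrow> subspace Y \<Longrightarrow> subspace (gop_add X Y)"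
proof (rule subspaceI)
  assume X: "subspace X" and Y: "subspace Y"
  show "0 \<in> gop_add X Y"
    using subspace_0[OF X] subspace_0[OF Y] unfolding gop_add_def zero_prod_def
    by (intro CollectI exI[of _ 0]) simp
  fix x y assume "x \<in> gop_add X Y" "y \<in> gop_add X Y"
  then obtain v w w' u z z' where "x = (v, w + w')" "(v, w) \<in> X" "(v, w') \<in> Y" "y = (u, z + z')" "(u, z) \<in> X" "(u, z') \<in> Y"
    by (auto simp: gop_add_def)
  then show "x + y \<in> gop_add X Y"
    using subspace_add[OF X, of "(v, w)" "(u, z)"] subspace_add[OF Y, of "(v, w')" "(u, z')"]
    unfolding gop_add_def by (intro CollectI exI[of _ "v + u"] exI[of _ "w + z"] exI[of _ "w' + z'"]) simp
next
  assume X: "subspace X" and Y: "subspace Y"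
  fix c x assume "x \<in> gop_add X Y"
  then obtain v w w' where "x = (v, w + w')" "(v, w) \<in> X" "(v, w') \<in> Y" by (auto simp: gop_add_def)
  then show "c *\<^sub>R x \<in> gop_add X Y"
    using subspace_scale[OF X, of "(v, w)" c] subspace_scale[OF Y, of "(v, w')" c]
    unfolding gop_add_def by (intro CollectI exI[of _ "c *\<^sub>R v"] exI[of _ "c *\<^sub>R w"] exI[of _ "c *\<^sub>R w'"]) (simp add: scaleR_add_right)
qed

lemma subspace_gop_scale: "subspace X \<Longrightarrow> subspace (gop_scale r X)"
proof (rule subspaceI)
  assume X: "subspace X"
  show "0 \<in> gop_scale r X"
    using subspace_0[OF X] unfolding gop_scale_def zero_prod_def by (intro CollectI exI[of _ 0]) simp
  fix x y assume "x \<in> gop_scale r X" "y \<in> gop_scale r X"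
  then obtain v w u z where "x = (v, r *\<^sub>R w)" "(v, w) \<in> X" "y = (u, r *\<^sub>R z)" "(u, z) \<in> X"
    by (auto simp: gop_scale_def)
  then show "x + y \<in> gop_scale r X"
    using subspace_add[OF X, of "(v, w)" "(u, z)"]
    unfolding gop_scale_def by (intro CollectI exI[of _ "v + u"] exI[of _ "w + z"]) (simp add: scaleR_add_right)
next
  assume X: "subspace X"
  fix c x assume "x \<in> gop_scale r X"
  then obtain v w where "x = (v, r *\<^sub>R w)" "(v, w) \<in> X" by (auto simp: gop_scale_def)
  then show "c *\<^sub>R x \<in> gop_scale r X"
    using subspace_scale[OF X, of "(v, w)" c]
    unfolding gop_scale_def by (intro CollectI exI[of _ "c *\<^sub>R v"] exI[of _ "c *\<^sub>R w"]) (simp add: mult.commute)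
qed

lemma subspace_relcomp: "subspace X \<Longrightarrow> subspace Y \<Longrightarrow> subspace (X O Y)"
proof (rule subspaceI)
  assume X: "subspace X" and Y: "subspace Y"
  show "0 \<in> X O Y"
    using subspace_0[OF X] subspace_0[OF Y] unfolding zero_prod_def by blast
  fix x y assume "x \<in> X O Y" "y \<in> X O Y"
  then obtain v w u v' w' u' where "x = (v, u)" "(v, w) \<in> X" "(w, u) \<in> Y" "y = (v', u')" "(v', w') \<in> X" "(w', u') \<in> Y"
    by (auto simp: relcomp_unfold)
  then show "x + y \<in> X O Y"
    using subspace_add[OF X, of "(v, w)" "(v', w')"] subspace_add[OF Y, of "(w, u)" "(w', u')"] by auto
next
  assume X: "subspace X" and Y: "subspace Y"
  fix c x assume "x \<in> X O Y"
  then obtain v w u where "x = (v, u)" "(v, w) \<in> X" "(w, u) \<in> Y" by (auto simp: relcomp_unfold)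
  then show "c *\<^sub>R x \<in> X O Y"
    using subspace_scale[OF X, of "(v, w)" c] subspace_scale[OF Y, of "(w, u)" c] by auto
qed

lemma subspace_graph_on: "subspace K \<Longrightarrow> linear A \<Longrightarrow> subspace (graph_on K A)"
  by (rule subspaceI)
    (auto simp: graph_on_def zero_prod_def linear_0 linear_add linear_scale subspace_0 subspace_add subspace_scale)

lemma subspace_diag_gop: "subspace (diag_gop b w)"
proof (rule subspaceI)
  show "0 \<in> diag_gop b w"
    by (simp add: diag_gop_def zero_prod_def subspace_0 subspace_closed_cspan)
  fix x y assume "x \<in> diag_gop b w" "y \<in> diag_gop b w"
  then obtain v u v' u' where xy: "x = (v, u)" "y = (v', u')" and v: "v \<in> closed_cspan (range b)" "v' \<in> closed_cspan (range b)"
    and h: "((\<lambda>n. (complex_of_real (w n) * cinner (b n) v) *\<^sub>C b n) has_sum u) UNIV"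
      "((\<lambda>n. (complex_of_real (w n) * cinner (b n) v') *\<^sub>C b n) has_sum u') UNIV"
    by (auto simp: diag_gop_def)
  show "x + y \<in> diag_gop b w"
    using has_sum_add[OF h] v
    by (simp add: xy diag_gop_def cinner_add_right distrib_left scaleC_add_left subspace_add subspace_closed_cspan)
next
  fix c x assume "x \<in> diag_gop b w"
  then obtain v u where x: "x = (v, u)" and v: "v \<in> closed_cspan (range b)"
    and h: "((\<lambda>n. (complex_of_real (w n) * cinner (b n) v) *\<^sub>C b n) has_sum u) UNIV"
    by (auto simp: diag_gop_def)
  show "c *\<^sub>R x \<in> diag_gop b w"
    using has_sum_scaleC[OF h, of "of_real c"] v
    by (simp add: x diag_gop_def mult.left_commute scaleR_conv_scaleC closed_cspan_scaleC)
qed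

lemma diag_gop_coeff:
  assumes b: "orthonormal_family b" and vu: "(v, u) \<in> diag_gop b w"
  shows "cinner (b n) u = of_real (w n) * cinner (b n) v" "u \<in> closed_cspan (range b)"
proof -
  have h: "((\<lambda>n. (complex_of_real (w n) * cinner (b n) v) *\<^sub>C b n) has_sum u) UNIV"
    using vu by (simp add: diag_gop_def)
  show "cinner (b n) u = of_real (w n) * cinner (b n) v"
    by (rule orthonormal_coeff[OF _ h]) (use b in \<open>simp_all add: orthonormal_family_on\<close>)
  show "u \<in> closed_cspan (range b)"
    by (rule has_sum_in_closed_subspace[OF closed_closed_cspan subspace_closed_cspan h]) (auto intro: in_closed_cspanI)
qed

lemma occ_sum_diff: "occ_sum (\<lambda>i. f i - c * g i) n = occ_sum f n - c * occ_sum g n"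
  by (simp add: occ_sum_def sum_subtractf sum_distrib_left algebra_simps)

lemma bounded_clinear_linear: "bounded_clinear W \<Longrightarrow> linear W"
  by (simp add: bounded_clinear_def clinear_def)

lemma bounded_clinear_scaleC: "bounded_clinear W \<Longrightarrow> W (c *\<^sub>C v) = c *\<^sub>C W v"
  by (simp add: bounded_clinear_def clinear_def)

lemma mult_xlnx_divide: "0 < q \<Longrightarrow> q * xlnx (p / q) = p * ln (p / q)"
  by (simp add: xlnx_def)

context collapse
begin

section \<open>Thermal weights, joint eigenbases and the functional \<open>U\<close>\<close>

definition tq :: "occ \<Rightarrow> real" where "tq n = gibbs_weight D n / Z_part D"

lemma Z_pos: "0 < Z_part D"
proof -
  have "0 \<le> Z_part D" unfolding Z_part_def by (rule infsum_nonneg) (simp add: gibbs_weight_def)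
  moreover have "Z_part D \<noteq> 0" using N_norm by auto
  ultimately show ?thesis by simp
qed

lemma tq_pos: "0 < tq n"
  using Z_pos by (simp add: tq_def gibbs_weight_def)

lemma tq_has_sum: "(tq has_sum 1) UNIV"
proof -
  have "(gibbs_weight D has_sum Z_part D) UNIV"
    using coll unfolding Z_part_def by (intro has_sum_infsum) (simp add: collapse_scattering_def)
  from has_sum_divide_const[OF this, of "Z_part D"] show ?thesis
    using Z_pos by (simp add: tq_def[abs_def])
qed

lemma tq_bounded: "\<forall>n. \<bar>tq n\<bar> \<le> (\<Sum>\<^sub>\<infinity>n. \<bar>tq n\<bar>)"
  by (rule summable_bounded) (use has_sum_imp_summable[OF tq_has_sum] tq_pos in \<open>simp add: less_imp_le\<close>)

lemma thermal_tq: "thermal D b = diag_op b tq"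
  by (simp add: thermal_def tq_def[abs_def])

text \<open>The combination of energy and angular momentum in \<open>U_op\<close> depends on the
  thermal weight alone, so it is constant on each thermal eigenspace.\<close>

lemma energy_tq: "beta_BH D * (occ_sum (freq D) n - Omega_BH D * occ_sum (\<lambda>i. real_of_int (azim D i)) n) = - ln (tq n * Z_part D)"
proof -
  have "tq n * Z_part D = gibbs_weight D n" using Z_pos by (simp add: tq_def)
  then show ?thesis by (simp add: gibbs_weight_def occ_sum_diff)
qed

text \<open>Positivity and unit trace, read off along \<open>\<psi>\<close>, make the eigenvalues
  \<open>p\<close> a probability distribution.\<close>

lemma joint_eigenbasis:
  fixes b :: "occ \<Rightarrow> 'w ell2"
  assumes b: "orthonormal_family b" "closed_cspan (range b) = K" and \<rho>: "density_matrix K \<rho>" "commute \<rho> (thermal D b)"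
  obtains \<psi> p where "orthonormal_family \<psi>" "closed_cspan (range \<psi>) = K" "\<And>n. \<rho> (\<psi> n) = p n *\<^sub>R \<psi> n"
    "\<And>m n. tq m \<noteq> tq n \<Longrightarrow> cinner (b m) (\<psi> n) = 0" "\<And>n. 0 \<le> p n" "(p has_sum 1) UNIV"
    "\<rho> = diag_op \<psi> p" "thermal D b = diag_op \<psi> tq"
proof -
  have R: "bounded_clinear \<rho>" "range \<rho> \<subseteq> closed_cspan (range b)" "\<And>u v. cinner u (\<rho> v) = cinner (\<rho> u) v"
    "\<And>v. 0 \<le> Re (cinner v (\<rho> v))" "has_trace K (graph_on K \<rho>) 1"
    using \<rho>(1) b(2) by (auto simp: density_matrix_def)
  have com: "\<rho> \<circ> diag_op b tq = diag_op b tq \<circ> \<rho>" using \<rho>(2) by (simp add: commute_def thermal_tq)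
  obtain \<psi> p where \<psi>: "orthonormal_family \<psi>" "closed_cspan (range \<psi>) = closed_cspan (range b)"
    "\<And>n. \<rho> (\<psi> n) = p n *\<^sub>R \<psi> n" "\<And>m n. tq m \<noteq> tq n \<Longrightarrow> cinner (b m) (\<psi> n) = 0"
    using simultaneous_eigenbasis[OF b(1) tq_pos has_sum_imp_summable[OF tq_has_sum] R(1-3) com] by blast
  have \<psi>\<psi>: "cinner (\<psi> n) (\<psi> n) = 1" for n using \<psi>(1) by (simp add: orthonormal_family_def)
  have p0: "0 \<le> p n" for n using R(4)[of "\<psi> n"] by (simp add: \<psi>(3) \<psi>\<psi>)
  have "(\<psi> n, p n *\<^sub>R \<psi> n) \<in> graph_on K \<rho>" for n
    using \<psi>(2,3) b(2) closed_cspan_base[of "\<psi> n" "range \<psi>"] by (auto simp: graph_on_def)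
  from has_trace_weights[OF R(5) \<psi>(1) _ this] have ps: "(p has_sum 1) UNIV" using \<psi>(2) b(2) by simp
  have pb: "\<forall>n. \<bar>p n\<bar> \<le> (\<Sum>\<^sub>\<infinity>n. \<bar>p n\<bar>)"
    by (rule summable_bounded) (use has_sum_imp_summable[OF ps] p0 in simp)
  have "\<rho> = diag_op \<psi> p"
    by (rule diag_op_of_eigenbasis[OF \<psi>(1) _ R(3) \<psi>(3) pb]) (use R(2) \<psi>(2) in simp)
  moreover have "thermal D b = diag_op \<psi> tq"
    unfolding thermal_tq by (rule diag_op_change_basis[OF b(1) tq_bounded \<psi>(1,2,4), symmetric])
  ultimately show ?thesis using that[of \<psi> p] \<psi> b(2) p0 ps by blast
qed

text \<open>\<open>w n\<close> is the eigenvalue of \<open>U_op\<close> at \<open>\<psi> n\<close>: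
  entropy contributes \<open>xlnx (p n)\<close>, energy \<open>- p n * ln (tq n * Z_part D)\<close>.
  Energy and angular momentum alone may mix the vectors of one thermal eigenspace, so a single trace
  is computed; the separate traces enter in the last claim, where their existence is
  assumed.\<close>

lemma joint_functional:
  fixes b :: "occ \<Rightarrow> 'w ell2"
  assumes b: "orthonormal_family b" "closed_cspan (range b) = K" and \<rho>: "bounded_clinear \<rho>" "range \<rho> \<subseteq> K"
    and \<psi>: "orthonormal_family \<psi>" "closed_cspan (range \<psi>) = K" "\<And>n. \<rho> (\<psi> n) = p n *\<^sub>R \<psi> n"
    and l: "\<And>m n. tq m \<noteq> tq n \<Longrightarrow> cinner (b m) (\<psi> n) = 0" and p: "\<And>n. 0 \<le> p n" "(p has_sum 1) UNIV" "\<rho> = diag_op \<psi> p"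
    and r: "((\<lambda>n. p n * ln (p n / tq n)) has_sum r) UNIV"
  shows "has_trace K (U_op D K b \<rho>) (of_real (r - ln (Z_part D)))"
    and "U_joint D K b \<rho> = ln (Z_part D) - r"
    and "traces_converge D K b \<rho> \<Longrightarrow> U_joint D K b \<rho> = U_fun D K b \<rho>"
proof -
  have ob: "orthonormal_on b UNIV" using b(1) by (simp add: orthonormal_family_on)
  have \<psi>K: "\<psi> n \<in> K" for n using closed_cspan_base[of "\<psi> n" "range \<psi>"] \<psi>(2) by simp
  have Ksub: "subspace K" using subspace_closed_cspan \<psi>(2) by blast
  have Ksc: "v \<in> K \<Longrightarrow> c *\<^sub>C v \<in> K" for c v using closed_cspan_scaleC \<psi>(2) by blast
  have \<psi>\<psi>: "cinner (\<psi> n) (\<psi> n) = 1" for n using \<psi>(1) by (simp add: orthonormal_family_def)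
  have pb: "\<forall>n. \<bar>p n\<bar> \<le> (\<Sum>\<^sub>\<infinity>n. \<bar>p n\<bar>)"
    by (rule summable_bounded) (use has_sum_imp_summable[OF p(2)] p(1) in simp)
  have p1: "p n \<le> 1" for n using finite_sum_le_has_sum[OF p(2), of "{n}"] p(1) by simp
  \<comment> \<open>On the unit interval x ln x lies between its tangent at 1, which is x - 1, and
    0.\<close>
  have xb: "\<forall>n. \<bar>xlnx (p n)\<bar> \<le> 1"
  proof
    fix n
    have "p n * ln (p n) \<le> 0" using p(1)[of n] p1[of n] by (cases "p n = 0") (simp_all add: mult_nonneg_nonpos)
    moreover have "p n - 1 \<le> p n * ln (p n)" using xlnx_tangent[of "p n" 1 1] p(1)[of n] by simp
    ultimately show "\<bar>xlnx (p n)\<bar> \<le> 1" using p(1)[of n] by (simp add: xlnx_def)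
  qed
  define w where "w n = p n * ln (p n / tq n) - p n * ln (Z_part D)" for n
  have w: "(w has_sum (r - ln (Z_part D))) UNIV"
    unfolding w_def diff_conv_add_uminus
    using has_sum_add[OF r has_sum_uminusI[OF has_sum_cmult_left[OF p(2), of "ln (Z_part D)"]]] by simp
  have wabs: "(\<lambda>n. \<bar>w n\<bar>) summable_on UNIV"
    using summable_on_iff_abs_summable_on_real[THEN iffD1, OF has_sum_imp_summable[OF w]] by (simp only: real_norm_def)
  note wb = summable_bounded[OF wabs]
  have weq: "w n = xlnx (p n) - p n * ln (tq n * Z_part D)" for n
  proof (cases "p n = 0")
    case False
    then have "0 < p n" using p(1)[of n] by simp
    then show ?thesis using tq_pos[of n] Z_pos by (simp add: w_def xlnx_def ln_div ln_mult algebra_simps)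
  qed (simp add: w_def xlnx_def)
  let ?E = "E_rho D K b \<rho>" and ?L = "L_rho D K b \<rho>" and ?X = "rho_ln_rho K \<rho>"
  have rlr: "diag_op \<psi> (\<lambda>n. xlnx (p n)) v = u" if "(v, u) \<in> ?X" for v u
    using that unfolding rho_ln_rho_def
  proof (rule fun_of_op_subset[OF bounded_clinear_diag_op[OF \<psi>(1) xb], rotated])
    fix v a assume va: "(v, a *\<^sub>R v) \<in> graph_on K \<rho>"
    then have vK: "v \<in> K" and ev: "diag_op \<psi> p v = a *\<^sub>R v" by (auto simp: graph_on_def p(3))
    show "diag_op \<psi> (\<lambda>n. xlnx (p n)) v = xlnx a *\<^sub>R v"
    proof (rule diag_op_eqI[OF \<psi>(1) xb])
      show "xlnx a *\<^sub>R v \<in> closed_cspan (range \<psi>)" using vK Ksub \<psi>(2) by (simp add: subspace_scale)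
      fix n
      have "a = p n \<or> cinner (\<psi> n) v = 0"
        using diag_op_coeff[OF \<psi>(1) pb, of n v] by (auto simp: ev)
      then show "cinner (\<psi> n) (xlnx a *\<^sub>R v) = of_real (xlnx (p n)) * cinner (\<psi> n) v" by auto
    qed
  qed
  have sub: "diag_op \<psi> w v = u" if vu: "(v, u) \<in> U_op D K b \<rho>" for v u
  proof -
    obtain u1 u2 u3 where u: "u = u1 + beta_BH D *\<^sub>R (u2 + (- Omega_BH D) *\<^sub>R u3)"
      and u1: "(v, u1) \<in> ?X" and u2: "(v, u2) \<in> ?E" and u3: "(v, u3) \<in> ?L"
      using vu unfolding U_op_def gop_add_def gop_scale_def by blast
    have vK: "v \<in> K" and e: "(\<rho> v, u2) \<in> energy_op D b" and a: "(\<rho> v, u3) \<in> angmom_op D b"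
      using u2 u3 by (auto simp: E_rho_def L_rho_def graph_on_def)
    define z where "z = beta_BH D *\<^sub>R (u2 + (- Omega_BH D) *\<^sub>R u3)"
    have zb: "cinner (b m) z = of_real (- ln (tq m * Z_part D)) * cinner (b m) (\<rho> v)" for m
      unfolding energy_tq[symmetric] z_def
      using diag_gop_coeff(1)[OF b(1) e[unfolded energy_op_def], of m] diag_gop_coeff(1)[OF b(1) a[unfolded angmom_op_def], of m]
      by (simp add: cinner_add_right cinner_diff_right algebra_simps)
    have zK: "z \<in> K"
      unfolding z_def using diag_gop_coeff(2)[OF b(1) e[unfolded energy_op_def]] diag_gop_coeff(2)[OF b(1) a[unfolded angmom_op_def]] b(2) Ksub
      by (intro subspace_scale subspace_add) auto
    have z\<psi>: "cinner (\<psi> n) z = of_real (- ln (tq n * Z_part D) * p n) * cinner (\<psi> n) v" for n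
    proof -
      have "((\<lambda>m. cinner (\<psi> n) (b m) * cinner (b m) z) has_sum cinner (\<psi> n) z) UNIV"
        by (rule Parseval[OF ob]) (use zK b(2) in simp)
      \<comment> \<open>Number states of another thermal weight do not overlap with
        \<open>\<psi> n\<close>, so the logarithm may be taken at \<open>n\<close> and leaves the
        sum.\<close>
      moreover have "cinner (\<psi> n) (b m) * cinner (b m) z =
          of_real (- ln (tq n * Z_part D)) * (cinner (\<psi> n) (b m) * cinner (b m) (\<rho> v))" for m
      proof (cases "tq m = tq n")
        case False
        then have "cinner (\<psi> n) (b m) = 0" using l[of m n] by (subst cinner_commute) simp
        then show ?thesis by simp
      qed (simp add: zb)
      moreover have "((\<lambda>m. of_real (- ln (tq n * Z_part D)) * (cinner (\<psi> n) (b m) * cinner (b m) (\<rho> v))) has_sum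
          of_real (- ln (tq n * Z_part D)) * cinner (\<psi> n) (\<rho> v)) UNIV"
        by (intro has_sum_cmult_right Parseval[OF ob]) (use \<rho>(2) b(2) in auto)
      ultimately have "cinner (\<psi> n) z = of_real (- ln (tq n * Z_part D)) * cinner (\<psi> n) (\<rho> v)"
        by (simp only: has_sum_unique)
      then show ?thesis by (simp add: p(3) diag_op_coeff[OF \<psi>(1) pb])
    qed
    have u1': "u1 = diag_op \<psi> (\<lambda>n. xlnx (p n)) v" using rlr[OF u1] by simp
    show ?thesis
    proof (rule diag_op_eqI[OF \<psi>(1) wb])
      show "u \<in> closed_cspan (range \<psi>)"
        unfolding u z_def[symmetric] u1' using diag_op_in[OF \<psi>(1) xb] zK \<psi>(2) Ksub by (simp add: subspace_add)
      show "cinner (\<psi> n) u = of_real (w n) * cinner (\<psi> n) v" for n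
        unfolding u z_def[symmetric] u1' cinner_add_right z\<psi> diag_op_coeff[OF \<psi>(1) xb] weq
        by (simp add: algebra_simps)
    qed
  qed
  have gop: "\<exists>u. (c *\<^sub>C \<psi> n, u) \<in> graph_on K \<rho> O diag_gop b f" for c n f
  proof -
    \<comment> \<open>Only these number states overlap with \<open>\<psi> n\<close>. The series of
      \<open>diag_gop\<close> is then a finite sum, which puts \<open>\<psi> n\<close> into the
      domain for any \<open>f\<close>.\<close>
    have fin: "finite {m. tq m = tq n}" by (rule finite_level_set[OF tq_pos has_sum_imp_summable[OF tq_has_sum]])
    let ?v = "(of_real (p n) * c) *\<^sub>C \<psi> n"
    have v: "\<rho> (c *\<^sub>C \<psi> n) = ?v" by (simp add: bounded_clinear_scaleC[OF \<rho>(1)] \<psi>(3) scaleR_conv_scaleC mult.commute)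
    have "((\<lambda>m. (complex_of_real (f m) * cinner (b m) ?v) *\<^sub>C b m) has_sum
        (\<Sum>m\<in>{m. tq m = tq n}. (complex_of_real (f m) * cinner (b m) ?v) *\<^sub>C b m)) UNIV"
      by (rule has_sum_finite_neutralI[OF fin]) (auto simp: l)
    moreover have "?v \<in> closed_cspan (range b)" using Ksc[OF \<psi>K] b(2) by simp
    ultimately have "(?v, \<Sum>m\<in>{m. tq m = tq n}. (complex_of_real (f m) * cinner (b m) ?v) *\<^sub>C b m) \<in> diag_gop b f"
      by (simp add: diag_gop_def)
    moreover have "(c *\<^sub>C \<psi> n, ?v) \<in> graph_on K \<rho>" using Ksc[OF \<psi>K, of c n] v by (auto simp: graph_on_def)
    ultimately show ?thesis by blast
  qed
  have xlr: "(c *\<^sub>C \<psi> n, xlnx (p n) *\<^sub>R c *\<^sub>C \<psi> n) \<in> ?X" for c n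
    unfolding rho_ln_rho_def
  proof (rule fun_of_op_base)
    have "\<rho> (c *\<^sub>C \<psi> n) = p n *\<^sub>R c *\<^sub>C \<psi> n" by (simp add: bounded_clinear_scaleC[OF \<rho>(1)] \<psi>(3) scaleR_scaleC)
    then show "(c *\<^sub>C \<psi> n, p n *\<^sub>R c *\<^sub>C \<psi> n) \<in> graph_on K \<rho>" using Ksc[OF \<psi>K, of c n] by (auto simp: graph_on_def)
  qed
  have dom: "c *\<^sub>C \<psi> n \<in> Domain (U_op D K b \<rho>)" for c n
  proof -
    obtain u2 u3 where "(c *\<^sub>C \<psi> n, u2) \<in> ?E" "(c *\<^sub>C \<psi> n, u3) \<in> ?L"
      using gop unfolding E_rho_def L_rho_def energy_op_def angmom_op_def by blast
    then have "(c *\<^sub>C \<psi> n, xlnx (p n) *\<^sub>R c *\<^sub>C \<psi> n + beta_BH D *\<^sub>R (u2 + (- Omega_BH D) *\<^sub>R u3)) \<in> U_op D K b \<rho>"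
      using xlr[of c n] unfolding U_op_def gop_add_def gop_scale_def by blast
    then show ?thesis by blast
  qed
  \<comment> \<open>\<open>dom\<close> provides some image, and \<open>sub\<close> identifies it as
    the value of \<open>diag_op \<psi> w\<close>.\<close>
  have in_U: "(\<psi> n, w n *\<^sub>R \<psi> n) \<in> U_op D K b \<rho>" for n
  proof -
    obtain u where u: "(\<psi> n, u) \<in> U_op D K b \<rho>" using dom[of 1 n] by auto
    have "u = w n *\<^sub>R \<psi> n" using sub[OF u] diag_op_base[OF \<psi>(1) wb] by simp
    then show ?thesis using u by simp
  qed
  have "subspace (U_op D K b \<rho>)"
    unfolding U_op_def rho_ln_rho_def E_rho_def L_rho_def energy_op_def angmom_op_def
    by (intro subspace_gop_add subspace_gop_scale subspace_fun_of_op subspace_relcomp subspace_graph_on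
        subspace_diag_gop Ksub bounded_clinear_linear \<rho>(1))
  then have "K \<subseteq> closure (Domain (U_op D K b \<rho>))"
    using dense_Domain[of "U_op D K b \<rho>" \<psi>] dom \<psi>(2) by blast
  from has_trace_diag[OF \<psi>(1,2) wabs sub this] infsumI[OF w]
  show tr: "has_trace K (U_op D K b \<rho>) (of_real (r - ln (Z_part D)))" by simp
  show "U_joint D K b \<rho> = ln (Z_part D) - r"
    unfolding U_joint_def Tr_eqI[OF tr \<psi>(1,2) in_U] by simp
  assume "traces_converge D K b \<rho>"
  then obtain t1 t2 t3 where t: "has_trace K ?X t1" "has_trace K ?E t2" "has_trace K ?L t3"
    by (auto simp: traces_converge_def trace_converges_def)
  have "\<forall>n. \<exists>u. (\<psi> n, u) \<in> ?E" "\<forall>n. \<exists>u. (\<psi> n, u) \<in> ?L"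
    using gop[of 1] unfolding E_rho_def L_rho_def energy_op_def angmom_op_def by simp_all
  \<comment> \<open>\<open>e n\<close> and \<open>a n\<close> need not be multiples of
    \<open>\<psi> n\<close>; the traces are added by comparing their diagonal sums along
    \<open>\<psi>\<close>.\<close>
  then obtain e a where ea: "\<And>n. (\<psi> n, e n) \<in> ?E" "\<And>n. (\<psi> n, a n) \<in> ?L" by metis
  have x1: "(\<psi> n, xlnx (p n) *\<^sub>R \<psi> n) \<in> ?X" for n using xlr[of 1 n] by simp
  have U: "(\<psi> n, xlnx (p n) *\<^sub>R \<psi> n + beta_BH D *\<^sub>R (e n + (- Omega_BH D) *\<^sub>R a n)) \<in> U_op D K b \<rho>" for n
    using x1[of n] ea[of n] unfolding U_op_def gop_add_def gop_scale_def by blast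
  have h1: "((\<lambda>n. cinner (\<psi> n) (xlnx (p n) *\<^sub>R \<psi> n)) has_sum t1) UNIV" by (rule has_trace_eval[OF t(1) \<psi>(1,2) x1])
  have h2: "((\<lambda>n. cinner (\<psi> n) (e n)) has_sum t2) UNIV" by (rule has_trace_eval[OF t(2) \<psi>(1,2) ea(1)])
  have h3: "((\<lambda>n. cinner (\<psi> n) (a n)) has_sum t3) UNIV" by (rule has_trace_eval[OF t(3) \<psi>(1,2) ea(2)])
  have "((\<lambda>n. cinner (\<psi> n) (xlnx (p n) *\<^sub>R \<psi> n) + of_real (beta_BH D) * (cinner (\<psi> n) (e n) + of_real (- Omega_BH D) * cinner (\<psi> n) (a n)))
      has_sum (t1 + of_real (beta_BH D) * (t2 + of_real (- Omega_BH D) * t3))) UNIV"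
    by (intro has_sum_add has_sum_cmult_right h1 h2 h3)
  moreover have "cinner (\<psi> n) (xlnx (p n) *\<^sub>R \<psi> n) + of_real (beta_BH D) * (cinner (\<psi> n) (e n) + of_real (- Omega_BH D) * cinner (\<psi> n) (a n))
      = cinner (\<psi> n) (xlnx (p n) *\<^sub>R \<psi> n + beta_BH D *\<^sub>R (e n + (- Omega_BH D) *\<^sub>R a n))" for n
    by (simp only: cinner_add_right cinner_scaleR_right)
  ultimately have eq: "of_real (r - ln (Z_part D)) = t1 + of_real (beta_BH D) * (t2 + of_real (- Omega_BH D) * t3)"
    using has_trace_eval[OF tr \<psi>(1,2) U] by (simp only: has_sum_unique)
  show "U_joint D K b \<rho> = U_fun D K b \<rho>"
    unfolding U_joint_def U_fun_def S_matter_def E_matter_def L_matter_def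
      Tr_eqI[OF tr \<psi>(1,2) U] Tr_eqI[OF t(1) \<psi>(1,2) x1] Tr_eqI[OF t(2) \<psi>(1,2) ea(1)] Tr_eqI[OF t(3) \<psi>(1,2) ea(2)] eq
    by (simp add: algebra_simps)
qed

subsection \<open>The evolution map on diagonal states\<close>

lemma in_state_mstate: "in_state D n = mstate (in_mode D) (occ_mset n)"
  by (simp add: in_state_def number_state_mstate)

lemma out_state_mstate: "out_state D n = mstate (rho_mode D) (occ_mset n)"
  by (simp add: out_state_def number_state_mstate)

lemma in_state: "orthonormal_family (in_state D)" "closed_cspan (range (in_state D)) = F_in D"
  using orthonormal_mstate[OF in_mode_orthonormal] bij_occ_mset
  by (auto simp: orthonormal_family_def in_state_mstate F_in_def bij_def inj_eq)

lemma out_state: "orthonormal_family (out_state D)" "closed_cspan (range (out_state D)) = F_out D"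
proof -
  show "orthonormal_family (out_state D)"
    using orthonormal_mstate[OF rho_mode(1)] bij_occ_mset
    by (auto simp: orthonormal_family_def out_state_mstate bij_def inj_eq)
  have "range (out_state D) = range (mstate (rho_mode D))"
    unfolding out_state_mstate[abs_def] using bij_is_surj[OF bij_occ_mset] by (metis image_image)
  then show "closed_cspan (range (out_state D)) = F_out D"
    by (simp add: F_out_def mstate_complete[OF rho_mode])
qed

lemma bounded_clinear_split_S: "bounded_clinear (fock_split \<circ> S)"
proof -
  have S: "bounded_linear S" "\<And>c v. S (c *\<^sub>C v) = c *\<^sub>C S v" using Smat by (simp_all add: S_matrix_def bounded_clinear_def clinear_def)
  obtain C where C: "\<And>v. norm (S v) \<le> norm v * C" using bounded_linear.bounded[OF S(1)] by blast
  show ?thesis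
    by (rule bounded_clinearI[where C = C])
      (simp_all add: linear_add[OF bounded_linear.linear[OF S(1)]] S(2) fock_split_add fock_split_scaleC S_fock norm_fock_split C)
qed

text \<open>In the orthonormal family of the images of number states, \<open>S v\<close> has the
  coefficients that \<open>v\<close> has in the number states.\<close>

lemma S_isometry: "v \<in> F_in D \<Longrightarrow> norm (fock_split (S v)) = norm v"
proof -
  assume v: "v \<in> F_in D"
  have S: "bounded_linear S" "\<And>c v. S (c *\<^sub>C v) = c *\<^sub>C S v" using Smat by (simp_all add: S_matrix_def bounded_clinear_def clinear_def)
  define s where "s n = S_state (occ_mset n)" for n
  have s: "orthonormal_on s UNIV"
    using S_state_orthonormal bij_occ_mset by (auto simp: orthonormal_family_def orthonormal_on_def s_def bij_def inj_eq)
  have o: "orthonormal_on (in_state D) UNIV" using in_state(1) by (simp add: orthonormal_family_on)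
  have v': "v \<in> closed_cspan (range (in_state D))" using v in_state(2) by simp
  have "((\<lambda>n. S (cinner (in_state D n) v *\<^sub>C in_state D n)) has_sum S v) UNIV"
    by (rule has_sum_bounded_linear[OF S(1) closed_cspan_Fourier[OF o v']])
  then have h: "((\<lambda>n. cinner (in_state D n) v *\<^sub>C s n) has_sum S v) UNIV"
    by (simp add: S(2) s_def S_state_def in_state_mstate)
  have "S v \<in> closed_cspan (range s)"
    by (rule has_sum_in_closed_subspace[OF closed_closed_cspan subspace_closed_cspan h]) (auto intro: in_closed_cspanI)
  from Parseval_norm[OF s this] have "((\<lambda>n. (cmod (cinner (in_state D n) v))\<^sup>2) has_sum (norm (S v))\<^sup>2) UNIV"
    by (simp add: orthonormal_coeff[OF s h])
  then have "(norm (S v))\<^sup>2 = (norm v)\<^sup>2" using Parseval_norm[OF o v'] by (rule has_sum_unique)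
  then show "norm (fock_split (S v)) = norm v" by (simp add: norm_fock_split S_fock power2_eq_iff_nonneg)
qed

text \<open>For each \<open>k\<close> the sum over the horizon coordinate reassembles the slices
  into an inner product of two horizon vectors, obtained by projecting the outgoing factor on
  \<open>f\<close> and on \<open>u\<close>.\<close>

lemma evolve_matrix:
  fixes \<psi> :: "'k \<Rightarrow> 'z list ell2"
  assumes \<psi>: "orthonormal_family \<psi>" "range \<psi> \<subseteq> F_in D" and w: "\<forall>k. 0 \<le> w k" "w summable_on UNIV"
  shows "((\<lambda>k. of_real (w k) * cinner (pinner f (fock_split (S (\<psi> k)))) (pinner u (fock_split (S (\<psi> k)))))
    has_sum cinner u (evolve S (diag_op \<psi> w) f)) UNIV"
proof -
  have iso: "norm (fock_split (S (\<psi> k))) = 1" for k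
    using S_isometry[of "\<psi> k"] \<psi>(2) orthonormal_norm[of \<psi> UNIV k] \<psi>(1) by (auto simp: orthonormal_family_on)
  let ?s = "\<lambda>k y. slice2 (fock_split (S (\<psi> k))) y"
  have "((\<lambda>(k, y). of_real (w k) * cinner (?s k y) f * cinner u (?s k y)) has_sum cinner u (evolve S (diag_op \<psi> w) f)) (UNIV \<times> UNIV)"
    using has_sum_cinner_right[OF evolve_has_sum(1)[OF bounded_clinear_split_S \<psi>(1) w iso], of u f]
    by (simp add: case_prod_unfold)
  then show ?thesis
  proof (rule has_sum_SigmaD)
    fix k
    let ?\<Phi> = "fock_split (S (\<psi> k))"
    have "((\<lambda>y. of_real (w k) * (cnj (coord (pinner f ?\<Phi>) y) * coord (pinner u ?\<Phi>) y)) has_sum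
        of_real (w k) * cinner (pinner f ?\<Phi>) (pinner u ?\<Phi>)) UNIV"
      by (intro has_sum_cmult_right cinner_has_sum)
    moreover have "cnj (cinner f (?s k y)) = cinner (?s k y) f" for y by (rule cinner_commute[symmetric])
    ultimately show "((\<lambda>y. case (k, y) of (k, y) \<Rightarrow> of_real (w k) * cinner (?s k y) f * cinner u (?s k y)) has_sum
        of_real (w k) * cinner (pinner f ?\<Phi>) (pinner u ?\<Phi>)) UNIV"
      by (simp add: coord_pinner mult.assoc)
  qed
qed

text \<open>The slices of the scattered vectors are symmetric, so \<open>gram_operator\<close>
  applies with \<open>fock\<close> as the subspace.\<close>

lemma evolve_gram:
  fixes \<psi> :: "'k \<Rightarrow> 'z list ell2"
  assumes \<psi>: "orthonormal_family \<psi>" "range \<psi> \<subseteq> F_in D" and w: "\<forall>k. 0 \<le> w k" "(w has_sum t) UNIV"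
  defines "G \<equiv> evolve S (diag_op \<psi> w)"
  shows "bounded_clinear G" "range G \<subseteq> fock" "cinner u (G v) = cinner (G u) v" "0 \<le> Re (cinner v (G v))"
    and "onb fock B \<Longrightarrow> ((\<lambda>b. cinner b (G b)) has_sum of_real t) B"
proof -
  have iso: "norm (fock_split (S (\<psi> k))) = 1" for k
    using S_isometry[of "\<psi> k"] \<psi>(2) orthonormal_norm[of \<psi> UNIV k] \<psi>(1) by (auto simp: orthonormal_family_on)
  let ?s = "\<lambda>x. slice2 (fock_split (S (\<psi> (fst x)))) (snd x)"
  note E = evolve_has_sum[OF bounded_clinear_split_S \<psi>(1) w(1) has_sum_imp_summable[OF w(2)] iso, unfolded case_prod_unfold]
  have 1: "((\<lambda>x. (of_real (w (fst x)) * cinner (?s x) f) *\<^sub>C ?s x) has_sum G f) UNIV" for f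
    unfolding G_def by (rule E(1))
  have 2: "0 \<le> w (fst x)" for x :: "'k \<times> 'y list" using w(1) by simp
  have 3: "((\<lambda>x. w (fst x) * (norm (?s x))\<^sup>2) has_sum t) UNIV" using E(2) infsumI[OF w(2)] by simp
  have 4: "?s x \<in> fock" for x by (rule slice2_fock_split[OF S_fock])
  note g = gram_operator[OF 1 2 3 closed_fock subspace_fock fock_scaleC 4]
  show "bounded_clinear G" by (rule g(1))
  show "range G \<subseteq> fock" by (rule g(2))
  show "cinner u (G v) = cinner (G u) v" by (rule g(3))
  show "0 \<le> Re (cinner v (G v))" by (rule g(4))
  show "onb fock B \<Longrightarrow> ((\<lambda>b. cinner b (G b)) has_sum of_real t) B" by (rule g(5))
qed

lemma evolve_density:
  fixes \<psi> :: "'k \<Rightarrow> 'z list ell2"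
  assumes \<psi>: "orthonormal_family \<psi>" "range \<psi> \<subseteq> F_in D" and w: "\<forall>k. 0 \<le> w k" "(w has_sum 1) UNIV"
  shows "density_matrix (F_out D) (evolve S (diag_op \<psi> w))"
proof -
  let ?G = "evolve S (diag_op \<psi> w)"
  note g = evolve_gram[OF assms]
  have "Domain (graph_on fock ?G) = fock" by (auto simp: graph_on_def)
  then have "has_trace fock (graph_on fock ?G) 1"
    unfolding has_trace_def using g(1,5) closure_subset[of "fock :: 'x list ell2 set"]
    by (intro conjI exI[of _ ?G]) (auto simp: graph_on_def)
  then show ?thesis unfolding density_matrix_def F_out_def using g by blast
qed

text \<open>Parseval in every horizon slice. For a unit vector it says that the outcomes
  \<open>j\<close> have total probability 1.\<close>

lemma pinner_norm_sum:
  assumes \<chi>: "orthonormal_family c" "closed_cspan (range c) = fock" and \<psi>: "\<psi> \<in> fock"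
  shows "((\<lambda>j. (norm (pinner (c j) (fock_split \<psi>)))\<^sup>2) has_sum (norm (fock_split \<psi>))\<^sup>2) UNIV"
proof -
  let ?\<Phi> = "fock_split \<psi>"
  have o: "orthonormal_on c UNIV" using \<chi>(1) by (simp add: orthonormal_family_on)
  have inner: "((\<lambda>j. case (y, j) of (y, j) \<Rightarrow> (cmod (cinner (c j) (slice2 ?\<Phi> y)))\<^sup>2) has_sum (norm (slice2 ?\<Phi> y))\<^sup>2) UNIV" for y
    using Parseval_norm[OF o, of "slice2 ?\<Phi> y"] \<chi>(2) slice2_fock_split[OF \<psi>] by simp
  have "((\<lambda>(y, j). (cmod (cinner (c j) (slice2 ?\<Phi> y)))\<^sup>2) has_sum (norm ?\<Phi>)\<^sup>2) (UNIV \<times> UNIV)"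
    by (rule has_sum_SigmaI[OF inner slice2_norm], rule summable_on_SigmaI[OF inner has_sum_imp_summable[OF slice2_norm]]) auto
  then have "((\<lambda>(j, y). (cmod (cinner (c j) (slice2 ?\<Phi> y)))\<^sup>2) has_sum (norm ?\<Phi>)\<^sup>2) (UNIV \<times> UNIV)"
    by (subst (asm) has_sum_swap) simp
  then show ?thesis
    by (rule has_sum_SigmaD) (use norm_ell2_has_sum[of "pinner (c j) ?\<Phi>" for j] in \<open>simp add: coord_pinner\<close>)
qed

text \<open>Projecting the outgoing factor on a number state leaves a horizon vector whose
  coefficients in the \<sigma>- and \<tau>-number states are the amplitudes.\<close>

lemma pinner_amplitude:
  "((\<lambda>B. cnj (amplitude a B A) * amplitude a' B A) has_sum
    cinner (pinner (mstate (rho_mode D) a) (fock_split (S_state A))) (pinner (mstate (rho_mode D) a') (fock_split (S_state A)))) UNIV"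
proof -
  let ?\<Phi> = "fock_split (S_state A)"
  have o: "orthonormal_on (mstate st_mode) UNIV" using orthonormal_mstate[OF st_mode(1)] by (simp add: orthonormal_family_on)
  have amp: "cinner (mstate st_mode B) (pinner (mstate (rho_mode D) a) ?\<Phi>) = amplitude a B A" for a B
    unfolding amplitude_def cinner_tensor2[symmetric] out_modes_def
    by (simp only: fock_split_mstate[symmetric], rule cinner_fock_split) (simp_all add: mstate_fock S_state_def S_fock)
  have "((\<lambda>B. cinner (pinner (mstate (rho_mode D) a) ?\<Phi>) (mstate st_mode B) * cinner (mstate st_mode B) (pinner (mstate (rho_mode D) a') ?\<Phi>))
      has_sum cinner (pinner (mstate (rho_mode D) a) ?\<Phi>) (pinner (mstate (rho_mode D) a') ?\<Phi>)) UNIV"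
    by (rule Parseval[OF o]) (simp add: mstate_complete[OF st_mode] pinner_fock_split S_state_def S_fock)
  moreover have "cinner (pinner (mstate (rho_mode D) a) ?\<Phi>) (mstate st_mode B) = cnj (amplitude a B A)" for B
    unfolding amp[symmetric] by (rule cinner_commute)
  ultimately show ?thesis by (simp only: amp)
qed

text \<open>By \<open>amplitude_unique\<close> no horizon state accompanies two different outgoing
  occupations, so every term of an off-diagonal matrix element vanishes. The diagonal elements are
  nonnegative with sum \<open>t\<close>, hence bounded by it.\<close>

lemma evolve_diagonal:
  assumes w: "\<forall>n. 0 \<le> w n" "(w has_sum t) UNIV"
  defines "G \<equiv> evolve S (diag_op (in_state D) w)"
  shows "G (out_state D a) = Re (cinner (out_state D a) (G (out_state D a))) *\<^sub>R out_state D a"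
    and "\<forall>n. \<bar>Re (cinner (out_state D n) (G (out_state D n)))\<bar> \<le> t"
    and "G = diag_op (out_state D) (\<lambda>n. Re (cinner (out_state D n) (G (out_state D n))))"
proof -
  have rng: "range (in_state D) \<subseteq> F_in D" unfolding in_state(2)[symmetric] by (auto intro: closed_cspan_base)
  note g = evolve_gram[OF in_state(1) rng w, folded G_def]
  note m = evolve_matrix[OF in_state(1) rng w(1) has_sum_imp_summable[OF w(2)], folded G_def]
  let ?d = "\<lambda>n. Re (cinner (out_state D n) (G (out_state D n)))"
  have off: "cinner (out_state D a') (G (out_state D a)) = 0" if "a' \<noteq> a" for a a'
  proof -
    have "occ_mset a \<noteq> occ_mset a'" using that bij_occ_mset by (auto simp: bij_def inj_eq)
    then have z: "cnj (amplitude (occ_mset a) B A) * amplitude (occ_mset a') B A = 0" for B A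
      using amplitude_unique by (metis complex_cnj_zero mult_eq_0_iff)
    have "cinner (pinner (out_state D a) (fock_split (S (in_state D k)))) (pinner (out_state D a') (fock_split (S (in_state D k)))) = 0" for k
      using has_sum_unique[OF pinner_amplitude[of "occ_mset a" "occ_mset k" "occ_mset a'", unfolded z] has_sum_0_simp]
      by (simp only: out_state_mstate in_state_mstate S_state_def)
    then show ?thesis using has_sum_unique[OF m[of "out_state D a" "out_state D a'"], of 0] by simp
  qed
  have self: "cinner (out_state D a) (G (out_state D a)) = of_real (?d a)" for a
  proof -
    have "cnj (cinner (out_state D a) (G (out_state D a))) = cinner (out_state D a) (G (out_state D a))"
      using g(3)[of "out_state D a" "out_state D a"] by (metis cinner_commute)
    then show ?thesis by (simp add: complex_eq_iff)
  qed
  have ev: "G (out_state D a) = ?d a *\<^sub>R out_state D a" for a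
  proof (rule closed_cspan_eqD[of "out_state D" UNIV])
    show "orthonormal_on (out_state D) UNIV" using out_state(1) by (simp add: orthonormal_family_on)
    show "G (out_state D a) \<in> closed_cspan (range (out_state D))" using g(2) by (auto simp: out_state(2) F_out_def)
    show "?d a *\<^sub>R out_state D a \<in> closed_cspan (range (out_state D))"
      by (intro subspace_scale[OF subspace_closed_cspan] closed_cspan_base) simp
    show "cinner (out_state D n) (G (out_state D a)) = cinner (out_state D n) (?d a *\<^sub>R out_state D a)" for n
      using off[of n a] self[of a] out_state(1) by (cases "n = a") (simp_all add: orthonormal_family_def)
  qed
  then show "G (out_state D a) = ?d a *\<^sub>R out_state D a" .
  have "onb fock (range (out_state D))" using orthonormal_onb[OF out_state(1)] by (simp add: out_state(2) F_out_def)
  then have "((\<lambda>b. cinner b (G b)) has_sum of_real t) (range (out_state D))" by (rule g(5))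
  then have "((\<lambda>n. cinner (out_state D n) (G (out_state D n))) has_sum of_real t) UNIV"
    using orthonormal_on_inj[of "out_state D" UNIV] out_state(1)
    by (subst (asm) has_sum_reindex) (simp_all add: orthonormal_family_on o_def)
  then have "(?d has_sum t) UNIV" using has_sum_Re by fastforce
  from finite_sum_le_has_sum[OF this, of "{n}" for n] g(4)
  show bd: "\<forall>n. \<bar>?d n\<bar> \<le> t" by simp
  show "G = diag_op (out_state D) ?d"
    by (rule diag_op_of_eigenbasis[OF out_state(1) _ g(3) ev bd]) (use g(2) in \<open>simp add: out_state(2) F_out_def\<close>)
qed

text \<open>Both sides are diagonal in the out number states. On the left the diagonal elements are
  Gibbs weights times transition probabilities, summed by \<open>amplitude_thermal\<close> and
  divided by \<open>Z_part D\<close>.\<close>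

lemma evolve_thermal: "evolve S (thermal D (in_state D)) = thermal D (out_state D)"
proof -
  have rng: "range (in_state D) \<subseteq> F_in D" unfolding in_state(2)[symmetric] by (auto intro: closed_cspan_base)
  have w: "\<forall>n. 0 \<le> tq n" using tq_pos by (simp add: less_imp_le)
  let ?G = "evolve S (diag_op (in_state D) tq)"
  have "Re (cinner (out_state D a) (?G (out_state D a))) = tq a" for a
  proof -
    let ?n = "\<lambda>A. (norm (pinner (mstate (rho_mode D) (occ_mset a)) (fock_split (S_state A))))\<^sup>2"
    have "((\<lambda>B. complex_of_real ((cmod (amplitude (occ_mset a) B A))\<^sup>2)) has_sum of_real (?n A)) UNIV" for A
      using pinner_amplitude[of "occ_mset a" A "occ_mset a"]
      by (simp only: complex_norm_square cinner_norm mult.commute)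
    then have B: "((\<lambda>B. (cmod (amplitude (occ_mset a) B A))\<^sup>2) has_sum ?n A) UNIV" for A
      by (simp only: has_sum_of_real_iff)
    have "((\<lambda>(n, B). (boltz_prod n)\<^sup>2 * (cmod (amplitude (occ_mset a) B n))\<^sup>2) has_sum (boltz_prod (occ_mset a))\<^sup>2) (UNIV \<times> UNIV)"
      using amplitude_thermal by simp
    then have "((\<lambda>A. (boltz_prod A)\<^sup>2 * ?n A) has_sum (boltz_prod (occ_mset a))\<^sup>2) UNIV"
      by (rule has_sum_SigmaD) (use has_sum_cmult_right[OF B] in simp)
    then have "((\<lambda>n. (boltz_prod (occ_mset n))\<^sup>2 * ?n (occ_mset n)) has_sum (boltz_prod (occ_mset a))\<^sup>2) UNIV"
      by (subst has_sum_reindex_bij_betw[OF bij_occ_mset, of "\<lambda>A. (boltz_prod A)\<^sup>2 * ?n A"])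
    from has_sum_divide_const[OF this, of "Z_part D"]
    have "((\<lambda>n. tq n * ?n (occ_mset n)) has_sum tq a) UNIV"
      by (simp add: tq_def gibbs_boltz)
    then have "((\<lambda>n. complex_of_real (tq n * ?n (occ_mset n))) has_sum of_real (tq a)) UNIV" by (rule has_sum_of_real)
    then have "((\<lambda>n. of_real (tq n) * cinner (pinner (out_state D a) (fock_split (S (in_state D n)))) (pinner (out_state D a) (fock_split (S (in_state D n)))))
        has_sum of_real (tq a)) UNIV"
      by (simp only: of_real_mult cinner_norm out_state_mstate in_state_mstate S_state_def)
    then have "cinner (out_state D a) (?G (out_state D a)) = of_real (tq a)"
      using evolve_matrix[OF in_state(1) rng w has_sum_imp_summable[OF tq_has_sum], of "out_state D a" "out_state D a"]
      by (rule has_sum_unique[symmetric])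
    then show ?thesis by simp
  qed
  then show ?thesis using evolve_diagonal(3)[OF w tq_has_sum] by (simp add: thermal_tq)
qed

text \<open>\<open>M j k\<close> below is the probability of finding \<open>c j\<close> when
  \<open>\<psi> k\<close> comes in. It carries the eigenvalues \<open>p\<close> to \<open>p'\<close>
  and, by thermality, \<open>tq\<close> to \<open>tq\<close>. By \<open>joint_functional\<close>
  both functionals are \<open>ln (Z_part D)\<close> minus a relative entropy.\<close>

lemma second_law:
  assumes \<rho>: "density_matrix (F_in D) \<rho>" "admissible D S \<rho>"
  shows "density_matrix (F_out D) (evolve S \<rho>)"
    and "trace_converges (F_in D) (U_op D (F_in D) (in_state D) \<rho>)"
    and "trace_converges (F_out D) (U_op D (F_out D) (out_state D) (evolve S \<rho>))"
    and "U_joint D (F_in D) (in_state D) \<rho> \<le> U_joint D (F_out D) (out_state D) (evolve S \<rho>)"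
    and "traces_converge D (F_in D) (in_state D) \<rho> \<Longrightarrow>
      U_joint D (F_in D) (in_state D) \<rho> = U_fun D (F_in D) (in_state D) \<rho>"
    and "traces_converge D (F_out D) (out_state D) (evolve S \<rho>) \<Longrightarrow>
      U_joint D (F_out D) (out_state D) (evolve S \<rho>) = U_fun D (F_out D) (out_state D) (evolve S \<rho>)"
proof -
  have adm: "commute \<rho> (thermal D (in_state D))" "commute (evolve S \<rho>) (thermal D (out_state D))"
    "rel_abs_convergent (F_in D) (thermal D (in_state D)) \<rho>"
    using \<rho>(2) by (auto simp: admissible_def)
  obtain \<psi> p where \<psi>: "orthonormal_family \<psi>" "closed_cspan (range \<psi>) = F_in D" "\<And>n. \<rho> (\<psi> n) = p n *\<^sub>R \<psi> n"
    "\<And>m n. tq m \<noteq> tq n \<Longrightarrow> cinner (in_state D m) (\<psi> n) = 0" "\<And>n. 0 \<le> p n" "(p has_sum 1) UNIV"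
    "\<rho> = diag_op \<psi> p" "thermal D (in_state D) = diag_op \<psi> tq"
    using joint_eigenbasis[OF in_state \<rho>(1) adm(1)] by blast
  have rng: "range \<psi> \<subseteq> F_in D" unfolding \<psi>(2)[symmetric] by (auto intro: closed_cspan_base)
  have p0: "\<forall>n. 0 \<le> p n" using \<psi>(5) by simp
  have th\<psi>: "thermal D (in_state D) (c *\<^sub>R \<psi> n) = (c * tq n) *\<^sub>R \<psi> n" for c n
    using diag_op_base[OF \<psi>(1) tq_bounded, of n]
      linear_scale[OF bounded_clinear_linear[OF bounded_clinear_diag_op[OF \<psi>(1) tq_bounded]], of c "\<psi> n"]
    by (simp add: \<psi>(8))
  have \<rho>lin: "linear \<rho>" using \<rho>(1) by (simp add: density_matrix_def bounded_clinear_linear)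
  have Ksub: "subspace (F_in D)" using subspace_closed_cspan \<psi>(2) by metis
  \<comment> \<open>Along \<open>\<psi>\<close> the trace in \<open>rel_abs_convergent\<close> is
    the series of the terms \<open>tq n * \<bar>xlnx (p n / tq n)\<bar>\<close>, which are the
    absolute values of the relative entropy terms.\<close>
  obtain r where r: "((\<lambda>n. p n * ln (p n / tq n)) has_sum r) UNIV"
  proof -
    let ?th = "thermal D (in_state D)"
    let ?Y = "(graph_on (F_in D) ?th)\<inverse> O graph_on (F_in D) \<rho>"
    obtain t where t: "has_trace (F_in D) (fun_of_op (\<lambda>x. \<bar>xlnx x\<bar>) ?Y O graph_on (F_in D) ?th) t"
      using adm(3) by (auto simp: rel_abs_convergent_def trace_converges_def)
    have "(\<psi> n, (\<bar>xlnx (p n / tq n)\<bar> * tq n) *\<^sub>R \<psi> n) \<in> fun_of_op (\<lambda>x. \<bar>xlnx x\<bar>) ?Y O graph_on (F_in D) ?th" for n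
    proof -
      have K: "c *\<^sub>R \<psi> n \<in> F_in D" for c using rng Ksub by (auto intro: subspace_scale)
      \<comment> \<open>The preimage of \<open>\<psi> n\<close> under the thermal state, as the
        inverse relation in \<open>?Y\<close> requires.\<close>
      have "((1 / tq n) *\<^sub>R \<psi> n, \<psi> n) \<in> graph_on (F_in D) ?th"
        using K th\<psi>[of "1 / tq n" n] tq_pos[of n] by (auto simp: graph_on_def)
      moreover have "((1 / tq n) *\<^sub>R \<psi> n, (p n / tq n) *\<^sub>R \<psi> n) \<in> graph_on (F_in D) \<rho>"
        using K by (auto simp: graph_on_def linear_scale[OF \<rho>lin] \<psi>(3))
      ultimately have "(\<psi> n, (p n / tq n) *\<^sub>R \<psi> n) \<in> ?Y" by blast
      then have "(\<psi> n, \<bar>xlnx (p n / tq n)\<bar> *\<^sub>R \<psi> n) \<in> fun_of_op (\<lambda>x. \<bar>xlnx x\<bar>) ?Y"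
        by (rule fun_of_op_base[where f = "\<lambda>x. \<bar>xlnx x\<bar>"])
      moreover have "(\<bar>xlnx (p n / tq n)\<bar> *\<^sub>R \<psi> n, (\<bar>xlnx (p n / tq n)\<bar> * tq n) *\<^sub>R \<psi> n) \<in> graph_on (F_in D) ?th"
        using K th\<psi> by (auto simp: graph_on_def)
      ultimately show ?thesis by blast
    qed
    from has_trace_weights(3)[OF t \<psi>(1,2) this]
    have "(\<lambda>n. \<bar>\<bar>xlnx (p n / tq n)\<bar> * tq n\<bar>) summable_on UNIV" .
    moreover have "\<bar>\<bar>xlnx (p n / tq n)\<bar> * tq n\<bar> = norm (p n * ln (p n / tq n))" for n
      using tq_pos[of n] by (simp add: abs_mult flip: mult_xlnx_divide[OF tq_pos])
    ultimately have "(\<lambda>n. norm (p n * ln (p n / tq n))) summable_on UNIV" by (simp only:)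
    from abs_summable_summable[OF this] show ?thesis using that by (auto simp: summable_on_def)
  qed
  have \<rho>': "bounded_clinear \<rho>" "range \<rho> \<subseteq> F_in D" using \<rho>(1) by (auto simp: density_matrix_def)
  note Uin = joint_functional[OF in_state \<rho>' \<psi>(1-7) r]
  let ?G = "evolve S \<rho>"
  show dG: "density_matrix (F_out D) ?G"
    unfolding \<psi>(7) by (rule evolve_density[OF \<psi>(1) rng p0 \<psi>(6)])
  obtain c p' where c: "orthonormal_family c" "closed_cspan (range c) = F_out D" "\<And>n. ?G (c n) = p' n *\<^sub>R c n"
    "\<And>m n. tq m \<noteq> tq n \<Longrightarrow> cinner (out_state D m) (c n) = 0" "\<And>n. 0 \<le> p' n" "(p' has_sum 1) UNIV"
    "?G = diag_op c p'" "thermal D (out_state D) = diag_op c tq"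
    using joint_eigenbasis[OF out_state dG adm(2)] by blast
  define M where "M j k = (norm (pinner (c j) (fock_split (S (\<psi> k)))))\<^sup>2" for j k
  have iso: "norm (fock_split (S (\<psi> k))) = 1" for k
    using S_isometry[of "\<psi> k"] rng orthonormal_norm[of \<psi> UNIV k] \<psi>(1) by (auto simp: orthonormal_family_on)
  have M: "0 \<le> M j k" "((\<lambda>j. M j k) has_sum 1) UNIV" for j k
    using pinner_norm_sum[OF c(1), of "S (\<psi> k)"] c(2) S_fock iso by (simp_all add: M_def F_out_def)
  have cn: "norm (c j) = 1" for j using orthonormal_norm[of c UNIV j] c(1) by (simp add: orthonormal_family_on)
  \<comment> \<open>Stated for any weights \<open>v\<close> diagonal in \<open>\<psi>\<close> whose
    evolved operator has the eigenvector \<open>c j\<close>, so that it yields the rows for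
    \<open>p\<close> and for \<open>tq\<close> alike.\<close>
  have row: "((\<lambda>k. M j k * v k) has_sum d) UNIV"
    if "evolve S (diag_op \<psi> v) (c j) = d *\<^sub>R c j" "\<forall>k. 0 \<le> v k" "v summable_on UNIV" for v d j
  proof -
    have "((\<lambda>k. complex_of_real (M j k * v k)) has_sum of_real d) UNIV"
      using evolve_matrix[OF \<psi>(1) rng that(2,3), of "c j" "c j"]
      by (simp add: that(1) cn M_def cinner_norm mult.commute)
    then show ?thesis by (simp only: has_sum_of_real_iff)
  qed
  have P: "((\<lambda>k. M j k * p k) has_sum p' j) UNIV" for j
    by (rule row) (use c(3) \<psi>(7) p0 has_sum_imp_summable[OF \<psi>(6)] in simp_all)
  have Q: "((\<lambda>k. M j k * tq k) has_sum tq j) UNIV" for j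
  proof (rule row)
    show "evolve S (diag_op \<psi> tq) (c j) = tq j *\<^sub>R c j"
      unfolding \<psi>(8)[symmetric] evolve_thermal c(8) by (rule diag_op_base[OF c(1) tq_bounded])
  qed (use tq_pos has_sum_imp_summable[OF tq_has_sum] in \<open>simp_all add: less_imp_le\<close>)
  note mono = relative_entropy_monotone[OF \<psi>(5,6) tq_pos tq_has_sum M P Q tq_pos c(6) tq_has_sum r]
  have G': "bounded_clinear ?G" "range ?G \<subseteq> F_out D" using dG by (auto simp: density_matrix_def)
  note Uout = joint_functional[OF out_state G' c(1-7) has_sum_infsum[OF mono(1)]]
  show "trace_converges (F_in D) (U_op D (F_in D) (in_state D) \<rho>)"
    "trace_converges (F_out D) (U_op D (F_out D) (out_state D) ?G)"
    using Uin(1) Uout(1) by (auto simp: trace_converges_def)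
  show "U_joint D (F_in D) (in_state D) \<rho> \<le> U_joint D (F_out D) (out_state D) ?G"
    using mono(2) Uin(2) Uout(2) by simp
  show "traces_converge D (F_in D) (in_state D) \<rho> \<Longrightarrow>
      U_joint D (F_in D) (in_state D) \<rho> = U_fun D (F_in D) (in_state D) \<rho>" by (rule Uin(3))
  show "traces_converge D (F_out D) (out_state D) ?G \<Longrightarrow>
      U_joint D (F_out D) (out_state D) ?G = U_fun D (F_out D) (out_state D) ?G" by (rule Uout(3))
qed

text \<open>Finitely many modes and boundedly many quanta leave finitely many number states, so all
  weights have finite support and are summable. By \<open>evolve_diagonal\<close> the evolved state
  is diagonal too, and diagonal operators commute.\<close>

lemma finite_diagonal_admissible:
  assumes \<rho>: "density_matrix (F_in D) \<rho>" "finite_diagonal D \<rho>"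
  shows "admissible D S \<rho>"
proof -
  obtain p I k where pIk: "finite I" "\<rho> = diag_op (in_state D) p"
    "\<And>n. p n \<noteq> 0 \<Longrightarrow> Poly_Mapping.keys n \<subseteq> I \<and> (\<Sum>i\<in>Poly_Mapping.keys n. Poly_Mapping.lookup n i) \<le> k"
    using \<rho>(2) by (auto simp: finite_diagonal_def)
  let ?F = "{n. p n \<noteq> 0}"
  have fin: "finite ?F"
  proof -
    have "occ_mset ` ?F \<subseteq> mset ` {xs. set xs \<subseteq> I \<and> length xs \<le> k}"
    proof
      fix A assume "A \<in> occ_mset ` ?F"
      then obtain n where n: "A = occ_mset n" "p n \<noteq> 0" by auto
      obtain xs where xs: "mset xs = A" by (metis ex_mset)
      have "size A = (\<Sum>i\<in>Poly_Mapping.keys n. Poly_Mapping.lookup n i)"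
        by (simp add: n(1) size_multiset_overloaded_eq)
      then have "set xs \<subseteq> I" "length xs \<le> k" using pIk(3)[OF n(2)] n(1) xs
        by (auto simp flip: set_mset_mset size_mset)
      then show "A \<in> mset ` {xs. set xs \<subseteq> I \<and> length xs \<le> k}" using xs by blast
    qed
    then have "finite (occ_mset ` ?F)"
      using finite_lists_length_le[OF pIk(1), of k] finite_surj by blast
    then show ?thesis
      by (rule finite_imageD) (rule inj_on_subset[OF bij_is_inj[OF bij_occ_mset]], simp)
  qed
  have summ: "(\<lambda>n. \<bar>f n\<bar>) summable_on UNIV" if "\<And>n. p n = 0 \<Longrightarrow> f n = 0" for f :: "occ \<Rightarrow> real"
    by (rule finite_nonzero_values_imp_summable_on, rule finite_subset[OF _ fin]) (use that in auto)
  note pb = summable_bounded[OF summ[of p, simplified]]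
  have p0: "0 \<le> p n" for n
  proof -
    have "0 \<le> Re (cinner (in_state D n) (\<rho> (in_state D n)))" using \<rho>(1) unfolding density_matrix_def by blast
    then show ?thesis using in_state(1) by (simp add: pIk(2) diag_op_base[OF in_state(1) pb] orthonormal_family_def)
  qed
  have "p summable_on UNIV" by (rule abs_summable_summable) (use summ[of p] in simp)
  then obtain t where t: "(p has_sum t) UNIV" by (auto simp: summable_on_def)
  have c1: "commute \<rho> (thermal D (in_state D))"
    unfolding thermal_tq pIk(2) by (rule diag_op_commute[OF in_state(1) pb tq_bounded])
  have "\<forall>n. 0 \<le> p n" using p0 by simp
  note ed = evolve_diagonal[OF this t]
  have c2: "commute (evolve S \<rho>) (thermal D (out_state D))"
    unfolding thermal_tq pIk(2) by (subst ed(3)) (rule diag_op_commute[OF out_state(1) ed(2) tq_bounded])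
  let ?b = "in_state D" and ?th = "thermal D (in_state D)" and ?K = "F_in D"
  let ?Y = "(graph_on ?K ?th)\<inverse> O graph_on ?K \<rho>"
  let ?X = "fun_of_op (\<lambda>x. \<bar>xlnx x\<bar>) ?Y"
  define h where "h n = \<bar>xlnx (p n / tq n)\<bar>" for n
  have hs: "(\<lambda>n. \<bar>h n\<bar>) summable_on UNIV" "(\<lambda>n. \<bar>tq n * h n\<bar>) summable_on UNIV"
    by (rule summ, simp add: h_def xlnx_def)+
  note hb = summable_bounded[OF hs(1)] and qhb = summable_bounded[OF hs(2)]
  have bK: "c *\<^sub>C ?b n \<in> ?K" for c n unfolding in_state(2)[symmetric] by (rule in_closed_cspanI) simp
  have Ksub: "subspace ?K" unfolding in_state(2)[symmetric] by (rule subspace_closed_cspan)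
  have thb: "bounded_clinear ?th" unfolding thermal_tq by (rule bounded_clinear_diag_op[OF in_state(1) tq_bounded])
  have \<rho>b: "bounded_clinear \<rho>" using \<rho>(1) by (simp add: density_matrix_def)
  have Xh: "diag_op ?b h v = u" if "(v, u) \<in> ?X" for v u
    using that
  proof (rule fun_of_op_subset[OF bounded_clinear_diag_op[OF in_state(1) hb], rotated])
    fix v a assume "(v, a *\<^sub>R v) \<in> ?Y"
    then obtain u where u: "u \<in> ?K" "v = diag_op ?b tq u" "diag_op ?b p u = a *\<^sub>R v"
      by (auto simp: graph_on_def thermal_tq pIk(2))
    show "diag_op ?b h v = \<bar>xlnx a\<bar> *\<^sub>R v"
    proof (rule diag_op_eqI[OF in_state(1) hb])
      show "\<bar>xlnx a\<bar> *\<^sub>R v \<in> closed_cspan (range ?b)"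
        unfolding u(2) by (intro subspace_scale[OF subspace_closed_cspan] diag_op_in[OF in_state(1) tq_bounded])
      fix n
      have "of_real (p n) * cinner (?b n) u = of_real (a * tq n) * cinner (?b n) u"
        using arg_cong[OF u(3), of "cinner (?b n)"] by (simp add: u(2) diag_op_coeff[OF in_state(1) pb] diag_op_coeff[OF in_state(1) tq_bounded])
      \<comment> \<open>An eigenvector of \<open>?Y\<close> for the eigenvalue \<open>a\<close> has
        components only where \<open>p n / tq n = a\<close>; there \<open>h n\<close> is
        \<open>\<bar>xlnx a\<bar>\<close>.\<close>
      then have "cinner (?b n) u = 0 \<or> p n = a * tq n" unfolding mult_cancel_right of_real_eq_iff by blast
      then show "cinner (?b n) (\<bar>xlnx a\<bar> *\<^sub>R v) = of_real (h n) * cinner (?b n) v"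
        using tq_pos[of n] by (auto simp: u(2) diag_op_coeff[OF in_state(1) tq_bounded] h_def)
    qed
  qed
  have "has_trace ?K (?X O graph_on ?K ?th) (of_real (\<Sum>\<^sub>\<infinity>n. tq n * h n))"
  proof (rule has_trace_diag[OF in_state hs(2)])
    fix v u assume "(v, u) \<in> ?X O graph_on ?K ?th"
    then have u: "u = diag_op ?b tq (diag_op ?b h v)" using Xh by (auto simp: graph_on_def thermal_tq)
    show "diag_op ?b (\<lambda>n. tq n * h n) v = u"
      unfolding u by (rule diag_op_eqI[OF in_state(1) qhb diag_op_in[OF in_state(1) tq_bounded]])
        (simp add: diag_op_coeff[OF in_state(1) tq_bounded] diag_op_coeff[OF in_state(1) hb] mult.assoc)
  next
    have "subspace (?X O graph_on ?K ?th)"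
      by (intro subspace_relcomp subspace_fun_of_op subspace_graph_on Ksub bounded_clinear_linear thb)
    moreover have "c *\<^sub>C ?b n \<in> Domain (?X O graph_on ?K ?th)" for c n
    proof -
      have e: "diag_op ?b f (d *\<^sub>C ?b n) = f n *\<^sub>R d *\<^sub>C ?b n" if "\<forall>n. \<bar>f n\<bar> \<le> C" for f C d
        using bounded_clinear_scaleC[OF bounded_clinear_diag_op[OF in_state(1) that]]
        by (simp add: diag_op_base[OF in_state(1) that] scaleR_scaleC)
      \<comment> \<open>Chosen so that the thermal state maps \<open>?d *\<^sub>C ?b n\<close> to
        \<open>c *\<^sub>C ?b n\<close>.\<close>
      let ?d = "of_real (1 / tq n) * c"
      have "tq n *\<^sub>R ?d *\<^sub>C ?b n = c *\<^sub>C ?b n" using tq_pos[of n] by (simp add: scaleR_conv_scaleC flip: mult.assoc)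
      then have "(?d *\<^sub>C ?b n, c *\<^sub>C ?b n) \<in> graph_on ?K ?th"
        using bK[of ?d n] e[OF tq_bounded, of ?d] by (auto simp: graph_on_def thermal_tq)
      moreover have "p n *\<^sub>R ?d *\<^sub>C ?b n = (p n / tq n) *\<^sub>R c *\<^sub>C ?b n" by (simp add: scaleR_conv_scaleC flip: mult.assoc)
      then have "(?d *\<^sub>C ?b n, (p n / tq n) *\<^sub>R c *\<^sub>C ?b n) \<in> graph_on ?K \<rho>"
        using bK[of ?d n] e[OF pb, of ?d] by (auto simp: graph_on_def pIk(2))
      ultimately have "(c *\<^sub>C ?b n, (p n / tq n) *\<^sub>R c *\<^sub>C ?b n) \<in> ?Y" by blast
      then have "(c *\<^sub>C ?b n, \<bar>xlnx (p n / tq n)\<bar> *\<^sub>R c *\<^sub>C ?b n) \<in> ?X"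
        by (rule fun_of_op_base[where f = "\<lambda>x. \<bar>xlnx x\<bar>"])
      moreover have "\<bar>xlnx (p n / tq n)\<bar> *\<^sub>R c *\<^sub>C ?b n \<in> ?K" by (intro subspace_scale[OF Ksub] bK)
      ultimately show ?thesis by (auto simp: graph_on_def)
    qed
    ultimately show "?K \<subseteq> closure (Domain (?X O graph_on ?K ?th))"
      using dense_Domain[of _ ?b] in_state(2) by metis
  qed
  then have "rel_abs_convergent ?K ?th \<rho>" by (auto simp: rel_abs_convergent_def trace_converges_def)
  then show ?thesis using c1 c2 by (simp add: admissible_def)
qed

end

theorem mainTheorem3:
  fixes D :: "('x, 'y, 'z) scattering"
    and S :: "'z list ell2 \<Rightarrow> ('x + 'y) list ell2"
    and N :: complex
  assumes "collapse_scattering D" and "S_matrix D N S"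
  shows
    "(\<forall>\<rho>\<^sub>0. density_matrix (F_in D) \<rho>\<^sub>0 \<and> admissible D S \<rho>\<^sub>0 \<longrightarrow>
        density_matrix (F_out D) (evolve S \<rho>\<^sub>0) \<and>
        trace_converges (F_in D) (U_op D (F_in D) (in_state D) \<rho>\<^sub>0) \<and>
        trace_converges (F_out D) (U_op D (F_out D) (out_state D) (evolve S \<rho>\<^sub>0)) \<and>
        U_joint D (F_out D) (out_state D) (evolve S \<rho>\<^sub>0)
          \<ge> U_joint D (F_in D) (in_state D) \<rho>\<^sub>0 \<and>
        (traces_converge D (F_in D) (in_state D) \<rho>\<^sub>0 \<longrightarrow>
           U_joint D (F_in D) (in_state D) \<rho>\<^sub>0 = U_fun D (F_in D) (in_state D) \<rho>\<^sub>0) \<and>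
        (traces_converge D (F_out D) (out_state D) (evolve S \<rho>\<^sub>0) \<longrightarrow>
           U_joint D (F_out D) (out_state D) (evolve S \<rho>\<^sub>0)
             = U_fun D (F_out D) (out_state D) (evolve S \<rho>\<^sub>0)) \<and>
        (traces_converge D (F_in D) (in_state D) \<rho>\<^sub>0 \<and>
         traces_converge D (F_out D) (out_state D) (evolve S \<rho>\<^sub>0) \<longrightarrow>
           U_fun D (F_out D) (out_state D) (evolve S \<rho>\<^sub>0)
             \<ge> U_fun D (F_in D) (in_state D) \<rho>\<^sub>0))
     \<and>
     (\<forall>\<rho>\<^sub>0 \<Delta>S_BH \<Delta>M_BH \<Delta>J_BH.
        density_matrix (F_in D) \<rho>\<^sub>0 \<and>
        traces_converge D (F_in D) (in_state D) \<rho>\<^sub>0 \<and>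
        traces_converge D (F_out D) (out_state D) (evolve S \<rho>\<^sub>0) \<and>
        \<Delta>S_BH = beta_BH D * (\<Delta>M_BH - Omega_BH D * \<Delta>J_BH) \<and>
        \<Delta>M_BH + (E_matter D (F_out D) (out_state D) (evolve S \<rho>\<^sub>0)
                  - E_matter D (F_in D) (in_state D) \<rho>\<^sub>0) = 0 \<and>
        \<Delta>J_BH + (L_matter D (F_out D) (out_state D) (evolve S \<rho>\<^sub>0)
                  - L_matter D (F_in D) (in_state D) \<rho>\<^sub>0) = 0 \<longrightarrow>
          (U_fun D (F_out D) (out_state D) (evolve S \<rho>\<^sub>0)
             \<ge> U_fun D (F_in D) (in_state D) \<rho>\<^sub>0
           \<longleftrightarrow> \<Delta>S_BH + (S_matter (F_out D) (evolve S \<rho>\<^sub>0) - S_matter (F_in D) \<rho>\<^sub>0) \<ge> 0))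
     \<and>
     (\<forall>\<rho>\<^sub>0. density_matrix (F_in D) \<rho>\<^sub>0 \<and> finite_diagonal D \<rho>\<^sub>0 \<longrightarrow> admissible D S \<rho>\<^sub>0)"
proof -
  interpret collapse D S N using assms by unfold_locales
  show ?thesis
  proof (intro conjI allI impI; (elim conjE)?)
    fix \<rho>\<^sub>0
    assume d: "density_matrix (F_in D) \<rho>\<^sub>0" "admissible D S \<rho>\<^sub>0"
    note law = second_law[OF d]
    show "density_matrix (F_out D) (evolve S \<rho>\<^sub>0)" by (rule law)
    show "trace_converges (F_in D) (U_op D (F_in D) (in_state D) \<rho>\<^sub>0)" by (rule law)
    show "trace_converges (F_out D) (U_op D (F_out D) (out_state D) (evolve S \<rho>\<^sub>0))" by (rule law)
    show "U_joint D (F_in D) (in_state D) \<rho>\<^sub>0 \<le> U_joint D (F_out D) (out_state D) (evolve S \<rho>\<^sub>0)" by (rule law)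
    show "traces_converge D (F_in D) (in_state D) \<rho>\<^sub>0 \<Longrightarrow>
      U_joint D (F_in D) (in_state D) \<rho>\<^sub>0 = U_fun D (F_in D) (in_state D) \<rho>\<^sub>0" by (rule law)
    show "traces_converge D (F_out D) (out_state D) (evolve S \<rho>\<^sub>0) \<Longrightarrow>
      U_joint D (F_out D) (out_state D) (evolve S \<rho>\<^sub>0) = U_fun D (F_out D) (out_state D) (evolve S \<rho>\<^sub>0)" by (rule law)
    show "traces_converge D (F_in D) (in_state D) \<rho>\<^sub>0 \<Longrightarrow> traces_converge D (F_out D) (out_state D) (evolve S \<rho>\<^sub>0) \<Longrightarrow>
      U_fun D (F_in D) (in_state D) \<rho>\<^sub>0 \<le> U_fun D (F_out D) (out_state D) (evolve S \<rho>\<^sub>0)"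
      using law(4-6) by simp
  next
    fix \<rho>\<^sub>0 \<Delta>S_BH \<Delta>M_BH \<Delta>J_BH
    let ?E = "E_matter D (F_out D) (out_state D) (evolve S \<rho>\<^sub>0) - E_matter D (F_in D) (in_state D) \<rho>\<^sub>0"
    let ?L = "L_matter D (F_out D) (out_state D) (evolve S \<rho>\<^sub>0) - L_matter D (F_in D) (in_state D) \<rho>\<^sub>0"
    assume first_law: "\<Delta>S_BH = beta_BH D * (\<Delta>M_BH - Omega_BH D * \<Delta>J_BH)"
      and "\<Delta>M_BH + ?E = 0" "\<Delta>J_BH + ?L = 0"
    then have M: "\<Delta>M_BH = - ?E" and J: "\<Delta>J_BH = - ?L" by linarith+
    \<comment> \<open>With the black hole's changes eliminated by the conservation laws, the energy
      part of the difference is exactly \<open>\<Delta>S_BH\<close>; the equivalence rests on this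
      identity.\<close>
    have "U_fun D (F_out D) (out_state D) (evolve S \<rho>\<^sub>0) - U_fun D (F_in D) (in_state D) \<rho>\<^sub>0 =
        \<Delta>S_BH + (S_matter (F_out D) (evolve S \<rho>\<^sub>0) - S_matter (F_in D) \<rho>\<^sub>0)"
      unfolding first_law M J U_fun_def by (simp add: algebra_simps)
    then show "U_fun D (F_in D) (in_state D) \<rho>\<^sub>0 \<le> U_fun D (F_out D) (out_state D) (evolve S \<rho>\<^sub>0)
        \<longleftrightarrow> 0 \<le> \<Delta>S_BH + (S_matter (F_out D) (evolve S \<rho>\<^sub>0) - S_matter (F_in D) \<rho>\<^sub>0)"
      by linarith
  next
    fix \<rho>\<^sub>0
    assume "density_matrix (F_in D) \<rho>\<^sub>0" "finite_diagonal D \<rho>\<^sub>0"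
    then show "admissible D S \<rho>\<^sub>0" by (rule finite_diagonal_admissible)
  qed
qed

end
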